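(* Assume that the initial curve $\gamma_0:S^1\to\mathbb R^n$ has a one-to-one convex projection onto the $xy$-plane and that its curve shortening flow $\gamma(\cdot,t)$ develops a Type II singularity as $t\to T$. Then the direction of the limit line is independent of the sequence $\{\tau_j\}$. Thus the tangent flow is unique.
   Context: $S^1=\mathbb R/2\pi\mathbb Z$. A curve shortening flow (CSF) in $\mathbb R^n$ is a smooth map $\gamma:S^1\times[0,T)\to\mathbb R^n$ with each $\gamma(\cdot,t)$ an immersion and $\gamma_t=\gamma_{ss}$, $\partial_s=|\gamma_u|^{-1}\partial_u$; $T$ is the maximal existence time. $P_{xy}$ is the orthogonal projection of $\mathbb R^n=\mathbb R^2\times\mathbb R^{n-2}$ onto the first two coordinates $x,y$. A smooth closed immersed curve $\gamma$ has a one-to-one convex projection (onto the $xy$-plane) if $P_{xy}|_\gamma$ is injective and $P_{xy}(\gamma)$ is a convex curve. The CSF develops a Type I singularity as $t\to T$ if $\limsup_{t\to T}\sup_{u}k^2(u,t)(T-t)<+\infty$ ($k$ the curvature), and a Type II singularity otherwise. It is a known earlier result that a CSF starting from a curve with a one-to-one convex projection keeps this property and shrinks to a point as $t\to T$; this point is assumed to be the origin. The rescaled CSF is $\Gamma(u,\tau):=\gamma(u,t)/\sqrt{2T-2t}$, $\tau:=-\tfrac12\log(T-t)$, with arc-length parameter $\sigma$. For a sequence $\tau_j\to+\infty$, the $j$-th rescaled CSF is $\Gamma_j(\sigma,\tau):=\Gamma(\sigma,\tau_j+\tau)$. $\Gamma_j$ locally smoothly converges to a rescaled flow $\Gamma_\infty$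 if for any real $a<b$ and $R>0$ there are a finite union of closed intervals $I=\cup I_\alpha$, an integer $J$ and smooth time-dependent reparameterizations $\phi_j$ such that for $j\ge J$, $\Gamma_j(\phi_j(u,\tau),\tau)$, $u\in I$, reparameterizes all the arcs $\Gamma_j(\cdot,\tau)\cap\overline{B_R(0)}$ for every $\tau\in[a,b]$, and $\Gamma_j(\phi_j(u,\tau),\tau)\to\Gamma_\infty(u,\tau)$ as smooth functions on $I\times[a,b]$. A (parameterized) tangent flow is a rescaled flow $\Gamma_\infty$ that is such a limit for some sequence $\tau_j\to+\infty$. For a unit vector $\vec v$, the flow $(\mathbb R\sqcup\mathbb R)\times\mathbb R\to\mathbb R^n$, $(\lambda,\tau)\mapsto\lambda\vec v$, is called a stationary line of multiplicity two. Under the hypotheses of the claim, every sequence $\tau_j\to+\infty$ has a subsequence along which $\Gamma_j$ locally smoothly converges to a stationary line $L$ of multiplicity two, with $L$ not perpendicular to the $xy$-plane; a limit line is a line $L$ obtained in this way for some sequence $\tau_j\to+\infty$. *)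

theory Defs
  imports "HOL-Analysis.Analysis" "HOL-Library.Real_Mod"
begin

section \<open>Smooth maps of two real variables\<close>

text \<open>\<open>D k l\<close> plays the role of the mixed partial derivative of order \<open>k\<close> in the first and
  \<open>l\<close> in the second variable. The sets \<open>S\<close> used below are unions of nondegenerate rectangles
  (possibly unbounded, possibly containing boundary points), on which the derivatives within \<open>S\<close>,
  and hence the whole family \<open>D\<close>, are determined by \<open>f\<close>; smoothness is then smoothness up to
  the boundary.\<close>

definition partials_on ::
  "(nat \<Rightarrow> nat \<Rightarrow> real \<times> real \<Rightarrow> 'a) \<Rightarrow> (real \<times> real \<Rightarrow> 'a::real_normed_vector) \<Rightarrow>
    (real \<times> real) set \<Rightarrow> bool" where
  "partials_on D f S \<longleftrightarrow>
     (\<forall>z\<in>S. D 0 0 z = f z) \<and>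
     (\<forall>k l. \<forall>z\<in>S. (D k l has_derivative
        (\<lambda>(h, m). h *\<^sub>R D (Suc k) l z + m *\<^sub>R D k (Suc l) z)) (at z within S))"

definition smooth2_on :: "(real \<times> real) set \<Rightarrow> (real \<Rightarrow> real \<Rightarrow> 'a::real_normed_vector) \<Rightarrow> bool" where
  "smooth2_on S f \<longleftrightarrow> (\<exists>D. partials_on D (\<lambda>(u, t). f u t) S)"

text \<open>Convergence as smooth functions on a compact \<open>S\<close>: uniform convergence of all partial
  derivatives. Finitely many members of the sequence may fail to be smooth.\<close>

definition smooth2_converges_on ::
  "(real \<times> real) set \<Rightarrow> (nat \<Rightarrow> real \<Rightarrow> real \<Rightarrow> 'a) \<Rightarrow>
    (real \<Rightarrow> real \<Rightarrow> 'a::real_normed_vector) \<Rightarrow> bool" where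
  "smooth2_converges_on S f g \<longleftrightarrow>
     (\<exists>D E. (\<forall>\<^sub>F j in sequentially. partials_on (D j) (\<lambda>(u, t). f j u t) S) \<and>
            partials_on E (\<lambda>(u, t). g u t) S \<and>
            (\<forall>k l. uniform_limit S (\<lambda>j. D j k l) (E k l) sequentially))"

section \<open>Curve shortening flow\<close>

definition arc_deriv ::
  "(real \<Rightarrow> 'a::real_normed_vector) \<Rightarrow> (real \<Rightarrow> 'b::real_normed_vector) \<Rightarrow> real \<Rightarrow> 'b" where
  "arc_deriv c f u = (1 / norm (vector_derivative c (at u))) *\<^sub>R vector_derivative f (at u)"

definition unit_tangent :: "(real \<Rightarrow> 'a::real_normed_vector) \<Rightarrow> real \<Rightarrow> 'a" where
  "unit_tangent c = arc_deriv c c"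

definition curvature_vector :: "(real \<Rightarrow> 'a::real_normed_vector) \<Rightarrow> real \<Rightarrow> 'a" where
  "curvature_vector c = arc_deriv c (arc_deriv c c)"

definition curvature :: "(real \<Rightarrow> 'a::real_normed_vector) \<Rightarrow> real \<Rightarrow> real" where
  "curvature c u = norm (curvature_vector c u)"

text \<open>Maps on \<open>S\<^sup>1 = \<real>/2\<pi>\<int>\<close> are \<open>2\<pi>\<close>-periodic maps on \<open>\<real>\<close>. Values of \<open>\<gamma> u t\<close> for
  \<open>t \<notin> [0,T)\<close> are irrelevant.\<close>

definition csf :: "(real \<Rightarrow> real \<Rightarrow> 'a::real_normed_vector) \<Rightarrow> real \<Rightarrow> bool" where
  "csf \<gamma> T \<longleftrightarrow> 0 < T \<and>
     (\<forall>u. \<forall>t\<in>{0..<T}. \<gamma> (u + 2 * pi) t = \<gamma> u t) \<and>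
     smooth2_on (UNIV \<times> {0..<T}) \<gamma> \<and>
     (\<forall>u. \<forall>t\<in>{0..<T}. vector_derivative (\<lambda>u. \<gamma> u t) (at u) \<noteq> 0) \<and>
     (\<forall>u. \<forall>t\<in>{0..<T}. ((\<lambda>t. \<gamma> u t) has_vector_derivative curvature_vector (\<lambda>u. \<gamma> u t) u)
                           (at t within {0..<T}))"

definition maximal_csf :: "(real \<Rightarrow> real \<Rightarrow> 'a::real_normed_vector) \<Rightarrow> real \<Rightarrow> bool" where
  "maximal_csf \<gamma> T \<longleftrightarrow> csf \<gamma> T \<and>
     \<not> (\<exists>T' \<gamma>'. T < T' \<and> csf \<gamma>' T' \<and> (\<forall>u. \<forall>t\<in>{0..<T}. \<gamma>' u t = \<gamma> u t))"

definition type_I_singularity :: "(real \<Rightarrow> real \<Rightarrow> 'a::real_normed_vector) \<Rightarrow> real \<Rightarrow> bool" where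
  "type_I_singularity \<gamma> T \<longleftrightarrow>
     Limsup (at_left T) (\<lambda>t. SUP u. ereal ((curvature (\<lambda>u. \<gamma> u t) u)\<^sup>2 * (T - t))) < \<infinity>"

definition type_II_singularity :: "(real \<Rightarrow> real \<Rightarrow> 'a::real_normed_vector) \<Rightarrow> real \<Rightarrow> bool" where
  "type_II_singularity \<gamma> T \<longleftrightarrow> \<not> type_I_singularity \<gamma> T"

definition shrinks_to :: "(real \<Rightarrow> real \<Rightarrow> 'a::real_normed_vector) \<Rightarrow> real \<Rightarrow> 'a \<Rightarrow> bool" where
  "shrinks_to \<gamma> T p \<longleftrightarrow> uniform_limit UNIV (\<lambda>t u. \<gamma> u t) (\<lambda>u. p) (at_left T)"

section \<open>One-to-one convex projections\<close>

text \<open>The \<open>xy\<close>-plane is spanned by the coordinates with two distinct indices \<open>ix\<close> and \<open>iy\<close>.\<close>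

definition P_xy :: "'n \<Rightarrow> 'n \<Rightarrow> real ^ 'n \<Rightarrow> real \<times> real" where
  "P_xy ix iy z = (z $ ix, z $ iy)"

definition convex_curve :: "(real \<times> real) set \<Rightarrow> bool" where
  "convex_curve C \<longleftrightarrow> (\<exists>K. convex K \<and> compact K \<and> interior K \<noteq> {} \<and> C = frontier K)"

text \<open>Injectivity is meant on \<open>S\<^sup>1\<close>, so that multiply covered curves are excluded.\<close>

definition one_to_one_convex_projection :: "'n \<Rightarrow> 'n \<Rightarrow> (real \<Rightarrow> real ^ 'n) \<Rightarrow> bool" where
  "one_to_one_convex_projection ix iy c \<longleftrightarrow>
     (\<forall>u w. P_xy ix iy (c u) = P_xy ix iy (c w) \<longrightarrow> [u = w] (rmod (2 * pi))) \<and>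
     convex_curve (range (\<lambda>u. P_xy ix iy (c u)))"

section \<open>Rescaled flows and tangent flows\<close>

text \<open>\<open>t = T - exp (-2\<tau>)\<close> solves \<open>\<tau> = - log (T - t) / 2\<close>.\<close>

definition rescaled_csf ::
  "(real \<Rightarrow> real \<Rightarrow> 'a::real_normed_vector) \<Rightarrow> real \<Rightarrow> real \<Rightarrow> real \<Rightarrow> 'a" where
  "rescaled_csf \<gamma> T u \<tau> = (let t = T - exp (- 2 * \<tau>) in (1 / sqrt (2 * T - 2 * t)) *\<^sub>R \<gamma> u t)"

text \<open>A flow parameterized by a one-dimensional manifold, the disjoint union over
  \<open>\<alpha> \<in> comps F\<close> of \<open>\<real>/p\<^sub>\<alpha>\<int>\<close> with \<open>p\<^sub>\<alpha> = period F \<alpha> \<ge> 0\<close>: a circle if \<open>p\<^sub>\<alpha> > 0\<close>, and the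
  real line if \<open>p\<^sub>\<alpha> = 0\<close>, since congruence modulo \<open>0\<close> is equality.\<close>

record 'a param_flow =
  comps :: "nat set"
  period :: "nat \<Rightarrow> real"
  pos :: "nat \<Rightarrow> real \<Rightarrow> real \<Rightarrow> 'a"

definition normal_part :: "(real \<Rightarrow> 'a::real_inner) \<Rightarrow> real \<Rightarrow> 'a \<Rightarrow> 'a" where
  "normal_part c u X = X - (X \<bullet> unit_tangent c u) *\<^sub>R unit_tangent c u"

text \<open>The rescaling turns \<open>\<gamma>\<^sub>t = \<gamma>\<^sub>s\<^sub>s\<close> into \<open>\<Gamma>\<^sub>\<tau> = \<Gamma>\<^sub>\<sigma>\<^sub>\<sigma> + \<Gamma>\<close>. Since limits are taken modulo
  time-dependent reparameterization, only the normal component of this equation is meaningful;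
  the stationary line, for example, satisfies only the latter.\<close>

definition rescaled_flow :: "'a::real_inner param_flow \<Rightarrow> bool" where
  "rescaled_flow F \<longleftrightarrow>
     (\<forall>\<alpha>\<in>comps F.
        0 \<le> period F \<alpha> \<and>
        smooth2_on UNIV (pos F \<alpha>) \<and>
        (\<forall>u \<tau>. pos F \<alpha> (u + period F \<alpha>) \<tau> = pos F \<alpha> u \<tau> \<and>
          vector_derivative (\<lambda>u. pos F \<alpha> u \<tau>) (at u) \<noteq> 0 \<and>
          normal_part (\<lambda>u. pos F \<alpha> u \<tau>) u (vector_derivative (\<lambda>\<tau>. pos F \<alpha> u \<tau>) (at \<tau>)) =
            curvature_vector (\<lambda>u. pos F \<alpha> u \<tau>) u +
            normal_part (\<lambda>u. pos F \<alpha> u \<tau>) u (pos F \<alpha> u \<tau>)))"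

definition stationary_double_line :: "'a::real_normed_vector \<Rightarrow> 'a param_flow" where
  "stationary_double_line v = \<lparr>comps = {0, 1}, period = (\<lambda>\<alpha>. 0), pos = (\<lambda>\<alpha> u \<tau>. u *\<^sub>R v)\<rparr>"

definition finite_interval_union :: "real set \<Rightarrow> bool" where
  "finite_interval_union S \<longleftrightarrow>
     (\<exists>P. finite P \<and> (\<forall>(c, d)\<in>P. c < d) \<and> S = (\<Union>(c, d)\<in>P. {c..d}))"

text \<open>\<open>\<Gamma>\<close> is a flow of closed curves, \<open>2\<pi>\<close>-periodic in its first argument, and the \<open>j\<close>-th
  flow of the sequence is \<open>\<Gamma>(\<cdot>, \<tau>\<^sub>j + \<tau>)\<close>. The parameter domain \<open>I = \<Union>\<^sub>\<alpha> I \<alpha>\<close> is a finite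
  union of compact intervals, with \<open>I \<alpha>\<close> contained in the component \<open>\<alpha>\<close> of the domain of \<open>F\<close>.
  The reparameterization \<open>\<phi> j\<close>, with values in \<open>\<real>/2\<pi>\<int>\<close> and written through lifts to \<open>\<real>\<close>,
  is injective (modulo the identifications in source and target) and immersive, and it runs
  through every point of the \<open>j\<close>-th curve lying in the closed ball. It may also run through
  points outside the ball: \<open>I\<close> does not depend on \<open>\<tau>\<close>, whereas the parameter set of the arcs
  inside the ball in general does. Likewise \<open>I\<close> contains all parameters at which \<open>F\<close> lies in the
  closed ball; otherwise \<open>F\<close> would be unconstrained at parameters that belong to no \<open>I\<close>.\<close>

definition locally_smoothly_converges ::
  "(real \<Rightarrow> real \<Rightarrow> 'a::real_inner) \<Rightarrow> (nat \<Rightarrow> real) \<Rightarrow> 'a param_flow \<Rightarrow> bool" where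
  "locally_smoothly_converges \<Gamma> \<tau>s F \<longleftrightarrow>
     (\<forall>a b R. a < b \<and> 0 < R \<longrightarrow>
       (\<exists>(I :: nat \<Rightarrow> real set) (J :: nat) (\<phi> :: nat \<Rightarrow> nat \<Rightarrow> real \<Rightarrow> real \<Rightarrow> real).
          (\<forall>\<alpha>\<in>comps F. finite_interval_union (I \<alpha>)) \<and>
          finite {\<alpha> \<in> comps F. I \<alpha> \<noteq> {}} \<and>
          (\<forall>\<alpha>\<in>comps F. \<forall>u. \<forall>\<tau>\<in>{a..b}. norm (pos F \<alpha> u \<tau>) \<le> R \<longrightarrow>
             (\<exists>w\<in>I \<alpha>. [u = w] (rmod period F \<alpha>))) \<and>
          (\<forall>j\<ge>J.
             (\<forall>\<alpha>\<in>comps F.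
                smooth2_on (I \<alpha> \<times> {a..b}) (\<phi> j \<alpha>) \<and>
                (\<forall>u\<in>I \<alpha>. \<forall>\<tau>\<in>{a..b}.
                   vector_derivative (\<lambda>u. \<phi> j \<alpha> u \<tau>) (at u within I \<alpha>) \<noteq> 0)) \<and>
             (\<forall>\<tau>\<in>{a..b}.
                (\<forall>\<alpha>\<in>comps F. \<forall>\<beta>\<in>comps F. \<forall>u\<in>I \<alpha>. \<forall>w\<in>I \<beta>.
                   [\<phi> j \<alpha> u \<tau> = \<phi> j \<beta> w \<tau>] (rmod (2 * pi)) \<longleftrightarrow>
                   \<alpha> = \<beta> \<and> [u = w] (rmod period F \<alpha>)) \<and>
                (\<forall>x. norm (\<Gamma> x (\<tau>s j + \<tau>)) \<le> R \<longrightarrow>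
                   (\<exists>\<alpha>\<in>comps F. \<exists>u\<in>I \<alpha>. [\<phi> j \<alpha> u \<tau> = x] (rmod (2 * pi)))))) \<and>
          (\<forall>\<alpha>\<in>comps F.
             smooth2_converges_on (I \<alpha> \<times> {a..b})
               (\<lambda>j u \<tau>. \<Gamma> (\<phi> j \<alpha> u \<tau>) (\<tau>s j + \<tau>)) (pos F \<alpha>))))"

definition tangent_flow ::
  "(real \<Rightarrow> real \<Rightarrow> 'a::real_inner) \<Rightarrow> real \<Rightarrow> 'a param_flow \<Rightarrow> bool" where
  "tangent_flow \<gamma> T F \<longleftrightarrow> rescaled_flow F \<and>
     (\<exists>\<tau>s. filterlim \<tau>s at_top sequentially \<and>
           locally_smoothly_converges (rescaled_csf \<gamma> T) \<tau>s F)"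

text \<open>\<open>v\<close> is a unit direction vector of a limit line; the line itself is \<open>span {v}\<close>.\<close>

definition limit_line_direction ::
  "(real \<Rightarrow> real \<Rightarrow> 'a::real_inner) \<Rightarrow> real \<Rightarrow> 'a \<Rightarrow> bool" where
  "limit_line_direction \<gamma> T v \<longleftrightarrow> norm v = 1 \<and>
     (\<exists>\<tau>s. filterlim \<tau>s at_top sequentially \<and>
           locally_smoothly_converges (rescaled_csf \<gamma> T) \<tau>s (stationary_double_line v))"

text \<open>Equality of parameterized flows up to time-dependent reparameterization. The
  diffeomorphism between corresponding components is written through a lift
  \<open>\<theta> \<alpha> (\<cdot>, \<tau>) : \<real> \<rightarrow> \<real>\<close>.\<close>

definition reparam_equivalent :: "'a param_flow \<Rightarrow> 'a param_flow \<Rightarrow> bool" where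
  "reparam_equivalent F G \<longleftrightarrow>
     (\<exists>(\<pi> :: nat \<Rightarrow> nat) (\<theta> :: nat \<Rightarrow> real \<Rightarrow> real \<Rightarrow> real).
        bij_betw \<pi> (comps F) (comps G) \<and>
        (\<forall>\<alpha>\<in>comps F.
           smooth2_on UNIV (\<theta> \<alpha>) \<and>
           (\<forall>\<tau>. bij (\<lambda>u. \<theta> \<alpha> u \<tau>) \<and>
             (\<forall>u. vector_derivative (\<lambda>u. \<theta> \<alpha> u \<tau>) (at u) \<noteq> 0) \<and>
             (\<forall>u w. [\<theta> \<alpha> u \<tau> = \<theta> \<alpha> w \<tau>] (rmod period G (\<pi> \<alpha>)) \<longleftrightarrow>
                    [u = w] (rmod period F \<alpha>)) \<and>
             (\<forall>u. pos F \<alpha> u \<tau> = pos G (\<pi> \<alpha>) (\<theta> \<alpha> u \<tau>) \<tau>))))"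

end

theory Submission
  imports Defs "HOL-Complex_Analysis.Complex_Analysis"
begin

text \<open>The hypotheses are contradictory: a curve shortening flow with one-to-one convex projection that
  shrinks to a point is of Type I. For positive time the projection is uniformly immersed and convex,
  so \<open>x\<^sub>t = x\<^sub>s\<^sub>s\<close>, with \<open>lam \<le> x\<^sub>s\<^sup>2 + y\<^sub>s\<^sup>2 \<le> 1\<close>, allows planar curves as barriers. A grim reaper
  and an Angenent oval show that a projection of small width \<open>w\<close> has length of order \<open>(T - t) / w\<close>;
  over such a long thin projection a parabolic lens keeps the width from decreasing, so that the width
  is at least of the order of \<open>\<surd>(T - t)\<close>. Hence the projection contains a ball of that radius, and
  Tso's maximum principle argument bounds the curvature by a multiple of \<open>1 / \<surd>(T - t)\<close>.\<close>

section \<open>Extrema and one-sided derivatives\<close>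

text \<open>The projection is not itself a curve shortening flow: its coordinates solve
  \<open>x\<^sub>t = x\<^sub>s\<^sub>s\<close> with s the arc length of the space curve. The inner
  barriers move by the estimate \<open>x\<^sub>s\<^sup>2 + y\<^sub>s\<^sup>2 \<le> 1\<close>; the
  outer barrier and the curvature estimate need the lower bound \<open>lam\<close>. This bound is
  the main obstacle, because the initial curve may have tangents perpendicular to the plane. It
  comes from tilting: once the projection is strictly curved, which a strong maximum principle
  yields at some positive time, it stays convex when a direction e' of the plane is replaced by
  \<open>M e' + \<zeta>\<close> with \<open>\<zeta>\<close> of norm at most 1. Convexity of a
  projection is preserved for every pair of directions, hence for all tilts at once, and this
  confines the tangents to slope at most M, so that \<open>lam = 1 / (1 + M\<^sup>2)\<close>.
  Convexity is carried by inscribed triangles rather than by curvature, since triangles make sense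
  where the projection fails to be immersed. In the curvature estimate the torsion of the space
  curve enters with the favourable sign.\<close>

lemma local_min_second_derivative:
  fixes f :: "real \<Rightarrow> real"
  assumes e: "0 < e"
    and d1: "\<And>x. \<bar>x - u\<bar> < e \<Longrightarrow> (f has_real_derivative f' x) (at x)"
    and d2: "(f' has_real_derivative c) (at u)"
    and min: "\<And>x. \<bar>x - u\<bar> < e \<Longrightarrow> f u \<le> f x"
  shows "f' u = 0" and "0 \<le> c"
proof -
  show z: "f' u = 0"
    using DERIV_local_min[OF d1[of u] e] min e by (simp add: abs_minus_commute)
  show "0 \<le> c"
  proof (rule ccontr)
    assume "\<not> 0 \<le> c"
    then obtain d where d: "0 < d" "\<And>h. 0 < h \<Longrightarrow> h < d \<Longrightarrow> f' (u + h) < f' u"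
      using DERIV_neg_dec_right[OF d2] by auto
    define h where "h = min d e / 2"
    have h: "0 < h" "h < d" "h < e" using d(1) e by (auto simp: h_def)
    obtain \<xi> where \<xi>: "u < \<xi>" "\<xi> < u + h" "f (u + h) - f u = (u + h - u) * f' \<xi>"
      using MVT2[of u "u + h" f f'] d1 h by force
    have "f' (u + (\<xi> - u)) < f' u" using \<xi> h by (intro d(2)) auto
    hence "f (u + h) < f u" using \<xi>(3) h z mult_pos_neg[of h "f' \<xi>"] by simp
    thus False using min[of "u + h"] h by auto
  qed
qed

text \<open>Minimality over the immediate past bounds the time derivative from above, while the
  second derivative test in space bounds it from below. The exponential weight accommodates
  zero-order terms in this comparison.\<close>

lemma left_derivative_le:
  fixes f :: "real \<Rightarrow> real"
  assumes d: "(f has_real_derivative c) (at t within S)" and e: "0 < e" "{t - e..t} \<subseteq> S"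
    and le: "\<And>r. t - e < r \<Longrightarrow> r < t \<Longrightarrow> f t * exp (- L * t) \<le> f r * exp (- L * r)"
  shows "c \<le> L * f t"
proof -
  define h where "h = (\<lambda>r. f r * exp (- L * r))"
  have "(f has_real_derivative c) (at t within {t - e..t})"
    using d e(2) by (rule DERIV_subset)
  hence "(h has_real_derivative (c - L * f t) * exp (- L * t)) (at t within {t - e..t})"
    unfolding h_def by (auto intro!: derivative_eq_intros simp: algebra_simps)
  moreover have "(at t within {t - e..t}) = at_left t"
    using e(1) by (intro at_within_Icc_at_left) simp
  ultimately have lim: "((\<lambda>r. (h r - h t) / (r - t)) \<longlongrightarrow> (c - L * f t) * exp (- L * t)) (at_left t)"
    by (simp add: has_field_derivative_iff)
  have ev: "eventually (\<lambda>r. t - e < r \<and> r < t) (at_left t)"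
    using e(1) by (auto intro!: eventually_at_leftI[of "t - e"])
  have "eventually (\<lambda>r. (h r - h t) / (r - t) \<le> 0) (at_left t)"
    using ev
  proof eventually_elim
    case (elim r)
    then have "h t \<le> h r" unfolding h_def by (intro le) auto
    then show ?case using elim by (intro divide_nonneg_neg) auto
  qed
  hence "(c - L * f t) * exp (- L * t) \<le> 0"
    by (rule tendsto_upperbound[OF lim]) simp
  thus ?thesis by (simp add: mult_le_0_iff)
qed

text \<open>The weight is positive and depends on time alone, so the minimiser is also a minimum of
  \<open>f\<close> on its own time slice and \<open>f\<close> is still negative there.\<close>

lemma obtain_weighted_min:
  fixes f :: "'a::topological_space \<times> real \<Rightarrow> real"
  assumes "compact E" "continuous_on E f" "z0 \<in> E" "f z0 < 0"
  obtains z t where "(z, t) \<in> E" "f (z, t) < 0"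
    "\<And>w r. (w, r) \<in> E \<Longrightarrow> f (z, t) * exp (- L * t) \<le> f (w, r) * exp (- L * r)"
proof -
  have "continuous_on E (\<lambda>q. f q * exp (- L * snd q))"
    by (intro continuous_intros assms)
  then obtain q where q: "q \<in> E" "\<And>q'. q' \<in> E \<Longrightarrow> f q * exp (- L * snd q) \<le> f q' * exp (- L * snd q')"
    using continuous_attains_inf[of E "\<lambda>q. f q * exp (- L * snd q)"] assms by blast
  have "f q * exp (- L * snd q) < 0"
    using q(2)[OF assms(3)] assms(4) by (meson exp_gt_zero le_less_trans mult_neg_pos)
  hence "f q < 0" by (simp add: mult_less_0_iff)
  then show ?thesis
    using that[of "fst q" "snd q"] q by (metis prod.collapse snd_conv)
qed

section \<open>The flow in terms of its partial derivatives\<close>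

text \<open>One family \<open>D\<close> carries all partial derivatives, and both
  \<open>D (Suc k) l\<close> and \<open>D k (Suc l)\<close> derive from \<open>D k l\<close>; hence
  mixed partials commute by construction. The equation \<open>evolution\<close> is the second
  arc-length derivative expanded in the parameter u.\<close>

locale flow =
  fixes D :: "nat \<Rightarrow> nat \<Rightarrow> real \<Rightarrow> real \<Rightarrow> 'a::euclidean_space" and T :: real
  assumes T_pos: "0 < T"
    and D_u: "t \<in> {0..<T} \<Longrightarrow> ((\<lambda>u. D k l u t) has_vector_derivative D (Suc k) l u t) (at u)"
    and D_t: "t \<in> {0..<T} \<Longrightarrow>
      ((\<lambda>t. D k l u t) has_vector_derivative D k (Suc l) u t) (at t within {0..<T})"
    and D_cont: "continuous_on (UNIV \<times> {0..<T}) (\<lambda>z. D k l (fst z) (snd z))"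
    and D_per: "t \<in> {0..<T} \<Longrightarrow> D k l (u + 2 * pi) t = D k l u t"
    and regular: "t \<in> {0..<T} \<Longrightarrow> D (Suc 0) 0 u t \<noteq> 0"
    and evolution: "t \<in> {0..<T} \<Longrightarrow> D 0 (Suc 0) u t =
      (1 / (norm (D (Suc 0) 0 u t))\<^sup>2) *\<^sub>R (D (Suc (Suc 0)) 0 u t -
        ((D (Suc 0) 0 u t \<bullet> D (Suc (Suc 0)) 0 u t) / (norm (D (Suc 0) 0 u t))\<^sup>2) *\<^sub>R D (Suc 0) 0 u t)"
begin

abbreviation "g \<equiv> D 0 0"
abbreviation "gu \<equiv> D (Suc 0) 0"
abbreviation "guu \<equiv> D (Suc (Suc 0)) 0"
abbreviation "guuu \<equiv> D (Suc (Suc (Suc 0))) 0"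
abbreviation "gt \<equiv> D 0 (Suc 0)"
abbreviation "gtu \<equiv> D (Suc 0) (Suc 0)"
abbreviation "gtuu \<equiv> D (Suc (Suc 0)) (Suc 0)"
abbreviation "gtt \<equiv> D 0 (Suc (Suc 0))"

text \<open>\<open>a\<close> is the inverse of the induced metric and \<open>ch\<close> its
  Christoffel symbol, the u-derivative of log |\<gamma>_u|. Hence a (f_uu - ch f_u) is the second
  arc-length derivative of f, while time derivatives are always taken at fixed u.\<close>

definition a :: "real \<Rightarrow> real \<Rightarrow> real" where "a u t = 1 / (norm (gu u t))\<^sup>2"
definition ch :: "real \<Rightarrow> real \<Rightarrow> real" where "ch u t = (gu u t \<bullet> guu u t) / (norm (gu u t))\<^sup>2"

lemma a_pos: "t \<in> {0..<T} \<Longrightarrow> 0 < a u t"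
  using regular by (simp add: a_def)

lemma a_norm: "t \<in> {0..<T} \<Longrightarrow> a u t * (norm (gu u t))\<^sup>2 = 1"
  using regular by (simp add: a_def)

lemma gt_eq: "t \<in> {0..<T} \<Longrightarrow> gt u t = a u t *\<^sub>R (guu u t - ch u t *\<^sub>R gu u t)"
  using evolution by (simp add: a_def ch_def)

lemma gt_inner:
  "t \<in> {0..<T} \<Longrightarrow> gt u t \<bullet> e = a u t * (guu u t \<bullet> e) - a u t * ch u t * (gu u t \<bullet> e)"
  by (simp add: gt_eq inner_diff_left algebra_simps)

lemma inner_u:
  "t \<in> {0..<T} \<Longrightarrow> ((\<lambda>u. D k l u t \<bullet> e) has_real_derivative D (Suc k) l u t \<bullet> e) (at u)"
  using D_u[of t k l u]
  unfolding has_real_derivative_iff_has_vector_derivative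
  by (rule bounded_linear.has_vector_derivative[OF bounded_linear_inner_left])

lemma inner_t:
  "t \<in> {0..<T} \<Longrightarrow>
    ((\<lambda>t. D k l u t \<bullet> e) has_real_derivative D k (Suc l) u t \<bullet> e) (at t within {0..<T})"
  using D_t[of t k l u]
  unfolding has_real_derivative_iff_has_vector_derivative
  by (rule bounded_linear.has_vector_derivative[OF bounded_linear_inner_left])

lemma D_cont_comp [continuous_intros]:
  assumes "continuous_on A p" "continuous_on A q" "\<And>z. z \<in> A \<Longrightarrow> q z \<in> {0..<T}"
  shows "continuous_on A (\<lambda>z. D k l (p z) (q z))"
proof -
  have "continuous_on A (\<lambda>z. (p z, q z))" by (intro continuous_intros assms)
  moreover have "(\<lambda>z. (p z, q z)) ` A \<subseteq> UNIV \<times> {0..<T}" using assms(3) by blast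
  ultimately show ?thesis using continuous_on_compose2[OF D_cont] by fastforce
qed

lemma D_per_int:
  assumes "t \<in> {0..<T}" shows "D k l (u + 2 * pi * of_int m) t = D k l u t"
proof -
  have *: "D k l (u + 2 * pi * of_nat m) t = D k l u t" for u m
  proof (induction m)
    case (Suc m)
    have "u + 2 * pi * of_nat (Suc m) = (u + 2 * pi * of_nat m) + 2 * pi"
      by (simp add: algebra_simps)
    then show ?case using D_per[OF assms] Suc by metis
  qed simp
  show ?thesis
  proof (cases "0 \<le> m")
    case True then show ?thesis using *[of u "nat m"] by simp
  next
    case False then show ?thesis using *[of "u + 2 * pi * of_int m" "nat (- m)"] by simp
  qed
qed

lemma period_representative:
  obtains m :: int where "u0 \<le> u + 2 * pi * of_int m" "u + 2 * pi * of_int m < u0 + 2 * pi"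
proof -
  define m where "m = - \<lfloor>(u - u0) / (2 * pi)\<rfloor>"
  have "of_int (- m) \<le> (u - u0) / (2 * pi)" "(u - u0) / (2 * pi) < of_int (- m) + 1"
    unfolding m_def by linarith+
  hence "of_int (- m) * (2 * pi) \<le> u - u0" "u - u0 < (of_int (- m) + 1) * (2 * pi)"
    using pi_gt_zero by (auto simp: field_simps)
  then show ?thesis using that[of m] by (auto simp: algebra_simps)
qed

end

lemma partials_restrict:
  assumes D: "\<And>k l z. z \<in> UNIV \<times> {0..<T} \<Longrightarrow> (D k l has_derivative
        (\<lambda>(h, m). h *\<^sub>R D (Suc k) l z + m *\<^sub>R D k (Suc l) z)) (at z within UNIV \<times> {0..<T})"
    and t: "(t::real) \<in> {0..<T}"
  shows "((\<lambda>u::real. D k l (u, t)) has_vector_derivative D (Suc k) l (u, t)) (at u)"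
    and "((\<lambda>t. D k l (u, t)) has_vector_derivative D k (Suc l) (u, t)) (at t within {0..<T})"
proof -
  note d = D[of "(u, t)" k l]
  have "((\<lambda>u. D k l (u, t)) has_derivative (\<lambda>h. h *\<^sub>R D (Suc k) l (u, t))) (at u within UNIV)"
    using has_derivative_in_compose[of "\<lambda>u. (u, t)" "\<lambda>h. (h, 0)" u UNIV "D k l"]
      has_derivative_subset[OF d, of "range (\<lambda>u. (u, t))"] t
    by (fastforce intro: derivative_eq_intros)
  then show "((\<lambda>u. D k l (u, t)) has_vector_derivative D (Suc k) l (u, t)) (at u)"
    by (simp add: has_vector_derivative_def)
  have "((\<lambda>t. D k l (u, t)) has_derivative (\<lambda>h. h *\<^sub>R D k (Suc l) (u, t))) (at t within {0..<T})"
    using has_derivative_in_compose[of "\<lambda>t. (u, t)" "\<lambda>h. (0, h)" t "{0..<T}" "D k l"]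
      has_derivative_subset[OF d, of "(\<lambda>t. (u, t)) ` {0..<T}"] t
    by (fastforce intro: derivative_eq_intros)
  then show "((\<lambda>t. D k l (u, t)) has_vector_derivative D k (Suc l) (u, t)) (at t within {0..<T})"
    by (simp add: has_vector_derivative_def)
qed

lemma curvature_vector_eq:
  fixes c :: "real \<Rightarrow> 'a::real_inner"
  assumes 1: "\<And>u. (c has_vector_derivative c1 u) (at u)" and 2: "\<And>u. (c1 has_vector_derivative c2 u) (at u)"
    and reg: "\<And>u. c1 u \<noteq> 0"
  shows "curvature_vector c u = (1 / (norm (c1 u))\<^sup>2) *\<^sub>R (c2 u - ((c1 u \<bullet> c2 u) / (norm (c1 u))\<^sup>2) *\<^sub>R c1 u)"
proof -
  have v: "vector_derivative c (at u) = c1 u" for u using 1 vector_derivative_at by blast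
  have T: "arc_deriv c c = (\<lambda>u. (1 / norm (c1 u)) *\<^sub>R c1 u)" by (auto simp: arc_deriv_def v)
  have n: "((\<lambda>u. 1 / norm (c1 u)) has_real_derivative - (c1 u \<bullet> c2 u) / norm (c1 u) ^ 3) (at u)"
  proof -
    have "((\<lambda>u. c1 u \<bullet> c1 u) has_real_derivative 2 * (c1 u \<bullet> c2 u)) (at u)"
      using bounded_bilinear.has_vector_derivative[OF bounded_bilinear_inner 2[of u] 2[of u]]
      by (simp add: has_real_derivative_iff_has_vector_derivative inner_commute)
    then have "((\<lambda>u. 1 / sqrt (c1 u \<bullet> c1 u)) has_real_derivative
        - (2 * (c1 u \<bullet> c2 u) * (inverse (sqrt (c1 u \<bullet> c1 u)) / 2)) / (sqrt (c1 u \<bullet> c1 u) * sqrt (c1 u \<bullet> c1 u))) (at u)"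
      using reg[of u] inner_gt_zero_iff[of "c1 u"]
      by (auto intro!: derivative_eq_intros simp: divide_simps simp del: inner_gt_zero_iff)
    then show ?thesis
      by (simp add: norm_eq_sqrt_inner divide_simps power3_eq_cube mult.commute)
  qed
  have "((\<lambda>u. (1 / norm (c1 u)) *\<^sub>R c1 u) has_vector_derivative
      (1 / norm (c1 u)) *\<^sub>R c2 u + (- (c1 u \<bullet> c2 u) / norm (c1 u) ^ 3) *\<^sub>R c1 u) (at u)"
    by (rule has_vector_derivative_scaleR[OF n 2])
  then have "curvature_vector c u = (1 / norm (c1 u)) *\<^sub>R
      ((1 / norm (c1 u)) *\<^sub>R c2 u + (- (c1 u \<bullet> c2 u) / norm (c1 u) ^ 3) *\<^sub>R c1 u)"
    unfolding curvature_vector_def T arc_deriv_def[of c "\<lambda>u. (1 / norm (c1 u)) *\<^sub>R c1 u"] v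
    by (simp add: vector_derivative_at)
  also have "\<dots> = (1 / (norm (c1 u))\<^sup>2) *\<^sub>R (c2 u - ((c1 u \<bullet> c2 u) / (norm (c1 u))\<^sup>2) *\<^sub>R c1 u)"
    by (simp add: scaleR_right_distrib scaleR_right_diff_distrib power2_eq_square power3_eq_cube mult.assoc)
  finally show ?thesis .
qed

lemma csf_imp_flow:
  fixes \<gamma> :: "real \<Rightarrow> real \<Rightarrow> 'a::euclidean_space"
  assumes "csf \<gamma> T"
  obtains D where "flow D T" "\<And>u t. t \<in> {0..<T} \<Longrightarrow> D 0 0 u t = \<gamma> u t"
    "\<And>u t. t \<in> {0..<T} \<Longrightarrow> curvature (\<lambda>u. \<gamma> u t) u = norm (D 0 (Suc 0) u t)"
proof -
  let ?S = "UNIV \<times> {0..<T} :: (real \<times> real) set"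
  have T: "0 < T" and per: "\<And>u t. t \<in> {0..<T} \<Longrightarrow> \<gamma> (u + 2 * pi) t = \<gamma> u t"
    and reg: "\<And>u t. t \<in> {0..<T} \<Longrightarrow> vector_derivative (\<lambda>u. \<gamma> u t) (at u) \<noteq> 0"
    and ev: "\<And>u t. t \<in> {0..<T} \<Longrightarrow> ((\<lambda>t. \<gamma> u t) has_vector_derivative curvature_vector (\<lambda>u. \<gamma> u t) u)
                           (at t within {0..<T})"
    using assms unfolding csf_def by auto
  obtain E where E0: "\<And>z. z \<in> ?S \<Longrightarrow> E 0 0 z = (case z of (u, t) \<Rightarrow> \<gamma> u t)"
    and E: "\<And>k l z. z \<in> ?S \<Longrightarrow> (E k l has_derivative
        (\<lambda>(h, m). h *\<^sub>R E (Suc k) l z + m *\<^sub>R E k (Suc l) z)) (at z within ?S)"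
    using assms unfolding csf_def smooth2_on_def partials_on_def by blast
  define D where "D k l u t = E k l (u, t)" for k l u t
  have Du: "((\<lambda>u. D k l u t) has_vector_derivative D (Suc k) l u t) (at u)"
    and Dt: "((\<lambda>t. D k l u t) has_vector_derivative D k (Suc l) u t) (at t within {0..<T})"
    if "t \<in> {0..<T}" for k l u t
    using partials_restrict[where D = E, OF E that] by (auto simp: D_def)
  have D0: "D 0 0 u t = \<gamma> u t" if "t \<in> {0..<T}" for u t
    using E0 that by (auto simp: D_def)
  have cont: "continuous_on ?S (\<lambda>z. D k l (fst z) (snd z))" for k l
    unfolding D_def using has_derivative_continuous_on[OF E, of k l] by simp
  have wt: "at t within {0..<T} \<noteq> bot" if "t \<in> {0..<T}" for t
    using that T by (simp add: trivial_limit_within islimpt_Ico)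
  have D1: "((\<lambda>u. \<gamma> u t) has_vector_derivative D (Suc 0) 0 u t) (at u)" if "t \<in> {0..<T}" for u t
    using Du[OF that, of 0 0 u] D0[OF that] by simp
  \<comment> \<open>Induction on the total order: the identity one order lower is differentiated, in
    u if k is positive and in t otherwise. At t = 0 the derivative within the half-open interval is
    still unique.\<close>
  have Dper: "D k l (u + 2 * pi) t = D k l u t" if "t \<in> {0..<T}" for k l u t
    using that
  proof (induction "k + l" arbitrary: k l u t)
    case 0
    then show ?case using per D0 by simp
  next
    case (Suc n)
    show ?case
    proof (cases k)
      case (Suc k')
      have *: "((\<lambda>u. D k' l (u + 2 * pi) t) has_vector_derivative D (Suc k') l (u + 2 * pi) t) (at u)"
      proof -
        have "((\<lambda>u. u + 2 * pi) has_vector_derivative 1) (at u)"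
          by (auto intro!: derivative_eq_intros)
        from vector_diff_chain_at[OF this Du[OF Suc.prems, of k' l "u + 2 * pi"]]
        show ?thesis by (simp add: o_def)
      qed
      have "(\<lambda>u. D k' l (u + 2 * pi) t) = (\<lambda>u. D k' l u t)"
        using Suc.hyps(1)[of k' l t] Suc.hyps(2) \<open>k = Suc k'\<close> Suc.prems by auto
      then show ?thesis using * Du[OF Suc.prems, of k' l u] \<open>k = Suc k'\<close>
        by (metis vector_derivative_unique_at)
    next
      case 0
      then obtain l' where l: "l = Suc l'" using Suc.hyps(2) by (cases l) auto
      have "\<And>s. s \<in> {0..<T} \<Longrightarrow> D k l' (u + 2 * pi) s = D k l' u s"
        using Suc.hyps(1)[of k l'] Suc.hyps(2) l 0 by auto
      then have "((\<lambda>s. D k l' u s) has_vector_derivative D k (Suc l') (u + 2 * pi) t) (at t within {0..<T})"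
        using Dt[OF Suc.prems, of k l' "u + 2 * pi"] Suc.prems
        by (metis (no_types, lifting) has_vector_derivative_transform)
      then show ?thesis using Dt[OF Suc.prems, of k l' u] l
        vector_derivative_unique_within[OF wt[OF Suc.prems]] by blast
    qed
  qed
  have reg': "D (Suc 0) 0 u t \<noteq> 0" if "t \<in> {0..<T}" for u t
    using reg[OF that, of u] D1[OF that, of u] vector_derivative_at by metis
  have curv: "curvature_vector (\<lambda>u. \<gamma> u t) u = (1 / (norm (D (Suc 0) 0 u t))\<^sup>2) *\<^sub>R (D (Suc (Suc 0)) 0 u t -
        ((D (Suc 0) 0 u t \<bullet> D (Suc (Suc 0)) 0 u t) / (norm (D (Suc 0) 0 u t))\<^sup>2) *\<^sub>R D (Suc 0) 0 u t)"
    if "t \<in> {0..<T}" for u t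
    using curvature_vector_eq[of "\<lambda>u. \<gamma> u t", OF D1[OF that] Du[OF that] reg'[OF that]] by simp
  have gt: "D 0 (Suc 0) u t = curvature_vector (\<lambda>u. \<gamma> u t) u" if "t \<in> {0..<T}" for u t
  proof -
    have "((\<lambda>t. D 0 0 u t) has_vector_derivative curvature_vector (\<lambda>u. \<gamma> u t) u) (at t within {0..<T})"
      using ev[OF that, of u] D0 that by (metis (no_types, lifting) has_vector_derivative_transform)
    then show ?thesis using Dt[OF that, of 0 0 u] vector_derivative_unique_within[OF wt[OF that]] by blast
  qed
  have "flow D T"
    by (unfold_locales) (use T Du Dt cont Dper reg' gt curv in auto)
  moreover have "curvature (\<lambda>u. \<gamma> u t) u = norm (D 0 (Suc 0) u t)" if "t \<in> {0..<T}" for u t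
    using gt[OF that] by (simp add: curvature_def)
  ultimately show ?thesis using that D0 by blast
qed

section \<open>Maximum principles\<close>

context flow
begin

lemma representative:
  obtains w where "u0 \<le> w" "w < u0 + 2 * pi" "\<And>k l t. t \<in> {0..<T} \<Longrightarrow> D k l u t = D k l w t"
    "\<exists>m::int. w = u + 2 * pi * of_int m"
proof -
  obtain m :: int where m: "u0 \<le> u + 2 * pi * of_int m" "u + 2 * pi * of_int m < u0 + 2 * pi"
    using period_representative .
  show ?thesis using that[of "u + 2 * pi * of_int m"] m D_per_int by auto
qed

text \<open>At an interior point of a sublevel set this supplies the two local facts needed for the
  maximum principle on regions: a neighbourhood in space for the second derivative test, and a short
  stretch of the past.\<close>

lemma eventually_nbhd:
  assumes q: "continuous_on (UNIV \<times> {0..<T}) q" and t: "0 < t" "t < T" and less: "q (u, t) < (c::real)"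
  obtains e where "0 < e" "\<And>w. \<bar>w - u\<bar> < e \<Longrightarrow> q (w, t) < c"
    "\<And>r. t - e < r \<Longrightarrow> r < t \<Longrightarrow> 0 < r \<and> q (u, r) < c"
proof -
  obtain d where d: "0 < d" "\<And>z. z \<in> UNIV \<times> {0..<T} \<Longrightarrow> dist z (u, t) < d \<Longrightarrow> dist (q z) (q (u, t)) < c - q (u, t)"
    using q[unfolded continuous_on_iff, rule_format, of "(u, t)" "c - q (u, t)"] t less by auto
  show ?thesis
  proof (rule that[of "min d t"])
    show "q (w, t) < c" if "\<bar>w - u\<bar> < min d t" for w
      using d(2)[of "(w, t)"] that t by (auto simp: dist_Pair_Pair dist_real_def)
    show "0 < r \<and> q (u, r) < c" if "t - min d t < r" "r < t" for r
    proof -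
      have "t - r < d" "0 < r" using that by linarith+
      then show ?thesis using d(2)[of "(u, r)"] that t by (auto simp: dist_Pair_Pair dist_real_def)
    qed
  qed (use d t in auto)
qed

text \<open>The lateral boundary condition is hidden in \<open>step\<close>: at a negative minimum
  the point must have belonged to the region shortly before, which an application proves by
  excluding the boundary. Periodicity reduces the minimisation to a compact set.\<close>

lemma region_max_principle:
  fixes f :: "real \<Rightarrow> real \<Rightarrow> real"
  assumes s: "0 \<le> s" "t1 < T"
    and E: "closed E" "E \<subseteq> UNIV \<times> {s..t1}" "\<And>u t (m::int). (u, t) \<in> E \<Longrightarrow> (u + 2 * pi * of_int m, t) \<in> E"
    and f: "continuous_on E (\<lambda>z. f (fst z) (snd z))"
      "\<And>u t (m::int). t \<in> {s..t1} \<Longrightarrow> f (u + 2 * pi * of_int m) t = f u t"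
    and init: "\<And>u. (u, s) \<in> E \<Longrightarrow> 0 \<le> f u s"
    and step: "\<And>u t. (u, t) \<in> E \<Longrightarrow> s < t \<Longrightarrow> t \<le> t1 \<Longrightarrow> f u t < 0 \<Longrightarrow>
        (\<And>w. (w, t) \<in> E \<Longrightarrow> f u t \<le> f w t) \<Longrightarrow>
        \<exists>e>0. (\<forall>r. t - e < r \<and> r < t \<longrightarrow> (u, r) \<in> E) \<and>
          (\<exists>c. ((\<lambda>r. f u r) has_real_derivative c) (at t within {0..<T}) \<and> L * f u t \<le> c)"
    and mem: "(u, t) \<in> E"
  shows "0 \<le> f u t"
proof (rule ccontr)
  assume "\<not> 0 \<le> f u t"
  hence neg: "f u t < 0" by simp
  let ?E = "E \<inter> ({0..2*pi} \<times> {s..t1})"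
  have cE: "compact ?E" by (intro closed_Int_compact E compact_Times compact_Icc)
  have rep: "\<exists>w'. (w', r) \<in> ?E \<and> f w' r = f w r" if "(w, r) \<in> E" for w r
  proof -
    obtain m :: int where m: "0 \<le> w + 2 * pi * of_int m" "w + 2 * pi * of_int m < 0 + 2 * pi"
      using period_representative .
    show ?thesis using E(3)[OF that, of m] f(2)[of r w m] m that E(2) by (intro exI[of _ "w + 2 * pi * of_int m"]) auto
  qed
  obtain w0 where w0: "(w0, t) \<in> ?E" "f w0 t = f u t" using rep[OF mem] by auto
  have cf: "continuous_on ?E (\<lambda>z. f (fst z) (snd z))" using f(1) continuous_on_subset by blast
  obtain z r where zr: "(z, r) \<in> ?E" "f z r < 0"
    and min: "\<And>w q. (w, q) \<in> ?E \<Longrightarrow> f z r * exp (- (L + 1) * r) \<le> f w q * exp (- (L + 1) * q)"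
    using obtain_weighted_min[OF cE cf, of "(w0, t)" "L + 1"] w0 neg by auto
  have minE: "f z r * exp (- (L + 1) * r) \<le> f w q * exp (- (L + 1) * q)" if "(w, q) \<in> E" for w q
    using rep[OF that] min by metis
  have "s < r" using init[of z] zr by (cases "s = r") auto
  moreover have "f z r \<le> f w r" if "(w, r) \<in> E" for w using minE[OF that] by simp
  ultimately obtain e c where e: "0 < e" "\<And>q. r - e < q \<Longrightarrow> q < r \<Longrightarrow> (z, q) \<in> E"
    and c: "((\<lambda>q. f z q) has_real_derivative c) (at r within {0..<T})" "L * f z r \<le> c"
    using step[of z r] zr by auto
  define d where "d = min e (r - s)"
  \<comment> \<open>The weight uses \<open>L + 1\<close> rather than \<open>L\<close>: since f is
    negative, this contradicts the lower bound \<open>L * f z r\<close> strictly.\<close>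
  have "c \<le> (L + 1) * f z r"
  proof (rule left_derivative_le[OF c(1)])
    show "0 < d" "{r - d..r} \<subseteq> {0..<T}" using e \<open>s < r\<close> zr s by (auto simp: d_def)
    show "f z r * exp (- (L + 1) * r) \<le> f z q * exp (- (L + 1) * q)" if "r - d < q" "q < r" for q
      using that by (intro minE e(2)) (auto simp: d_def)
  qed
  thus False using c(2) zr(2) by (simp add: algebra_simps)
qed

lemma circle_max_principle:
  fixes f :: "real \<Rightarrow> real \<Rightarrow> real"
  assumes s: "0 \<le> s" "s \<le> t1" "t1 < T"
    and f: "continuous_on (UNIV \<times> {s..t1}) (\<lambda>z. f (fst z) (snd z))"
      "\<And>u t (m::int). t \<in> {s..t1} \<Longrightarrow> f (u + 2 * pi * of_int m) t = f u t"
    and init: "\<And>u. 0 \<le> f u s"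
    and step: "\<And>u t. s < t \<Longrightarrow> t \<le> t1 \<Longrightarrow> f u t < 0 \<Longrightarrow> (\<And>w. f u t \<le> f w t) \<Longrightarrow>
          \<exists>c. ((\<lambda>r. f u r) has_real_derivative c) (at t within {0..<T}) \<and> L * f u t \<le> c"
  shows "0 \<le> f u t1"
proof (rule region_max_principle[OF s(1,3), of "UNIV \<times> {s..t1}" f L])
  fix u t assume *: "(u, t) \<in> UNIV \<times> {s..t1}" "s < t" "t \<le> t1" "f u t < 0" "\<And>w. (w, t) \<in> UNIV \<times> {s..t1} \<Longrightarrow> f u t \<le> f w t"
  show "\<exists>e>0. (\<forall>r. t - e < r \<and> r < t \<longrightarrow> (u, r) \<in> UNIV \<times> {s..t1}) \<and>
          (\<exists>c. ((\<lambda>r. f u r) has_real_derivative c) (at t within {0..<T}) \<and> L * f u t \<le> c)"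
    using step[OF *(2,3,4)] * by (intro exI[of _ "t - s"]) auto
qed (use assms in \<open>auto intro!: closed_Times\<close>)

text \<open>At a spatial minimum of \<open>\<phi> (x) + \<psi> (y)\<close> the equation \<open>x\<^sub>t = x\<^sub>s\<^sub>s\<close> bounds the time derivative
  coming from the motion of the curve from below; \<open>a u t * (gu u t \<bullet> e)\<^sup>2\<close> is \<open>x\<^sub>s\<^sup>2\<close>.\<close>

lemma spatial_min:
  fixes \<phi> \<psi> \<phi>' \<psi>' :: "real \<Rightarrow> real"
  assumes t: "t \<in> {0..<T}" and e: "0 < e"
    and d1: "\<And>x. (\<phi> has_real_derivative \<phi>' x) (at x)" "(\<phi>' has_real_derivative c1) (at (g u t \<bullet> e1))"
    and d2: "\<And>x. (\<psi> has_real_derivative \<psi>' x) (at x)" "(\<psi>' has_real_derivative c2) (at (g u t \<bullet> e2))"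
    and min: "\<And>w. \<bar>w - u\<bar> < e \<Longrightarrow> \<phi> (g u t \<bullet> e1) + \<psi> (g u t \<bullet> e2) \<le> \<phi> (g w t \<bullet> e1) + \<psi> (g w t \<bullet> e2)"
  shows "- (c1 * (a u t * (gu u t \<bullet> e1)\<^sup>2)) - c2 * (a u t * (gu u t \<bullet> e2)\<^sup>2)
    \<le> \<phi>' (g u t \<bullet> e1) * (gt u t \<bullet> e1) + \<psi>' (g u t \<bullet> e2) * (gt u t \<bullet> e2)"
proof -
  let ?h1 = "\<lambda>w. \<phi>' (g w t \<bullet> e1) * (gu w t \<bullet> e1) + \<psi>' (g w t \<bullet> e2) * (gu w t \<bullet> e2)"
  let ?h2 = "c1 * (gu u t \<bullet> e1) * (gu u t \<bullet> e1) + (guu u t \<bullet> e1) * \<phi>' (g u t \<bullet> e1)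
     + (c2 * (gu u t \<bullet> e2) * (gu u t \<bullet> e2) + (guu u t \<bullet> e2) * \<psi>' (g u t \<bullet> e2))"
  have 1: "((\<lambda>w. \<phi> (g w t \<bullet> e1) + \<psi> (g w t \<bullet> e2)) has_real_derivative ?h1 x) (at x)" for x
    by (intro DERIV_add DERIV_chain2[OF d1(1)] DERIV_chain2[OF d2(1)] inner_u t)
  have 2: "(?h1 has_real_derivative ?h2) (at u)"
    by (intro DERIV_add DERIV_mult DERIV_chain2[where f = \<phi>' and g = "\<lambda>w. g w t \<bullet> e1", OF d1(2)] DERIV_chain2[where f = \<psi>' and g = "\<lambda>w. g w t \<bullet> e2", OF d2(2)] inner_u t)
  have z: "?h1 u = 0" and p: "0 \<le> ?h2"
    using local_min_second_derivative[OF e 1 2 min] by blast+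
  \<comment> \<open>Subtracting a multiple of the vanishing first derivative turns the second
    u-derivative into the second arc-length derivative, whose linear part is the velocity.\<close>
  have "0 \<le> a u t * ?h2 - a u t * ch u t * ?h1 u"
    using p z a_pos[OF t, of u] by simp
  then show ?thesis
    unfolding gt_inner[OF t] by (simp add: algebra_simps power2_eq_square)
qed

lemma spatial_min_linear:
  assumes t: "t \<in> {0..<T}" and e: "0 < e"
    and min: "\<And>w. \<bar>w - u\<bar> < e \<Longrightarrow> g u t \<bullet> v \<le> g w t \<bullet> v"
  shows "0 \<le> gt u t \<bullet> v"
  using spatial_min[OF t e, of "\<lambda>x. x" "\<lambda>x. 1" 0 u v "\<lambda>x. 0" "\<lambda>x. 0" 0 0] min by auto

section \<open>The support function\<close>

definition H :: "'a \<Rightarrow> real \<Rightarrow> real" where "H v t = (SUP u. g u t \<bullet> v)"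

lemma H_props:
  assumes t: "t \<in> {0..<T}"
  shows H_ge: "g u t \<bullet> v \<le> H v t" and H_attained: "\<exists>u. g u t \<bullet> v = H v t"
proof -
  have "continuous_on {0..2*pi} (\<lambda>u. g u t \<bullet> v)" using t by (intro continuous_intros) auto
  then obtain w where w: "w \<in> {0..2*pi}" "\<And>u. u \<in> {0..2*pi} \<Longrightarrow> g u t \<bullet> v \<le> g w t \<bullet> v"
    using continuous_attains_sup[of "{0..2*pi}"] by (metis compact_Icc atLeastatMost_empty_iff2 pi_ge_zero mult_nonneg_nonneg zero_le_numeral)
  have all: "g u t \<bullet> v \<le> g w t \<bullet> v" for u
  proof -
    obtain u' where "0 \<le> u'" "u' < 0 + 2 * pi" "g u t = g u' t"
      using representative[of 0 u] t by metis
    then show ?thesis using w(2)[of u'] by auto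
  qed
  have "H v t = g w t \<bullet> v" unfolding H_def
    using all by (intro cSup_eq_maximum) auto
  then show "g u t \<bullet> v \<le> H v t" "\<exists>u. g u t \<bullet> v = H v t" using all by auto
qed

text \<open>Every linear coordinate of the curve solves the heat equation f_t = f_ss, so its maximum
  cannot increase.\<close>

lemma H_antimono:
  assumes "0 \<le> s" "s \<le> t" "t < T"
  shows "H v t \<le> H v s"
proof -
  have "0 \<le> H v s - g u t \<bullet> v" for u
  proof (rule circle_max_principle[OF assms, of "\<lambda>u t. H v s - g u t \<bullet> v" 0 u])
    show "continuous_on (UNIV \<times> {s..t}) (\<lambda>z. H v s - g (fst z) (snd z) \<bullet> v)"
      using assms by (intro continuous_intros) auto
    show "H v s - g (u + 2 * pi * of_int m) r \<bullet> v = H v s - g u r \<bullet> v" if "r \<in> {s..t}" for u r m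
      using D_per_int[of r] that assms by auto
    show "0 \<le> H v s - g u s \<bullet> v" for u using H_ge[of s u v] assms by auto
    show "\<exists>c. ((\<lambda>r. H v s - g u r \<bullet> v) has_real_derivative c) (at r within {0..<T}) \<and> 0 * (H v s - g u r \<bullet> v) \<le> c"
      if "s < r" "r \<le> t" "H v s - g u r \<bullet> v < 0" "\<And>w. H v s - g u r \<bullet> v \<le> H v s - g w r \<bullet> v" for u r
    proof -
      have r: "r \<in> {0..<T}" using that assms by auto
      have "((\<lambda>r. H v s - g u r \<bullet> v) has_real_derivative 0 - gt u r \<bullet> v) (at r within {0..<T})"
        by (intro DERIV_diff DERIV_const inner_t r)
      moreover have "0 \<le> gt u r \<bullet> (- v)"
        by (rule spatial_min_linear[OF r zero_less_one]) (use that(4) in auto)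
      ultimately show ?thesis by auto
    qed
  qed
  moreover obtain u where "g u t \<bullet> v = H v t" using H_attained[of t v] assms by auto
  ultimately show ?thesis by (metis diff_ge_0_iff_ge)
qed

section \<open>Positivity of triangles\<close>

text \<open>Twice the signed area of a triangle inscribed in the projection is affine in each of the three points,
  hence solves a linear heat equation on ordered triples, with vanishing boundary values.\<close>

definition tri :: "'a \<Rightarrow> 'a \<Rightarrow> real \<Rightarrow> real \<Rightarrow> real \<Rightarrow> real \<Rightarrow> real" where
  "tri e1 e2 t u1 u2 u3 =
    ((g u2 t - g u1 t) \<bullet> e1) * ((g u3 t - g u1 t) \<bullet> e2) - ((g u2 t - g u1 t) \<bullet> e2) * ((g u3 t - g u1 t) \<bullet> e1)"

definition ordered :: "real \<Rightarrow> real \<Rightarrow> real \<Rightarrow> bool" where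
  "ordered u1 u2 u3 \<longleftrightarrow> u1 \<le> u2 \<and> u2 \<le> u3 \<and> u3 \<le> u1 + 2 * pi"

lemma tri_preserved:
  assumes st: "0 \<le> s" "s \<le> t1" "t1 < T"
    and init: "\<And>u1 u2 u3. ordered u1 u2 u3 \<Longrightarrow> 0 \<le> tri e1 e2 s u1 u2 u3"
    and ord: "ordered v1 v2 v3"
  shows "0 \<le> tri e1 e2 t1 v1 v2 v3"
proof (rule ccontr)
  assume neg: "\<not> 0 \<le> tri e1 e2 t1 v1 v2 v3"
  let ?f = "\<lambda>z. tri e1 e2 (snd z) (fst (fst z)) (fst (snd (fst z))) (snd (snd (fst z)))"
  define E :: "((real \<times> real \<times> real) \<times> real) set"
    where "E = {z. fst (fst z) \<in> {0..2*pi} \<and> fst (fst z) \<le> fst (snd (fst z)) \<and> fst (snd (fst z)) \<le> snd (snd (fst z))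
      \<and> snd (snd (fst z)) \<le> fst (fst z) + 2 * pi \<and> snd z \<in> {s..t1}}"
  have "closed E"
    unfolding E_def atLeastAtMost_iff
    by (intro closed_Collect_conj closed_Collect_le continuous_intros)
  moreover have "E \<subseteq> ({0..2*pi} \<times> {0..4*pi} \<times> {0..4*pi}) \<times> {s..t1}"
    unfolding E_def by (auto; linarith)
  ultimately have cE: "compact E"
    by (metis compact_Icc compact_Times closed_Int_compact inf.absorb1)
  have cf: "continuous_on E ?f"
    unfolding tri_def E_def using st by (intro continuous_intros) auto
  have shift: "tri e1 e2 r (u1 + 2 * pi * of_int m) (u2 + 2 * pi * of_int m) (u3 + 2 * pi * of_int m) = tri e1 e2 r u1 u2 u3"
    if "r \<in> {s..t1}" for u1 u2 u3 r m
    using D_per_int[of r] that st by (auto simp: tri_def)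
  have rep: "\<exists>w1 w2 w3. ((w1, w2, w3), r) \<in> E \<and> tri e1 e2 r w1 w2 w3 = tri e1 e2 r u1 u2 u3"
    if "ordered u1 u2 u3" "r \<in> {s..t1}" for u1 u2 u3 r
  proof -
    obtain m :: int where "0 \<le> u1 + 2 * pi * of_int m" "u1 + 2 * pi * of_int m < 0 + 2 * pi"
      using period_representative .
    then have "((u1 + 2 * pi * of_int m, u2 + 2 * pi * of_int m, u3 + 2 * pi * of_int m), r) \<in> E"
      using that by (auto simp: E_def ordered_def)
    then show ?thesis using shift[OF that(2)] by blast
  qed
  obtain w where "w \<in> E" "?f w < 0" using rep[OF ord, of t1] neg st by (metis atLeastAtMost_iff fst_conv snd_conv linorder_not_le order_refl)
  from obtain_weighted_min[OF cE cf this, of 1] obtain z r where z: "(z, r) \<in> E" "?f (z, r) < 0"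
    and min: "\<And>w q. (w, q) \<in> E \<Longrightarrow> ?f (z, r) * exp (- 1 * r) \<le> ?f (w, q) * exp (- 1 * q)" by blast
  obtain u1 u2 u3 where u: "z = (u1, u2, u3)" by (metis prod.collapse)
  have neg': "tri e1 e2 r u1 u2 u3 < 0" using z(2) u by simp
  have r: "r \<in> {s..t1}" and o: "ordered u1 u2 u3" using z(1) u by (auto simp: E_def ordered_def)
  have rT: "r \<in> {0..<T}" using r st by auto
  have minE: "tri e1 e2 r u1 u2 u3 * exp (- 1 * r) \<le> tri e1 e2 q w1 w2 w3 * exp (- 1 * q)"
    if "ordered w1 w2 w3" "q \<in> {s..t1}" for w1 w2 w3 q
    using rep[OF that] min u by fastforce
  have minr: "tri e1 e2 r u1 u2 u3 \<le> tri e1 e2 r w1 w2 w3" if "ordered w1 w2 w3" for w1 w2 w3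
    using minE[OF that r] by simp
  \<comment> \<open>Triples with two coinciding points of the circle span no area, so a negative
    minimum is interior in each of the three variables.\<close>
  have "u1 \<noteq> u2" "u2 \<noteq> u3" "u3 \<noteq> u1 + 2 * pi"
    using neg' D_per[OF rT] by (auto simp: tri_def)
  then obtain e where e: "0 < e" "u1 + e < u2" "u2 + e < u3" "u3 + e < u1 + 2 * pi"
  proof -
    have "0 < u2 - u1" "0 < u3 - u2" "0 < u1 + 2 * pi - u3"
      using o \<open>u1 \<noteq> u2\<close> \<open>u2 \<noteq> u3\<close> \<open>u3 \<noteq> u1 + 2 * pi\<close> by (auto simp: ordered_def)
    then obtain e where "0 < e" "e < u2 - u1" "e < u3 - u2" "e < u1 + 2 * pi - u3"
      by (meson field_lbound_gt_zero order_less_trans)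
    then show ?thesis using that[of e] by linarith
  qed
  define X where "X u = g u r \<bullet> e1" for u
  define Y where "Y u = g u r \<bullet> e2" for u
  \<comment> \<open>The cofactor vectors: with two vertices frozen the area is an affine function of
    the third. The linear minimum test thus applies in each slot separately, without mixed second
    derivatives, and the three velocities add up to the time derivative.\<close>
  define E1 where "E1 = (Y u2 - Y u3) *\<^sub>R e1 + (X u3 - X u2) *\<^sub>R e2"
  define E2 where "E2 = (Y u3 - Y u1) *\<^sub>R e1 + (X u1 - X u3) *\<^sub>R e2"
  define E3 where "E3 = (Y u1 - Y u2) *\<^sub>R e1 + (X u2 - X u1) *\<^sub>R e2"
  have T1: "tri e1 e2 r w u2 u3 = g w r \<bullet> E1 + (X u2 * Y u3 - Y u2 * X u3)" for w
    by (simp add: tri_def X_def Y_def E1_def algebra_simps inner_diff_left inner_add_right)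
  have T2: "tri e1 e2 r u1 w u3 = g w r \<bullet> E2 + (X u3 * Y u1 - Y u3 * X u1)" for w
    by (simp add: tri_def X_def Y_def E2_def algebra_simps inner_diff_left inner_add_right)
  have T3: "tri e1 e2 r u1 u2 w = g w r \<bullet> E3 + (X u1 * Y u2 - Y u1 * X u2)" for w
    by (simp add: tri_def X_def Y_def E3_def algebra_simps inner_diff_left inner_add_right)
  have "0 \<le> gt u1 r \<bullet> E1"
  proof (rule spatial_min_linear[OF rT e(1)])
    fix w assume "\<bar>w - u1\<bar> < e"
    then have "ordered w u2 u3" using e by (auto simp: ordered_def)
    from minr[OF this] show "g u1 r \<bullet> E1 \<le> g w r \<bullet> E1" by (simp add: T1)
  qed
  moreover have "0 \<le> gt u2 r \<bullet> E2"
  proof (rule spatial_min_linear[OF rT e(1)])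
    fix w assume "\<bar>w - u2\<bar> < e"
    then have "ordered u1 w u3" using e by (auto simp: ordered_def)
    from minr[OF this] show "g u2 r \<bullet> E2 \<le> g w r \<bullet> E2" by (simp add: T2)
  qed
  moreover have "0 \<le> gt u3 r \<bullet> E3"
  proof (rule spatial_min_linear[OF rT e(1)])
    fix w assume "\<bar>w - u3\<bar> < e"
    then have "ordered u1 u2 w" using e by (auto simp: ordered_def)
    from minr[OF this] show "g u3 r \<bullet> E3 \<le> g w r \<bullet> E3" by (simp add: T3)
  qed
  moreover have "((\<lambda>q. tri e1 e2 q u1 u2 u3) has_real_derivative gt u1 r \<bullet> E1 + gt u2 r \<bullet> E2 + gt u3 r \<bullet> E3) (at r within {0..<T})"
    unfolding tri_def inner_diff_left
    by (rule derivative_eq_intros inner_t rT refl)+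
      (simp add: E1_def E2_def E3_def X_def Y_def inner_add_right algebra_simps)
  moreover have "s < r" using init[OF o] neg' r by (cases "s = r") auto
  ultimately have "gt u1 r \<bullet> E1 + gt u2 r \<bullet> E2 + gt u3 r \<bullet> E3 \<le> 1 * tri e1 e2 r u1 u2 u3"
    using minE[OF o] r st
    by (intro left_derivative_le[of "\<lambda>q. tri e1 e2 q u1 u2 u3" _ r "{0..<T}" "r - s" 1]) auto
  then show False using neg' \<open>0 \<le> gt u1 r \<bullet> E1\<close> \<open>0 \<le> gt u2 r \<bullet> E2\<close> \<open>0 \<le> gt u3 r \<bullet> E3\<close> by linarith
qed

end

section \<open>Injective parameterizations of convex curves\<close>

definition det2 :: "real \<times> real \<Rightarrow> real \<times> real \<Rightarrow> real" where
  "det2 v w = fst v * snd w - snd v * fst w"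

lemma det2_polar:
  "det2 (r * cos x, r * sin x) (r' * cos y, r' * sin y) = r * r' * sin (y - x)"
  by (simp add: det2_def sin_diff algebra_simps)

text \<open>The last conclusion expresses convexity of the curve in terms of \<open>p\<close> only.\<close>

lemma convex_curve_polar_angle:
  fixes p :: "real \<Rightarrow> real \<times> real"
  assumes cont: "continuous_on UNIV p" and per: "\<And>u. p (u + 2 * pi) = p u"
    and inj: "\<And>u w. p u = p w \<Longrightarrow> [u = w] (rmod (2 * pi))" and conv: "convex_curve (range p)"
  obtains c \<alpha> r where "continuous_on UNIV \<alpha>" "\<And>u. 0 < r u"
    "\<And>u. p u - c = (r u * cos (\<alpha> u), r u * sin (\<alpha> u))"
    "strict_mono \<alpha> \<and> (\<forall>u. \<alpha> (u + 2 * pi) = \<alpha> u + 2 * pi) \<or>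
     strict_mono (\<lambda>u. \<alpha> (- u)) \<and> (\<forall>u. \<alpha> (u + 2 * pi) = \<alpha> u - 2 * pi)"
    "\<And>u1 u2 u3 s t. 0 \<le> s \<Longrightarrow> 0 \<le> t \<Longrightarrow> p u3 - c = s *\<^sub>R (p u1 - c) + t *\<^sub>R (p u2 - c) \<Longrightarrow> 1 \<le> s + t"
proof -
  obtain K where K: "convex K" "compact K" "interior K \<noteq> {}" "range p = frontier K"
    using conv by (auto simp: convex_curve_def)
  obtain c where c: "c \<in> interior K" using K by auto
  have cl: "closure K = K" using K compact_imp_closed closure_closed by auto
  have pf: "p u \<in> K" "p u \<notin> interior K" for u
    using K(4) cl by (auto simp: frontier_def)
  have seg: "c + b *\<^sub>R (m - c) \<in> interior K" if "m \<in> K" "0 \<le> b" "b < 1" for m b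
  proof (cases "b = 0 \<or> m = c")
    case True then show ?thesis using c by auto
  next
    case False
    then have "c + b *\<^sub>R (m - c) \<in> open_segment c m"
      using that by (auto simp: in_segment algebra_simps intro!: exI[of _ b])
    then show ?thesis using in_interior_closure_convex_segment[OF K(1) c] that cl by blast
  qed
  \<comment> \<open>If s + t were below 1, the point \<open>p u3\<close> would lie strictly between
    the interior point c and a point of K, hence in the interior of K instead of on its
    frontier.\<close>
  have star: "1 \<le> s + t" if st: "0 \<le> s" "0 \<le> t" "p u3 - c = s *\<^sub>R (p u1 - c) + t *\<^sub>R (p u2 - c)" for u1 u2 u3 s t
  proof (rule ccontr)
    assume less: "\<not> 1 \<le> s + t"
    show False
    proof (cases "s + t = 0")
      case True
      then have "s = 0" "t = 0" using st by linarith+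
      then have "p u3 = c" using st by simp
      then show False using c pf by metis
    next
      case False
      define m where "m = (s / (s + t)) *\<^sub>R p u1 + (t / (s + t)) *\<^sub>R p u2"
      have "m \<in> K" unfolding m_def
        using st False by (intro convexD[OF K(1)] pf) (auto simp: divide_simps)
      moreover have "(s + t) *\<^sub>R m = s *\<^sub>R p u1 + t *\<^sub>R p u2"
        using False by (simp add: m_def scaleR_right_distrib)
      then have eq: "p u3 = c + (s + t) *\<^sub>R (m - c)"
        using st(3) by (simp add: algebra_simps)
      ultimately have "p u3 \<in> interior K"
        unfolding eq using st less by (intro seg) auto
      then show False using pf by blast
    qed
  qed
  define C where "C u = Complex (fst (p u - c)) (snd (p u - c))" for u
  have C0: "C u \<noteq> 0" for u
  proof
    assume "C u = 0"
    then have "p u = c" by (auto simp: C_def complex_eq_iff prod_eq_iff)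
    then show False using c pf by metis
  qed
  have "continuous_on UNIV C" unfolding C_def
    by (intro continuous_intros cont)
  then obtain h where h: "continuous_on UNIV h" "\<And>u. C u = exp (h u)"
    using continuous_logarithm_on_contractible[of UNIV C] C0 convex_imp_contractible[of "UNIV::real set"] by auto
  define \<alpha> where "\<alpha> u = Im (h u)" for u
  define r where "r u = exp (Re (h u))" for u
  have ca: "continuous_on UNIV \<alpha>" unfolding \<alpha>_def by (intro continuous_intros h)
  have r0: "0 < r u" for u by (simp add: r_def)
  have "C u = r u *\<^sub>R cis (\<alpha> u)" for u
    by (simp add: h(2) r_def \<alpha>_def exp_eq_polar scaleR_conv_of_real)
  then have pol: "p u - c = (r u * cos (\<alpha> u), r u * sin (\<alpha> u))" for u
    by (simp add: C_def complex_eq_iff prod_eq_iff)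
  \<comment> \<open>A ray from the interior point c meets the frontier only once: the nearer of two
    points would be interior.\<close>
  have inj_ang: "[u = w] (rmod (2 * pi))" if "cis (\<alpha> u) = cis (\<alpha> w)" for u w
  proof -
    have *: "p x - c = (r x / r y) *\<^sub>R (p y - c)" if "cis (\<alpha> x) = cis (\<alpha> y)" for x y
      using that r0[of y] by (simp add: pol complex_eq_iff)
    have "\<not> r x < r y" if "cis (\<alpha> x) = cis (\<alpha> y)" for x y
    proof
      assume "r x < r y"
      then have "c + (r x / r y) *\<^sub>R (p y - c) \<in> interior K"
        using r0 by (intro seg pf) (auto simp: less_imp_le)
      then show False using *[OF that] pf[of x] by (metis add.commute diff_add_cancel)
    qed
    then have "r u = r w" using that by (metis linorder_neqE_linordered_idom)
    then have "p u = p w" using *[OF that] r0[of w] by simp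
    then show ?thesis by (rule inj)
  qed
  have per_ang: "\<exists>k::int. \<alpha> (u + 2 * pi) = \<alpha> u + 2 * pi * of_int k" for u
  proof -
    have "cis (\<alpha> (u + 2 * pi)) = cis (\<alpha> u)"
    proof -
      have 1: "(r (u + 2 * pi) * cos (\<alpha> (u + 2 * pi)), r (u + 2 * pi) * sin (\<alpha> (u + 2 * pi)))
          = (r u * cos (\<alpha> u), r u * sin (\<alpha> u))" using pol per by metis
      have "(r (u + 2 * pi))\<^sup>2 = (r (u + 2 * pi) * cos (\<alpha> (u + 2 * pi)))\<^sup>2 + (r (u + 2 * pi) * sin (\<alpha> (u + 2 * pi)))\<^sup>2"
        by (simp add: power_mult_distrib flip: distrib_left)
      also have "\<dots> = (r u * cos (\<alpha> u))\<^sup>2 + (r u * sin (\<alpha> u))\<^sup>2" using 1 by simp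
      also have "\<dots> = (r u)\<^sup>2" by (simp add: power_mult_distrib flip: distrib_left)
      finally have "r (u + 2 * pi) = r u" using r0 by (simp add: less_imp_le)
      then show ?thesis using 1 r0[of u] by (simp add: complex_eq_iff)
    qed
    then have "[\<alpha> u = \<alpha> (u + 2 * pi)] (rmod (2 * pi))" using cis_eq_iff rcong_sym by blast
    then show ?thesis by (auto simp: rcong_altdef mult.commute)
  qed
  \<comment> \<open>A value taken twice would force a local extremum z strictly between the two
    parameters, which contradicts injectivity of the angle modulo \<open>2 * pi\<close>.\<close>
  have "inj \<alpha>"
  proof
    fix u w assume eq: "\<alpha> u = \<alpha> w"
    show "u = w"
    proof (rule ccontr)
      assume "u \<noteq> w"
      have False if xy: "x < y" "\<alpha> x = \<alpha> y" for x y
      proof -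
        have "compact {x..y}" "{x..y} \<noteq> {}" using that by auto
        moreover have cxy: "continuous_on {x..y} \<alpha>" using ca continuous_on_subset by blast
        ultimately obtain z where z: "x < z" "z < y" "\<exists>e>0. (\<forall>v. \<bar>v - z\<bar> < e \<longrightarrow> \<alpha> v \<le> \<alpha> z) \<or> (\<forall>v. \<bar>v - z\<bar> < e \<longrightarrow> \<alpha> z \<le> \<alpha> v)"
        proof -
          obtain z1 where z1: "z1 \<in> {x..y}" "\<And>v. v \<in> {x..y} \<Longrightarrow> \<alpha> v \<le> \<alpha> z1"
            using continuous_attains_sup[OF _ _ cxy] less_imp_le[OF \<open>x < y\<close>] compact_Icc by fastforce
          obtain z2 where z2: "z2 \<in> {x..y}" "\<And>v. v \<in> {x..y} \<Longrightarrow> \<alpha> z2 \<le> \<alpha> v"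
            using continuous_attains_inf[OF _ _ cxy] less_imp_le[OF \<open>x < y\<close>] compact_Icc by fastforce
          consider "x < z1 \<and> z1 < y" | "x < z2 \<and> z2 < y" | "\<alpha> z1 = \<alpha> x" "\<alpha> z2 = \<alpha> x"
          proof -
            have "x < z1 \<and> z1 < y \<or> \<alpha> z1 = \<alpha> x"
              using z1(1) xy(2) by (cases "z1 = x"; cases "z1 = y") auto
            moreover have "x < z2 \<and> z2 < y \<or> \<alpha> z2 = \<alpha> x"
              using z2(1) xy(2) by (cases "z2 = x"; cases "z2 = y") auto
            ultimately show ?thesis using that by blast
          qed
          then show ?thesis
          proof cases
            case 1
            then show ?thesis
              by (intro that[of z1] exI[of _ "min (z1 - x) (y - z1)"] conjI disjI1 allI impI z1(2)) (auto simp: abs_less_iff)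
          next
            case 2
            then show ?thesis
              by (intro that[of z2] exI[of _ "min (z2 - x) (y - z2)"] conjI disjI2 allI impI z2(2)) (auto simp: abs_less_iff)
          next
            case 3
            have const: "\<alpha> v = \<alpha> x" if "v \<in> {x..y}" for v using 3 z1(2)[OF that] z2(2)[OF that] by simp
            have "\<alpha> v \<le> \<alpha> ((x + y) / 2)" if v: "\<bar>v - (x + y) / 2\<bar> < (y - x) / 2" for v
            proof -
              have "v \<in> {x..y}" "(x + y) / 2 \<in> {x..y}" using v xy(1) by (auto simp: abs_less_iff field_simps)
              from this[THEN const] show ?thesis by linarith
            qed
            then show ?thesis using \<open>x < y\<close>
              by (intro that[of "(x + y) / 2"] exI[of _ "(y - x) / 2"] conjI disjI1) auto
          qed
        qed
        then obtain e where e: "0 < e" "(\<forall>v. \<bar>v - z\<bar> < e \<longrightarrow> \<alpha> v \<le> \<alpha> z) \<or> (\<forall>v. \<bar>v - z\<bar> < e \<longrightarrow> \<alpha> z \<le> \<alpha> v)" by blast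
        \<comment> \<open>The window around z has length at most pi, so injectivity modulo
          \<open>2 * pi\<close> is injectivity there. A continuous injective function is strictly
          monotone and has no extremum at z.\<close>
        define d where "d = min e pi / 2"
        have d: "0 < d" "d < e" "d < pi" using e(1) pi_gt_zero unfolding d_def by linarith+
        have "inj_on \<alpha> {z - d..z + d}"
        proof
          fix v w assume vw: "v \<in> {z - d..z + d}" "w \<in> {z - d..z + d}" "\<alpha> v = \<alpha> w"
          then obtain k :: int where k: "w = v + of_int k * (2 * pi)" using inj_ang[of v w] by (auto simp: rcong_altdef)
          then have "\<bar>of_int k * (2 * pi)\<bar> < 2 * pi" using vw d by auto
          then have "\<bar>of_int k\<bar> < (1::real)" by (simp add: abs_mult)
          then show "v = w" using k by auto
        qed
        moreover have "continuous_on {z - d..z + d} \<alpha>" using ca continuous_on_subset by blast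
        ultimately have "\<alpha> (z - d) < \<alpha> z \<and> \<alpha> z < \<alpha> (z + d) \<or> \<alpha> (z + d) < \<alpha> z \<and> \<alpha> z < \<alpha> (z - d)"
          using continuous_inj_imp_mono[of "z - d" z "z + d" \<alpha>] d by auto
        moreover have b: "\<bar>(z - d) - z\<bar> < e" "\<bar>(z + d) - z\<bar> < e" using d by auto
        ultimately show False using e(2) by (meson linorder_not_le)
      qed
      then show False using eq \<open>u \<noteq> w\<close> by (metis linorder_neqE_linordered_idom)
    qed
  qed
  then consider "strict_mono \<alpha>" | "strict_antimono_on UNIV \<alpha>"
    using injective_eq_monotone_map[of UNIV \<alpha>] ca by auto
  then show ?thesis
  proof cases
    case 1
    have per1: "\<alpha> (u + 2 * pi) = \<alpha> u + 2 * pi" for u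
    proof -
      obtain k :: int where k: "\<alpha> (u + 2 * pi) = \<alpha> u + 2 * pi * of_int k" using per_ang by blast
      have "\<alpha> u < \<alpha> (u + 2 * pi)" using 1 by (simp add: strict_mono_less)
      then have "0 < k" using k by (simp add: zero_less_mult_iff)
      \<comment> \<open>Two or more turns per period would, by the intermediate value theorem,
        repeat the angle after one turn at a parameter strictly inside the period.\<close>
      moreover have "\<not> 2 \<le> k"
      proof
        assume "2 \<le> k"
        then have "2 * pi * 2 \<le> 2 * pi * of_int k" by (intro mult_left_mono) auto
        then have "\<alpha> u + 2 * pi < \<alpha> (u + 2 * pi)" using k pi_gt_zero by linarith
        then obtain w where w: "u \<le> w" "w \<le> u + 2 * pi" "\<alpha> w = \<alpha> u + 2 * pi"
          using IVT'[of \<alpha> u "\<alpha> u + 2 * pi" "u + 2 * pi"] continuous_on_subset[OF ca] pi_gt_zero by auto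
        have "w \<noteq> u" "w \<noteq> u + 2 * pi" using w \<open>\<alpha> u + 2 * pi < \<alpha> (u + 2 * pi)\<close> by auto
        then have uw: "u < w" "w < u + 2 * pi" using w by linarith+
        have "[u = w] (rmod (2 * pi))" by (rule inj_ang) (simp add: w(3) complex_eq_iff)
        then obtain j :: int where j: "w = u + of_int j * (2 * pi)" by (auto simp: rcong_altdef)
        have "0 < of_int j * (2 * pi)" "of_int j * (2 * pi) < 1 * (2 * pi)" using uw j by linarith+
        then have "0 < real_of_int j" "real_of_int j < 1" by (auto simp: zero_less_mult_iff)
        then show False by auto
      qed
      ultimately show ?thesis using k by (cases "k = 1") auto
    qed
    show ?thesis
    proof (rule that[OF ca r0 pol])
      show "strict_mono \<alpha> \<and> (\<forall>u. \<alpha> (u + 2 * pi) = \<alpha> u + 2 * pi) \<or>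
        strict_mono (\<lambda>u. \<alpha> (- u)) \<and> (\<forall>u. \<alpha> (u + 2 * pi) = \<alpha> u - 2 * pi)"
        using 1 per1 by blast
      show "1 \<le> s + t" if "0 \<le> s" "0 \<le> t" "p u3 - c = s *\<^sub>R (p u1 - c) + t *\<^sub>R (p u2 - c)" for u1 u2 u3 s t
        by (rule star[OF that])
    qed
  next
    case 2
    have less: "\<alpha> y < \<alpha> x" if "x < y" for x y using 2 that by (auto simp: monotone_on_def)
    have per2: "\<alpha> (u + 2 * pi) = \<alpha> u - 2 * pi" for u
    proof -
      obtain k :: int where k: "\<alpha> (u + 2 * pi) = \<alpha> u + 2 * pi * of_int k" using per_ang by blast
      have "\<alpha> (u + 2 * pi) < \<alpha> u" using less by simp
      then have "k < 0" using k by (simp add: mult_less_0_iff)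
      moreover have "\<not> k \<le> - 2"
      proof
        assume "k \<le> - 2"
        then have "2 * pi * of_int k \<le> 2 * pi * (- 2)" by (intro mult_left_mono) auto
        then have "\<alpha> (u + 2 * pi) < \<alpha> u - 2 * pi" using k pi_gt_zero by linarith
        then obtain w where w: "u \<le> w" "w \<le> u + 2 * pi" "\<alpha> w = \<alpha> u - 2 * pi"
          using IVT2'[of \<alpha> "u + 2 * pi" "\<alpha> u - 2 * pi" u] continuous_on_subset[OF ca] pi_gt_zero by auto
        have "w \<noteq> u" "w \<noteq> u + 2 * pi" using w \<open>\<alpha> (u + 2 * pi) < \<alpha> u - 2 * pi\<close> by auto
        then have uw: "u < w" "w < u + 2 * pi" using w by linarith+
        have "[u = w] (rmod (2 * pi))"
          by (rule inj_ang) (simp add: w(3) complex_eq_iff cos_diff sin_diff)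
        then obtain j :: int where j: "w = u + of_int j * (2 * pi)" by (auto simp: rcong_altdef)
        have "0 < of_int j * (2 * pi)" "of_int j * (2 * pi) < 1 * (2 * pi)" using uw j by linarith+
        then have "0 < real_of_int j" "real_of_int j < 1" by (auto simp: zero_less_mult_iff)
        then show False by auto
      qed
      ultimately show ?thesis using k by (cases "k = - 1") auto
    qed
    have mono2: "strict_mono (\<lambda>u. \<alpha> (- u))" using less by (auto simp: strict_mono_def)
    show ?thesis
    proof (rule that[OF ca r0 pol])
      show "strict_mono \<alpha> \<and> (\<forall>u. \<alpha> (u + 2 * pi) = \<alpha> u + 2 * pi) \<or>
        strict_mono (\<lambda>u. \<alpha> (- u)) \<and> (\<forall>u. \<alpha> (u + 2 * pi) = \<alpha> u - 2 * pi)"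
        using mono2 per2 by blast
      show "1 \<le> s + t" if "0 \<le> s" "0 \<le> t" "p u3 - c = s *\<^sub>R (p u1 - c) + t *\<^sub>R (p u2 - c)" for u1 u2 u3 s t
        by (rule star[OF that])
    qed
  qed
qed

text \<open>Seen from c, the triangle is a signed sum of three sectors whose angles add up to
  \<open>2 * pi\<close>. At most one angle exceeds pi; its sector is then negative, and radial
  convexity says that the other two outweigh it.\<close>

lemma polar_angle_positive_triangles:
  fixes p :: "real \<Rightarrow> real \<times> real"
  assumes ca: "continuous_on UNIV \<alpha>" and r0: "\<And>u. 0 < r u"
    and pol: "\<And>u. p u - c = (r u * cos (\<alpha> u), r u * sin (\<alpha> u))"
    and mono: "strict_mono \<alpha>" and per: "\<And>u. \<alpha> (u + 2 * pi) = \<alpha> u + 2 * pi"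
    and star: "\<And>u1 u2 u3 s t. 0 \<le> s \<Longrightarrow> 0 \<le> t \<Longrightarrow>
      p u3 - c = s *\<^sub>R (p u1 - c) + t *\<^sub>R (p u2 - c) \<Longrightarrow> 1 \<le> s + t"
  shows "u1 \<le> u2 \<Longrightarrow> u2 \<le> u3 \<Longrightarrow> u3 \<le> u1 + 2 * pi \<Longrightarrow> 0 \<le> det2 (p u2 - p u1) (p u3 - p u1)"
    and "\<exists>\<eta>. 0 < \<eta> \<and> \<eta> < 2 * pi \<and> (\<forall>u. 0 < det2 (p u - c) (p (u + \<eta>) - c) \<and>
      (\<forall>d. 0 \<le> d \<and> d \<le> \<eta> \<longrightarrow> 0 \<le> det2 (p u - c) (p (u + d) - c)))"
proof -
  have det: "det2 (p u - c) (p w - c) = r u * r w * sin (\<alpha> w - \<alpha> u)" for u w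
    by (simp add: pol det2_polar)
  \<comment> \<open>Cramer's rule expresses the direction of v through those of u and w;
    \<open>star\<close> bounds the sum of the two coefficients from below.\<close>
  have cone: "det2 (p u - c) (p w - c) \<le> det2 (p u - c) (p v - c) + det2 (p v - c) (p w - c)"
    if "0 \<le> det2 (p u - c) (p v - c)" "0 \<le> det2 (p v - c) (p w - c)" "0 < det2 (p u - c) (p w - c)" for u v w
  proof -
    let ?D = "det2 (p u - c) (p w - c)"
    have "?D *\<^sub>R (p v - c) = det2 (p v - c) (p w - c) *\<^sub>R (p u - c) + det2 (p u - c) (p v - c) *\<^sub>R (p w - c)"
      by (simp add: det2_def prod_eq_iff algebra_simps)
    then have "(inverse ?D * ?D) *\<^sub>R (p v - c) = (det2 (p v - c) (p w - c) / ?D) *\<^sub>R (p u - c) + (det2 (p u - c) (p v - c) / ?D) *\<^sub>R (p w - c)"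
      unfolding scaleR_scaleR[symmetric] by (simp add: scaleR_right_distrib divide_inverse mult.commute)
    then have "p v - c = (det2 (p v - c) (p w - c) / ?D) *\<^sub>R (p u - c) + (det2 (p u - c) (p v - c) / ?D) *\<^sub>R (p w - c)"
      using that(3) by simp
    from star[OF _ _ this] that show ?thesis by (simp add: divide_simps)
  qed
  show "0 \<le> det2 (p u2 - p u1) (p u3 - p u1)" if u: "u1 \<le> u2" "u2 \<le> u3" "u3 \<le> u1 + 2 * pi"
  proof -
    let ?D = "\<lambda>u w. det2 (p u - c) (p w - c)"
    have F: "det2 (p u2 - p u1) (p u3 - p u1) = ?D u1 u2 + ?D u2 u3 + ?D u3 u1"
      by (simp add: det2_def algebra_simps)
    define A where "A = \<alpha> u2 - \<alpha> u1"
    define B where "B = \<alpha> u3 - \<alpha> u2"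
    define C where "C = 2 * pi - (A + B)"
    have "\<alpha> u1 \<le> \<alpha> u2" "\<alpha> u2 \<le> \<alpha> u3" "\<alpha> u3 \<le> \<alpha> (u1 + 2 * pi)"
      using u mono by (simp_all only: strict_mono_less_eq)
    then have ABC: "0 \<le> A" "0 \<le> B" "0 \<le> C"
      using per[of u1] by (simp_all add: A_def B_def C_def)
    have sum: "A + B + C = 2 * pi" by (simp add: C_def)
    have "sin (\<alpha> u1 - \<alpha> u3) = sin C"
    proof -
      have "sin (\<alpha> u1 - \<alpha> u3) = sin (\<alpha> u1 - \<alpha> u3 + 2 * pi)" by simp
      also have "\<alpha> u1 - \<alpha> u3 + 2 * pi = C" by (simp add: A_def B_def C_def)
      finally show ?thesis .
    qed
    then have D: "?D u1 u2 = r u1 * r u2 * sin A" "?D u2 u3 = r u2 * r u3 * sin B" "?D u3 u1 = r u3 * r u1 * sin C"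
      by (simp_all add: det A_def B_def)
    have anti: "?D w v = - ?D v w" for v w by (simp add: det2_def)
    have pos: "0 \<le> r v * r w * sin X" if "0 \<le> X" "X \<le> pi" for v w X
      using that r0 by (simp add: less_imp_le sin_ge_zero)
    have neg: "r v * r w * sin X < 0" if "pi < X" "X < 2 * pi" for v w X
      using that r0 sin_lt_zero[of X] by (simp add: mult_less_0_iff)
    consider "A \<le> pi" "B \<le> pi" "C \<le> pi" | "A = 2 * pi \<or> B = 2 * pi \<or> C = 2 * pi"
      | "pi < A" "A < 2 * pi" | "pi < B" "B < 2 * pi" | "pi < C" "C < 2 * pi"
      using ABC sum by fastforce
    then show ?thesis
    proof cases
      case 1
      then show ?thesis unfolding F D using ABC pos by (intro add_nonneg_nonneg) auto
    next
      case 2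
      then have "(A = 2 * pi \<and> B = 0 \<and> C = 0) \<or> (A = 0 \<and> B = 2 * pi \<and> C = 0) \<or> (A = 0 \<and> B = 0 \<and> C = 2 * pi)"
        using ABC sum by linarith
      then have "sin A = 0" "sin B = 0" "sin C = 0" by auto
      then show ?thesis unfolding F D by simp
    next
      case 3
      then have "?D u2 u1 \<le> ?D u2 u3 + ?D u3 u1"
        using cone[of u2 u3 u1] neg[of A u1 u2] pos[of B u2 u3] pos[of C u3 u1] D anti[of u2 u1] ABC sum by simp
      then show ?thesis unfolding F anti[of u2 u1] by simp
    next
      case 4
      then have "?D u3 u2 \<le> ?D u3 u1 + ?D u1 u2"
        using cone[of u3 u1 u2] neg[of B u2 u3] pos[of C u3 u1] pos[of A u1 u2] D anti[of u3 u2] ABC sum by simp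
      then show ?thesis unfolding F anti[of u3 u2] by simp
    next
      case 5
      then have "?D u1 u3 \<le> ?D u1 u2 + ?D u2 u3"
        using cone[of u1 u2 u3] neg[of C u3 u1] pos[of A u1 u2] pos[of B u2 u3] D anti[of u1 u3] ABC sum by simp
      then show ?thesis unfolding F anti[of u1 u3] by simp
    qed
  qed
  show "\<exists>\<eta>. 0 < \<eta> \<and> \<eta> < 2 * pi \<and> (\<forall>u. 0 < det2 (p u - c) (p (u + \<eta>) - c) \<and>
      (\<forall>d. 0 \<le> d \<and> d \<le> \<eta> \<longrightarrow> 0 \<le> det2 (p u - c) (p (u + d) - c)))"
  proof -
    \<comment> \<open>The interval exceeds one period by 1, so that a step of length at most 1
      starting anywhere in a period stays inside. The step \<open>\<eta>\<close> is chosen to turn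
      the angle by less than pi.\<close>
    have "uniformly_continuous_on {0..2 * pi + 1} \<alpha>"
      by (intro compact_uniformly_continuous continuous_on_subset[OF ca]) auto
    then obtain d where d: "0 < d" "\<And>x y. x \<in> {0..2*pi+1} \<Longrightarrow> y \<in> {0..2*pi+1} \<Longrightarrow> dist y x < d \<Longrightarrow> dist (\<alpha> y) (\<alpha> x) < pi"
      unfolding uniformly_continuous_on_def by (metis pi_gt_zero)
    define \<eta> where "\<eta> = min d 1 / 2"
    have \<eta>: "0 < \<eta>" "\<eta> < d" "\<eta> < 1" using d(1) by (auto simp: \<eta>_def)
    have per': "\<alpha> (u + 2 * pi * of_nat m) = \<alpha> u + 2 * pi * of_nat m" for u m
    proof (induction m)
      case (Suc m)
      have "u + 2 * pi * of_nat (Suc m) = (u + 2 * pi * of_nat m) + 2 * pi" by (simp add: algebra_simps)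
      then show ?case using per[of "u + 2 * pi * of_nat m"] Suc by (simp add: algebra_simps)
    qed simp
    have per'': "\<alpha> (u + 2 * pi * of_int m) = \<alpha> u + 2 * pi * of_int m" for u m
    proof (cases "0 \<le> m")
      case True then show ?thesis using per'[of u "nat m"] by simp
    next
      case False then show ?thesis using per'[of "u + 2 * pi * of_int m" "nat (- m)"] by simp
    qed
    have inc: "\<alpha> (u + \<eta>) - \<alpha> u < pi" for u
    proof -
      define m where "m = - \<lfloor>u / (2 * pi)\<rfloor>"
      define w where "w = u + 2 * pi * of_int m"
      have "of_int (- m) \<le> u / (2 * pi)" "u / (2 * pi) < of_int (- m) + 1"
        unfolding m_def by linarith+
      then have "of_int (- m) * (2 * pi) \<le> u" "u < (of_int (- m) + 1) * (2 * pi)"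
        using pi_gt_zero by (auto simp: field_simps)
      then have "0 \<le> w" "w \<le> 2 * pi" by (auto simp: w_def algebra_simps)
      then have "dist (\<alpha> (w + \<eta>)) (\<alpha> w) < pi" using \<eta> by (intro d(2)) (auto simp: dist_real_def)
      moreover have "\<alpha> (w + \<eta>) - \<alpha> w = \<alpha> (u + \<eta>) - \<alpha> u"
        using per''[of u m] per''[of "u + \<eta>" m] by (simp add: w_def algebra_simps)
      ultimately show ?thesis by (simp add: dist_real_def)
    qed
    have bd: "0 \<le> \<alpha> (u + e) - \<alpha> u" "\<alpha> (u + e) - \<alpha> u \<le> \<alpha> (u + \<eta>) - \<alpha> u" if "0 \<le> e" "e \<le> \<eta>" for u e
      using that mono by (simp_all add: strict_mono_less_eq)
    have "0 < det2 (p u - c) (p (u + \<eta>) - c)" for u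
      unfolding det using inc[of u] r0 mono \<eta>(1) by (intro mult_pos_pos sin_gt_zero) (auto simp: strict_mono_less)
    moreover have "0 \<le> det2 (p u - c) (p (u + e) - c)" if "0 \<le> e" "e \<le> \<eta>" for u e
      unfolding det using bd[OF that, of u] inc[of u] r0
      by (intro mult_nonneg_nonneg sin_ge_zero) (auto simp: less_imp_le)
    moreover have "\<eta> < 2 * pi" using \<eta> pi_gt3 by linarith
    ultimately show ?thesis using \<eta>(1) by blast
  qed
qed

lemma right_derivative_ge:
  fixes f :: "real \<Rightarrow> real"
  assumes d: "(f has_real_derivative c) (at x)" and e: "0 < e"
    and ge: "\<And>h. 0 < h \<Longrightarrow> h < e \<Longrightarrow> f x + k * h \<le> f (x + h)"
  shows "k \<le> c"
proof -
  have "((\<lambda>h. (f (x + h) - f x) / h) \<longlongrightarrow> c) (at_right 0)"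
    using d unfolding DERIV_def by (rule filterlim_mono) (auto simp: at_within_le_at)
  moreover have "eventually (\<lambda>h. k \<le> (f (x + h) - f x) / h) (at_right 0)"
    using ge by (intro eventually_at_rightI[of 0 e] e) (auto simp: field_simps)
  ultimately show ?thesis by (rule tendsto_lowerbound) simp
qed

context flow
begin

section \<open>Signed areas\<close>

text \<open>The determinant of the components of v and w along e1 and e2. The pair e1, e2 is
  arbitrary, not necessarily orthonormal, because tilted projections use other pairs.\<close>

definition dd :: "'a \<Rightarrow> 'a \<Rightarrow> 'a \<Rightarrow> 'a \<Rightarrow> real" where
  "dd e1 e2 v w = (v \<bullet> e1) * (w \<bullet> e2) - (v \<bullet> e2) * (w \<bullet> e1)"

lemma tri_eq_dd: "tri e1 e2 t u1 u2 u3 = dd e1 e2 (g u2 t - g u1 t) (g u3 t - g u1 t)"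
  by (simp add: tri_def dd_def)

lemma dd_self [simp]: "dd e1 e2 v v = 0" by (simp add: dd_def)
lemma dd_zero [simp]: "dd e1 e2 0 v = 0" "dd e1 e2 v 0 = 0" by (simp_all add: dd_def)
lemma dd_anti: "dd e1 e2 v w = - dd e1 e2 w v" by (simp add: dd_def)
lemma dd_linear:
  "dd e1 e2 (v + v') w = dd e1 e2 v w + dd e1 e2 v' w" "dd e1 e2 w (v + v') = dd e1 e2 w v + dd e1 e2 w v'"
  "dd e1 e2 (v - v') w = dd e1 e2 v w - dd e1 e2 v' w" "dd e1 e2 w (v - v') = dd e1 e2 w v - dd e1 e2 w v'"
  "dd e1 e2 (r *\<^sub>R v) w = r * dd e1 e2 v w" "dd e1 e2 w (r *\<^sub>R v) = r * dd e1 e2 w v"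
  by (simp_all add: dd_def algebra_simps inner_add_left inner_diff_left)

lemma dd_const_u:
  assumes "t \<in> {0..<T}"
  shows "((\<lambda>u. dd e1 e2 v (D k l u t - w)) has_real_derivative dd e1 e2 v (D (Suc k) l u t)) (at u)"
    and "((\<lambda>u. dd e1 e2 (D k l u t - w) v) has_real_derivative dd e1 e2 (D (Suc k) l u t) v) (at u)"
  unfolding dd_def inner_diff_left
  by (rule derivative_eq_intros inner_u assms refl | simp)+

lemma dd_u:
  assumes "t \<in> {0..<T}"
  shows "((\<lambda>u. dd e1 e2 (D k l u t) (D k' l' u t)) has_real_derivative
    dd e1 e2 (D (Suc k) l u t) (D k' l' u t) + dd e1 e2 (D k l u t) (D (Suc k') l' u t)) (at u)"
  unfolding dd_def
  by (rule derivative_eq_intros inner_u assms refl | simp add: algebra_simps)+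

lemma dd_t:
  assumes "t \<in> {0..<T}"
  shows "((\<lambda>t. dd e1 e2 (D k l u t) (D k' l' u t)) has_real_derivative
    dd e1 e2 (D k (Suc l) u t) (D k' l' u t) + dd e1 e2 (D k l u t) (D k' (Suc l') u t)) (at t within {0..<T})"
  unfolding dd_def
  by (rule derivative_eq_intros inner_t assms refl | simp add: algebra_simps)+

text \<open>The derivative of the triangle inequality as the second vertex leaves the first: the
  projected curve lies to the left of each of its tangents. Nothing is assumed about
  immersion.\<close>

lemma tangent_nonneg:
  assumes t: "t \<in> {0..<T}" and tri: "\<And>u1 u2 u3. ordered u1 u2 u3 \<Longrightarrow> 0 \<le> tri e1 e2 t u1 u2 u3"
  shows "0 \<le> dd e1 e2 (gu u t) (g w t - g u t)"
proof -
  obtain w' where w': "u \<le> w'" "w' < u + 2 * pi" "g w t = g w' t"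
    using representative[of u w] t by metis
  show ?thesis
  proof (cases "w' = u")
    case False
    show ?thesis unfolding w'(3)
    proof (rule right_derivative_ge[where x = u and e = "w' - u" and f = "\<lambda>x. dd e1 e2 (g x t - g u t) (g w' t - g u t)",
        OF dd_const_u(2)[OF t]])
      show "dd e1 e2 (g u t - g u t) (g w' t - g u t) + 0 * h \<le> dd e1 e2 (g (u + h) t - g u t) (g w' t - g u t)"
        if "0 < h" "h < w' - u" for h
        using tri[of u "u + h" w'] that w' by (auto simp: ordered_def tri_eq_dd)
    qed (use False w' in auto)
  qed (use w' in simp)
qed

lemma tangent_dd_guu_nonneg:
  assumes t: "t \<in> {0..<T}" and tan: "\<And>w. 0 \<le> dd e1 e2 (gu u t) (g w t - g u t)"
  shows "0 \<le> dd e1 e2 (gu u t) (guu u t)"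
proof (rule local_min_second_derivative(2)[OF zero_less_one])
  show "((\<lambda>w. dd e1 e2 (gu u t) (g w t - g u t)) has_real_derivative dd e1 e2 (gu u t) (gu x t)) (at x)" for x
    by (rule dd_const_u(1)[OF t])
  show "((\<lambda>w. dd e1 e2 (gu u t) (gu w t)) has_real_derivative dd e1 e2 (gu u t) (guu u t)) (at u)"
    using dd_const_u(1)[OF t, of e1 e2 "gu u t" "Suc 0" 0 0] by simp
  show "dd e1 e2 (gu u t) (g u t - g u t) \<le> dd e1 e2 (gu u t) (g x t - g u t)" for x
    using tan[of x] by simp
qed

lemma dd_gt: "t \<in> {0..<T} \<Longrightarrow> dd e1 e2 (gu u t) (gt u t) = a u t * dd e1 e2 (gu u t) (guu u t)"
  by (simp add: gt_eq dd_linear)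

section \<open>Evolution of the velocity\<close>

lemma gu_gt: "t \<in> {0..<T} \<Longrightarrow> gu u t \<bullet> gt u t = 0"
  using regular[of t u] by (simp add: gt_eq inner_diff_right ch_def power2_norm_eq_inner)

lemma guu_eq: "t \<in> {0..<T} \<Longrightarrow> guu u t = (norm (gu u t))\<^sup>2 *\<^sub>R gt u t + ch u t *\<^sub>R gu u t"
  using regular[of t u] by (simp add: gt_eq a_def)

lemma inner_D_u:
  assumes "t \<in> {0..<T}"
  shows "((\<lambda>u. D k l u t \<bullet> D k' l' u t) has_real_derivative
    D k l u t \<bullet> D (Suc k') l' u t + D (Suc k) l u t \<bullet> D k' l' u t) (at u)"
  using bounded_bilinear.has_vector_derivative[OF bounded_bilinear_inner D_u[OF assms] D_u[OF assms]]
  unfolding has_real_derivative_iff_has_vector_derivative .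

lemma inner_D_t:
  assumes "t \<in> {0..<T}"
  shows "((\<lambda>t. D k l u t \<bullet> D k' l' u t) has_real_derivative
    D k l u t \<bullet> D k' (Suc l') u t + D k (Suc l) u t \<bullet> D k' l' u t) (at t within {0..<T})"
  using bounded_bilinear.has_vector_derivative[OF bounded_bilinear_inner D_t[OF assms] D_t[OF assms]]
  unfolding has_real_derivative_iff_has_vector_derivative .

text \<open>Differentiating the orthogonality of velocity and tangent in u. Since mixed partials
  commute, this is also the evolution of the length element, |\<gamma>_u|_t = - k^2
  |\<gamma>_u|.\<close>

lemma gu_gtu:
  assumes t: "t \<in> {0..<T}"
  shows "gu u t \<bullet> gtu u t = - ((norm (gu u t))\<^sup>2 * (norm (gt u t))\<^sup>2)"
proof -
  have "((\<lambda>u. gu u t \<bullet> gt u t) has_real_derivative 0) (at u)"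
    using gu_gt[OF t] by simp
  from DERIV_unique[OF this inner_D_u[OF t]] have "gu u t \<bullet> gtu u t = - (guu u t \<bullet> gt u t)"
    by simp
  also have "guu u t \<bullet> gt u t = (norm (gu u t))\<^sup>2 * (norm (gt u t))\<^sup>2"
    using gu_gt[OF t] by (simp add: guu_eq[OF t] inner_add_left flip: power2_norm_eq_inner)
  finally show ?thesis .
qed

lemma at_within_T: "t \<in> {0..<T} \<Longrightarrow> at t within {0..<T} \<noteq> bot"
  using T_pos by (simp add: trivial_limit_within islimpt_Ico)

text \<open>The term with factor 2 k^2 stems from the shrinking of the length element. The
  tangential coefficient r stays unspecified: pairing with \<open>gt\<close> by the inner product,
  or with \<open>gu\<close> by \<open>dd\<close>, removes it.\<close>

lemma gtt_eq:
  assumes t: "t \<in> {0..<T}"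
  obtains r where "gtt u t = a u t *\<^sub>R (gtuu u t - ch u t *\<^sub>R gtu u t)
    + (2 * (norm (gt u t))\<^sup>2) *\<^sub>R gt u t + r *\<^sub>R gu u t"
proof -
  define n where "n = gu u t \<bullet> gu u t"
  define n' where "n' = 2 * (gu u t \<bullet> gtu u t)"
  define b where "b = gu u t \<bullet> guu u t"
  define b' where "b' = gu u t \<bullet> gtuu u t + gtu u t \<bullet> guu u t"
  have n0: "n \<noteq> 0" using regular[OF t, of u] by (simp add: n_def)
  have dn: "((\<lambda>t. gu u t \<bullet> gu u t) has_real_derivative n') (at t within {0..<T})"
    using inner_D_t[OF t, of "Suc 0" 0 u "Suc 0" 0] by (simp add: n'_def inner_commute)
  have db: "((\<lambda>t. gu u t \<bullet> guu u t) has_real_derivative b') (at t within {0..<T})"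
    using inner_D_t[OF t, of "Suc 0" 0 u "Suc (Suc 0)" 0] by (simp add: b'_def)
  \<comment> \<open>The equation is multiplied by |\<gamma>_u|^4 before it is differentiated in
    time, which avoids derivatives of quotients.\<close>
  have eq: "((gu u t \<bullet> gu u t) * (gu u t \<bullet> gu u t)) *\<^sub>R gt u t =
      (gu u t \<bullet> gu u t) *\<^sub>R guu u t - (gu u t \<bullet> guu u t) *\<^sub>R gu u t" if "t \<in> {0..<T}" for t
    using regular[OF that, of u]
    by (simp add: gt_eq[OF that] a_def ch_def scaleR_right_diff_distrib power2_norm_eq_inner)
  have "((\<lambda>t. ((gu u t \<bullet> gu u t) * (gu u t \<bullet> gu u t)) *\<^sub>R gt u t) has_vector_derivative
      (n * n) *\<^sub>R gtt u t + (n' * n + n' * n) *\<^sub>R gt u t) (at t within {0..<T})"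
    using has_vector_derivative_scaleR[OF DERIV_mult[OF dn dn] D_t[OF t, of 0 "Suc 0" u]] by (simp add: n_def)
  moreover have "((\<lambda>t. (gu u t \<bullet> gu u t) *\<^sub>R guu u t - (gu u t \<bullet> guu u t) *\<^sub>R gu u t) has_vector_derivative
      (n *\<^sub>R gtuu u t + n' *\<^sub>R guu u t) - (b *\<^sub>R gtu u t + b' *\<^sub>R gu u t)) (at t within {0..<T})"
    using has_vector_derivative_diff[OF has_vector_derivative_scaleR[OF dn D_t[OF t, of "Suc (Suc 0)" 0 u]]
      has_vector_derivative_scaleR[OF db D_t[OF t, of "Suc 0" 0 u]]] by (simp add: n_def b_def)
  from has_vector_derivative_transform[OF t eq this]
  have "((\<lambda>t. ((gu u t \<bullet> gu u t) * (gu u t \<bullet> gu u t)) *\<^sub>R gt u t) has_vector_derivative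
      (n *\<^sub>R gtuu u t + n' *\<^sub>R guu u t) - (b *\<^sub>R gtu u t + b' *\<^sub>R gu u t)) (at t within {0..<T})"
    by simp
  ultimately have *: "(n * n) *\<^sub>R gtt u t + (n' * n + n' * n) *\<^sub>R gt u t
      = (n *\<^sub>R gtuu u t + n' *\<^sub>R guu u t) - (b *\<^sub>R gtu u t + b' *\<^sub>R gu u t)"
    using vector_derivative_unique_within[OF at_within_T[OF t]] by blast
  have guu: "guu u t = n *\<^sub>R gt u t + (b / n) *\<^sub>R gu u t"
    using guu_eq[OF t, of u] by (simp add: n_def b_def ch_def power2_norm_eq_inner)
  have "(n * n) *\<^sub>R gtt u t = n *\<^sub>R gtuu u t - b *\<^sub>R gtu u t - (n' * n) *\<^sub>R gt u t + (n' * b / n - b') *\<^sub>R gu u t"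
  proof -
    define X where "X = (n' * n) *\<^sub>R gt u t"
    have "n' *\<^sub>R guu u t = X + (n' * b / n) *\<^sub>R gu u t"
      unfolding guu X_def by (simp add: scaleR_right_distrib)
    moreover have "(n' * n + n' * n) *\<^sub>R gt u t = X + X" by (simp only: X_def scaleR_left_distrib)
    ultimately have "(n * n) *\<^sub>R gtt u t + (X + X) =
        n *\<^sub>R gtuu u t + (X + (n' * b / n) *\<^sub>R gu u t) - (b *\<^sub>R gtu u t + b' *\<^sub>R gu u t)"
      using * by simp
    then have "(n * n) *\<^sub>R gtt u t =
        n *\<^sub>R gtuu u t + (X + (n' * b / n) *\<^sub>R gu u t) - (b *\<^sub>R gtu u t + b' *\<^sub>R gu u t) - (X + X)"
      by (metis add_diff_cancel_right')
    also have "\<dots> = n *\<^sub>R gtuu u t - b *\<^sub>R gtu u t - X + (n' * b / n - b') *\<^sub>R gu u t"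
      unfolding scaleR_left_diff_distrib by (simp add: algebra_simps)
    finally show ?thesis unfolding X_def .
  qed
  then have *: "inverse (n * n) *\<^sub>R ((n * n) *\<^sub>R gtt u t)
      = inverse (n * n) *\<^sub>R (n *\<^sub>R gtuu u t - b *\<^sub>R gtu u t - (n' * n) *\<^sub>R gt u t + (n' * b / n - b') *\<^sub>R gu u t)"
    by simp
  have "gtt u t = (1 / n) *\<^sub>R gtuu u t - (b / (n * n)) *\<^sub>R gtu u t - (n' / n) *\<^sub>R gt u t
      + (inverse (n * n) * (n' * b / n - b')) *\<^sub>R gu u t"
  proof -
    have "inverse (n * n) * (n * n) = 1" "inverse (n * n) * n = 1 / n" "inverse (n * n) * b = b / (n * n)"
      "inverse (n * n) * (n' * n) = n' / n" using n0 by (simp_all add: field_simps)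
    then show "?thesis" using * [unfolded scaleR_right_distrib scaleR_right_diff_distrib scaleR_scaleR]
      by (simp only: scaleR_one)
  qed
  moreover have "n' / n = - (2 * (norm (gt u t))\<^sup>2)"
    using gu_gtu[OF t, of u] n0 by (simp add: n'_def n_def power2_norm_eq_inner divide_simps)
  ultimately have "gtt u t = a u t *\<^sub>R (gtuu u t - ch u t *\<^sub>R gtu u t)
    + (2 * (norm (gt u t))\<^sup>2) *\<^sub>R gt u t + (inverse (n * n) * (n' * b / n - b')) *\<^sub>R gu u t"
    by (simp add: a_def ch_def n_def[symmetric] b_def[symmetric] power2_norm_eq_inner scaleR_right_diff_distrib)
  then show ?thesis using that by blast
qed

section \<open>Regularity of the projection after the initial time\<close>

text \<open>The comparison function G depends on the parameter u and not on the position, so its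
  derivatives enter through \<open>a\<close> and \<open>ch\<close>.\<close>

lemma spatial_min_scalar:
  assumes t: "t \<in> {0..<T}" and e: "0 < e"
    and d1: "\<And>x. (G has_real_derivative G1 x) (at x)" and d2: "(G1 has_real_derivative G2) (at u)"
    and min: "\<And>w. \<bar>w - u\<bar> < e \<Longrightarrow> g u t \<bullet> v - G u \<le> g w t \<bullet> v - G w"
  shows "a u t * (G2 - ch u t * G1 u) \<le> gt u t \<bullet> v"
proof -
  have z: "gu u t \<bullet> v - G1 u = 0" and p: "0 \<le> guu u t \<bullet> v - G2"
    using local_min_second_derivative[OF e DERIV_diff[OF inner_u[OF t] d1] DERIV_diff[OF inner_u[OF t] d2] min] by blast+
  have "0 \<le> a u t * (guu u t \<bullet> v - G2)" using p a_pos[OF t, of u] by simp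
  moreover have "gu u t \<bullet> v = G1 u" using z by simp
  ultimately show ?thesis by (simp add: gt_inner[OF t] algebra_simps)
qed

lemma cont_a [continuous_intros]:
  assumes "continuous_on A p" "continuous_on A q" "\<And>z. z \<in> A \<Longrightarrow> q z \<in> {0..<T}"
  shows "continuous_on A (\<lambda>z. a (p z) (q z))"
  unfolding a_def using assms regular by (intro continuous_intros) auto

lemma cont_ch [continuous_intros]:
  assumes "continuous_on A p" "continuous_on A q" "\<And>z. z \<in> A \<Longrightarrow> q z \<in> {0..<T}"
  shows "continuous_on A (\<lambda>z. ch (p z) (q z))"
  unfolding ch_def using assms regular by (intro continuous_intros) auto

lemma compact_lower_bound:
  fixes q :: "'b::topological_space \<Rightarrow> real"
  assumes "compact K" "continuous_on K q" "\<And>z. z \<in> K \<Longrightarrow> 0 < q z"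
  obtains m where "0 < m" "\<And>z. z \<in> K \<Longrightarrow> m \<le> q z"
proof (cases "K = {}")
  case True then show ?thesis using that[of 1] by simp
next
  case False
  then obtain z where "z \<in> K" "\<And>y. y \<in> K \<Longrightarrow> q z \<le> q y" using continuous_attains_inf[OF assms(1) _ assms(2)] by blast
  then show ?thesis using that[of "q z"] assms(3) by blast
qed

lemma compact_upper_bound:
  fixes q :: "'b::topological_space \<Rightarrow> real"
  assumes "compact K" "continuous_on K q"
  obtains M where "0 < M" "\<And>z. z \<in> K \<Longrightarrow> \<bar>q z\<bar> \<le> M"
proof -
  have "bounded (q ` K)" using compact_continuous_image[OF assms(2,1)] compact_imp_bounded by blast
  then obtain M where "\<And>z. z \<in> K \<Longrightarrow> norm (q z) \<le> M" unfolding bounded_iff by blast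
  then show ?thesis using that[of "max M 1"] by (force simp: real_norm_def)
qed

lemma positive_tube:
  assumes q: "continuous_on (UNIV \<times> {0..<T}) q" and s: "s \<in> {0..<T}" and K: "compact K"
    and pos: "\<And>u. u \<in> K \<Longrightarrow> 0 < (q (u::real, s) :: real)"
  obtains t1 m where "s < t1" "t1 < T" "0 < m" "\<And>u t. u \<in> K \<Longrightarrow> t \<in> {s..t1} \<Longrightarrow> m \<le> q (u, t)"
proof -
  have "continuous_on K (\<lambda>u. q (u, s))"
    using s by (intro continuous_on_compose2[OF q] continuous_intros) auto
  then obtain m where m: "0 < m" "\<And>u. u \<in> K \<Longrightarrow> m \<le> q (u, s)"
    using compact_lower_bound[OF K] pos by metis
  define r where "r = (s + T) / 2"
  have r: "s < r" "r < T" using s by (auto simp: r_def)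
  have "uniformly_continuous_on (K \<times> {s..r}) q"
    using s r by (intro compact_uniformly_continuous compact_Times K compact_Icc continuous_on_subset[OF q]) auto
  then obtain d where d: "0 < d" "\<And>x y. x \<in> K \<times> {s..r} \<Longrightarrow> y \<in> K \<times> {s..r} \<Longrightarrow> dist y x < d \<Longrightarrow> dist (q y) (q x) < m / 2"
    unfolding uniformly_continuous_on_def using m(1) by (metis half_gt_zero)
  define t1 where "t1 = min r (s + d / 2)"
  show ?thesis
  proof (rule that[of t1 "m / 2"])
    show "s < t1" "t1 < T" "0 < m / 2" using r d m by (auto simp: t1_def)
    fix u t assume ut: "u \<in> K" "t \<in> {s..t1}"
    then have "dist (u, t) (u, s) < d" using d(1) by (auto simp: dist_Pair_Pair dist_real_def t1_def)
    then have "dist (q (u, t)) (q (u, s)) < m / 2"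
      using d(2)[of "(u, s)" "(u, t)"] ut r by (auto simp: t1_def)
    then show "m / 2 \<le> q (u, t)" using m(2)[OF ut(1)] unfolding dist_real_def by linarith
  qed
qed

lemma dd_has_derivatives_exp:
  "((\<lambda>w. \<epsilon> * (exp (K * (w - b) + c) - d)) has_real_derivative K * (\<epsilon> * exp (K * (x - b) + c))) (at x)"
  "((\<lambda>w. K * (\<epsilon> * exp (K * (w - b) + c))) has_real_derivative K * (K * (\<epsilon> * exp (K * (x - b) + c)))) (at x)"
  "((\<lambda>w. \<epsilon> * (exp (K * (b - w) + c) - d)) has_real_derivative - K * (\<epsilon> * exp (K * (b - x) + c))) (at x)"
  "((\<lambda>w. - K * (\<epsilon> * exp (K * (b - w) + c))) has_real_derivative K * (K * (\<epsilon> * exp (K * (b - x) + c)))) (at x)"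
  by (auto intro!: derivative_eq_intros)

text \<open>The area spanned with a fixed point \<open>c\<close> is positive near the diagonal and stays above the
  barrier \<open>\<epsilon> (e\<^bsup>K d + C t\<^esup> - e\<^bsup>C t\<^sub>e\<^esup>)\<close>, which vanishes on the diagonal at time \<open>t\<^sub>e\<close> with positive slope.\<close>

lemma radial_positive:
  assumes \<eta>: "0 < \<eta>" "\<eta> < 2 * pi"
    and init: "\<And>u d. 0 \<le> d \<Longrightarrow> d \<le> \<eta> \<Longrightarrow> 0 \<le> dd e1 e2 (g u 0 - c) (g (u + d) 0 - c)"
    and pos: "\<And>u. 0 < dd e1 e2 (g u 0 - c) (g (u + \<eta>) 0 - c)"
  obtains t0 where "0 < t0" "t0 < T" "\<And>u t. 0 < t \<Longrightarrow> t \<le> t0 \<Longrightarrow> 0 < dd e1 e2 (g u t - c) (gu u t)"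
proof -
  let ?f = "\<lambda>u w t. dd e1 e2 (g u t - c) (g w t - c)"
  have "continuous_on (UNIV \<times> {0..<T}) (\<lambda>z. ?f (fst z) (fst z + \<eta>) (snd z))"
    unfolding dd_def by (intro continuous_intros) auto
  then obtain t0 m where t0: "0 < t0" "t0 < T" and m: "0 < m"
    and edge0: "\<And>u t. u \<in> {0..2*pi} \<Longrightarrow> t \<in> {0..t0} \<Longrightarrow> m \<le> ?f u (u + \<eta>) t"
    using positive_tube[of "\<lambda>z. ?f (fst z) (fst z + \<eta>) (snd z)" 0 "{0..2*pi}"] T_pos pos by auto
  have shift: "?f (u + 2 * pi * of_int k) (w + 2 * pi * of_int k) t = ?f u w t" if "t \<in> {0..<T}" for u w t k
    using D_per_int[OF that] by simp
  have edge: "m \<le> ?f u (u + \<eta>) t" if "t \<in> {0..t0}" for u t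
  proof -
    obtain k :: int where "0 \<le> u + 2 * pi * of_int k" "u + 2 * pi * of_int k < 0 + 2 * pi"
      using period_representative .
    then show ?thesis using edge0[of "u + 2 * pi * of_int k" t] shift[of t u k "u + \<eta>"] that t0
      by (auto simp: algebra_simps)
  qed
  have "0 < dd e1 e2 (g v te - c) (gu v te)" if te: "0 < te" "te \<le> t0" for v te
  proof -
    have teT: "te < T" using te t0 by simp
    have cp: "compact ({0..4*pi} \<times> {0..te})" by (intro compact_Times compact_Icc)
    have ca: "continuous_on ({0..4*pi} \<times> {0..te}) (\<lambda>z. a (fst z) (snd z))"
      and cc: "continuous_on ({0..4*pi} \<times> {0..te}) (\<lambda>z. a (fst z) (snd z) * ch (fst z) (snd z))"
      using teT by (auto intro!: continuous_intros)
    have "0 < a (fst z) (snd z)" if "z \<in> {0..4*pi} \<times> {0..te}" for z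
      using that teT by (intro a_pos) auto
    from compact_lower_bound[OF cp ca this] obtain as where
      as: "0 < as" "\<And>z. z \<in> {0..4*pi} \<times> {0..te} \<Longrightarrow> as \<le> a (fst z) (snd z)" by blast
    from compact_upper_bound[OF cp cc] obtain cs where
      cs: "0 < cs" "\<And>z. z \<in> {0..4*pi} \<times> {0..te} \<Longrightarrow> \<bar>a (fst z) (snd z) * ch (fst z) (snd z)\<bar> \<le> cs" by blast
    \<comment> \<open>The first bound lets the second-order terms absorb the drift and still leave
      \<open>as * K\<close>. The second gives \<open>K * \<eta> \<le> C * te\<close>, so that the
      barrier is nonpositive at time 0.\<close>
    define K where "K = max (2 * cs / as) (\<eta> / (as * te)) + 1"
    have "0 < 2 * cs / as" using cs(1) as(1) by simp
    then have K0: "0 < K" unfolding K_def by linarith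
    have "2 * cs / as \<le> K" "\<eta> / (as * te) \<le> K" by (auto simp: K_def)
    then have K: "2 * cs \<le> as * K" "\<eta> \<le> as * te * K" using as(1) te(1) by (auto simp: field_simps)
    define C where "C = as * K * K"
    have CK: "K * \<eta> \<le> C * te" using mult_left_mono[OF K(2), of K] K0 by (simp add: C_def algebra_simps)
    \<comment> \<open>With this size the barrier at separation \<open>\<eta>\<close> never exceeds
      m, the lower bound for the area there.\<close>
    define \<epsilon> where "\<epsilon> = m / exp (K * \<eta> + C * te)"
    have \<epsilon>: "0 < \<epsilon>" using m by (simp add: \<epsilon>_def)
    define h where "h u w t = ?f u w t - \<epsilon> * (exp (K * (w - u) + C * t) - exp (C * te))" for u w t
    have hn: "0 \<le> h u w te" if uw: "u \<le> w" "w \<le> u + \<eta>" for u w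
    proof (rule ccontr)
      assume neg: "\<not> 0 \<le> h u w te"
      let ?h = "\<lambda>z. h (fst (fst z)) (snd (fst z)) (snd z)"
      define E :: "((real \<times> real) \<times> real) set" where
        "E = {z. fst (fst z) \<in> {0..2*pi} \<and> fst (fst z) \<le> snd (fst z) \<and> snd (fst z) \<le> fst (fst z) + \<eta> \<and> snd z \<in> {0..te}}"
      have "closed E" unfolding E_def atLeastAtMost_iff
        by (intro closed_Collect_conj closed_Collect_le continuous_intros)
      moreover have "E \<subseteq> ({0..2*pi} \<times> {0..4*pi}) \<times> {0..te}"
        unfolding E_def using \<eta>(2) by auto
      ultimately have cE: "compact E"
        by (metis compact_Icc compact_Times closed_Int_compact inf.absorb1)
      have cf: "continuous_on E ?h"
        unfolding h_def dd_def E_def using teT by (intro continuous_intros) auto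
      have rep: "\<exists>u' w'. ((u', w'), t) \<in> E \<and> h u' w' t = h u w t"
        if "u \<le> w" "w \<le> u + \<eta>" "t \<in> {0..te}" for u w t
      proof -
        obtain k :: int where "0 \<le> u + 2 * pi * of_int k" "u + 2 * pi * of_int k < 0 + 2 * pi"
          using period_representative .
        then have "((u + 2 * pi * of_int k, w + 2 * pi * of_int k), t) \<in> E" using that by (auto simp: E_def)
        moreover have "h (u + 2 * pi * of_int k) (w + 2 * pi * of_int k) t = h u w t"
          using shift[of t u k w] that teT by (simp add: h_def)
        ultimately show ?thesis by blast
      qed
      obtain z0 where "z0 \<in> E" "?h z0 < 0"
      proof -
        obtain u' w' where "((u', w'), te) \<in> E" "h u' w' te = h u w te" using rep[OF uw, of te] te by auto
        then show ?thesis using that[of "((u', w'), te)"] neg by simp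
      qed
      from obtain_weighted_min[OF cE cf this, of 1] obtain z r where z: "(z, r) \<in> E" "?h (z, r) < 0"
        and min: "\<And>w q. (w, q) \<in> E \<Longrightarrow> ?h (z, r) * exp (- 1 * r) \<le> ?h (w, q) * exp (- 1 * q)" by blast
      obtain u1 u2 where zu: "z = (u1, u2)" by (metis prod.collapse)
      have hneg: "h u1 u2 r < 0" and u12: "u1 \<le> u2" "u2 \<le> u1 + \<eta>" and r: "r \<in> {0..te}"
        and ub: "u1 \<in> {0..4*pi}" "u2 \<in> {0..4*pi}"
        using z zu \<eta>(2) by (auto simp: E_def)
      have rT: "r \<in> {0..<T}" using r teT by auto
      have minE: "h u1 u2 r * exp (- 1 * r) \<le> h u w q * exp (- 1 * q)"
        if "u \<le> w" "w \<le> u + \<eta>" "q \<in> {0..te}" for u w q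
        using rep[OF that] min zu by fastforce
      have minr: "h u1 u2 r \<le> h u w r" if "u \<le> w" "w \<le> u + \<eta>" for u w
        using minE[OF that r] by simp
      have "r \<noteq> 0"
      proof
        assume "r = 0"
        have "K * (u2 - u1) \<le> K * \<eta>" using u12 K0 by (intro mult_left_mono) auto
        then have "\<epsilon> * (exp (K * (u2 - u1) + C * 0) - exp (C * te)) \<le> 0"
          using CK \<epsilon> by (intro mult_nonneg_nonpos) auto
        moreover have "0 \<le> ?f u1 u2 0" using init[of "u2 - u1" u1] u12 by simp
        ultimately show False using hneg \<open>r = 0\<close> by (simp add: h_def)
      qed
      have "C * r \<le> C * te" using r as(1) K0 by (intro mult_left_mono) (auto simp: C_def)
      have "u1 \<noteq> u2"
      proof
        assume "u1 = u2"
        moreover have "\<epsilon> * (exp (C * r) - exp (C * te)) \<le> 0"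
          using \<epsilon> \<open>C * r \<le> C * te\<close> by (intro mult_nonneg_nonpos) auto
        ultimately show False using hneg by (simp add: h_def)
      qed
      have "u2 \<noteq> u1 + \<eta>"
      proof
        assume *: "u2 = u1 + \<eta>"
        have "\<epsilon> * (exp (K * \<eta> + C * r) - exp (C * te)) \<le> \<epsilon> * exp (K * \<eta> + C * te)"
          using \<epsilon> \<open>C * r \<le> C * te\<close> by (intro mult_left_mono) (auto intro: order_trans[of _ "exp (K * \<eta> + C * r)"])
        also have "\<dots> = m" by (simp add: \<epsilon>_def)
        finally show False using edge[of r u1] r te hneg * by (auto simp: h_def)
      qed
      define e where "e = min (u2 - u1) (u1 + \<eta> - u2)"
      have e: "0 < e" "e \<le> u2 - u1" "e \<le> u1 + \<eta> - u2"
        using u12 \<open>u1 \<noteq> u2\<close> \<open>u2 \<noteq> u1 + \<eta>\<close> by (auto simp: e_def)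
      define V1 where "V1 = ((g u2 r - c) \<bullet> e2) *\<^sub>R e1 - ((g u2 r - c) \<bullet> e1) *\<^sub>R e2"
      define V2 where "V2 = ((g u1 r - c) \<bullet> e1) *\<^sub>R e2 - ((g u1 r - c) \<bullet> e2) *\<^sub>R e1"
      have f1: "?f w u2 r = g w r \<bullet> V1 - c \<bullet> V1" for w
        by (simp add: dd_def V1_def inner_diff_left inner_diff_right algebra_simps)
      have f2: "?f u1 w r = g w r \<bullet> V2 - c \<bullet> V2" for w
        by (simp add: dd_def V2_def inner_diff_left inner_diff_right algebra_simps)
      define X where "X = \<epsilon> * exp (K * (u2 - u1) + C * r)"
      have X: "0 < X" using \<epsilon> by (simp add: X_def)
      have min2: "g u2 r \<bullet> V2 - \<epsilon> * (exp (K * (u2 - u1) + C * r) - exp (C * te))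
          \<le> g w r \<bullet> V2 - \<epsilon> * (exp (K * (w - u1) + C * r) - exp (C * te))" if "\<bar>w - u2\<bar> < e" for w
        using minr[of u1 w] that e unfolding h_def f2 by auto
      have min1: "g u1 r \<bullet> V1 - \<epsilon> * (exp (K * (u2 - u1) + C * r) - exp (C * te))
          \<le> g w r \<bullet> V1 - \<epsilon> * (exp (K * (u2 - w) + C * r) - exp (C * te))" if "\<bar>w - u1\<bar> < e" for w
        using minr[of w u2] that e unfolding h_def f1 by auto
      have "a u2 r * (K * (K * X) - ch u2 r * (K * X)) \<le> gt u2 r \<bullet> V2"
        unfolding X_def
        by (rule spatial_min_scalar[OF rT e(1) dd_has_derivatives_exp(1,2)]) (rule min2)
      moreover have "a u1 r * (K * (K * X) - ch u1 r * (- K * X)) \<le> gt u1 r \<bullet> V1"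
        unfolding X_def
        by (rule spatial_min_scalar[OF rT e(1) dd_has_derivatives_exp(3,4)]) (rule min1)
      ultimately have "(a u1 r * K + a u2 r * K + a u1 r * ch u1 r - a u2 r * ch u2 r) * (K * X)
          \<le> gt u1 r \<bullet> V1 + gt u2 r \<bullet> V2" by (simp add: algebra_simps)
      moreover have "as * K * (K * X) \<le> (a u1 r * K + a u2 r * K + a u1 r * ch u1 r - a u2 r * ch u2 r) * (K * X)"
      proof (rule mult_right_mono)
        have "as * K \<le> a u1 r * K" "as * K \<le> a u2 r * K"
          using as(2)[of "(u1, r)"] as(2)[of "(u2, r)"] ub r K0 by auto
        moreover have "\<bar>a u1 r * ch u1 r\<bar> \<le> cs" "\<bar>a u2 r * ch u2 r\<bar> \<le> cs"
          using cs(2)[of "(u1, r)"] cs(2)[of "(u2, r)"] ub r by auto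
        ultimately show "as * K \<le> a u1 r * K + a u2 r * K + a u1 r * ch u1 r - a u2 r * ch u2 r"
          using K(1) by linarith
      qed (use K0 X in simp)
      ultimately have ge: "C * X \<le> gt u1 r \<bullet> V1 + gt u2 r \<bullet> V2" by (simp add: C_def algebra_simps)
      have "((\<lambda>q. h u1 u2 q) has_real_derivative gt u1 r \<bullet> V1 + gt u2 r \<bullet> V2 - C * X) (at r within {0..<T})"
        unfolding h_def dd_def inner_diff_left
        by (rule derivative_eq_intros inner_t rT refl)+
          (simp add: V1_def V2_def X_def inner_diff_left inner_diff_right algebra_simps)
      then have "gt u1 r \<bullet> V1 + gt u2 r \<bullet> V2 - C * X \<le> 1 * h u1 u2 r"
        using minE[OF u12] r \<open>r \<noteq> 0\<close> teT
        by (intro left_derivative_le[of "\<lambda>q. h u1 u2 q" _ r "{0..<T}" r 1]) auto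
      then show False using ge hneg by linarith
    qed
    \<comment> \<open>At time te the barrier vanishes on the diagonal, as does the area; comparing
      the one-sided slopes there gives strict positivity.\<close>
    have "\<epsilon> * exp (C * te) * K \<le> dd e1 e2 (g v te - c) (gu v te)"
    proof (rule right_derivative_ge[OF _ \<eta>(1)])
      show "((\<lambda>w. ?f v w te) has_real_derivative dd e1 e2 (g v te - c) (gu v te)) (at v)"
        by (rule dd_const_u(1)) (use te teT in auto)
      show "?f v v te + \<epsilon> * exp (C * te) * K * d \<le> ?f v (v + d) te" if "0 < d" "d < \<eta>" for d
      proof -
        have "0 \<le> h v (v + d) te" using hn that by auto
        moreover have "\<epsilon> * exp (C * te) * (K * d) \<le> \<epsilon> * exp (C * te) * (exp (K * d) - 1)"
        proof (rule mult_left_mono)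
          show "K * d \<le> exp (K * d) - 1" using exp_ge_add_one_self[of "K * d"] by linarith
        qed (use \<epsilon> in simp)
        ultimately show ?thesis by (simp add: h_def exp_add algebra_simps)
      qed
    qed
    then show ?thesis using \<epsilon> K0 by (meson exp_gt_zero less_le_trans mult_pos_pos)
  qed
  then show ?thesis using that t0 by blast
qed

text \<open>The function \<open>det (p\<^sub>u, p\<^sub>t)\<close>, a positive multiple of the curvature of the projection, solves a
  linear parabolic equation as long as the projection is immersed.\<close>

definition pp :: "'a \<Rightarrow> 'a \<Rightarrow> 'a \<Rightarrow> 'a \<Rightarrow> real" where
  "pp e1 e2 v w = (v \<bullet> e1) * (w \<bullet> e1) + (v \<bullet> e2) * (w \<bullet> e2)"

text \<open>A planar identity that recovers the area of x and y from their components along and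
  across v; it will be divided by \<open>pp e1 e2 v v\<close>.\<close>

lemma dd_pp: "pp e1 e2 v v * dd e1 e2 x y = pp e1 e2 v x * dd e1 e2 v y - pp e1 e2 v y * dd e1 e2 v x"
  by (simp add: dd_def pp_def algebra_simps)

definition chu :: "real \<Rightarrow> real \<Rightarrow> real" where
  "chu u t = ((gu u t \<bullet> guuu u t + guu u t \<bullet> guu u t) * (gu u t \<bullet> gu u t)
     - (gu u t \<bullet> guu u t) * (2 * (gu u t \<bullet> guu u t))) / (gu u t \<bullet> gu u t)\<^sup>2"

lemma ch_u:
  assumes t: "t \<in> {0..<T}" shows "((\<lambda>u. ch u t) has_real_derivative chu u t) (at u)"
proof -
  have "((\<lambda>u. (gu u t \<bullet> guu u t) / (gu u t \<bullet> gu u t)) has_real_derivative chu u t) (at u)"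
    using DERIV_divide[OF inner_D_u[OF t, where u = u and k = "Suc 0" and l = 0 and k' = "Suc (Suc 0)" and l' = 0]
      inner_D_u[OF t, where u = u and k = "Suc 0" and l = 0 and k' = "Suc 0" and l' = 0]]
      regular[OF t, of u]
    by (simp add: chu_def inner_commute power2_eq_square)
  then show ?thesis by (simp add: ch_def power2_norm_eq_inner)
qed

definition cb :: "'a \<Rightarrow> 'a \<Rightarrow> real \<Rightarrow> real \<Rightarrow> real" where
  "cb e1 e2 u t = - 3 * a u t * ch u t - 2 * pp e1 e2 (gu u t) (gt u t) / pp e1 e2 (gu u t) (gu u t)"

definition cc :: "'a \<Rightarrow> 'a \<Rightarrow> real \<Rightarrow> real \<Rightarrow> real" where
  "cc e1 e2 u t = 2 * a u t * (ch u t)\<^sup>2 - a u t * chu u t + 2 * (norm (gt u t))\<^sup>2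
    + 2 * pp e1 e2 (gu u t) (gt u t) * ch u t / pp e1 e2 (gu u t) (gu u t)
    + 2 * pp e1 e2 (gu u t) (gtu u t) / pp e1 e2 (gu u t) (gu u t)"

text \<open>The only obstruction to a closed linear equation is the area of \<open>gt\<close> and
  \<open>gtu\<close>. With \<open>dd_pp\<close> for the tangent vector it becomes a combination of I
  and its derivative, at the price of dividing by the squared length of the projected
  tangent.\<close>

lemma dd_velocity_evolution:
  assumes t: "t \<in> {0..<T}" and P: "pp e1 e2 (gu u t) (gu u t) \<noteq> 0"
  defines "I \<equiv> \<lambda>u t. dd e1 e2 (gu u t) (gt u t)"
  defines "I1 \<equiv> \<lambda>u t. ch u t * I u t + dd e1 e2 (gu u t) (gtu u t)"
  obtains I2 where "\<And>u. ((\<lambda>u. I u t) has_real_derivative I1 u t) (at u)"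
    "((\<lambda>u. I1 u t) has_real_derivative I2) (at u)"
    "((\<lambda>t. I u t) has_real_derivative a u t * I2 + cb e1 e2 u t * I1 u t + cc e1 e2 u t * I u t) (at t within {0..<T})"
proof -
  have 1: "((\<lambda>u. I u t) has_real_derivative I1 u t) (at u)" for u
    using dd_u[OF t, where u = u and k = "Suc 0" and l = 0 and k' = 0 and l' = "Suc 0"]
    by (simp add: I_def I1_def guu_eq[OF t] dd_linear)
  define I2 where "I2 = chu u t * I u t + ch u t * I1 u t
    + (dd e1 e2 (guu u t) (gtu u t) + dd e1 e2 (gu u t) (gtuu u t))"
  have 2: "((\<lambda>u. I1 u t) has_real_derivative I2) (at u)"
    using DERIV_add[OF DERIV_mult[OF ch_u[OF t, of u] 1[of u]] dd_u[OF t, where u = u and k = "Suc 0" and l = 0 and k' = "Suc 0" and l' = "Suc 0"]]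
    by (simp add: I1_def I2_def algebra_simps)
  obtain r where r: "gtt u t = a u t *\<^sub>R (gtuu u t - ch u t *\<^sub>R gtu u t)
    + (2 * (norm (gt u t))\<^sup>2) *\<^sub>R gt u t + r *\<^sub>R gu u t" using gtt_eq[OF t] .
  have 3: "((\<lambda>t. I u t) has_real_derivative dd e1 e2 (gtu u t) (gt u t) + dd e1 e2 (gu u t) (gtt u t)) (at t within {0..<T})"
    unfolding I_def by (rule dd_t[OF t])
  define J where "J = dd e1 e2 (gu u t) (gtu u t)"
  define Q where "Q = dd e1 e2 (gt u t) (gtu u t)"
  define S where "S = dd e1 e2 (gu u t) (gtuu u t)"
  define n where "n = (norm (gu u t))\<^sup>2"
  have an: "a u t * n = 1" using a_norm[OF t] by (simp add: n_def)
  have J: "J = I1 u t - ch u t * I u t" by (simp add: J_def I1_def)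
  have I2: "I2 = chu u t * I u t + ch u t * I1 u t + (n * Q + ch u t * J + S)"
    by (simp add: I2_def guu_eq[OF t, of u] dd_linear J_def Q_def S_def n_def)
  have "dd e1 e2 (gtu u t) (gt u t) + dd e1 e2 (gu u t) (gtt u t)
      = - Q + a u t * (S - ch u t * J) + 2 * (norm (gt u t))\<^sup>2 * I u t"
    unfolding r by (simp add: dd_linear dd_anti[of _ _ "gtu u t" "gt u t"] Q_def S_def J_def I_def algebra_simps)
  also have "\<dots> = a u t * (S + n * Q) - 2 * Q - a u t * ch u t * J + 2 * (norm (gt u t))\<^sup>2 * I u t"
  proof -
    have "a u t * (S + n * Q) = a u t * S + a u t * n * Q" by (simp add: algebra_simps)
    then show ?thesis unfolding an by (simp add: algebra_simps)
  qed
  also have "S + n * Q = I2 - chu u t * I u t - ch u t * I1 u t - ch u t * J" by (simp add: I2)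
  also have "Q = pp e1 e2 (gu u t) (gt u t) / pp e1 e2 (gu u t) (gu u t) * J
      - pp e1 e2 (gu u t) (gtu u t) / pp e1 e2 (gu u t) (gu u t) * I u t"
    using dd_pp[of e1 e2 "gu u t" "gt u t" "gtu u t"] P
    by (simp add: Q_def J_def I_def field_simps)
  finally have "dd e1 e2 (gtu u t) (gt u t) + dd e1 e2 (gu u t) (gtt u t)
      = a u t * I2 + cb e1 e2 u t * I1 u t + cc e1 e2 u t * I u t"
    unfolding J cb_def cc_def by (simp add: algebra_simps power2_eq_square diff_divide_distrib)
  then show ?thesis using that[OF 1 2] 3 by simp
qed

text \<open>The barrier \<open>\<epsilon> (e\<^bsup>- K \<xi> + C t\<^esup> - e\<^bsup>\<Lambda> t\<^esup>)\<close> spreads positivity from an arc to the whole curve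
  instantaneously.\<close>

lemma dd_velocity_positive:
  assumes t12: "0 \<le> t1" "t1 < t2" "t2 < T"
    and P: "\<And>u t. t \<in> {t1..t2} \<Longrightarrow> pp e1 e2 (gu u t) (gu u t) \<noteq> 0"
    and nonneg: "\<And>u t. t \<in> {t1..t2} \<Longrightarrow> 0 \<le> dd e1 e2 (gu u t) (gt u t)"
    and us: "0 < dd e1 e2 (gu us t1) (gt us t1)"
  obtains t where "t1 < t" "t \<le> t2" "\<And>u. 0 < dd e1 e2 (gu u t) (gt u t)"
proof -
  define I where "I u t = dd e1 e2 (gu u t) (gt u t)" for u t
  have cI: "continuous_on (UNIV \<times> {0..<T}) (\<lambda>z. I (fst z) (snd z))"
    unfolding I_def dd_def by (intro continuous_intros) auto
  have "isCont (\<lambda>u. I u t1) us"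
    using dd_u[where t = t1 and u = us and k = "Suc 0" and l = 0 and k' = 0 and l' = "Suc 0"] t12 unfolding I_def by (intro DERIV_isCont) auto
  then obtain d where d: "0 < d" "\<And>u. \<bar>u - us\<bar> < d \<Longrightarrow> \<bar>I u t1 - I us t1\<bar> < I us t1"
    using us unfolding continuous_at_eps_delta I_def dist_real_def by metis
  define \<eta> where "\<eta> = min (d / 2) 1"
  have \<eta>: "0 < \<eta>" "\<eta> < d" "\<eta> \<le> 1" using d(1) by (auto simp: \<eta>_def)
  have "0 < I u t1" if "u \<in> {us - \<eta>..us + \<eta>}" for u
  proof -
    have "\<bar>u - us\<bar> < d" using that \<eta> by auto
    from d(2)[OF this] show ?thesis by linarith
  qed
  then obtain t3 m where t3: "t1 < t3" "t3 < T" and m: "0 < m"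
    and Im: "\<And>u t. u \<in> {us - \<eta>..us + \<eta>} \<Longrightarrow> t \<in> {t1..t3} \<Longrightarrow> m \<le> I u t"
    using positive_tube[OF cI, of t1 "{us - \<eta>..us + \<eta>}"] t12 by auto
  define t' where "t' = min t2 t3"
  have t': "t1 < t'" "t' \<le> t2" "t' \<le> t3" "t' < T" using t12 t3 by (auto simp: t'_def)
  \<comment> \<open>The complement, within one period, of the arc where I is bounded below by m; at
    both lateral ends the barrier has to stay below m.\<close>
  let ?K = "{us + \<eta>..us + 2 * pi - \<eta>} \<times> {t1..t'}"
  have cp: "compact ?K" by (intro compact_Times compact_Icc)
  have KT: "snd z \<in> {0..<T}" "snd z \<in> {t1..t2}" if "z \<in> ?K" for z using that t' t12 by auto
  have cont: "continuous_on ?K (\<lambda>z. a (fst z) (snd z))" "continuous_on ?K (\<lambda>z. cb e1 e2 (fst z) (snd z))"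
    "continuous_on ?K (\<lambda>z. cc e1 e2 (fst z) (snd z))"
  proof -
    show "continuous_on ?K (\<lambda>z. a (fst z) (snd z))" using KT by (intro continuous_intros)
    have [continuous_intros]: "continuous_on ?K (\<lambda>z. pp e1 e2 (D k l (fst z) (snd z)) (D k' l' (fst z) (snd z)))" for k l k' l'
      unfolding pp_def using KT by (intro continuous_intros)
    have [continuous_intros]: "continuous_on ?K (\<lambda>z. chu (fst z) (snd z))"
      unfolding chu_def using KT regular by (intro continuous_intros) auto
    show "continuous_on ?K (\<lambda>z. cb e1 e2 (fst z) (snd z))"
      unfolding cb_def using KT P by (intro continuous_intros) auto
    show "continuous_on ?K (\<lambda>z. cc e1 e2 (fst z) (snd z))"
      unfolding cc_def using KT P by (intro continuous_intros) auto
  qed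
  have "0 < a (fst z) (snd z)" if "z \<in> ?K" for z using KT(1)[OF that] by (rule a_pos)
  from compact_lower_bound[OF cp cont(1) this] obtain as where
    as: "0 < as" "\<And>z. z \<in> ?K \<Longrightarrow> as \<le> a (fst z) (snd z)" by blast
  from compact_upper_bound[OF cp cont(2)] obtain B where
    B: "0 < B" "\<And>z. z \<in> ?K \<Longrightarrow> \<bar>cb e1 e2 (fst z) (snd z)\<bar> \<le> B" by blast
  from compact_upper_bound[OF cp cont(3)] obtain \<Lambda> where
    \<Lambda>: "0 < \<Lambda>" "\<And>z. z \<in> ?K \<Longrightarrow> \<bar>cc e1 e2 (fst z) (snd z)\<bar> \<le> \<Lambda>" by blast
  define \<tau> where "\<tau> = t' - t1"
  have \<tau>: "0 < \<tau>" using t' by (simp add: \<tau>_def)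
  \<comment> \<open>Diffusion has to beat the drift B and the reaction \<open>\<Lambda>\<close> and,
    in addition, to raise the barrier across a whole period within the time \<open>\<tau>\<close>;
    hence the summand \<open>2 * pi / \<tau>\<close>.\<close>
  define K where "K = (B + 2 * pi / \<tau> + 2 * \<Lambda>) / as + 1"
  have pt: "0 < 2 * pi / \<tau>" using \<tau> by simp
  have K1: "1 \<le> K" using B \<Lambda> as pt by (simp add: K_def)
  have "as * K = B + 2 * pi / \<tau> + 2 * \<Lambda> + as" using as(1) by (simp add: K_def field_simps)
  then have asK: "B + 2 * pi / \<tau> + 2 * \<Lambda> < as * K" using as(1) by simp
  \<comment> \<open>The rate at which the barrier may rise while remaining a subsolution: diffusion
    contributes at least as K^2, drift costs at most B K, and the zero-order term at most
    \<open>\<Lambda>\<close>.\<close>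
  define C where "C = (as * K - B) * K - \<Lambda>"
  have C1: "2 * pi / \<tau> * K + \<Lambda> < C"
  proof -
    have "(2 * pi / \<tau> + 2 * \<Lambda>) * K < (as * K - B) * K" using asK K1 by (intro mult_strict_right_mono) auto
    moreover have "2 * \<Lambda> \<le> 2 * \<Lambda> * K" using K1 \<Lambda>(1) by simp
    ultimately show ?thesis by (simp add: C_def algebra_simps)
  qed
  have C0: "0 < C" using C1 \<Lambda>(1) pt K1 by (smt (verit) mult_nonneg_nonneg)
  define \<epsilon> where "\<epsilon> = m / exp (C * \<tau>)"
  have \<epsilon>: "0 < \<epsilon>" using m by (simp add: \<epsilon>_def)
  define G where "G u t = \<epsilon> * (exp (K * (us + \<eta> - u) + C * (t - t1)) - exp (\<Lambda> * (t - t1)))" for u t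
  have main: "G u t' \<le> I u t'" if u: "u \<in> {us + \<eta>..us + 2 * pi - \<eta>}" for u
  proof (rule ccontr)
    assume "\<not> G u t' \<le> I u t'"
    then have neg: "I u t' - G u t' < 0" by simp
    let ?h = "\<lambda>z. I (fst z) (snd z) - G (fst z) (snd z)"
    have cK: "continuous_on ?K ?h"
      unfolding G_def using KT
      by (intro continuous_intros continuous_on_subset[OF cI]) auto
    have "(u, t') \<in> ?K" "?h (u, t') < 0" using u t' neg by auto
    from obtain_weighted_min[OF cp cK this, of "\<Lambda> + 1"] obtain z r where z: "(z, r) \<in> ?K" "?h (z, r) < 0"
      and min: "\<And>w q. (w, q) \<in> ?K \<Longrightarrow> ?h (z, r) * exp (- (\<Lambda> + 1) * r) \<le> ?h (w, q) * exp (- (\<Lambda> + 1) * q)"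
      by blast
    have r: "r \<in> {t1..t'}" and zu: "z \<in> {us + \<eta>..us + 2 * pi - \<eta>}" using z(1) by auto
    have rT: "r \<in> {0..<T}" using r t' t12 by auto
    have Iz: "I z r < G z r" using z(2) by simp
    have I0: "0 \<le> I z r" using nonneg[of r z] r t' by (auto simp: I_def)
    have Kz: "K * (us + \<eta> - z) \<le> 0" using K1 zu by (simp add: mult_nonneg_nonpos)
    have "r \<noteq> t1"
    proof
      assume "r = t1"
      then have "G z r \<le> 0" unfolding G_def using \<epsilon> Kz by (intro mult_nonneg_nonpos) auto
      then show False using Iz I0 by simp
    qed
    have Gm: "G z r \<le> m"
    proof -
      have "exp (K * (us + \<eta> - z) + C * (r - t1)) \<le> exp (C * \<tau>)"
      proof -
        have "C * (r - t1) \<le> C * \<tau>" using C0 r by (intro mult_left_mono) (auto simp: \<tau>_def)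
        then show ?thesis using Kz by simp
      qed
      then have "exp (K * (us + \<eta> - z) + C * (r - t1)) - exp (\<Lambda> * (r - t1)) \<le> exp (C * \<tau>)"
        by (smt (verit) exp_gt_zero)
      then have "G z r \<le> \<epsilon> * exp (C * \<tau>)" unfolding G_def using \<epsilon> by (intro mult_left_mono) auto
      then show ?thesis by (simp add: \<epsilon>_def)
    qed
    have "z \<noteq> us + \<eta>" "z \<noteq> us + 2 * pi - \<eta>"
    proof -
      show "z \<noteq> us + \<eta>" using Im[of z r] Gm Iz r t' \<eta> by auto
      show "z \<noteq> us + 2 * pi - \<eta>"
      proof
        assume "z = us + 2 * pi - \<eta>"
        then have "z = us - \<eta> + 2 * pi" by simp
        then have "I z r = I (us - \<eta>) r" using D_per[OF rT, of _ _ "us - \<eta>"] by (simp only: I_def)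
        then show False using Im[of "us - \<eta>" r] Gm Iz r t' \<eta> by auto
      qed
    qed
    define e where "e = min (z - (us + \<eta>)) (us + 2 * pi - \<eta> - z)"
    have e: "0 < e" using zu \<open>z \<noteq> us + \<eta>\<close> \<open>z \<noteq> us + 2 * pi - \<eta>\<close> by (auto simp: e_def)
    have Pz: "pp e1 e2 (gu z r) (gu z r) \<noteq> 0" using P[of r z] r t' by auto
    obtain I2 where d1: "\<And>u. ((\<lambda>u. I u r) has_real_derivative ch u r * I u r + dd e1 e2 (gu u r) (gtu u r)) (at u)"
      and d2: "((\<lambda>u. ch u r * I u r + dd e1 e2 (gu u r) (gtu u r)) has_real_derivative I2) (at z)"
      and dt: "((\<lambda>t. I z t) has_real_derivative a z r * I2
        + cb e1 e2 z r * (ch z r * I z r + dd e1 e2 (gu z r) (gtu z r)) + cc e1 e2 z r * I z r) (at r within {0..<T})"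
      using dd_velocity_evolution[OF rT Pz, folded I_def] by blast
    define X where "X = \<epsilon> * exp (K * (us + \<eta> - z) + C * (r - t1))"
    define Y where "Y = \<epsilon> * exp (\<Lambda> * (r - t1))"
    have XY: "0 < X" "0 < Y" "G z r = X - Y" using \<epsilon> by (auto simp: X_def Y_def G_def algebra_simps)
    have g1: "((\<lambda>u. G u r) has_real_derivative - K * (\<epsilon> * exp (K * (us + \<eta> - x) + C * (r - t1)))) (at x)" for x
      unfolding G_def by (rule dd_has_derivatives_exp(3))
    have g2: "((\<lambda>x. - K * (\<epsilon> * exp (K * (us + \<eta> - x) + C * (r - t1)))) has_real_derivative K * (K * X)) (at z)"
      unfolding X_def by (rule dd_has_derivatives_exp(4))
    have gt: "((\<lambda>q. G z q) has_real_derivative C * X - \<Lambda> * Y) (at r within {0..<T})"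
      unfolding G_def X_def Y_def by (auto intro!: derivative_eq_intros simp: algebra_simps)
    have minr: "I z r - G z r \<le> I w r - G w r" if "\<bar>w - z\<bar> < e" for w
    proof -
      have "(w, r) \<in> ?K" using that r by (auto simp: e_def)
      from min[OF this] show ?thesis by simp
    qed
    have z1: "ch z r * I z r + dd e1 e2 (gu z r) (gtu z r) - (- K * X) = 0" and z2: "0 \<le> I2 - K * (K * X)"
      using local_min_second_derivative[OF e DERIV_diff[OF d1 g1] DERIV_diff[OF d2 g2] minr] by (auto simp: X_def)
    have bnd: "as \<le> a z r" "\<bar>cb e1 e2 z r\<bar> \<le> B" "\<bar>cc e1 e2 z r\<bar> \<le> \<Lambda>"
      using as(2)[OF z(1)] B(2)[OF z(1)] \<Lambda>(2)[OF z(1)] by auto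
    have Ieq: "ch z r * I z r + dd e1 e2 (gu z r) (gtu z r) = - K * X" using z1 by simp
    have dh: "((\<lambda>q. I z q - G z q) has_real_derivative (a z r * I2 + cb e1 e2 z r * (- K * X) + cc e1 e2 z r * I z r)
        - (C * X - \<Lambda> * Y)) (at r within {0..<T})"
      using DERIV_diff[OF dt gt] unfolding Ieq .
    have "(a z r * I2 + cb e1 e2 z r * (- K * X) + cc e1 e2 z r * I z r) - (C * X - \<Lambda> * Y) \<le> (\<Lambda> + 1) * (I z r - G z r)"
    proof (rule left_derivative_le[OF dh, of "r - t1"])
      show "(I z r - G z r) * exp (- (\<Lambda> + 1) * r) \<le> (I z q - G z q) * exp (- (\<Lambda> + 1) * q)"
        if "r - (r - t1) < q" "q < r" for q
        using min[of z q] that r zu by auto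
    qed (use r \<open>r \<noteq> t1\<close> rT t12 in auto)
    moreover have "a z r * (K * (K * X)) \<le> a z r * I2"
      using z2 a_pos[OF rT, of z] by (intro mult_left_mono) auto
    moreover have "as * (K * (K * X)) \<le> a z r * (K * (K * X))"
      using bnd(1) XY K1 by (intro mult_right_mono) auto
    moreover have "cb e1 e2 z r * (K * X) \<le> B * (K * X)"
      using bnd(2) XY K1 by (intro mult_right_mono) auto
    moreover have "cc e1 e2 z r * (I z r - G z r) \<ge> \<Lambda> * (I z r - G z r)"
      using bnd(3) Iz by (intro mult_right_mono_neg) auto
    moreover have "- \<Lambda> * X \<le> cc e1 e2 z r * X" "- \<Lambda> * Y \<le> - cc e1 e2 z r * Y"
      using mult_right_mono[of "- \<Lambda>" "cc e1 e2 z r" X] mult_right_mono[of "- \<Lambda>" "- cc e1 e2 z r" Y] bnd(3) XY by auto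
    moreover have "cc e1 e2 z r * (I z r - G z r) = cc e1 e2 z r * I z r - cc e1 e2 z r * X + cc e1 e2 z r * Y"
      by (simp add: XY algebra_simps)
    moreover have "C * X = as * (K * (K * X)) - B * (K * X) - \<Lambda> * X" by (simp add: C_def algebra_simps)
    ultimately show False using Iz by (simp add: algebra_simps)
  qed
  have Gpos: "0 < G u t'" if "u \<le> us + 2 * pi - \<eta>" for u
  proof -
    have "K * (u - us - \<eta>) \<le> K * (2 * pi)" using that \<eta> K1 by (intro mult_left_mono) auto
    moreover have "(2 * pi / \<tau> * K + \<Lambda>) * \<tau> < C * \<tau>" using C1 \<tau> by (intro mult_strict_right_mono)
    moreover have "(2 * pi / \<tau> * K + \<Lambda>) * \<tau> = 2 * pi * K + \<Lambda> * \<tau>" using \<tau> by (simp add: field_simps)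
    ultimately have "\<Lambda> * \<tau> < K * (us + \<eta> - u) + C * \<tau>" by (simp add: algebra_simps)
    then show ?thesis using \<epsilon> by (simp add: G_def \<tau>_def)
  qed
  have "0 < I u t'" for u
  proof -
    have "t' \<in> {0..<T}" using t' t12 by simp
    then obtain w where w: "us - \<eta> \<le> w" "w < us - \<eta> + 2 * pi" "I u t' = I w t'"
      using representative[of "us - \<eta>" u] unfolding I_def by metis
    show ?thesis
    proof (cases "w \<le> us + \<eta>")
      case True
      then show ?thesis using Im[of w t'] w t' m by auto
    next
      case False
      then show ?thesis using main[of w] Gpos[of w] w by auto
    qed
  qed
  then show ?thesis using that t' unfolding I_def by blast
qed

section \<open>Tilted projections\<close>

text \<open>Curvedness makes the neighbours of u lie strictly to the left of the tangent at u. A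
  further contact point w on that tangent would then form a negatively ordered triangle with u and
  one such neighbour.\<close>

lemma strict_tangent:
  assumes t: "t \<in> {0..<T}" and tri: "\<And>u1 u2 u3. ordered u1 u2 u3 \<Longrightarrow> 0 \<le> tri e1 e2 t u1 u2 u3"
    and curved: "\<And>u. 0 < dd e1 e2 (gu u t) (guu u t)"
    and uw: "u < w" "w < u + 2 * pi"
  shows "0 < dd e1 e2 (gu u t) (g w t - g u t)"
proof -
  let ?B = "\<lambda>w. dd e1 e2 (gu u t) (g w t - g u t)"
  let ?B1 = "\<lambda>w. dd e1 e2 (gu u t) (gu w t)"
  have dB: "(?B has_real_derivative ?B1 x) (at x)" for x by (rule dd_const_u(1)[OF t])
  have dB1: "(?B1 has_real_derivative dd e1 e2 (gu u t) (guu u t)) (at u)"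
    using dd_const_u(1)[OF t, of e1 e2 "gu u t" "Suc 0" 0 0] by simp
  have nonneg: "0 \<le> ?B x" for x by (rule tangent_nonneg[OF t tri])
  obtain d1 where d1: "0 < d1" "\<And>h. 0 < h \<Longrightarrow> h < d1 \<Longrightarrow> 0 < ?B1 (u + h)"
    using DERIV_pos_inc_right[OF dB1 curved] by (auto simp: dd_self)
  obtain d2 where d2: "0 < d2" "\<And>h. 0 < h \<Longrightarrow> h < d2 \<Longrightarrow> ?B1 (u - h) < 0"
    using DERIV_pos_inc_left[OF dB1 curved] by (auto simp: dd_self)
  define e where "e = min d1 (min d2 pi)"
  have e: "0 < e" "e \<le> d1" "e \<le> d2" "e \<le> pi" using d1 d2 by (auto simp: e_def)
  have right: "0 < ?B (u + h)" if h: "0 < h" "h < e" for h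
  proof -
    obtain \<xi> where "u < \<xi>" "\<xi> < u + h" "?B (u + h) - ?B u = (u + h - u) * ?B1 \<xi>"
      using MVT2[of u "u + h" ?B ?B1] dB h by auto
    moreover have "0 < ?B1 (u + (\<xi> - u))" using calculation h e by (intro d1(2)) auto
    ultimately show ?thesis using h by simp
  qed
  have left: "0 < ?B (u + 2 * pi - h)" if h: "0 < h" "h < e" for h
  proof -
    obtain \<xi> where \<xi>: "u - h < \<xi>" "\<xi> < u" "?B u - ?B (u - h) = (u - (u - h)) * ?B1 \<xi>"
      using MVT2[of "u - h" u ?B ?B1] dB h by auto
    moreover have "?B1 (u - (u - \<xi>)) < 0" using \<xi> h e by (intro d2(2)) auto
    ultimately have "0 < ?B (u - h)" using h mult_pos_neg[of h "?B1 \<xi>"] by simp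
    then show ?thesis using D_per[OF t, of 0 0 "u - h"] by (simp add: algebra_simps)
  qed
  show ?thesis
  proof (rule ccontr)
    assume "\<not> 0 < ?B w"
    then have z: "?B w = 0" using nonneg[of w] by simp
    let ?d = "g w t - g u t"
    \<comment> \<open>The sign of S tells whether w lies ahead of u, behind u, or on top of u in the
      projection. The neighbour is taken after u in the first case and before u in the second; in
      the third, areas vanish along an arc and so does their derivative.\<close>
    define S where "S = pp e1 e2 (gu u t) ?d"
    have P: "0 < pp e1 e2 (gu u t) (gu u t)"
    proof -
      have "gu u t \<bullet> e1 \<noteq> 0 \<or> gu u t \<bullet> e2 \<noteq> 0" using curved[of u] by (auto simp: dd_def)
      then show ?thesis by (auto simp: pp_def add_pos_nonneg add_nonneg_pos zero_less_mult_iff linorder_neq_iff)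
    qed
    have Sx: "pp e1 e2 (gu u t) (gu u t) * dd e1 e2 ?d x = S * dd e1 e2 (gu u t) x" for x
      using dd_pp[of e1 e2 "gu u t" ?d x] z by (simp add: S_def)
    consider "0 < S" | "S < 0" | "S = 0" by linarith
    then show False
    proof cases
      case 1
      define h where "h = min (w - u) e / 2"
      have h: "0 < h" "h < w - u" "h < e" using uw e by (auto simp: h_def)
      have "0 \<le> tri e1 e2 t u (u + h) w" using h uw by (intro tri) (auto simp: ordered_def)
      then have "dd e1 e2 ?d (g (u + h) t - g u t) \<le> 0"
        by (simp add: tri_eq_dd dd_anti[of _ _ ?d])
      then have "S * ?B (u + h) \<le> 0"
        using Sx[of "g (u + h) t - g u t"] P by (metis mult_le_0_iff order_less_imp_le)
      then show False using 1 right[OF h(1,3)] by (simp add: mult_le_0_iff)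
    next
      case 2
      define h where "h = min (u + 2 * pi - w) e / 2"
      have h: "0 < h" "h < u + 2 * pi - w" "h < e" using uw e by (auto simp: h_def)
      have "0 \<le> tri e1 e2 t u w (u + 2 * pi - h)" using h uw by (intro tri) (auto simp: ordered_def)
      then have "0 \<le> dd e1 e2 ?d (g (u + 2 * pi - h) t - g u t)" by (simp add: tri_eq_dd)
      then have "0 \<le> S * ?B (u + 2 * pi - h)"
        using Sx[of "g (u + 2 * pi - h) t - g u t"] P by (metis mult_nonneg_nonneg order_less_imp_le)
      then show False using 2 left[OF h(1,3)] by (simp add: zero_le_mult_iff)
    next
      case 3
      then have dx: "dd e1 e2 ?d x = 0" for x using Sx[of x] P by simp
      define h where "h = min (u + 2 * pi - w) e / 2"
      have h: "0 < h" "h < u + 2 * pi - w" "h < e" using uw e by (auto simp: h_def)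
      define w' where "w' = u + 2 * pi - h"
      have w': "w < w'" "w' < u + 2 * pi" using h by (auto simp: w'_def)
      have zero: "dd e1 e2 (g (u + k) t - g u t) (g w' t - g u t) = 0" if k: "0 < k" "k < w - u" for k
      proof -
        let ?x = "g (u + k) t - g u t" and ?y = "g w' t - g u t"
        have "0 \<le> dd e1 e2 ?x ?y"
          using tri[of u "u + k" w'] k w' by (simp add: ordered_def tri_eq_dd)
        moreover have "0 \<le> dd e1 e2 (g w t - g (u + k) t) (g w' t - g (u + k) t)"
          using tri[of "u + k" w w'] k w' by (simp add: ordered_def tri_eq_dd)
        moreover have "dd e1 e2 (g w t - g (u + k) t) (g w' t - g (u + k) t) = dd e1 e2 (?d - ?x) (?y - ?x)" by simp
        moreover have "\<dots> = dd e1 e2 ?d (?y - ?x) - dd e1 e2 ?x ?y + dd e1 e2 ?x ?x"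
          by (simp only: dd_linear)
        ultimately show ?thesis by (simp only: dx dd_self)
      qed
      have "((\<lambda>v. dd e1 e2 (g v t - g u t) (g w' t - g u t)) has_real_derivative ?B w') (at u)"
        by (rule dd_const_u(2)[OF t])
      from DERIV_minus[OF this] have "0 \<le> - ?B w'"
        by (rule right_derivative_ge[where e = "w - u"]) (use uw zero in auto)
      moreover have "0 < ?B w'" using left[OF h(1,3)] by (simp add: w'_def)
      ultimately show False by simp
    qed
  qed
qed

text \<open>The signed distance \<open>\<phi>\<close> from the chord through u1 and u3 starts and
  ends with positive increments into the arc. Were it negative at u2, it would have a positive
  critical point on either side of u2, and each of the two would have to be the strictly higher
  one.\<close>

lemma strict_tangent_imp_tri:
  assumes t: "t \<in> {0..<T}"
    and strict: "\<And>u w. u < w \<Longrightarrow> w < u + 2 * pi \<Longrightarrow> 0 < dd e1 e2 (gu u t) (g w t - g u t)"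
    and ord: "ordered u1 u2 u3"
  shows "0 \<le> tri e1 e2 t u1 u2 u3"
proof (rule ccontr)
  assume neg: "\<not> 0 \<le> tri e1 e2 t u1 u2 u3"
  let ?w = "g u3 t - g u1 t"
  define \<phi> where "\<phi> v = dd e1 e2 (g v t - g u1 t) ?w" for v
  have d\<phi>: "(\<phi> has_real_derivative dd e1 e2 (gu v t) ?w) (at v)" for v
    unfolding \<phi>_def by (rule dd_const_u(2)[OF t])
  have neg2: "\<phi> u2 < 0" using neg by (simp add: \<phi>_def tri_eq_dd)
  have z: "\<phi> u1 = 0" "\<phi> u3 = 0" by (simp_all add: \<phi>_def)
  have per: "g (u1 + 2 * pi) t = g u1 t" by (rule D_per[OF t])
  have ne: "u1 \<noteq> u2" "u2 \<noteq> u3" using neg2 z by auto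
  have "u3 \<noteq> u1 + 2 * pi" using neg2 per by (auto simp: \<phi>_def)
  then have o: "u1 < u2" "u2 < u3" "u3 < u1 + 2 * pi" using ord ne by (auto simp: ordered_def)
  have strict': "0 < dd e1 e2 (gu v t) (g w t - g v t)" if "v \<noteq> w" "\<bar>v - w\<bar> < 2 * pi" for v w
  proof (cases "v < w")
    case True then show ?thesis using strict[of v w] that by auto
  next
    case False
    then show ?thesis using strict[of v "w + 2 * pi"] D_per[OF t, of 0 0 w] that by auto
  qed
  \<comment> \<open>At such a point the tangent is parallel to the chord, so strict convexity puts
    every other point of the arc strictly lower. The identity \<open>pl\<close> is the three-term
    Pluecker relation for planar determinants.\<close>
  have crit: "dd e1 e2 (g v t - g w t) ?w > 0"
    if v: "u1 < v" "v < u3" "dd e1 e2 (gu v t) ?w = 0" "0 < \<phi> v" and w: "w \<noteq> v" "u1 < w" "w < u3" for v w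
  proof -
    let ?X = "g u1 t - g v t" and ?Y = "g w t - g v t"
    have pl: "dd e1 e2 (gu v t) ?w * dd e1 e2 ?X ?Y - dd e1 e2 (gu v t) ?X * dd e1 e2 ?w ?Y
      + dd e1 e2 (gu v t) ?Y * dd e1 e2 ?w ?X = 0"
      by (simp add: dd_def algebra_simps)
    have "dd e1 e2 ?w ?X = \<phi> v"
      by (simp add: \<phi>_def dd_def algebra_simps inner_diff_left)
    then have "dd e1 e2 (gu v t) ?X * dd e1 e2 ?w ?Y = dd e1 e2 (gu v t) ?Y * \<phi> v" using pl v(3) by simp
    moreover have "0 < dd e1 e2 (gu v t) ?X" "0 < dd e1 e2 (gu v t) ?Y"
      using strict'[of v u1] strict'[of v w] v w o by auto
    ultimately have "0 < dd e1 e2 ?w ?Y" using v(4) by (metis mult_pos_pos zero_less_mult_pos)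
    moreover have "dd e1 e2 ?w ?Y = dd e1 e2 (g v t - g w t) ?w"
      by (simp add: dd_def algebra_simps inner_diff_left)
    ultimately show ?thesis by simp
  qed
  have cont: "continuous_on A \<phi>" for A
    using d\<phi> by (meson DERIV_isCont continuous_at_imp_continuous_on)
  have "0 < dd e1 e2 (gu u1 t) ?w" using strict[of u1 u3] o by simp
  then obtain h1 where h1: "0 < h1" "\<And>h. 0 < h \<Longrightarrow> h < h1 \<Longrightarrow> \<phi> u1 < \<phi> (u1 + h)"
    using DERIV_pos_inc_right[OF d\<phi>] by blast
  have "dd e1 e2 (gu u3 t) ?w < 0"
  proof -
    have "0 < dd e1 e2 (gu u3 t) (g u1 t - g u3 t)" using strict[of u3 "u1 + 2 * pi"] per o by simp
    then show ?thesis by (simp add: dd_linear)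
  qed
  then obtain h2 where h2: "0 < h2" "\<And>h. 0 < h \<Longrightarrow> h < h2 \<Longrightarrow> \<phi> u3 < \<phi> (u3 - h)"
    using DERIV_neg_dec_left[OF d\<phi>] by blast
  have ex: "\<exists>v. x < v \<and> v < y \<and> dd e1 e2 (gu v t) ?w = 0 \<and> 0 < \<phi> v"
    if xy: "x < y" "\<phi> x \<le> 0" "\<phi> y \<le> 0" "p \<in> {x..y}" "0 < \<phi> p" for x y p
  proof -
    obtain v where v: "v \<in> {x..y}" "\<And>w. w \<in> {x..y} \<Longrightarrow> \<phi> w \<le> \<phi> v"
      using continuous_attains_sup[of "{x..y}" \<phi>] cont xy(4) by auto
    have pos: "0 < \<phi> v" using v(2)[OF xy(4)] xy(5) by simp
    then have i: "x < v" "v < y" using v(1) xy by (auto simp: less_le)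
    have "dd e1 e2 (gu v t) ?w = 0"
      by (rule DERIV_local_max[OF d\<phi>, of "min (v - x) (y - v)"]) (use i v in \<open>auto simp: abs_less_iff\<close>)
    then show ?thesis using i pos by blast
  qed
  have "\<exists>p. p \<in> {u1..u2} \<and> 0 < \<phi> p"
  proof -
    define h where "h = min h1 (u2 - u1) / 2"
    have "0 < h" "h < h1" "h < u2 - u1" using h1(1) o by (auto simp: h_def)
    then show ?thesis using h1(2)[of h] z by (intro exI[of _ "u1 + h"]) auto
  qed
  then obtain v1 where v1: "u1 < v1" "v1 < u2" "dd e1 e2 (gu v1 t) ?w = 0" "0 < \<phi> v1"
    using ex[of u1 u2] o z neg2 by auto
  have "\<exists>p. p \<in> {u2..u3} \<and> 0 < \<phi> p"
  proof -
    define h where "h = min h2 (u3 - u2) / 2"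
    have "0 < h" "h < h2" "h < u3 - u2" using h2(1) o by (auto simp: h_def)
    then show ?thesis using h2(2)[of h] z by (intro exI[of _ "u3 - h"]) auto
  qed
  then obtain v2 where v2: "u2 < v2" "v2 < u3" "dd e1 e2 (gu v2 t) ?w = 0" "0 < \<phi> v2"
    using ex[of u2 u3] o z neg2 by auto
  have "0 < dd e1 e2 (g v1 t - g v2 t) ?w" "0 < dd e1 e2 (g v2 t - g v1 t) ?w"
    using crit[of v1 v2] crit[of v2 v1] v1 v2 o by auto
  then show False by (simp add: dd_linear)
qed

lemma taylor_bound:
  assumes t: "t \<in> {0..<T}" and S: "\<And>u. norm (guu u t) \<le> S"
  shows "norm (g (u + r) t - g u t - r *\<^sub>R gu u t) \<le> S * r\<^sup>2"
proof -
  have S0: "0 \<le> S" using S[of 0] norm_ge_zero order_trans by blast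
  have lip: "norm (f y - f x) \<le> B * \<bar>y - x\<bar>"
    if d: "\<And>z. (f has_vector_derivative f' z) (at z)" and B: "\<And>z. \<bar>z - x\<bar> \<le> \<bar>y - x\<bar> \<Longrightarrow> norm (f' z) \<le> B"
    for f f' :: "real \<Rightarrow> 'a" and x y B
  proof -
    have B0: "0 \<le> B" using order_trans[OF norm_ge_zero B[of x]] by simp
    have "norm (f y - f x) \<le> B * norm (y - x)"
    proof (rule differentiable_bound[of "{z. \<bar>z - x\<bar> \<le> \<bar>y - x\<bar>}" f "\<lambda>z h. h *\<^sub>R f' z"])
      have "{z. \<bar>z - x\<bar> \<le> \<bar>y - x\<bar>} = cball x \<bar>y - x\<bar>" by (auto simp: dist_real_def)
      then show "convex {z. \<bar>z - x\<bar> \<le> \<bar>y - x\<bar>}" by simp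
      show "(f has_derivative (\<lambda>h. h *\<^sub>R f' z)) (at z within {z. \<bar>z - x\<bar> \<le> \<bar>y - x\<bar>})" for z
        using d[of z] by (simp add: has_vector_derivative_def has_derivative_at_withinI)
      show "onorm (\<lambda>h. h *\<^sub>R f' z) \<le> B" if "z \<in> {z. \<bar>z - x\<bar> \<le> \<bar>y - x\<bar>}" for z
      proof (rule onorm_bound[OF B0])
        have "\<bar>h\<bar> * norm (f' z) \<le> \<bar>h\<bar> * B" for h using B[of z] that by (intro mult_left_mono) auto
        then show "norm (h *\<^sub>R f' z) \<le> B * norm h" for h by (simp add: mult.commute)
      qed
    qed auto
    then show ?thesis by simp
  qed
  have "norm ((g (u + r) t - (u + r) *\<^sub>R gu u t) - (g u t - u *\<^sub>R gu u t)) \<le> S * \<bar>r\<bar> * \<bar>(u + r) - u\<bar>"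
  proof (rule lip)
    show "((\<lambda>w. g w t - w *\<^sub>R gu u t) has_vector_derivative gu z t - gu u t) (at z)" for z
      using D_u[OF t, of 0 0 z] by (auto intro!: derivative_eq_intros)
    show "norm (gu z t - gu u t) \<le> S * \<bar>r\<bar>" if "\<bar>z - u\<bar> \<le> \<bar>u + r - u\<bar>" for z
    proof -
      have "norm (gu z t - gu u t) \<le> S * \<bar>z - u\<bar>"
        by (rule lip[OF D_u[OF t]]) (rule S)
      also have "\<dots> \<le> S * \<bar>r\<bar>" using that S0 by (intro mult_left_mono) auto
      finally show ?thesis .
    qed
  qed
  then show ?thesis by (simp add: algebra_simps power2_eq_square flip: abs_mult)
qed

lemma dd_abs_le: "\<bar>dd e1 e2 v w\<bar> \<le> 2 * (norm e1 * norm e2) * (norm v * norm w)"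
proof -
  have "\<bar>(v \<bullet> e1) * (w \<bullet> e2)\<bar> \<le> (norm v * norm e1) * (norm w * norm e2)"
    "\<bar>(v \<bullet> e2) * (w \<bullet> e1)\<bar> \<le> (norm v * norm e2) * (norm w * norm e1)"
    unfolding abs_mult by (intro mult_mono Cauchy_Schwarz_ineq2; simp)+
  then show ?thesis unfolding dd_def by (simp add: algebra_simps)
qed

text \<open>The tangent determinant is at least of order r^2 in the parameter distance r, and the
  tilt perturbs it only by order r^2, because its linear part is the area of the tangent with
  itself. A large M therefore wins, uniformly in the direction p, q and the perturbation
  \<open>\<zeta>\<close>.\<close>

lemma tilt_positive:
  assumes t: "t \<in> {0..<T}" and tri: "\<And>u1 u2 u3. ordered u1 u2 u3 \<Longrightarrow> 0 \<le> tri e1 e2 t u1 u2 u3"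
    and curved: "\<And>u. 0 < dd e1 e2 (gu u t) (guu u t)"
    and unit: "norm e1 = 1" "norm e2 = 1"
  obtains M where "0 < M" "\<And>p q \<zeta> u1 u2 u3. p\<^sup>2 + q\<^sup>2 = 1 \<Longrightarrow> norm \<zeta> \<le> 1 \<Longrightarrow> ordered u1 u2 u3 \<Longrightarrow>
    0 \<le> tri (p *\<^sub>R e1 + q *\<^sub>R e2) (M *\<^sub>R (p *\<^sub>R e2 - q *\<^sub>R e1) + \<zeta>) t u1 u2 u3"
proof -
  have per_all: "P u" if P: "\<And>u. u \<in> {0..2*pi} \<Longrightarrow> P u" and inv: "\<And>u m::int. P (u + 2 * pi * of_int m) \<Longrightarrow> P u" for P u
  proof -
    obtain m :: int where "0 \<le> u + 2 * pi * of_int m" "u + 2 * pi * of_int m < 0 + 2 * pi"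
      using period_representative .
    then show ?thesis using P[of "u + 2 * pi * of_int m"] inv[of u m] by auto
  qed
  have cD: "continuous_on {0..2*pi} (\<lambda>u. norm (D k l u t))" for k l using t by (intro continuous_intros) auto
  obtain S where S: "0 < S" "\<And>u. u \<in> {0..2*pi} \<Longrightarrow> \<bar>norm (guu u t)\<bar> \<le> S"
    using compact_upper_bound[OF compact_Icc cD] by blast
  obtain G where G: "0 < G" "\<And>u. u \<in> {0..2*pi} \<Longrightarrow> \<bar>norm (gu u t)\<bar> \<le> G"
    using compact_upper_bound[OF compact_Icc cD] by blast
  have S': "norm (guu u t) \<le> S" and G': "norm (gu u t) \<le> G" for u
    by (rule per_all[where P = "\<lambda>u. norm (guu u t) \<le> S"], use S D_per_int[OF t] in auto)
      (rule per_all[where P = "\<lambda>u. norm (gu u t) \<le> G"], use G D_per_int[OF t] in auto)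
  let ?B = "\<lambda>u r. dd e1 e2 (gu u t) (g (u + r) t - g u t)"
  \<comment> \<open>Near the diagonal this is Taylor's formula with second derivative at least m /
    2; away from it, strictness of the tangent inequality and compactness.\<close>
  obtain \<kappa> where \<kappa>: "0 < \<kappa>" "\<And>u r. \<bar>r\<bar> \<le> pi \<Longrightarrow> \<kappa> * r\<^sup>2 \<le> ?B u r"
  proof -
    let ?K = "{0..2*pi} \<times> {-pi..pi}"
    have cK: "compact ?K" by (intro compact_Times compact_Icc)
    have cq: "continuous_on ?K (\<lambda>z. dd e1 e2 (gu (fst z) t) (guu (fst z + snd z) t))"
      unfolding dd_def using t by (intro continuous_intros) auto
    have c0: "continuous_on {0..2*pi} (\<lambda>u. dd e1 e2 (gu u t) (guu u t))"
      unfolding dd_def using t by (intro continuous_intros) auto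
    obtain m where m: "0 < m" "\<And>u. u \<in> {0..2*pi} \<Longrightarrow> m \<le> dd e1 e2 (gu u t) (guu u t)"
      using compact_lower_bound[OF compact_Icc c0 curved] by blast
    have "uniformly_continuous_on ?K (\<lambda>z. dd e1 e2 (gu (fst z) t) (guu (fst z + snd z) t))"
      by (rule compact_uniformly_continuous[OF cq cK])
    then obtain d where d: "0 < d" "\<And>x y. x \<in> ?K \<Longrightarrow> y \<in> ?K \<Longrightarrow> dist y x < d \<Longrightarrow>
        dist (dd e1 e2 (gu (fst y) t) (guu (fst y + snd y) t)) (dd e1 e2 (gu (fst x) t) (guu (fst x + snd x) t)) < m / 2"
      unfolding uniformly_continuous_on_def using m(1) by (metis half_gt_zero)
    define \<eta> where "\<eta> = min (d / 2) pi"
    have \<eta>: "0 < \<eta>" "\<eta> < d" "\<eta> \<le> pi" using d(1) by (auto simp: \<eta>_def)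
    have near0: "m / 2 \<le> dd e1 e2 (gu u t) (guu (u + r) t)" if "u \<in> {0..2*pi}" "\<bar>r\<bar> \<le> \<eta>" for u r
    proof -
      have "dist (dd e1 e2 (gu u t) (guu (u + r) t)) (dd e1 e2 (gu u t) (guu (u + 0) t)) < m / 2"
      proof -
        have "- pi \<le> r" "r \<le> pi" using that(2) \<eta>(3) by linarith+
        then show ?thesis using d(2)[of "(u, 0)" "(u, r)"] that \<eta> by (auto simp: dist_Pair_Pair)
      qed
      then show ?thesis using m(2)[OF that(1)] unfolding dist_real_def add_0_right by linarith
    qed
    have near: "m / 4 * r\<^sup>2 \<le> ?B u r" if u: "u \<in> {0..2*pi}" and r: "\<bar>r\<bar> \<le> \<eta>" for u r
    proof (cases "r = 0")
      case False
      let ?f = "\<lambda>x. dd e1 e2 (gu u t) (g x t - g u t)"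
      let ?diff = "\<lambda>n::nat. if n = 0 then ?f else if n = 1 then (\<lambda>x. dd e1 e2 (gu u t) (gu x t)) else (\<lambda>x. dd e1 e2 (gu u t) (guu x t))"
      have "\<forall>k x. k < 2 \<and> u - \<eta> \<le> x \<and> x \<le> u + \<eta> \<longrightarrow> DERIV (?diff k) x :> ?diff (Suc k) x"
        using dd_const_u(1)[OF t, of e1 e2 "gu u t" 0 0 "g u t"] dd_const_u(1)[OF t, of e1 e2 "gu u t" "Suc 0" 0 0]
        by (auto simp: less_2_cases_iff)
      moreover have "u - \<eta> \<le> u + r" "u + r \<le> u + \<eta>" using r by linarith+
      ultimately obtain x where x: "if u + r < u then u + r < x \<and> x < u else u < x \<and> x < u + r"
        "?f (u + r) = (\<Sum>k<2. ?diff k u / fact k * (u + r - u) ^ k) + ?diff 2 x / fact 2 * (u + r - u)\<^sup>2"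
        using Taylor[of 2 ?diff ?f "u - \<eta>" "u + \<eta>" u "u + r"] False r \<eta> by auto
      have "?B u r = dd e1 e2 (gu u t) (guu (u + (x - u)) t) / 2 * r\<^sup>2"
        using x(2) by (simp add: numeral_2_eq_2)
      moreover have "m / 2 \<le> dd e1 e2 (gu u t) (guu (u + (x - u)) t)"
        using x(1) r by (intro near0 u) (auto split: if_splits)
      then have "m / 4 * r\<^sup>2 \<le> dd e1 e2 (gu u t) (guu (u + (x - u)) t) / 2 * r\<^sup>2"
        by (intro mult_right_mono) auto
      ultimately show ?thesis by simp
    qed simp
    let ?F = "{0..2*pi} \<times> ({-pi..-\<eta>} \<union> {\<eta>..pi})"
    have cF: "compact ?F" by (intro compact_Times compact_Un compact_Icc)
    have cB: "continuous_on ?F (\<lambda>z. ?B (fst z) (snd z))"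
      unfolding dd_def using t by (intro continuous_intros) auto
    have strict: "0 < ?B u r" if "\<eta> \<le> \<bar>r\<bar>" "\<bar>r\<bar> \<le> pi" for u r
    proof (cases "0 < r")
      case True
      then show ?thesis using strict_tangent[OF t tri curved, of u "u + r"] that pi_gt_zero by auto
    next
      case False
      then have "u < (u + r) + 2 * pi" "(u + r) + 2 * pi < u + 2 * pi" using that \<eta> pi_gt_zero by (auto simp: abs_if split: if_splits)
      from strict_tangent[OF t tri curved this] show ?thesis using D_per[OF t, of 0 0 "u + r"] by simp
    qed
    have "0 < ?B (fst z) (snd z)" if "z \<in> ?F" for z
      using that \<eta> by (intro strict) auto
    from compact_lower_bound[OF cF cB this] obtain k where k: "0 < k" "\<And>z. z \<in> ?F \<Longrightarrow> k \<le> ?B (fst z) (snd z)" by blast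
    define \<kappa> where "\<kappa> = min (m / 4) (k / pi\<^sup>2)"
    have k0: "0 < \<kappa>" using m k by (simp add: \<kappa>_def)
    have kle: "\<kappa> \<le> m / 4" "\<kappa> \<le> k / pi\<^sup>2" unfolding \<kappa>_def by (rule min.cobounded1, rule min.cobounded2)
    have base: "\<kappa> * r\<^sup>2 \<le> ?B u r" if "u \<in> {0..2*pi}" "\<bar>r\<bar> \<le> pi" for u r
    proof (cases "\<bar>r\<bar> \<le> \<eta>")
      case True
      have "\<kappa> * r\<^sup>2 \<le> m / 4 * r\<^sup>2" by (intro mult_right_mono kle) auto
      then show ?thesis using near[OF that(1) True] by linarith
    next
      case False
      have "\<kappa> * r\<^sup>2 \<le> k / pi\<^sup>2 * pi\<^sup>2"
        using that(2) k(1) by (intro mult_mono kle) (auto simp: abs_le_square_iff[symmetric])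
      also have "\<dots> = k" by simp
      also have "k \<le> ?B u r" using k(2)[of "(u, r)"] that False by (auto simp: abs_if split: if_splits)
      finally show ?thesis .
    qed
    have "\<kappa> * r\<^sup>2 \<le> ?B u r" if "\<bar>r\<bar> \<le> pi" for u r
    proof (rule per_all[where P = "\<lambda>u. \<kappa> * r\<^sup>2 \<le> ?B u r"])
      show "\<kappa> * r\<^sup>2 \<le> ?B u r" if "u \<in> {0..2*pi}" for u using base[OF that \<open>\<bar>r\<bar> \<le> pi\<close>] .
      show "\<kappa> * r\<^sup>2 \<le> ?B u r" if "\<kappa> * r\<^sup>2 \<le> ?B (u + 2 * pi * of_int m) r" for u m
      proof -
        have "u + 2 * pi * of_int m + r = u + r + 2 * pi * of_int m" by simp
        then have "g (u + 2 * pi * of_int m + r) t = g (u + r) t" using D_per_int[OF t] by metis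
        then show ?thesis using that D_per_int[OF t] by simp
      qed
    qed
    then show ?thesis using that[OF k0] by blast
  qed
  \<comment> \<open>The perturbation is at most 2 * 2 * G * S * r^2 by the crude determinant bound;
    one further r^2 keeps the inequality strict.\<close>
  define M where "M = (4 * G * S + 1) / \<kappa>"
  have M: "0 < M" "M * \<kappa> = 4 * G * S + 1" using G S \<kappa> by (auto simp: M_def add_pos_pos)
  show ?thesis
  proof (rule that[OF M(1)])
    fix p q \<zeta> u1 u2 u3
    assume pq: "p\<^sup>2 + q\<^sup>2 = (1::real)" and \<zeta>: "norm (\<zeta>::'a) \<le> 1" and ord: "ordered u1 u2 u3"
    let ?e = "p *\<^sub>R e1 + q *\<^sub>R e2"
    have dd_eq: "dd ?e (M *\<^sub>R (p *\<^sub>R e2 - q *\<^sub>R e1) + \<zeta>) v w = M * dd e1 e2 v w + dd ?e \<zeta> v w" for v w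
    proof -
      have "dd ?e (M *\<^sub>R (p *\<^sub>R e2 - q *\<^sub>R e1) + \<zeta>) v w = M * ((p\<^sup>2 + q\<^sup>2) * dd e1 e2 v w) + dd ?e \<zeta> v w"
        by (simp add: dd_def inner_add_right inner_diff_right algebra_simps power2_eq_square)
      then show ?thesis by (simp add: pq)
    qed
    have "p\<^sup>2 \<le> 1" "q\<^sup>2 \<le> 1" using pq zero_le_power2[of p] zero_le_power2[of q] by linarith+
    then have "\<bar>p\<bar> \<le> 1" "\<bar>q\<bar> \<le> 1" by (simp_all add: abs_square_le_1)
    then have ne: "norm ?e \<le> 2" using norm_triangle_ineq[of "p *\<^sub>R e1" "q *\<^sub>R e2"] unit by simp
    have pos: "0 < dd ?e (M *\<^sub>R (p *\<^sub>R e2 - q *\<^sub>R e1) + \<zeta>) (gu u t) (g (u + r) t - g u t)"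
      if r: "\<bar>r\<bar> \<le> pi" "r \<noteq> 0" for u r
    proof -
      let ?R = "g (u + r) t - g u t - r *\<^sub>R gu u t"
      have "dd ?e \<zeta> (gu u t) (g (u + r) t - g u t) = dd ?e \<zeta> (gu u t) ?R"
        by (simp add: dd_linear)
      moreover have "\<bar>dd ?e \<zeta> (gu u t) ?R\<bar> \<le> 2 * (norm ?e * norm \<zeta>) * (norm (gu u t) * norm ?R)" by (rule dd_abs_le)
      also have "\<dots> \<le> 2 * (2 * 1) * (G * (S * r\<^sup>2))"
        by (intro mult_mono ne \<zeta> G' taylor_bound[OF t S'] order_refl mult_nonneg_nonneg norm_ge_zero)
          (use G(1) in auto)
      ultimately have "- (4 * G * S * r\<^sup>2) \<le> dd ?e \<zeta> (gu u t) (g (u + r) t - g u t)" by (simp add: algebra_simps)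
      moreover have "M * (\<kappa> * r\<^sup>2) \<le> M * ?B u r" using \<kappa>(2)[OF r(1)] M(1) by (intro mult_left_mono) auto
      moreover have "M * (\<kappa> * r\<^sup>2) = (4 * G * S + 1) * r\<^sup>2" by (simp only: M(2) mult.assoc[symmetric])
      moreover have "(4 * G * S + 1) * r\<^sup>2 = 4 * G * S * r\<^sup>2 + r\<^sup>2" by (simp add: algebra_simps)
      moreover have "0 < r\<^sup>2" using r by simp
      ultimately show ?thesis unfolding dd_eq by linarith
    qed
    show "0 \<le> tri ?e (M *\<^sub>R (p *\<^sub>R e2 - q *\<^sub>R e1) + \<zeta>) t u1 u2 u3"
    proof (rule strict_tangent_imp_tri[OF t _ ord])
      fix u w :: real assume uw: "u < w" "w < u + 2 * pi"
      show "0 < dd ?e (M *\<^sub>R (p *\<^sub>R e2 - q *\<^sub>R e1) + \<zeta>) (gu u t) (g w t - g u t)"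
      proof (cases "w - u \<le> pi")
        case True
        then show ?thesis using pos[of "w - u" u] uw by simp
      next
        case False
        have "g (u + (w - 2 * pi - u)) t = g w t" using D_per[OF t, of 0 0 "w - 2 * pi"] by simp
        then show ?thesis using pos[of "w - 2 * pi - u" u] uw False by simp
      qed
    qed
  qed
qed

text \<open>For a plane direction orthogonal to the tangent, the tilted tangent inequality has the
  sign of the second pairing alone. Using both \<open>\<zeta>\<close> and \<open>- \<zeta>\<close>
  bounds the vertical part of the tangent by M times its planar part.\<close>

lemma slope_bound:
  assumes t: "t \<in> {0..<T}" and orth: "norm e1 = 1" "norm e2 = 1" "e1 \<bullet> e2 = 0"
    and tilt: "\<And>p q \<zeta> u1 u2 u3. p\<^sup>2 + q\<^sup>2 = 1 \<Longrightarrow> norm \<zeta> \<le> 1 \<Longrightarrow> ordered u1 u2 u3 \<Longrightarrow>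
      0 \<le> tri (p *\<^sub>R e1 + q *\<^sub>R e2) (M *\<^sub>R (p *\<^sub>R e2 - q *\<^sub>R e1) + \<zeta>) t u1 u2 u3"
    and nondeg: "tri e1 e2 t v1 v2 v3 \<noteq> 0"
  shows "(norm (gu u t))\<^sup>2 \<le> (1 + M\<^sup>2) * pp e1 e2 (gu u t) (gu u t)"
proof -
  let ?x = "gu u t \<bullet> e1" and ?y = "gu u t \<bullet> e2"
  obtain p q where pq: "p\<^sup>2 + q\<^sup>2 = 1" "gu u t \<bullet> (p *\<^sub>R e1 + q *\<^sub>R e2) = 0"
  proof (cases "?x = 0 \<and> ?y = 0")
    case True
    then show ?thesis using that[of 1 0] by simp
  next
    case False
    then have n: "0 < ?x\<^sup>2 + ?y\<^sup>2" by (simp add: sum_power2_gt_zero_iff)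
    define n where "n = sqrt (?x\<^sup>2 + ?y\<^sup>2)"
    have n2: "n\<^sup>2 = ?x\<^sup>2 + ?y\<^sup>2" "n \<noteq> 0" using n by (auto simp: n_def)
    have "(- ?y / n)\<^sup>2 + (?x / n)\<^sup>2 = 1"
    proof -
      have "(- ?y / n)\<^sup>2 + (?x / n)\<^sup>2 = (?x\<^sup>2 + ?y\<^sup>2) / n\<^sup>2"
        by (simp add: power_divide add_divide_distrib)
      also have "\<dots> = n\<^sup>2 / n\<^sup>2" by (simp only: n2(1))
      finally show ?thesis using n2(2) by simp
    qed
    then show ?thesis using that[of "- ?y / n" "?x / n"] by (simp add: inner_add_right inner_diff_right)
  qed
  let ?e = "p *\<^sub>R e1 + q *\<^sub>R e2" and ?e' = "p *\<^sub>R e2 - q *\<^sub>R e1"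
  have dd_rot: "dd ?e ?e' v w = dd e1 e2 v w" for v w
  proof -
    have "dd ?e ?e' v w = (p\<^sup>2 + q\<^sup>2) * dd e1 e2 v w"
      by (simp add: dd_def inner_add_right inner_diff_right algebra_simps power2_eq_square)
    then show ?thesis by (simp add: pq)
  qed
  obtain w where w: "(g w t - g u t) \<bullet> ?e \<noteq> 0"
  proof (rule ccontr)
    assume "\<not> thesis"
    then have "(g w t - g u t) \<bullet> ?e = 0" for w using that by blast
    then have const: "g w t \<bullet> ?e = g u t \<bullet> ?e" for w by (simp only: inner_diff_left right_minus_eq)
    have "(g w t - g w' t) \<bullet> ?e = 0" for w w' unfolding inner_diff_left const[of w] const[of w'] by simp
    then have "tri e1 e2 t v1 v2 v3 = 0"
      unfolding tri_eq_dd dd_rot[symmetric] by (simp add: dd_def)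
    then show False using nondeg by simp
  qed
  let ?d = "g w t - g u t"
  have "0 \<le> dd ?e (M *\<^sub>R ?e' + \<zeta>) (gu u t) ?d" if "norm \<zeta> \<le> 1" for \<zeta>
    using tilt[OF pq(1) that] by (rule tangent_nonneg[OF t])
  then have key: "(gu u t \<bullet> \<zeta>) * (?d \<bullet> ?e) \<le> - M * (gu u t \<bullet> ?e') * (?d \<bullet> ?e)" if "norm \<zeta> \<le> 1" for \<zeta>
  proof -
    have "dd ?e (M *\<^sub>R ?e' + \<zeta>) (gu u t) ?d = - (gu u t \<bullet> (M *\<^sub>R ?e' + \<zeta>)) * (?d \<bullet> ?e)"
      using pq(2) by (simp add: dd_def)
    also have "gu u t \<bullet> (M *\<^sub>R ?e' + \<zeta>) = M * (gu u t \<bullet> ?e') + gu u t \<bullet> \<zeta>"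
      by (simp add: inner_add_right)
    finally show ?thesis using \<open>norm \<zeta> \<le> 1 \<Longrightarrow> 0 \<le> dd ?e (M *\<^sub>R ?e' + \<zeta>) (gu u t) ?d\<close> that
      by (simp add: algebra_simps)
  qed
  have abs: "\<bar>gu u t \<bullet> \<zeta>\<bar> \<le> \<bar>M * (gu u t \<bullet> ?e')\<bar>" if "norm \<zeta> \<le> 1" for \<zeta>
  proof -
    have "\<bar>gu u t \<bullet> \<zeta>\<bar> * \<bar>?d \<bullet> ?e\<bar> = \<bar>(gu u t \<bullet> \<zeta>) * (?d \<bullet> ?e)\<bar>" by (simp add: abs_mult)
    also have "\<dots> \<le> \<bar>M * (gu u t \<bullet> ?e') * (?d \<bullet> ?e)\<bar>"
      using key[OF that] key[of "- \<zeta>"] that by simp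
    finally show ?thesis using w by (simp add: abs_mult)
  qed
  define P where "P = ?x *\<^sub>R e1 + ?y *\<^sub>R e2"
  define z where "z = gu u t - P"
  have inner12: "e1 \<bullet> e1 = 1" "e2 \<bullet> e2 = 1" "e2 \<bullet> e1 = 0"
    using orth by (simp_all add: dot_square_norm inner_commute)
  have zP: "z \<bullet> P = 0" "P \<bullet> P = ?x\<^sup>2 + ?y\<^sup>2"
    using inner12 orth(3) by (simp_all add: z_def P_def inner_add_left inner_add_right inner_diff_left power2_eq_square)
  have "(norm (gu u t))\<^sup>2 = z \<bullet> z + P \<bullet> P"
  proof -
    have "gu u t = z + P" by (simp add: z_def)
    then show ?thesis using zP(1) by (simp add: power2_norm_eq_inner inner_add_left inner_add_right inner_commute)
  qed
  moreover have "z \<bullet> z \<le> M\<^sup>2 * pp e1 e2 (gu u t) (gu u t)"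
  proof -
    \<comment> \<open>The unit vector of the component of the tangent orthogonal to the plane; if
      that component is zero, so is \<open>\<zeta>\<close>.\<close>
    define \<zeta> where "\<zeta> = (1 / norm z) *\<^sub>R z"
    have "norm \<zeta> \<le> 1" by (simp add: \<zeta>_def)
    have "gu u t \<bullet> \<zeta> = norm z"
    proof -
      have "gu u t \<bullet> z = z \<bullet> z" using zP(1) by (metis z_def diff_add_cancel inner_add_left inner_commute add.right_neutral)
      then show ?thesis by (simp add: \<zeta>_def dot_square_norm power2_eq_square)
    qed
    then have "norm z \<le> \<bar>M * (gu u t \<bullet> ?e')\<bar>" using abs[OF \<open>norm \<zeta> \<le> 1\<close>] by simp
    then have "(norm z)\<^sup>2 \<le> (M * (gu u t \<bullet> ?e'))\<^sup>2" by (metis abs_le_square_iff abs_norm_cancel)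
    also have "\<dots> = M\<^sup>2 * (gu u t \<bullet> ?e')\<^sup>2" by (simp add: power_mult_distrib)
    also have "(gu u t \<bullet> ?e')\<^sup>2 = (gu u t \<bullet> ?e')\<^sup>2 + (gu u t \<bullet> ?e)\<^sup>2" using pq(2) by simp
    also have "\<dots> = (p\<^sup>2 + q\<^sup>2) * pp e1 e2 (gu u t) (gu u t)"
      by (simp add: pp_def inner_add_right inner_diff_right algebra_simps power2_eq_square)
    finally show ?thesis by (simp add: pq dot_square_norm)
  qed
  ultimately show ?thesis by (simp add: zP pp_def algebra_simps power2_eq_square)
qed

text \<open>If all triangles are flat, then at the point farthest from \<open>g 0\<close> the
  projected tangent is both orthogonal and parallel to the connecting vector, hence zero.\<close>

lemma degenerate_critical:
  assumes t: "t \<in> {0..<T}" and deg: "\<And>u1 u2 u3. tri e1 e2 t u1 u2 u3 = 0"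
  shows "\<exists>u. pp e1 e2 (gu u t) (gu u t) = 0"
proof (rule ccontr)
  assume "\<not> ?thesis"
  then have P: "pp e1 e2 (gu u t) (gu u t) \<noteq> 0" for u by blast
  let ?f = "\<lambda>w. pp e1 e2 (g w t - g 0 t) (g w t - g 0 t)"
  have "continuous_on {0..2*pi} ?f" unfolding pp_def using t by (intro continuous_intros) auto
  then obtain w where "w \<in> {0..2*pi}" and w: "\<And>v. v \<in> {0..2*pi} \<Longrightarrow> ?f v \<le> ?f w"
    using continuous_attains_sup[of "{0..2*pi}" ?f] by force
  have max: "?f v \<le> ?f w" for v
  proof -
    obtain v' where "0 \<le> v'" "v' < 0 + 2 * pi" "g v t = g v' t" using representative[of 0 v] t by metis
    then show ?thesis using w[of v'] by simp
  qed
  have "(?f has_real_derivative 2 * pp e1 e2 (gu w t) (g w t - g 0 t)) (at w)"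
    unfolding pp_def inner_diff_left
    by (rule derivative_eq_intros inner_u t refl)+ (simp add: algebra_simps)
  then have 1: "pp e1 e2 (gu w t) (g w t - g 0 t) = 0"
    using DERIV_local_max[of ?f "2 * pp e1 e2 (gu w t) (g w t - g 0 t)" w 1] max by simp
  have "((\<lambda>v. dd e1 e2 (g v t - g w t) (g 0 t - g w t)) has_real_derivative dd e1 e2 (gu w t) (g 0 t - g w t)) (at w)"
    by (rule dd_const_u(2)[OF t])
  moreover have "(\<lambda>v. dd e1 e2 (g v t - g w t) (g 0 t - g w t)) = (\<lambda>v. 0)"
    using deg[of w _ 0] by (simp add: tri_eq_dd)
  ultimately have "((\<lambda>v. 0) has_real_derivative dd e1 e2 (gu w t) (g 0 t - g w t)) (at w)" by simp
  then have "dd e1 e2 (gu w t) (g 0 t - g w t) = 0" using DERIV_unique DERIV_const by blast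
  then have 2: "dd e1 e2 (gu w t) (g w t - g 0 t) = 0" by (simp add: dd_linear)
  let ?d = "g w t - g 0 t"
  have "pp e1 e2 (gu w t) (gu w t) * ?f w = (pp e1 e2 (gu w t) ?d)\<^sup>2 + (dd e1 e2 (gu w t) ?d)\<^sup>2"
    by (simp add: pp_def dd_def algebra_simps power2_eq_square)
  then have "?f w = 0" using 1 2 P[of w] by simp
  then have "?f v \<le> 0" for v using max[of v] by simp
  then have z: "(g v t - g 0 t) \<bullet> e1 = 0 \<and> (g v t - g 0 t) \<bullet> e2 = 0" for v
    by (simp add: pp_def sum_squares_le_zero_iff)
  have "gu 0 t \<bullet> e = 0" if "\<And>v. (g v t - g 0 t) \<bullet> e = 0" for e
  proof -
    have "g v t \<bullet> e = g 0 t \<bullet> e" for v using that[of v] by (simp only: inner_diff_left right_minus_eq)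
    then have eq: "(\<lambda>v. g v t \<bullet> e) = (\<lambda>v. g 0 t \<bullet> e)" by (rule ext)
    have "((\<lambda>v. g 0 t \<bullet> e) has_real_derivative gu 0 t \<bullet> e) (at 0)"
      using inner_u[OF t, where k = 0 and l = 0 and u = 0 and e = e] unfolding eq .
    then show ?thesis using DERIV_unique DERIV_const by blast
  qed
  then have "gu 0 t \<bullet> e1 = 0" "gu 0 t \<bullet> e2 = 0" using z by blast+
  then show False using P[of 0] by (simp add: pp_def)
qed

text \<open>The slope bound needs a triangle of nonzero area. At a first degenerate time the bound
  would persist by continuity in time, whereas a flat projection has a point with vanishing
  projected tangent.\<close>

lemma immersed_preserved:
  assumes s: "s \<in> {0..<T}" and orth: "norm e1 = 1" "norm e2 = 1" "e1 \<bullet> e2 = 0"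
    and tilt: "\<And>p q \<zeta> u1 u2 u3. p\<^sup>2 + q\<^sup>2 = 1 \<Longrightarrow> norm \<zeta> \<le> 1 \<Longrightarrow> ordered u1 u2 u3 \<Longrightarrow>
      0 \<le> tri (p *\<^sub>R e1 + q *\<^sub>R e2) (M *\<^sub>R (p *\<^sub>R e2 - q *\<^sub>R e1) + \<zeta>) s u1 u2 u3"
    and imm: "\<And>u. pp e1 e2 (gu u s) (gu u s) \<noteq> 0"
    and t: "t \<in> {s..<T}"
  shows "(norm (gu u t))\<^sup>2 \<le> (1 + M\<^sup>2) * pp e1 e2 (gu u t) (gu u t)"
proof -
  have tilt': "0 \<le> tri (p *\<^sub>R e1 + q *\<^sub>R e2) (M *\<^sub>R (p *\<^sub>R e2 - q *\<^sub>R e1) + \<zeta>) r u1 u2 u3"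
    if "r \<in> {s..<T}" "p\<^sup>2 + q\<^sup>2 = 1" "norm \<zeta> \<le> 1" "ordered u1 u2 u3" for r p q \<zeta> u1 u2 u3
    using that s by (intro tri_preserved[of s r] tilt) auto
  have bound: "(norm (gu u r))\<^sup>2 \<le> (1 + M\<^sup>2) * pp e1 e2 (gu u r) (gu u r)"
    if "r \<in> {s..<T}" "tri e1 e2 r v1 v2 v3 \<noteq> 0" for r u v1 v2 v3
    using that s by (intro slope_bound[OF _ orth tilt']) auto
  have "\<exists>v1 v2 v3. tri e1 e2 t v1 v2 v3 \<noteq> 0"
  proof (rule ccontr)
    assume deg: "\<not> ?thesis"
    define N where "N = {r \<in> {s..t}. \<forall>v1 v2 v3. tri e1 e2 r v1 v2 v3 = 0}"
    have "N = {s..t} \<inter> (\<Inter>v1. \<Inter>v2. \<Inter>v3. {r \<in> {s..t}. tri e1 e2 r v1 v2 v3 = 0})" by (auto simp: N_def)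
    moreover have "closed {r \<in> {s..t}. tri e1 e2 r v1 v2 v3 = 0}" for v1 v2 v3
      unfolding tri_def using s t
      by (intro continuous_closed_preimage_constant continuous_intros closed_atLeastAtMost) auto
    ultimately have "closed N" by (simp add: closed_INT closed_Int)
    have "t \<in> N" using deg t by (auto simp: N_def)
    have bb: "bdd_below N" unfolding N_def by (rule bdd_belowI[of _ s]) auto
    define r where "r = Inf N"
    have rN: "r \<in> N" unfolding r_def using \<open>closed N\<close> \<open>t \<in> N\<close> bb by (intro closed_contains_Inf) auto
    have rT: "r \<in> {0..<T}" "s \<le> r" using rN s t by (auto simp: N_def)
    have "r \<noteq> s" using degenerate_critical[OF s, of e1 e2] imm rN by (auto simp: N_def)
    then have sr: "s < r" using rT by simp
    have before: "(norm (gu u q))\<^sup>2 \<le> (1 + M\<^sup>2) * pp e1 e2 (gu u q) (gu u q)" if q: "s < q" "q < r" for u q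
    proof -
      have "q \<notin> N" using cInf_lower[OF _ bb, of q] q by (auto simp: r_def)
      then obtain v1 v2 v3 where "tri e1 e2 q v1 v2 v3 \<noteq> 0" using q rN by (auto simp: N_def)
      then show ?thesis using bound q rT by auto
    qed
    have at_r: "(norm (gu u r))\<^sup>2 \<le> (1 + M\<^sup>2) * pp e1 e2 (gu u r) (gu u r)" for u
    proof -
      have c: "continuous_on {s..r} (\<lambda>q. (1 + M\<^sup>2) * pp e1 e2 (gu u q) (gu u q) - (norm (gu u q))\<^sup>2)"
        unfolding pp_def using s rT by (intro continuous_intros) auto
      have "0 \<le> (1 + M\<^sup>2) * pp e1 e2 (gu u r) (gu u r) - (norm (gu u r))\<^sup>2"
      proof (rule continuous_ge_on_closure[OF c[folded closure_greaterThanLessThan[OF sr]]])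
        show "r \<in> closure {s<..<r}" using sr by simp
      qed (use before in auto)
      then show ?thesis by simp
    qed
    obtain u where "pp e1 e2 (gu u r) (gu u r) = 0" using degenerate_critical[OF rT(1), of e1 e2] rN by (auto simp: N_def)
    then show False using at_r[of u] regular[OF rT(1), of u] by simp
  qed
  then show ?thesis using bound[OF t] by blast
qed

text \<open>The bound starts at a positive time because the initial projection need be neither
  immersed nor curved. Radial monotonicity gives immersion at once, and the point farthest from c
  provides the curvature that spreads over the whole curve.\<close>

lemma uniformly_immersed_projection:
  assumes orth: "norm e1 = 1" "norm e2 = 1" "e1 \<bullet> e2 = 0"
    and tri: "\<And>u1 u2 u3. ordered u1 u2 u3 \<Longrightarrow> 0 \<le> tri e1 e2 0 u1 u2 u3"
    and \<eta>: "0 < \<eta>" "\<eta> < 2 * pi"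
    and rad: "\<And>u d. 0 \<le> d \<Longrightarrow> d \<le> \<eta> \<Longrightarrow> 0 \<le> dd e1 e2 (g u 0 - c) (g (u + d) 0 - c)"
    and rad': "\<And>u. 0 < dd e1 e2 (g u 0 - c) (g (u + \<eta>) 0 - c)"
  obtains t0 lam where "0 < t0" "t0 < T" "0 < lam"
    "\<And>u t. t \<in> {t0..<T} \<Longrightarrow> lam \<le> a u t * ((gu u t \<bullet> e1)\<^sup>2 + (gu u t \<bullet> e2)\<^sup>2)"
    "\<And>u w t. t \<in> {t0..<T} \<Longrightarrow> 0 \<le> dd e1 e2 (gu u t) (g w t - g u t)"
proof -
  have tri_t: "0 \<le> tri e1 e2 t u1 u2 u3" if "t \<in> {0..<T}" "ordered u1 u2 u3" for t u1 u2 u3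
    using that by (intro tri_preserved[of 0 t] tri) auto
  have tan: "0 \<le> dd e1 e2 (gu u t) (g w t - g u t)" if "t \<in> {0..<T}" for t u w
    using tri_t[OF that] by (rule tangent_nonneg[OF that])
  obtain t2 where t2: "0 < t2" "t2 < T" and pos: "\<And>u t. 0 < t \<Longrightarrow> t \<le> t2 \<Longrightarrow> 0 < dd e1 e2 (g u t - c) (gu u t)"
    using radial_positive[OF \<eta> rad rad'] by blast
  define t1 where "t1 = t2 / 2"
  have t1: "0 < t1" "t1 < t2" using t2 by (auto simp: t1_def)
  have t1T: "t1 \<in> {0..<T}" using t1 t2 by auto
  have imm: "pp e1 e2 (gu u t) (gu u t) \<noteq> 0" if "0 < t" "t \<le> t2" for u t
  proof
    assume "pp e1 e2 (gu u t) (gu u t) = 0"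
    then have "gu u t \<bullet> e1 = 0 \<and> gu u t \<bullet> e2 = 0" by (simp add: pp_def sum_squares_eq_zero_iff)
    then show False using pos[OF that, of u] by (simp add: dd_def)
  qed
  have nonneg: "0 \<le> dd e1 e2 (gu u t) (gt u t)" if "t \<in> {t1..t2}" for u t
  proof -
    have tT: "t \<in> {0..<T}" using that t1 t2 by auto
    then show ?thesis
      using tangent_dd_guu_nonneg[OF tT tan[OF tT]] a_pos[OF tT, of u] by (simp add: dd_gt[OF tT])
  qed
  let ?f = "\<lambda>w. pp e1 e2 (g w t1 - c) (g w t1 - c)"
  have "continuous_on {0..2*pi} ?f" unfolding pp_def using t1T by (intro continuous_intros) auto
  then obtain us where "us \<in> {0..2*pi}" and us: "\<And>v. v \<in> {0..2*pi} \<Longrightarrow> ?f v \<le> ?f us"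
    using continuous_attains_sup[of "{0..2*pi}" ?f] by force
  have max: "?f v \<le> ?f us" for v
  proof -
    obtain v' where "0 \<le> v'" "v' < 0 + 2 * pi" "g v t1 = g v' t1" using representative[of 0 v] t1T by metis
    then show ?thesis using us[of v'] by simp
  qed
  \<comment> \<open>the projection is curved at its point farthest from \<open>c\<close>\<close>
  have vpos: "0 < dd e1 e2 (gu us t1) (gt us t1)"
  proof -
    let ?r = "g us t1 - c" and ?v = "gu us t1"
    have d1: "((\<lambda>w. - ?f w) has_real_derivative - 2 * pp e1 e2 (gu w t1) (g w t1 - c)) (at w)" for w
      unfolding pp_def inner_diff_left
      by (rule derivative_eq_intros inner_u t1T refl)+ (simp add: algebra_simps)
    have d2: "((\<lambda>w. - 2 * pp e1 e2 (gu w t1) (g w t1 - c)) has_real_derivative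
        - 2 * (pp e1 e2 (guu us t1) ?r + pp e1 e2 ?v ?v)) (at us)"
      unfolding pp_def inner_diff_left
      by (rule derivative_eq_intros inner_u t1T refl)+ (simp add: algebra_simps)
    have c: "pp e1 e2 ?v ?r = 0" "pp e1 e2 (guu us t1) ?r + pp e1 e2 ?v ?v \<le> 0"
      using local_min_second_derivative[OF zero_less_one d1 d2] max by auto
    have pr: "0 < dd e1 e2 ?r ?v" using pos[of t1 us] t1 by simp
    have pv: "0 < pp e1 e2 ?v ?v"
      using imm[of t1 us] t1 by (simp add: pp_def less_le sum_squares_ge_zero)
    have id1: "pp e1 e2 ?r ?r * dd e1 e2 ?v x = pp e1 e2 ?r ?v * dd e1 e2 ?r x - pp e1 e2 ?r x * dd e1 e2 ?r ?v" for x
      by (rule dd_pp)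
    have comm: "pp e1 e2 x y = pp e1 e2 y x" for x y by (simp add: pp_def mult.commute)
    have "pp e1 e2 ?r (guu us t1) < 0" using c(2) pv comm[of "guu us t1" ?r] by linarith
    then have "0 < - pp e1 e2 ?r (guu us t1) * dd e1 e2 ?r ?v" using pr by (simp add: mult_neg_pos)
    then have "0 < pp e1 e2 ?r ?r * dd e1 e2 ?v (guu us t1)" using id1[of "guu us t1"] c(1) comm[of ?r ?v] by simp
    moreover have "0 \<le> pp e1 e2 ?r ?r" by (simp add: pp_def sum_squares_ge_zero)
    ultimately have "0 < dd e1 e2 ?v (guu us t1)" by (simp add: zero_less_mult_iff)
    then show ?thesis using a_pos[OF t1T, of us] by (simp add: dd_gt[OF t1T])
  qed
  have imm12: "pp e1 e2 (gu u t) (gu u t) \<noteq> 0" if "t \<in> {t1..t2}" for u t using imm[of t u] that t1 by auto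
  have "0 \<le> t1" using t1 by simp
  from dd_velocity_positive[OF this t1(2) t2(2) imm12 nonneg vpos] obtain t0
    where t0: "t1 < t0" "t0 \<le> t2" and curv: "\<And>u. 0 < dd e1 e2 (gu u t0) (gt u t0)" by blast
  have t0T: "t0 \<in> {0..<T}" using t0 t1 t2 by auto
  have curved: "0 < dd e1 e2 (gu u t0) (guu u t0)" for u
    using curv[of u] a_pos[OF t0T, of u] by (simp add: dd_gt[OF t0T] zero_less_mult_iff)
  obtain M where M: "0 < M" and tilt: "\<And>p q \<zeta> u1 u2 u3. p\<^sup>2 + q\<^sup>2 = 1 \<Longrightarrow> norm \<zeta> \<le> 1 \<Longrightarrow> ordered u1 u2 u3 \<Longrightarrow>
    0 \<le> tri (p *\<^sub>R e1 + q *\<^sub>R e2) (M *\<^sub>R (p *\<^sub>R e2 - q *\<^sub>R e1) + \<zeta>) t0 u1 u2 u3"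
    using tilt_positive[OF t0T tri_t[OF t0T] curved orth(1,2)] by blast
  show ?thesis
  proof (rule that[of t0 "1 / (1 + M\<^sup>2)"])
    have M1: "0 < 1 + M\<^sup>2" by (simp add: add_pos_nonneg)
    then show "0 < 1 / (1 + M\<^sup>2)" by simp
    show "1 / (1 + M\<^sup>2) \<le> a u t * ((gu u t \<bullet> e1)\<^sup>2 + (gu u t \<bullet> e2)\<^sup>2)" if t: "t \<in> {t0..<T}" for u t
    proof -
      have tT: "t \<in> {0..<T}" using t t0 t1 by auto
      have "(norm (gu u t))\<^sup>2 \<le> (1 + M\<^sup>2) * pp e1 e2 (gu u t) (gu u t)"
        using t0 t1 by (intro immersed_preserved[OF t0T orth tilt imm t]) auto
      then have "a u t * (norm (gu u t))\<^sup>2 \<le> a u t * ((1 + M\<^sup>2) * pp e1 e2 (gu u t) (gu u t))"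
        using a_pos[OF tT, of u] by (intro mult_left_mono) auto
      then show ?thesis using a_norm[OF tT, of u] M1 by (simp add: pp_def power2_eq_square field_simps)
    qed
    show "0 \<le> dd e1 e2 (gu u t) (g w t - g u t)" if "t \<in> {t0..<T}" for u w t
      using that t0T by (intro tan) auto
  qed (use t0 t1 t2 in auto)
qed

section \<open>Barriers for flows with uniformly immersed convex projection\<close>

lemma H_ge_later: "0 \<le> s \<Longrightarrow> s \<le> t \<Longrightarrow> t < T \<Longrightarrow> g u t \<bullet> v \<le> H v s"
  using order_trans[OF H_ge[of t u v] H_antimono[of s t v]] by simp

text \<open>The convex hull of the projection, as a cylinder over the plane.\<close>

definition K :: "'a \<Rightarrow> 'a \<Rightarrow> real \<Rightarrow> 'a set" where
  "K e1 e2 t = {z. \<forall>p q. z \<bullet> (p *\<^sub>R e1 + q *\<^sub>R e2) \<le> H (p *\<^sub>R e1 + q *\<^sub>R e2) t}"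

lemma K_iff: "z \<in> K e1 e2 t \<longleftrightarrow> (\<forall>p q. z \<bullet> (p *\<^sub>R e1 + q *\<^sub>R e2) \<le> H (p *\<^sub>R e1 + q *\<^sub>R e2) t)"
  by (simp add: K_def)

lemma K_rotate:
  assumes "p\<^sup>2 + q\<^sup>2 = 1"
  shows "K (p *\<^sub>R e1 + q *\<^sub>R e2) (p *\<^sub>R e2 - q *\<^sub>R e1) t = K e1 e2 t"
proof -
  have 1: "x *\<^sub>R (p *\<^sub>R e1 + q *\<^sub>R e2) + y *\<^sub>R (p *\<^sub>R e2 - q *\<^sub>R e1)
      = (x * p - y * q) *\<^sub>R e1 + (x * q + y * p) *\<^sub>R e2" for x y
    by (simp add: algebra_simps)
  have 2: "((x * p + y * q) * p - (y * p - x * q) * q) = x" "((x * p + y * q) * q + (y * p - x * q) * p) = y" for x y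
  proof -
    have "(x * p + y * q) * p - (y * p - x * q) * q = x * (p\<^sup>2 + q\<^sup>2)"
      "(x * p + y * q) * q + (y * p - x * q) * p = y * (p\<^sup>2 + q\<^sup>2)"
      by (simp_all add: algebra_simps power2_eq_square)
    then show "((x * p + y * q) * p - (y * p - x * q) * q) = x" "((x * p + y * q) * q + (y * p - x * q) * p) = y"
      using assms by simp_all
  qed
  show ?thesis
  proof (intro set_eqI iffI)
    fix z assume z: "z \<in> K (p *\<^sub>R e1 + q *\<^sub>R e2) (p *\<^sub>R e2 - q *\<^sub>R e1) t"
    show "z \<in> K e1 e2 t" unfolding K_iff
    proof (intro allI)
      fix x y show "z \<bullet> (x *\<^sub>R e1 + y *\<^sub>R e2) \<le> H (x *\<^sub>R e1 + y *\<^sub>R e2) t"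
        using z[unfolded K_iff 1, rule_format, of "x * p + y * q" "y * p - x * q"] unfolding 2 .
    qed
  qed (simp add: K_iff 1)
qed

end

text \<open>\<open>immersed\<close> bounds the squared projection of the unit tangent from below,
  and \<open>tangent\<close> encodes convexity with counterclockwise orientation. The frame is a
  parameter, so that barriers aligned with the axes apply in every direction through
  \<open>rotate\<close>.\<close>

locale convex_flow = flow D T
  for D :: "nat \<Rightarrow> nat \<Rightarrow> real \<Rightarrow> real \<Rightarrow> 'a::euclidean_space" and T :: real +
  fixes e1 e2 :: 'a and lam t0 :: real
  assumes orth: "norm e1 = 1" "norm e2 = 1" "e1 \<bullet> e2 = 0"
    and t0: "0 \<le> t0" "t0 < T" and lam: "0 < lam"
    and immersed: "t \<in> {t0..<T} \<Longrightarrow> lam \<le> a u t * ((gu u t \<bullet> e1)\<^sup>2 + (gu u t \<bullet> e2)\<^sup>2)"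
    and tangent: "t \<in> {t0..<T} \<Longrightarrow> 0 \<le> dd e1 e2 (gu u t) (g w t - g u t)"
    and shrink: "0 < e \<Longrightarrow> \<exists>t1<T. \<forall>t u. t1 < t \<longrightarrow> t < T \<longrightarrow> norm (g u t) < e"
begin

lemma t0_T: "t \<in> {t0..<T} \<Longrightarrow> t \<in> {0..<T}" using t0 by auto

lemma inner_e: "e1 \<bullet> e1 = 1" "e2 \<bullet> e2 = 1" "e2 \<bullet> e1 = 0" "e1 \<bullet> e2 = 0"
  using orth by (simp_all add: dot_square_norm inner_commute)

lemma dd_rotate:
  assumes "p\<^sup>2 + q\<^sup>2 = 1"
  shows "dd (p *\<^sub>R e1 + q *\<^sub>R e2) (p *\<^sub>R e2 - q *\<^sub>R e1) v w = dd e1 e2 v w"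
proof -
  have "dd (p *\<^sub>R e1 + q *\<^sub>R e2) (p *\<^sub>R e2 - q *\<^sub>R e1) v w = (p\<^sup>2 + q\<^sup>2) * dd e1 e2 v w"
    by (simp add: dd_def inner_add_right inner_diff_right algebra_simps power2_eq_square)
  then show ?thesis by (simp add: assms)
qed

lemma norm_rotate:
  assumes "p\<^sup>2 + q\<^sup>2 = 1"
  shows "(v \<bullet> (p *\<^sub>R e1 + q *\<^sub>R e2))\<^sup>2 + (v \<bullet> (p *\<^sub>R e2 - q *\<^sub>R e1))\<^sup>2 = (v \<bullet> e1)\<^sup>2 + (v \<bullet> e2)\<^sup>2"
proof -
  have "(v \<bullet> (p *\<^sub>R e1 + q *\<^sub>R e2))\<^sup>2 + (v \<bullet> (p *\<^sub>R e2 - q *\<^sub>R e1))\<^sup>2 = (p\<^sup>2 + q\<^sup>2) * ((v \<bullet> e1)\<^sup>2 + (v \<bullet> e2)\<^sup>2)"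
    by (simp add: inner_add_right inner_diff_right algebra_simps power2_eq_square)
  then show ?thesis by (simp add: assms)
qed

lemma rotate:
  assumes pq: "p\<^sup>2 + q\<^sup>2 = 1"
  shows "convex_flow D T (p *\<^sub>R e1 + q *\<^sub>R e2) (p *\<^sub>R e2 - q *\<^sub>R e1) lam t0"
proof unfold_locales
  show "norm (p *\<^sub>R e1 + q *\<^sub>R e2) = 1" "norm (p *\<^sub>R e2 - q *\<^sub>R e1) = 1"
    using pq by (simp_all add: norm_eq_sqrt_inner inner_add_left inner_add_right inner_diff_left inner_diff_right
      inner_e power2_eq_square)
  show "(p *\<^sub>R e1 + q *\<^sub>R e2) \<bullet> (p *\<^sub>R e2 - q *\<^sub>R e1) = 0"
    by (simp add: inner_add_left inner_diff_right inner_e)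
qed (use t0 lam immersed tangent shrink dd_rotate[OF pq] norm_rotate[OF pq] in auto)

lemma speed_bounds:
  assumes "t \<in> {t0..<T}"
  shows "0 \<le> a u t * (gu u t \<bullet> e1)\<^sup>2" "0 \<le> a u t * (gu u t \<bullet> e2)\<^sup>2"
    "a u t * (gu u t \<bullet> e1)\<^sup>2 + a u t * (gu u t \<bullet> e2)\<^sup>2 \<le> 1"
    "lam \<le> a u t * (gu u t \<bullet> e1)\<^sup>2 + a u t * (gu u t \<bullet> e2)\<^sup>2"
proof -
  let ?v = "gu u t"
  have a0: "0 < a u t" using assms t0_T a_pos by blast
  then show "0 \<le> a u t * (?v \<bullet> e1)\<^sup>2" "0 \<le> a u t * (?v \<bullet> e2)\<^sup>2" by auto
  let ?P = "(?v \<bullet> e1) *\<^sub>R e1 + (?v \<bullet> e2) *\<^sub>R e2"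
  have "0 \<le> (?v - ?P) \<bullet> (?v - ?P)" by simp
  also have "\<dots> = ?v \<bullet> ?v - ((?v \<bullet> e1)\<^sup>2 + (?v \<bullet> e2)\<^sup>2)"
    by (simp add: inner_diff_left inner_diff_right inner_add_left inner_add_right inner_e
      power2_eq_square inner_commute algebra_simps)
  also have "?v \<bullet> ?v = (norm ?v)\<^sup>2" by (simp add: dot_square_norm)
  finally have "a u t * ((?v \<bullet> e1)\<^sup>2 + (?v \<bullet> e2)\<^sup>2) \<le> a u t * (norm ?v)\<^sup>2"
    using a0 by (intro mult_left_mono) auto
  then show "a u t * (?v \<bullet> e1)\<^sup>2 + a u t * (?v \<bullet> e2)\<^sup>2 \<le> 1"
    using a_norm[OF t0_T[OF assms], of u] by (simp add: distrib_left)
  show "lam \<le> a u t * (?v \<bullet> e1)\<^sup>2 + a u t * (?v \<bullet> e2)\<^sup>2"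
    using immersed[OF assms, of u] by (simp add: distrib_left)
qed

lemma gu_nonzero: "t \<in> {t0..<T} \<Longrightarrow> gu u t \<bullet> e1 \<noteq> 0 \<or> gu u t \<bullet> e2 \<noteq> 0"
  using speed_bounds(4)[of t u] lam by auto

lemma K_tangent:
  assumes t: "t \<in> {t0..<T}" and z: "z \<in> K e1 e2 t"
  shows "0 \<le> dd e1 e2 (gu u t) (z - g u t)"
proof -
  let ?v = "(gu u t \<bullet> e2) *\<^sub>R e1 + (- (gu u t \<bullet> e1)) *\<^sub>R e2"
  have v: "x \<bullet> ?v = - dd e1 e2 (gu u t) x" for x by (simp add: dd_def inner_diff_right)
  obtain w where "g w t \<bullet> ?v = H ?v t" using H_attained[OF t0_T[OF t]] by blast
  moreover have "(g w t - g u t) \<bullet> ?v \<le> 0" unfolding v using tangent[OF t] by simp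
  moreover have "z \<bullet> ?v \<le> H ?v t" using z unfolding K_iff by blast
  ultimately have "(z - g u t) \<bullet> ?v \<le> 0" by (simp add: inner_diff_left)
  then show ?thesis unfolding v by simp
qed

lemma g_in_K: "t \<in> {0..<T} \<Longrightarrow> g u t \<in> K e1 e2 t"
  by (auto simp: K_iff intro: H_ge)

lemma K_antimono: "0 \<le> s \<Longrightarrow> s \<le> t \<Longrightarrow> t < T \<Longrightarrow> z \<in> K e1 e2 t \<Longrightarrow> z \<in> K e1 e2 s"
  unfolding K_iff using H_antimono order_trans by blast

lemma K_convex: "convex (K e1 e2 t)"
proof -
  have "K e1 e2 t = (\<Inter>p. \<Inter>q. {z. (p *\<^sub>R e1 + q *\<^sub>R e2) \<bullet> z \<le> H (p *\<^sub>R e1 + q *\<^sub>R e2) t})"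
    by (auto simp: K_def inner_commute)
  then show ?thesis by (simp add: convex_INT convex_halfspace_le)
qed

lemma K_cong:
  assumes "z \<in> K e1 e2 t" "z \<bullet> e1 = z' \<bullet> e1" "z \<bullet> e2 = z' \<bullet> e2"
  shows "z' \<in> K e1 e2 t"
  using assms by (simp add: K_iff inner_add_right)

lemma g_tendsto: "((\<lambda>t. g u t) \<longlongrightarrow> 0) (at_left T)"
proof (rule tendstoI)
  fix e :: real assume "0 < e"
  then obtain t1 where "t1 < T" "\<And>t u. t1 < t \<Longrightarrow> t < T \<Longrightarrow> norm (g u t) < e" using shrink by metis
  then show "\<forall>\<^sub>F t in at_left T. dist (g u t) 0 < e"
    by (intro eventually_at_leftI[of t1]) auto
qed

lemma eventually_left: "s < T \<Longrightarrow> eventually (\<lambda>t. s < t \<and> t < T) (at_left T)"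
  by (auto intro!: eventually_at_leftI[of s])

lemma cos_one_ge: "1 / 2 \<le> cos (1::real)"
proof -
  have "cos (pi / 3) \<le> cos 1" using pi_gt3 by (intro cos_monotone_0_pi_le) auto
  then show ?thesis by (simp add: cos_60)
qed

text \<open>The translating grim reaper \<open>cos (\<mu> y) = \<kappa> e\<^bsup>lam \<mu>\<^sup>2 t + \<mu> x\<^esup>\<close> is an outer barrier: the tips of a
  thin projection move in with speed at least of the order of the reciprocal width.\<close>

lemma tip:
  assumes s: "s \<in> {t0..<T}" and w: "0 < w" "H e2 s + H (- e2) s \<le> w"
  shows "2 * lam * (T - s) / w - w \<le> H e1 s"
proof -
  have sT: "s \<in> {0..<T}" using s t0_T by blast
  \<comment> \<open>The strip of width w then has half-width 1 in the scaled variable, less than pi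
    / 2, so the cosine stays above 1 / 2.\<close>
  define \<mu> where "\<mu> = 2 / w"
  have \<mu>: "0 < \<mu>" "\<mu> * w = 2" using w by (auto simp: \<mu>_def)
  define y0 where "y0 = (H e2 s - H (- e2) s) / 2"
  have strip: "\<bar>\<mu> * (g u r \<bullet> e2 - y0)\<bar> \<le> 1" if "r \<in> {s..<T}" for u r
  proof -
    have "g u r \<bullet> e2 \<le> H e2 s" "g u r \<bullet> (- e2) \<le> H (- e2) s"
      using that sT by (intro H_ge_later; simp)+
    then have "\<bar>g u r \<bullet> e2 - y0\<bar> \<le> w / 2" using w(2) unfolding y0_def by (simp add: abs_le_iff field_simps)
    then have "\<mu> * \<bar>g u r \<bullet> e2 - y0\<bar> \<le> \<mu> * (w / 2)" using \<mu> by (intro mult_left_mono) auto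
    then show ?thesis using \<mu> by (simp add: abs_mult)
  qed
  have cos_pos: "1 / 2 \<le> cos (\<mu> * (g u r \<bullet> e2 - y0))" if "r \<in> {s..<T}" for u r
  proof -
    have "cos 1 \<le> cos \<bar>\<mu> * (g u r \<bullet> e2 - y0)\<bar>"
      using strip[OF that, of u] pi_gt3 by (intro cos_monotone_0_pi_le) auto
    then show ?thesis using cos_one_ge by simp
  qed
  \<comment> \<open>Normalised so that the exponential side is at most 1 / 2 on the initial curve,
    below the minimum of the cosine.\<close>
  define \<kappa> where "\<kappa> = exp (- \<mu> * H e1 s) / 2"
  have \<kappa>: "0 < \<kappa>" by (simp add: \<kappa>_def)
  define G where "G r x = \<kappa> * exp (lam * \<mu>\<^sup>2 * (r - s) + \<mu> * x)" for r x
  have G0: "0 < G r x" for r x using \<kappa> by (simp add: G_def)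
  have main: "0 \<le> cos (\<mu> * (g u t \<bullet> e2 - y0)) - G t (g u t \<bullet> e1)" if t: "t \<in> {s..<T}" for u t
  proof (rule circle_max_principle[of s t "\<lambda>u t. cos (\<mu> * (g u t \<bullet> e2 - y0)) - G t (g u t \<bullet> e1)" "\<mu>\<^sup>2 * lam" u])
    show "continuous_on (UNIV \<times> {s..t}) (\<lambda>z. cos (\<mu> * (g (fst z) (snd z) \<bullet> e2 - y0)) - G (snd z) (g (fst z) (snd z) \<bullet> e1))"
      unfolding G_def using sT t by (intro continuous_intros) auto
    show "cos (\<mu> * (g (u + 2 * pi * of_int m) r \<bullet> e2 - y0)) - G r (g (u + 2 * pi * of_int m) r \<bullet> e1)
       = cos (\<mu> * (g u r \<bullet> e2 - y0)) - G r (g u r \<bullet> e1)" if "r \<in> {s..t}" for u r m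
      using that D_per_int[of r] sT t by auto
    show "0 \<le> cos (\<mu> * (g u s \<bullet> e2 - y0)) - G s (g u s \<bullet> e1)" for u
    proof -
      have "\<mu> * (g u s \<bullet> e1) \<le> \<mu> * H e1 s" using H_ge[OF sT] \<mu> by simp
      then have "exp (- \<mu> * H e1 s + \<mu> * (g u s \<bullet> e1)) \<le> 1" by simp
      then have "G s (g u s \<bullet> e1) \<le> 1 / 2" by (simp add: G_def \<kappa>_def exp_add[symmetric] exp_diff exp_minus field_simps)
      then show ?thesis using cos_pos[of s u] s by simp
    qed
    fix u r assume r: "s < r" "r \<le> t" and neg: "cos (\<mu> * (g u r \<bullet> e2 - y0)) - G r (g u r \<bullet> e1) < 0"
      and min: "\<And>w. cos (\<mu> * (g u r \<bullet> e2 - y0)) - G r (g u r \<bullet> e1) \<le> cos (\<mu> * (g w r \<bullet> e2 - y0)) - G r (g w r \<bullet> e1)"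
    have rT: "r \<in> {0..<T}" "r \<in> {t0..<T}" "r \<in> {s..<T}" using r t s sT by auto
    define c where "c = cos (\<mu> * (g u r \<bullet> e2 - y0))"
    define G' where "G' = G r (g u r \<bullet> e1)"
    define X where "X = a u r * (gu u r \<bullet> e1)\<^sup>2"
    define Y where "Y = a u r * (gu u r \<bullet> e2)\<^sup>2"
    define c' where "c' = - (\<mu> * G') * (gt u r \<bullet> e1) + (- \<mu> * sin (\<mu> * (g u r \<bullet> e2 - y0))) * (gt u r \<bullet> e2)"
    have "- (- (\<mu>\<^sup>2 * G') * X) - (- \<mu>\<^sup>2 * c) * Y \<le> c'"
      unfolding X_def Y_def c'_def G'_def
    proof (rule spatial_min[OF rT(1) zero_less_one, where \<phi> = "\<lambda>x. - G r x" and \<phi>' = "\<lambda>x. - (\<mu> * G r x)"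
          and \<psi> = "\<lambda>y. cos (\<mu> * (y - y0))" and \<psi>' = "\<lambda>y. - \<mu> * sin (\<mu> * (y - y0))"])
      show "((\<lambda>x. - G r x) has_real_derivative - (\<mu> * G r x)) (at x)" for x
        unfolding G_def by (auto intro!: derivative_eq_intros)
      show "((\<lambda>x. - (\<mu> * G r x)) has_real_derivative - (\<mu>\<^sup>2 * G r (g u r \<bullet> e1))) (at (g u r \<bullet> e1))"
        unfolding G_def by (auto intro!: derivative_eq_intros simp: power2_eq_square)
      show "((\<lambda>y. cos (\<mu> * (y - y0))) has_real_derivative - \<mu> * sin (\<mu> * (y - y0))) (at y)" for y
        by (auto intro!: derivative_eq_intros)
      show "((\<lambda>y. - \<mu> * sin (\<mu> * (y - y0))) has_real_derivative - \<mu>\<^sup>2 * c) (at (g u r \<bullet> e2))"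
        unfolding c_def by (auto intro!: derivative_eq_intros simp: power2_eq_square)
      show "- G r (g u r \<bullet> e1) + cos (\<mu> * (g u r \<bullet> e2 - y0)) \<le> - G r (g w r \<bullet> e1) + cos (\<mu> * (g w r \<bullet> e2 - y0))" for w
        using min[of w] by simp
    qed
    then have "\<mu>\<^sup>2 * (G' * X + c * Y) \<le> c'" by (simp add: algebra_simps)
    moreover have "lam * (c - G') \<le> G' * X + c * Y - lam * G'"
    proof -
      have "lam \<le> X + Y" "0 \<le> X" "0 \<le> c" "c \<le> G'"
        using speed_bounds[OF rT(2), of u] cos_pos[OF rT(3), of u] neg by (auto simp: X_def Y_def c_def G'_def)
      then have "c * lam \<le> c * (X + Y)" "c * X \<le> G' * X" by (auto intro!: mult_left_mono mult_right_mono)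
      then show ?thesis by (simp add: algebra_simps)
    qed
    then have "\<mu>\<^sup>2 * (lam * (c - G')) \<le> \<mu>\<^sup>2 * (G' * X + c * Y - lam * G')" by (intro mult_left_mono) auto
    ultimately have "\<mu>\<^sup>2 * lam * (c - G') \<le> c' - lam * \<mu>\<^sup>2 * G'" by (simp add: algebra_simps)
    moreover have "((\<lambda>q. cos (\<mu> * (g u q \<bullet> e2 - y0)) - G q (g u q \<bullet> e1)) has_real_derivative c' - lam * \<mu>\<^sup>2 * G') (at r within {0..<T})"
      unfolding G_def c'_def G'_def
      by (rule derivative_eq_intros inner_t rT refl)+ (simp add: algebra_simps)
    ultimately show "\<exists>c. ((\<lambda>q. cos (\<mu> * (g u q \<bullet> e2 - y0)) - G q (g u q \<bullet> e1)) has_real_derivative c) (at r within {0..<T}) \<and>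
        \<mu>\<^sup>2 * lam * (cos (\<mu> * (g u r \<bullet> e2 - y0)) - G r (g u r \<bullet> e1)) \<le> c"
      unfolding c_def G'_def by blast
  qed (use t sT in auto)
  have upper: "lam * \<mu>\<^sup>2 * (t - s) + \<mu> * (g 0 t \<bullet> e1) \<le> \<mu> * H e1 s + 1" if "t \<in> {s..<T}" for t
  proof -
    have "G t (g 0 t \<bullet> e1) \<le> 1" using main[OF that, of 0] cos_le_one order_trans by fastforce
    then have "exp (lam * \<mu>\<^sup>2 * (t - s) + \<mu> * (g 0 t \<bullet> e1) - \<mu> * H e1 s) \<le> 2"
      by (simp add: G_def \<kappa>_def exp_add exp_diff exp_minus field_simps)
    also have "2 \<le> exp (1::real)" using exp_ge_add_one_self[of 1] by simp
    finally show ?thesis by simp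
  qed
  \<comment> \<open>Every point of the curve tends to the origin, so in the limit only the travelled
    distance of the barrier remains on the left.\<close>
  have lim: "((\<lambda>t. lam * \<mu>\<^sup>2 * (t - s) + \<mu> * (g 0 t \<bullet> e1)) \<longlongrightarrow> lam * \<mu>\<^sup>2 * (T - s) + \<mu> * (0 \<bullet> e1)) (at_left T)"
    by (intro tendsto_intros g_tendsto)
  have "lam * \<mu>\<^sup>2 * (T - s) + \<mu> * (0 \<bullet> e1) \<le> \<mu> * H e1 s + 1"
    by (rule tendsto_upperbound[OF lim]) (use s in \<open>auto intro!: upper eventually_mono[OF eventually_left[of s]]\<close>)
  then have "\<mu> * (lam * \<mu> * (T - s) - H e1 s - w / 2) \<le> 0" using \<mu> by (simp add: algebra_simps power2_eq_square)
  then have "lam * \<mu> * (T - s) - H e1 s - w / 2 \<le> 0" using \<mu> by (simp add: mult_le_0_iff)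
  then show ?thesis using w by (simp add: \<mu>_def algebra_simps)
qed

text \<open>The squared planar distance d from z satisfies d_t = d_ss - 2 (x_s^2 + y_s^2), and the
  bracket is at most 1.\<close>

lemma circle_barrier:
  assumes s: "s \<in> {t0..<T}" and t: "t \<in> {s..<T}"
    and init: "\<And>u. \<rho> \<le> ((g u s - z) \<bullet> e1)\<^sup>2 + ((g u s - z) \<bullet> e2)\<^sup>2"
  shows "\<rho> - 2 * (t - s) \<le> ((g u t - z) \<bullet> e1)\<^sup>2 + ((g u t - z) \<bullet> e2)\<^sup>2"
proof -
  have sT: "s \<in> {0..<T}" using s t0_T by blast
  let ?f = "\<lambda>u t. (g u t \<bullet> e1 - z \<bullet> e1)\<^sup>2 + (g u t \<bullet> e2 - z \<bullet> e2)\<^sup>2 - \<rho> + 2 * (t - s)"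
  have "0 \<le> ?f u t"
  proof (rule circle_max_principle[of s t ?f 0 u])
    show "continuous_on (UNIV \<times> {s..t}) (\<lambda>z. ?f (fst z) (snd z))"
      using sT t by (intro continuous_intros) auto
    show "?f (u + 2 * pi * of_int m) r = ?f u r" if "r \<in> {s..t}" for u r m
      using that D_per_int[of r] sT t by auto
    show "0 \<le> ?f u s" for u using init[of u] by (simp add: inner_diff_left)
    fix u r assume r: "s < r" "r \<le> t" and min: "\<And>w. ?f u r \<le> ?f w r"
    have rT: "r \<in> {0..<T}" "r \<in> {t0..<T}" using r t s sT by auto
    define c' where "c' = 2 * (g u r \<bullet> e1 - z \<bullet> e1) * (gt u r \<bullet> e1) + 2 * (g u r \<bullet> e2 - z \<bullet> e2) * (gt u r \<bullet> e2)"
    have "- (2 * (a u r * (gu u r \<bullet> e1)\<^sup>2)) - 2 * (a u r * (gu u r \<bullet> e2)\<^sup>2) \<le> c'"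
      unfolding c'_def
    proof (rule spatial_min[OF rT(1) zero_less_one, where \<phi> = "\<lambda>x. (x - z \<bullet> e1)\<^sup>2" and \<phi>' = "\<lambda>x. 2 * (x - z \<bullet> e1)"
          and \<psi> = "\<lambda>y. (y - z \<bullet> e2)\<^sup>2" and \<psi>' = "\<lambda>y. 2 * (y - z \<bullet> e2)"])
      show "(g u r \<bullet> e1 - z \<bullet> e1)\<^sup>2 + (g u r \<bullet> e2 - z \<bullet> e2)\<^sup>2 \<le> (g w r \<bullet> e1 - z \<bullet> e1)\<^sup>2 + (g w r \<bullet> e2 - z \<bullet> e2)\<^sup>2" for w
        using min[of w] by simp
    qed (auto intro!: derivative_eq_intros)
    then have "0 \<le> c' + 2" using speed_bounds(3)[OF rT(2), of u] by simp
    moreover have "(?f u has_real_derivative c' + 2) (at r within {0..<T})"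
      unfolding c'_def by (rule derivative_eq_intros inner_t rT refl)+ (simp add: algebra_simps)
    ultimately show "\<exists>c. (?f u has_real_derivative c) (at r within {0..<T}) \<and> 0 * ?f u r \<le> c" by auto
  qed (use t sT in auto)
  then show ?thesis by (simp add: inner_diff_left)
qed

text \<open>The winding number of the projection around \<open>z\<close> is constant as long as the curve avoids \<open>z\<close>.\<close>

lemma enclosed_persists:
  assumes s: "s \<in> {t0..<T}" and t: "t \<in> {s..<T}"
    and inside: "\<And>u. 0 < dd e1 e2 (gu u s) (z - g u s)"
    and avoid: "\<And>r u. r \<in> {s..t} \<Longrightarrow> g u r \<bullet> e1 \<noteq> z \<bullet> e1 \<or> g u r \<bullet> e2 \<noteq> z \<bullet> e2"
  shows "z \<in> K e1 e2 t"
proof (rule ccontr)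
  assume "z \<notin> K e1 e2 t"
  then obtain p q where pq: "H (p *\<^sub>R e1 + q *\<^sub>R e2) t < z \<bullet> (p *\<^sub>R e1 + q *\<^sub>R e2)"
    unfolding K_iff by (auto simp: not_le)
  have sT: "s \<in> {0..<T}" and tT: "t \<in> {0..<T}" using s t t0_T by auto
  define P where "P r x = Complex (g (2 * pi * x) r \<bullet> e1) (g (2 * pi * x) r \<bullet> e2)" for r x
  define Z where "Z = Complex (z \<bullet> e1) (z \<bullet> e2)"
  have PZ: "P r x \<noteq> Z" if "r \<in> {s..t}" for r x
    using avoid[OF that, of "2 * pi * x"] by (auto simp: P_def Z_def)
  have loop: "P r 1 = P r 0" if "r \<in> {0..<T}" for r
    using D_per[OF that, of 0 0 0] by (simp add: P_def)
  have dP: "(P s has_vector_derivative (2 * pi) *\<^sub>R Complex (gu (2 * pi * x) s \<bullet> e1) (gu (2 * pi * x) s \<bullet> e2)) (at x)" for x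
  proof -
    have d: "((\<lambda>x. g (2 * pi * x) s \<bullet> e) has_real_derivative (gu (2 * pi * x) s \<bullet> e) * (2 * pi)) (at x)" for e
      by (rule DERIV_chain2[OF inner_u[OF sT]]) (auto intro!: derivative_eq_intros)
    have "((\<lambda>x. of_real (g (2 * pi * x) s \<bullet> e1) + \<i> * of_real (g (2 * pi * x) s \<bullet> e2)) has_vector_derivative
        of_real ((gu (2 * pi * x) s \<bullet> e1) * (2 * pi)) + \<i> * of_real ((gu (2 * pi * x) s \<bullet> e2) * (2 * pi))) (at x)"
      by (intro has_vector_derivative_add has_vector_derivative_mult_right has_vector_derivative_of_real
        d)
    then show ?thesis unfolding P_def by (simp add: Complex_eq scaleR_conv_of_real algebra_simps)
  qed
  have "continuous_on {0..1} (\<lambda>x. (2 * pi) *\<^sub>R Complex (gu (2 * pi * x) s \<bullet> e1) (gu (2 * pi * x) s \<bullet> e2))"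
    unfolding Complex_eq using sT by (intro continuous_intros) auto
  then have "P s C1_differentiable_on {0..1}"
    unfolding C1_differentiable_on_def
    by (intro exI[of _ "\<lambda>x. (2 * pi) *\<^sub>R Complex (gu (2 * pi * x) s \<bullet> e1) (gu (2 * pi * x) s \<bullet> e2)"] conjI ballI dP)
  then have vp: "valid_path (P s)"
    unfolding valid_path_def by (rule C1_differentiable_imp_piecewise)
  have "continuous_on {0..1} (\<lambda>x. dd e1 e2 (gu (2 * pi * x) s) (z - g (2 * pi * x) s))"
    unfolding dd_def using sT by (intro continuous_intros) auto
  from compact_lower_bound[OF compact_Icc this inside] obtain m where
    m: "0 < m" "\<And>x. x \<in> {0..1} \<Longrightarrow> m \<le> dd e1 e2 (gu (2 * pi * x) s) (z - g (2 * pi * x) s)" by blast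
  \<comment> \<open>The positive determinants make the argument of the curve around Z increase, at a
    rate bounded below by compactness.\<close>
  have "0 < Re (winding_number (P s) Z)"
  proof (rule winding_number_pos_lt[OF vp _ m(1)])
    show "Z \<notin> path_image (P s)" using PZ t by (auto simp: path_image_def)
    fix x :: real assume x: "0 < x" "x < 1"
    let ?d = "dd e1 e2 (gu (2 * pi * x) s) (z - g (2 * pi * x) s)"
    have "vector_derivative (P s) (at x) = (2 * pi) *\<^sub>R Complex (gu (2 * pi * x) s \<bullet> e1) (gu (2 * pi * x) s \<bullet> e2)"
      using dP vector_derivative_at by blast
    then have "Im (vector_derivative (P s) (at x) * cnj (P s x - Z)) = 2 * pi * ?d"
      by (simp add: P_def Z_def dd_def inner_diff_left algebra_simps)
    moreover have "m \<le> 2 * pi * ?d"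
    proof -
      have "m \<le> ?d" using m(2) x by simp
      also have "1 * ?d \<le> 2 * pi * ?d" using pi_gt3 inside[of "2 * pi * x"] by (intro mult_right_mono) auto
      finally show ?thesis by simp
    qed
    ultimately show "m \<le> Im (vector_derivative (P s) (at x) * cnj (P s x - Z))" by simp
  qed
  moreover have "winding_number (P s) Z = winding_number (P t) Z"
  proof (rule winding_number_homotopic_loops)
    show "homotopic_loops (- {Z}) (P s) (P t)"
      unfolding homotopic_loops
    proof (intro exI[of _ "\<lambda>y. P (s + fst y * (t - s)) (snd y)"] conjI ballI)
      have r: "s + x * (t - s) \<in> {s..t}" if "x \<in> {0..1}" for x
      proof -
        have "0 \<le> x * (t - s)" using that t by simp
        moreover have "x * (t - s) \<le> 1 * (t - s)" using that t by (intro mult_right_mono) auto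
        ultimately show ?thesis by auto
      qed
      have rT: "s + x * (t - s) \<in> {0..<T}" if "x \<in> {0..1}" for x using r[OF that] sT tT by auto
      show "continuous_on ({0..1} \<times> {0..1}) (\<lambda>y. P (s + fst y * (t - s)) (snd y))"
        unfolding P_def Complex_eq using rT by (intro continuous_intros) auto
      show "(\<lambda>y. P (s + fst y * (t - s)) (snd y)) \<in> {0..1} \<times> {0..1} \<rightarrow> - {Z}"
        using PZ[OF r] by fastforce
      fix x :: real assume x: "x \<in> {0..1}"
      show "pathfinish ((\<lambda>y. P (s + fst y * (t - s)) (snd y)) \<circ> Pair x) = pathstart ((\<lambda>y. P (s + fst y * (t - s)) (snd y)) \<circ> Pair x)"
        using loop[OF rT[OF x]] by (simp add: pathfinish_def pathstart_def)
    qed auto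
  qed
  \<comment> \<open>A point outside the hull is separated from the loop by a half-plane.\<close>
  moreover have "winding_number (P t) Z = 0"
  proof (rule winding_number_zero_outside)
    let ?S = "{w. Complex p q \<bullet> w \<le> H (p *\<^sub>R e1 + q *\<^sub>R e2) t}"
    have "continuous_on {0..1} (P t)" unfolding P_def Complex_eq using tT by (intro continuous_intros) auto
    then show "path (P t)" by (simp add: path_def)
    show "convex ?S" by (rule convex_halfspace_le)
    show "pathfinish (P t) = pathstart (P t)" using loop[OF tT] by (simp add: pathfinish_def pathstart_def)
    show "Z \<notin> ?S" using pq by (simp add: Z_def inner_complex_def inner_add_right)
    show "path_image (P t) \<subseteq> ?S"
      using H_ge[OF tT, of _ "p *\<^sub>R e1 + q *\<^sub>R e2"] by (auto simp: path_image_def P_def inner_complex_def inner_add_right)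
  qed
  ultimately show False by simp
qed

text \<open>Enclosure would last up to T while the hull collapses to the origin. Hence z projects to
  the origin, and the curve finally enters the square of half-side \<open>\<rho>\<close> around
  z.\<close>

lemma enclosed_ball_dies:
  assumes s: "s \<in> {t0..<T}" and inside: "\<And>u. 0 < dd e1 e2 (gu u s) (z - g u s)" and \<rho>: "0 < \<rho>"
    and avoid: "\<And>r u. r \<in> {s..<T} \<Longrightarrow> \<rho> \<le> \<bar>g u r \<bullet> e1 - z \<bullet> e1\<bar> \<or> \<rho> \<le> \<bar>g u r \<bullet> e2 - z \<bullet> e2\<bar>"
  shows False
proof -
  have zK: "z \<in> K e1 e2 t" if "t \<in> {s..<T}" for t
  proof (rule enclosed_persists[OF s that inside])
    fix r u assume "r \<in> {s..t}"
    then show "g u r \<bullet> e1 \<noteq> z \<bullet> e1 \<or> g u r \<bullet> e2 \<noteq> z \<bullet> e2" using avoid[of r u] \<rho> that by auto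
  qed
  have small: "\<exists>t\<in>{s..<T}. \<forall>u. norm (g u t) < e" if e: "0 < e" for e
  proof -
    obtain t1 where t1: "t1 < T" "\<And>t u. t1 < t \<Longrightarrow> t < T \<Longrightarrow> norm (g u t) < e" using shrink[OF e] by metis
    have "max t1 s < T" using t1 s by auto
    then obtain t where "max t1 s < t" "t < T" using dense by blast
    then show ?thesis using t1 by (intro bexI[of _ t]) auto
  qed
  have le: "z \<bullet> v \<le> 0" if v: "v = p *\<^sub>R e1 + q *\<^sub>R e2" "norm v = 1" for v p q
  proof (rule field_le_epsilon)
    fix e :: real assume "0 < e"
    then obtain t where t: "t \<in> {s..<T}" "\<And>u. norm (g u t) < e" using small by blast
    obtain u where "g u t \<bullet> v = H v t" using H_attained[of t v] t s t0 by auto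
    moreover have "g u t \<bullet> v \<le> norm (g u t) * norm v" by (rule norm_cauchy_schwarz)
    moreover have "z \<bullet> v \<le> H v t" using zK[OF t(1)] unfolding K_iff v(1) by blast
    ultimately show "z \<bullet> v \<le> 0 + e" using t(2)[of u] v(2) by simp
  qed
  have "z \<bullet> e1 = 0" "z \<bullet> e2 = 0"
    using le[of e1 1 0] le[of "- e1" "-1" 0] le[of e2 0 1] le[of "- e2" 0 "-1"] orth by auto
  moreover obtain t where t: "t \<in> {s..<T}" "\<And>u. norm (g u t) < \<rho>" using small[OF \<rho>] by blast
  moreover have "\<bar>g 0 t \<bullet> e1\<bar> \<le> norm (g 0 t)" "\<bar>g 0 t \<bullet> e2\<bar> \<le> norm (g 0 t)"
    using Cauchy_Schwarz_ineq2[of "g 0 t" e1] Cauchy_Schwarz_ineq2[of "g 0 t" e2] orth by auto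
  ultimately show False using avoid[OF t(1), of 0] t(2)[of 0] by auto
qed

end

section \<open>Width of the projection in a given direction and minimal width\<close>

context flow
begin

definition width :: "'a \<Rightarrow> real \<Rightarrow> real" where "width v t = H v t + H (- v) t"

lemma width_ge:
  assumes "t \<in> {0..<T}" shows "(g u t - g w t) \<bullet> v \<le> width v t"
  using H_ge[OF assms, of u v] H_ge[OF assms, of w "- v"] by (simp add: width_def inner_diff_left)

lemma width_attained:
  assumes "t \<in> {0..<T}" shows "\<exists>u w. width v t = (g u t - g w t) \<bullet> v"
proof -
  obtain u w where "g u t \<bullet> v = H v t" "g w t \<bullet> (- v) = H (- v) t"
    using H_attained[OF assms] by metis
  then have "width v t = (g u t - g w t) \<bullet> v" by (simp add: width_def inner_diff_left)
  then show ?thesis by blast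
qed

lemma width_antimono: "0 \<le> s \<Longrightarrow> s \<le> t \<Longrightarrow> t < T \<Longrightarrow> width v t \<le> width v s"
  unfolding width_def using H_antimono[of s t v] H_antimono[of s t "- v"] by linarith

lemma H_continuous:
  assumes t: "t \<in> {0..<T}"
  shows "continuous_on A (\<lambda>v. H v t)"
proof -
  have "continuous_on {0..2*pi} (\<lambda>u. norm (g u t))" using t by (intro continuous_intros) auto
  then obtain R where R: "0 < R" "\<And>u. u \<in> {0..2*pi} \<Longrightarrow> \<bar>norm (g u t)\<bar> \<le> R"
    using compact_upper_bound[OF compact_Icc] by blast
  have le: "H v t - H v' t \<le> R * norm (v - v')" for v v'
  proof -
    obtain u where u: "g u t \<bullet> v = H v t" using H_attained[OF t] by blast
    obtain w where "0 \<le> w" "w < 0 + 2 * pi" "g u t = g w t" using representative[of 0 u] t by metis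
    then have "norm (g u t) \<le> R" using R(2)[of w] by simp
    have "H v t - H v' t \<le> g u t \<bullet> (v - v')" using H_ge[OF t, of u v'] u by (simp add: inner_diff_right)
    also have "\<dots> \<le> norm (g u t) * norm (v - v')" by (rule norm_cauchy_schwarz)
    also have "\<dots> \<le> R * norm (v - v')" using \<open>norm (g u t) \<le> R\<close> by (intro mult_right_mono) auto
    finally show ?thesis .
  qed
  have "R-lipschitz_on A (\<lambda>v. H v t)"
  proof (rule lipschitz_onI)
    show "dist (H v t) (H v' t) \<le> R * dist v v'" for v v'
      using le[of v v'] le[of v' v] by (simp add: dist_real_def dist_norm abs_le_iff norm_minus_commute)
  qed (use R in simp)
  then show ?thesis by (rule lipschitz_on_continuous_on)
qed

lemma minimal_width:
  assumes t: "t \<in> {0..<T}"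
  obtains p q where "p\<^sup>2 + q\<^sup>2 = 1"
    "\<And>p' q'. p'\<^sup>2 + q'\<^sup>2 = 1 \<Longrightarrow> width (p *\<^sub>R e1 + q *\<^sub>R e2) t \<le> width (p' *\<^sub>R e1 + q' *\<^sub>R e2) t"
proof -
  let ?S = "sphere 0 1 :: (real \<times> real) set"
  have S: "z \<in> ?S \<longleftrightarrow> (fst z)\<^sup>2 + (snd z)\<^sup>2 = 1" for z
    by (auto simp: norm_prod_def)
  have c: "continuous_on ?S (\<lambda>z. width (fst z *\<^sub>R e1 + snd z *\<^sub>R e2) t)"
    unfolding width_def
    by (intro continuous_on_add continuous_on_compose2[OF H_continuous[OF t, of UNIV]] continuous_intros) auto
  have "(1, 0) \<in> ?S" by (simp add: S)
  then have ne: "?S \<noteq> {}" by blast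
  from continuous_attains_inf[OF compact_sphere ne c] obtain z where z: "z \<in> ?S"
    "\<And>z'. z' \<in> ?S \<Longrightarrow> width (fst z *\<^sub>R e1 + snd z *\<^sub>R e2) t \<le> width (fst z' *\<^sub>R e1 + snd z' *\<^sub>R e2) t"
    by blast
  show ?thesis
  proof (rule that[of "fst z" "snd z"])
    show "(fst z)\<^sup>2 + (snd z)\<^sup>2 = 1" using z(1) S by blast
    show "width (fst z *\<^sub>R e1 + snd z *\<^sub>R e2) t \<le> width (p' *\<^sub>R e1 + q' *\<^sub>R e2) t" if "p'\<^sup>2 + q'\<^sup>2 = 1" for p' q'
      using z(2)[of "(p', q')"] S[of "(p', q')"] that by simp
  qed
qed

definition min_width :: "'a \<Rightarrow> 'a \<Rightarrow> real \<Rightarrow> real" where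
  "min_width e1 e2 t = Inf {width (p *\<^sub>R e1 + q *\<^sub>R e2) t | p q. p\<^sup>2 + q\<^sup>2 = 1}"

lemma min_width_le:
  assumes "t \<in> {0..<T}" "p\<^sup>2 + q\<^sup>2 = 1"
  shows "min_width e1 e2 t \<le> width (p *\<^sub>R e1 + q *\<^sub>R e2) t"
proof -
  obtain p0 q0 where "\<And>p' q'. p'\<^sup>2 + q'\<^sup>2 = 1 \<Longrightarrow> width (p0 *\<^sub>R e1 + q0 *\<^sub>R e2) t \<le> width (p' *\<^sub>R e1 + q' *\<^sub>R e2) t"
    using minimal_width[OF assms(1)] by blast
  then show ?thesis unfolding min_width_def using assms(2)
    by (intro cInf_lower bdd_belowI[of _ "width (p0 *\<^sub>R e1 + q0 *\<^sub>R e2) t"]) auto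
qed

lemma min_width_attained:
  assumes "t \<in> {0..<T}"
  obtains p q where "p\<^sup>2 + q\<^sup>2 = 1" "min_width e1 e2 t = width (p *\<^sub>R e1 + q *\<^sub>R e2) t"
proof -
  obtain p q where pq: "p\<^sup>2 + q\<^sup>2 = 1"
    "\<And>p' q'. p'\<^sup>2 + q'\<^sup>2 = 1 \<Longrightarrow> width (p *\<^sub>R e1 + q *\<^sub>R e2) t \<le> width (p' *\<^sub>R e1 + q' *\<^sub>R e2) t"
    using minimal_width[OF assms] by blast
  then have "min_width e1 e2 t = width (p *\<^sub>R e1 + q *\<^sub>R e2) t"
    unfolding min_width_def by (intro cInf_eq_minimum) auto
  then show ?thesis using that pq(1) by blast
qed

end

context convex_flow
begin

text \<open>Zero width puts the projection on a line; at an extremal point along that line both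
  components of the tangent vanish.\<close>

lemma width_pos:
  assumes t: "t \<in> {t0..<T}" shows "0 < width e1 t"
proof (rule ccontr)
  assume neg: "\<not> 0 < width e1 t"
  have tT: "t \<in> {0..<T}" using t t0_T by blast
  have "g u t \<bullet> e1 = g 0 t \<bullet> e1" for u
    using width_ge[OF tT, of u 0 e1] width_ge[OF tT, of 0 u e1] neg by (simp add: inner_diff_left)
  then have eq: "(\<lambda>u. g u t \<bullet> e1) = (\<lambda>u. g 0 t \<bullet> e1)" by (rule ext)
  obtain u where u: "g u t \<bullet> e2 = H e2 t" using H_attained[OF tT] by blast
  have "((\<lambda>u. g 0 t \<bullet> e1) has_real_derivative gu u t \<bullet> e1) (at u)"
    using inner_u[OF tT, where k = 0 and l = 0 and u = u and e = e1] unfolding eq .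
  then have "gu u t \<bullet> e1 = 0" using DERIV_unique DERIV_const by blast
  moreover have "gu u t \<bullet> e2 = 0"
    using DERIV_local_max[OF inner_u[OF tT, where k = 0 and l = 0 and u = u and e = e2] zero_less_one] H_ge[OF tT] u by auto
  ultimately show False using gu_nonzero[OF t] by blast
qed

lemma min_width_pos:
  assumes t: "t \<in> {t0..<T}" shows "0 < min_width e1 e2 t"
proof -
  obtain p q where "p\<^sup>2 + q\<^sup>2 = 1" "min_width e1 e2 t = width (p *\<^sub>R e1 + q *\<^sub>R e2) t"
    using min_width_attained[OF t0_T[OF t]] .
  then show ?thesis using convex_flow.width_pos[OF rotate t] by simp
qed

lemma min_width_antimono:
  assumes "0 \<le> s" "s \<le> t" "t < T" shows "min_width e1 e2 t \<le> min_width e1 e2 s"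
proof -
  have sT: "s \<in> {0..<T}" "t \<in> {0..<T}" using assms by auto
  obtain p q where "p\<^sup>2 + q\<^sup>2 = 1" "min_width e1 e2 s = width (p *\<^sub>R e1 + q *\<^sub>R e2) s"
    using min_width_attained[OF sT(1)] .
  then show ?thesis
    using min_width_le[OF sT(2), of p q e1 e2] width_antimono[OF assms, of "p *\<^sub>R e1 + q *\<^sub>R e2"] by simp
qed

lemma rectangle_inside:
  assumes s: "s \<in> {t0..<T}"
    and corner: "\<And>\<sigma> \<tau>. \<sigma> \<in> {-1, 1} \<Longrightarrow> \<tau> \<in> {-1, 1} \<Longrightarrow> z + (\<sigma> * l) *\<^sub>R e1 + (\<tau> * h) *\<^sub>R e2 \<in> K e1 e2 s"
    and z': "\<bar>z' \<bullet> e1 - z \<bullet> e1\<bar> < l" "\<bar>z' \<bullet> e2 - z \<bullet> e2\<bar> < h"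
  shows "0 < dd e1 e2 (gu u s) (z' - g u s)"
proof -
  let ?x = "gu u s \<bullet> e1" and ?y = "gu u s \<bullet> e2"
  \<comment> \<open>The signs select the corner lying farthest to the right of the given tangent. As
    that corner is in the hull, a point inside the rectangle is strictly to the left.\<close>
  define \<sigma> where "\<sigma> = (if 0 \<le> ?y then 1 else -1 :: real)"
  define \<tau> where "\<tau> = (if 0 \<le> ?x then -1 else 1 :: real)"
  have "0 \<le> dd e1 e2 (gu u s) (z + (\<sigma> * l) *\<^sub>R e1 + (\<tau> * h) *\<^sub>R e2 - g u s)"
    by (intro K_tangent[OF s] corner) (auto simp: \<sigma>_def \<tau>_def)
  also have "\<dots> = dd e1 e2 (gu u s) (z' - g u s) + ?x * (\<tau> * h - (z' \<bullet> e2 - z \<bullet> e2)) - ?y * (\<sigma> * l - (z' \<bullet> e1 - z \<bullet> e1))"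
    by (simp add: dd_def inner_diff_left inner_add_left inner_e algebra_simps)
  finally have ge: "?y * (\<sigma> * l - (z' \<bullet> e1 - z \<bullet> e1)) - ?x * (\<tau> * h - (z' \<bullet> e2 - z \<bullet> e2)) \<le> dd e1 e2 (gu u s) (z' - g u s)"
    by simp
  have y: "0 \<le> ?y * (\<sigma> * l - (z' \<bullet> e1 - z \<bullet> e1))" "?y \<noteq> 0 \<Longrightarrow> 0 < ?y * (\<sigma> * l - (z' \<bullet> e1 - z \<bullet> e1))"
    using z'(1) by (auto simp: \<sigma>_def abs_less_iff zero_le_mult_iff zero_less_mult_iff)
  have x: "?x * (\<tau> * h - (z' \<bullet> e2 - z \<bullet> e2)) \<le> 0" "?x \<noteq> 0 \<Longrightarrow> ?x * (\<tau> * h - (z' \<bullet> e2 - z \<bullet> e2)) < 0"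
    using z'(2) by (auto simp: \<tau>_def abs_less_iff mult_le_0_iff mult_less_0_iff)
  show ?thesis using gu_nonzero[OF s, of u] x y ge by fastforce
qed

lemma rectangle_outside:
  assumes s: "s \<in> {t0..<T}"
    and corner: "\<And>\<sigma> \<tau>. \<sigma> \<in> {-1, 1} \<Longrightarrow> \<tau> \<in> {-1, 1} \<Longrightarrow> z + (\<sigma> * l) *\<^sub>R e1 + (\<tau> * h) *\<^sub>R e2 \<in> K e1 e2 s"
  shows "l \<le> \<bar>g u s \<bullet> e1 - z \<bullet> e1\<bar> \<or> h \<le> \<bar>g u s \<bullet> e2 - z \<bullet> e2\<bar>"
  using rectangle_inside[OF s corner, of "g u s" u] by force

text \<open>The shrinking Angenent oval \<open>cos (\<mu> y) = \<kappa> e\<^bsup>\<mu>\<^sup>2 t\<^esup> cosh (\<mu> x)\<close> is an inner barrier: since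
  \<open>x\<^sub>s\<^sup>2 + y\<^sub>s\<^sup>2 \<le> 1\<close>, the projection moves inwards at most as fast as a planar curve.\<close>

lemma oval_lifetime:
  assumes s: "s \<in> {t0..<T}" and h: "0 < h" "2 * h \<le> l"
    and corner: "\<And>\<sigma> \<tau>. \<sigma> \<in> {-1, 1} \<Longrightarrow> \<tau> \<in> {-1, 1} \<Longrightarrow> z + (\<sigma> * l) *\<^sub>R e1 + (\<tau> * h) *\<^sub>R e2 \<in> K e1 e2 s"
  shows "h * l / 4 \<le> T - s"
proof (rule ccontr)
  assume "\<not> ?thesis"
  then have short: "T - s < h * l / 4" by simp
  have sT: "s \<in> {0..<T}" using s t0_T by blast
  \<comment> \<open>With this frequency the cosine vanishes exactly on the long sides of the
    rectangle.\<close>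
  define \<mu> where "\<mu> = pi / (2 * h)"
  have \<mu>: "0 < \<mu>" "\<mu> * h = pi / 2" using h by (auto simp: \<mu>_def)
  \<comment> \<open>The hyperbolic side reaches 1 at the short sides, so the initial oval lies in
    the rectangle.\<close>
  define \<kappa> where "\<kappa> = 1 / cosh (\<mu> * l)"
  have \<kappa>: "0 < \<kappa>" by (simp add: \<kappa>_def)
  define \<kappa>' where "\<kappa>' = \<kappa> * exp (\<mu>\<^sup>2 * (T - s))"
  \<comment> \<open>The oval still surrounds z at time T when \<open>\<kappa>' < 1\<close>. The
    assumed shortness bounds the exponent by half of \<open>\<mu> * l\<close>, using pi < 4, and
    \<open>\<mu> * l\<close> is at least 3 because 2 h \<le> l; then exp (3 / 2) > 2 leaves enough
    room below the cosh.\<close>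
  have \<kappa>': "0 < \<kappa>'" "\<kappa>' < 1"
  proof -
    show "0 < \<kappa>'" using \<kappa> by (simp add: \<kappa>'_def)
    have "\<mu>\<^sup>2 * (T - s) \<le> \<mu>\<^sup>2 * (h * l / 4)" using short by (intro mult_left_mono) auto
    also have "\<dots> = pi / 8 * (\<mu> * l)" using \<mu>(2) by (simp add: power2_eq_square)
    also have "\<dots> \<le> 4 / 8 * (\<mu> * l)" using pi_less_4 \<mu> h by (intro mult_right_mono) auto
    finally have "\<mu>\<^sup>2 * (T - s) \<le> \<mu> * l / 2" by simp
    moreover have "3 \<le> \<mu> * l"
    proof -
      have "3 \<le> \<mu> * (2 * h)" using \<mu>(2) pi_gt3 by simp
      also have "\<dots> \<le> \<mu> * l" using h \<mu> by (intro mult_left_mono) auto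
      finally show ?thesis .
    qed
    ultimately have "exp (3 / 2) * exp (\<mu>\<^sup>2 * (T - s)) \<le> exp (\<mu> * l)" by (simp add: exp_add[symmetric])
    moreover have "5 / 2 * exp (\<mu>\<^sup>2 * (T - s)) \<le> exp (3 / 2) * exp (\<mu>\<^sup>2 * (T - s))"
      using exp_ge_add_one_self[of "3 / 2"] by (intro mult_right_mono) auto
    moreover have "exp (\<mu> * l) < 2 * cosh (\<mu> * l)" by (simp add: cosh_field_def)
    moreover have "0 < exp (\<mu>\<^sup>2 * (T - s))" by simp
    ultimately have "exp (\<mu>\<^sup>2 * (T - s)) < cosh (\<mu> * l)" by linarith
    then show "\<kappa>' < 1" by (simp add: \<kappa>'_def \<kappa>_def divide_simps)
  qed
  define G where "G r x = \<kappa> * exp (\<mu>\<^sup>2 * (r - s)) * cosh (\<mu> * (x - z \<bullet> e1))" for r x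
  define f where "f u r = G r (g u r \<bullet> e1) - cos (\<mu> * (g u r \<bullet> e2 - z \<bullet> e2))" for u r
  have G0: "0 < G r x" for r x using \<kappa> by (simp add: G_def)
  have main: "0 \<le> f u t" if t: "t \<in> {s..<T}" and u: "\<bar>g u t \<bullet> e2 - z \<bullet> e2\<bar> \<le> h" for u t
  proof -
    let ?q = "\<lambda>z'. \<bar>g (fst z') (snd z') \<bullet> e2 - z \<bullet> e2\<bar>"
    \<comment> \<open>The comparison is confined to the strip, beyond which the cosine becomes
      positive again at some point. On the edge of the strip the cosine vanishes and f is
      positive.\<close>
    let ?E = "(UNIV \<times> {s..t}) \<inter> ?q -` {..h}"
    have cq: "continuous_on (UNIV \<times> {0..<T}) ?q" by (intro continuous_intros) auto
    show ?thesis
    proof (rule region_max_principle[of s t ?E f "\<mu>\<^sup>2" u t])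
      show "closed ?E" using sT t
        by (intro continuous_closed_preimage continuous_on_subset[OF cq]) (auto intro!: closed_Times)
      show "(u + 2 * pi * of_int m, r) \<in> ?E" if "(u, r) \<in> ?E" for u r m
        using that D_per_int[of r 0 0 u m] sT t by auto
      show "continuous_on ?E (\<lambda>z. f (fst z) (snd z))"
        unfolding f_def G_def using sT t by (intro continuous_intros) auto
      show "f (u + 2 * pi * of_int m) r = f u r" if "r \<in> {s..t}" for u r m
        using that D_per_int[of r 0 0 u m] sT t by (auto simp: f_def)
      show "0 \<le> f u s" if "(u, s) \<in> ?E" for u
      proof -
        have le: "\<bar>g u s \<bullet> e2 - z \<bullet> e2\<bar> \<le> h" using that by simp
        show ?thesis
        proof (cases "\<bar>g u s \<bullet> e2 - z \<bullet> e2\<bar> = h")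
          case True
          then have "\<bar>\<mu> * (g u s \<bullet> e2 - z \<bullet> e2)\<bar> = pi / 2" using \<mu> by (simp add: abs_mult)
          then have "cos (\<mu> * (g u s \<bullet> e2 - z \<bullet> e2)) = 0" by (metis cos_abs_real cos_pi_half)
          then show ?thesis using G0[of s] by (simp add: f_def less_imp_le)
        next
          case False
          then have "l \<le> \<bar>g u s \<bullet> e1 - z \<bullet> e1\<bar>" using rectangle_outside[OF s corner, of u] le by auto
          then have "\<mu> * l \<le> \<bar>\<mu> * (g u s \<bullet> e1 - z \<bullet> e1)\<bar>" using \<mu> by (simp add: abs_mult)
          then have "cosh (\<mu> * l) \<le> cosh \<bar>\<mu> * (g u s \<bullet> e1 - z \<bullet> e1)\<bar>"
            using \<mu> h by (subst cosh_real_nonneg_le_iff) auto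
          then have "1 \<le> G s (g u s \<bullet> e1)" by (simp add: G_def \<kappa>_def divide_simps)
          then show ?thesis using cos_le_one[of "\<mu> * (g u s \<bullet> e2 - z \<bullet> e2)"] unfolding f_def by linarith
        qed
      qed
      fix u r assume ur: "(u, r) \<in> ?E" and r: "s < r" "r \<le> t" and neg: "f u r < 0"
        and min: "\<And>w. (w, r) \<in> ?E \<Longrightarrow> f u r \<le> f w r"
      have rT: "r \<in> {0..<T}" "r \<in> {t0..<T}" using r t s sT by auto
      have "\<bar>g u r \<bullet> e2 - z \<bullet> e2\<bar> \<noteq> h"
      proof
        assume "\<bar>g u r \<bullet> e2 - z \<bullet> e2\<bar> = h"
        then have "\<bar>\<mu> * (g u r \<bullet> e2 - z \<bullet> e2)\<bar> = pi / 2" using \<mu> by (simp add: abs_mult)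
        then have "cos (\<mu> * (g u r \<bullet> e2 - z \<bullet> e2)) = 0" by (metis cos_abs_real cos_pi_half)
        then show False using G0[of r "g u r \<bullet> e1"] neg by (simp add: f_def)
      qed
      then have "?q (u, r) < h" using ur by simp
      then obtain e where e: "0 < e" "\<And>w. \<bar>w - u\<bar> < e \<Longrightarrow> ?q (w, r) < h"
          "\<And>r'. r - e < r' \<Longrightarrow> r' < r \<Longrightarrow> 0 < r' \<and> ?q (u, r') < h"
        using eventually_nbhd[OF cq, of r u h] r sT rT by auto
      define c where "c = cos (\<mu> * (g u r \<bullet> e2 - z \<bullet> e2))"
      define G' where "G' = G r (g u r \<bullet> e1)"
      define X where "X = a u r * (gu u r \<bullet> e1)\<^sup>2"
      define Y where "Y = a u r * (gu u r \<bullet> e2)\<^sup>2"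
      define S where "S x = \<kappa> * exp (\<mu>\<^sup>2 * (r - s)) * (\<mu> * sinh (\<mu> * (x - z \<bullet> e1)))" for x
      define c' where "c' = S (g u r \<bullet> e1) * (gt u r \<bullet> e1) + \<mu> * sin (\<mu> * (g u r \<bullet> e2 - z \<bullet> e2)) * (gt u r \<bullet> e2)"
      have "- (\<mu>\<^sup>2 * G' * X) - \<mu>\<^sup>2 * c * Y \<le> c'"
        unfolding X_def Y_def c'_def
      proof (rule spatial_min[OF rT(1) e(1), where \<phi> = "G r" and \<phi>' = S
            and \<psi> = "\<lambda>y. - cos (\<mu> * (y - z \<bullet> e2))" and \<psi>' = "\<lambda>y. \<mu> * sin (\<mu> * (y - z \<bullet> e2))"])
        show "(G r has_real_derivative S x) (at x)" for x
          unfolding G_def S_def by (auto intro!: derivative_eq_intros)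
        show "(S has_real_derivative \<mu>\<^sup>2 * G') (at (g u r \<bullet> e1))"
          unfolding G_def S_def G'_def by (auto intro!: derivative_eq_intros simp: power2_eq_square)
        show "((\<lambda>y. - cos (\<mu> * (y - z \<bullet> e2))) has_real_derivative \<mu> * sin (\<mu> * (y - z \<bullet> e2))) (at y)" for y
          by (auto intro!: derivative_eq_intros)
        show "((\<lambda>y. \<mu> * sin (\<mu> * (y - z \<bullet> e2))) has_real_derivative \<mu>\<^sup>2 * c) (at (g u r \<bullet> e2))"
          unfolding c_def by (auto intro!: derivative_eq_intros simp: power2_eq_square)
        fix w assume "\<bar>w - u\<bar> < e"
        then have "(w, r) \<in> ?E" using e(2)[of w] ur by auto
        from min[OF this] show "G r (g u r \<bullet> e1) + - cos (\<mu> * (g u r \<bullet> e2 - z \<bullet> e2))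
            \<le> G r (g w r \<bullet> e1) + - cos (\<mu> * (g w r \<bullet> e2 - z \<bullet> e2))" by (simp add: f_def)
      qed
      moreover have "f u r \<le> G' - G' * X - c * Y"
      proof -
        have XY: "0 \<le> X" "0 \<le> Y" "X + Y \<le> 1" using speed_bounds[OF rT(2), of u] by (auto simp: X_def Y_def)
        have G'0: "0 < G'" using G0 by (simp add: G'_def)
        have fe: "f u r = G' - c" by (simp add: f_def G'_def c_def)
        have "G' * Y \<le> G' * (1 - X)" using XY G'0 by (intro mult_left_mono) auto
        then have "(G' - c) * Y \<le> G' - G' * X - c * Y" by (simp add: algebra_simps)
        moreover have "(G' - c) * 1 \<le> (G' - c) * Y" using XY neg fe by (intro mult_left_mono_neg) auto
        ultimately show ?thesis using fe by simp
      qed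
      then have "\<mu>\<^sup>2 * f u r \<le> \<mu>\<^sup>2 * (G' - G' * X - c * Y)" by (intro mult_left_mono) auto
      ultimately have "\<mu>\<^sup>2 * f u r \<le> c' + \<mu>\<^sup>2 * G'" by (simp add: algebra_simps)
      moreover have "(f u has_real_derivative c' + \<mu>\<^sup>2 * G') (at r within {0..<T})"
      proof -
        have "((\<lambda>q. \<kappa> * exp (\<mu>\<^sup>2 * (q - s)) * cosh (\<mu> * (g u q \<bullet> e1 - z \<bullet> e1)) - cos (\<mu> * (g u q \<bullet> e2 - z \<bullet> e2)))
            has_real_derivative c' + \<mu>\<^sup>2 * G') (at r within {0..<T})"
          unfolding G_def c'_def G'_def S_def
          by (rule derivative_eq_intros inner_t rT refl)+ (simp add: algebra_simps)
        then show ?thesis unfolding f_def[abs_def] G_def .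
      qed
      ultimately have "\<exists>c. (f u has_real_derivative c) (at r within {0..<T}) \<and> \<mu>\<^sup>2 * f u r \<le> c" by blast
      moreover have "(u, r') \<in> ?E" if "r - min e (r - s) < r'" "r' < r" for r'
      proof -
        have "r - e < r'" "s < r'" using that by linarith+
        then show ?thesis using e(3)[of r'] that r by auto
      qed
      ultimately show "\<exists>e>0. (\<forall>r'. r - e < r' \<and> r' < r \<longrightarrow> (u, r') \<in> ?E) \<and>
          (\<exists>c. (f u has_real_derivative c) (at r within {0..<T}) \<and> \<mu>\<^sup>2 * f u r \<le> c)"
        using e(1) r by (intro exI[of _ "min e (r - s)"]) auto
    qed (use sT t u in auto)
  qed
  \<comment> \<open>A square around z that stays inside the oval up to T, by continuity and
    \<open>\<kappa>' < 1\<close>.\<close>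
  obtain \<rho> where \<rho>: "0 < \<rho>" "\<rho> \<le> h" "\<And>x y. \<bar>x\<bar> < \<rho> \<Longrightarrow> \<bar>y\<bar> < \<rho> \<Longrightarrow> \<kappa>' * cosh (\<mu> * x) < cos (\<mu> * y)"
  proof -
    have "isCont (\<lambda>x. \<kappa>' * cosh (\<mu> * x)) 0" "isCont (\<lambda>y. cos (\<mu> * y)) 0" by (intro continuous_intros)+
    moreover have "0 < (1 - \<kappa>') / 2" using \<kappa>' by simp
    ultimately obtain d1 d2 where d: "0 < d1" "0 < d2"
      "\<And>x. dist x 0 < d1 \<Longrightarrow> dist (\<kappa>' * cosh (\<mu> * x)) (\<kappa>' * cosh (\<mu> * 0)) < (1 - \<kappa>') / 2"
      "\<And>y. dist y 0 < d2 \<Longrightarrow> dist (cos (\<mu> * y)) (cos (\<mu> * 0)) < (1 - \<kappa>') / 2"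
      unfolding continuous_at_eps_delta by metis
    have "\<kappa>' * cosh (\<mu> * x) < cos (\<mu> * y)" if "\<bar>x\<bar> < d1" "\<bar>y\<bar> < d2" for x y
    proof -
      have "\<bar>\<kappa>' * cosh (\<mu> * x) - \<kappa>'\<bar> < (1 - \<kappa>') / 2" "\<bar>cos (\<mu> * y) - 1\<bar> < (1 - \<kappa>') / 2"
        using d(3)[of x] d(4)[of y] that by (simp_all add: dist_real_def)
      then have "\<kappa>' * cosh (\<mu> * x) - \<kappa>' < (1 - \<kappa>') / 2" "- (cos (\<mu> * y) - 1) < (1 - \<kappa>') / 2"
        unfolding abs_less_iff by blast+
      then show ?thesis by (simp add: field_simps)
    qed
    then show ?thesis using that[of "min h (min d1 d2)"] d(1,2) h by auto
  qed
  show False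
  proof (rule enclosed_ball_dies[OF s _ \<rho>(1), of z])
    show "0 < dd e1 e2 (gu u s) (z - g u s)" for u
      by (rule rectangle_inside[OF s corner]) (use h in auto)
    fix r u assume r: "r \<in> {s..<T}"
    show "\<rho> \<le> \<bar>g u r \<bullet> e1 - z \<bullet> e1\<bar> \<or> \<rho> \<le> \<bar>g u r \<bullet> e2 - z \<bullet> e2\<bar>"
    proof (rule ccontr)
      assume "\<not> ?thesis"
      then have near: "\<bar>g u r \<bullet> e1 - z \<bullet> e1\<bar> < \<rho>" "\<bar>g u r \<bullet> e2 - z \<bullet> e2\<bar> < \<rho>" by auto
      have "G r (g u r \<bullet> e1) \<le> \<kappa>' * cosh (\<mu> * (g u r \<bullet> e1 - z \<bullet> e1))"
        unfolding G_def \<kappa>'_def using \<kappa> r \<mu> by (intro mult_right_mono mult_left_mono) (auto intro!: mult_left_mono)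
      also have "\<dots> < cos (\<mu> * (g u r \<bullet> e2 - z \<bullet> e2))" by (rule \<rho>(3)[OF near])
      finally show False using main[OF r, of u] near(2) \<rho>(2) by (simp add: f_def)
    qed
  qed
qed

section \<open>Lower bound for the width\<close>

lemma K_width:
  assumes "c \<in> K e1 e2 t" "c' \<in> K e1 e2 t"
  shows "\<bar>(c - c') \<bullet> (p *\<^sub>R e1 + q *\<^sub>R e2)\<bar> \<le> width (p *\<^sub>R e1 + q *\<^sub>R e2) t"
proof -
  let ?v = "p *\<^sub>R e1 + q *\<^sub>R e2"
  have v: "- ?v = (- p) *\<^sub>R e1 + (- q) *\<^sub>R e2" by simp
  have le: "x \<bullet> ?v \<le> H ?v t" "- (x \<bullet> ?v) \<le> H (- ?v) t" if "x \<in> K e1 e2 t" for x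
  proof -
    show "x \<bullet> ?v \<le> H ?v t" using that unfolding K_iff by blast
    have "x \<bullet> (- ?v) \<le> H (- ?v) t" using that unfolding K_iff v by blast
    then show "- (x \<bullet> ?v) \<le> H (- ?v) t" by (simp only: inner_minus_right)
  qed
  show ?thesis
    using le[OF assms(1)] le[OF assms(2)] unfolding width_def inner_diff_left abs_le_iff by linarith
qed

lemma K_comb:
  assumes "c1 \<in> K e1 e2 t" "c2 \<in> K e1 e2 t" "c3 \<in> K e1 e2 t" "0 \<le> \<alpha>" "0 \<le> \<beta>" "0 \<le> \<gamma>" "\<alpha> + \<beta> + \<gamma> = 1"
    and "z \<bullet> e1 = \<alpha> * (c1 \<bullet> e1) + \<beta> * (c2 \<bullet> e1) + \<gamma> * (c3 \<bullet> e1)"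
    and "z \<bullet> e2 = \<alpha> * (c1 \<bullet> e2) + \<beta> * (c2 \<bullet> e2) + \<gamma> * (c3 \<bullet> e2)"
  shows "z \<in> K e1 e2 t"
proof (rule K_cong)
  have "(\<Sum>i\<in>{1::nat,2,3}. (if i = 1 then \<alpha> else if i = 2 then \<beta> else \<gamma>) *\<^sub>R (if i = 1 then c1 else if i = 2 then c2 else c3)) \<in> K e1 e2 t"
    using assms by (intro convex_sum[OF _ K_convex]) auto
  then show "\<alpha> *\<^sub>R c1 + (\<beta> *\<^sub>R c2 + \<gamma> *\<^sub>R c3) \<in> K e1 e2 t" by simp
qed (use assms in \<open>simp_all add: inner_add_left\<close>)

lemma plane_dist_rotate:
  assumes "p\<^sup>2 + q\<^sup>2 = 1" shows "(v \<bullet> (p *\<^sub>R e1 + q *\<^sub>R e2))\<^sup>2 \<le> (v \<bullet> e1)\<^sup>2 + (v \<bullet> e2)\<^sup>2"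
  using norm_rotate[OF assms, of v] zero_le_power2[of "v \<bullet> (p *\<^sub>R e2 - q *\<^sub>R e1)"] by linarith

text \<open>A longest projected chord, of length D1, and a point at distance
  \<open>\<bar>\<eta>\<bar> \<ge> w / 2\<close> from its line span a triangle. The rectangle between
  the heights \<open>\<eta> / 4\<close> and \<open>\<eta> / 2\<close>, with base D1 / 2, fits into
  it, its far side being the full section of the triangle. D1 also bounds every width.\<close>

lemma rectangle_exists:
  assumes s: "s \<in> {t0..<T}" and w: "0 < w" "\<And>p q. p\<^sup>2 + q\<^sup>2 = 1 \<Longrightarrow> w \<le> width (p *\<^sub>R e1 + q *\<^sub>R e2) s"
  obtains p q z l h where "p\<^sup>2 + q\<^sup>2 = 1" "w / 16 \<le> h" "2 * h \<le> l"
    "\<And>\<sigma> \<tau>. \<sigma> \<in> {-1, 1} \<Longrightarrow> \<tau> \<in> {-1, 1} \<Longrightarrow>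
      z + (\<sigma> * l) *\<^sub>R (p *\<^sub>R e1 + q *\<^sub>R e2) + (\<tau> * h) *\<^sub>R (p *\<^sub>R e2 - q *\<^sub>R e1) \<in> K e1 e2 s"
    "\<And>p' q'. p'\<^sup>2 + q'\<^sup>2 = 1 \<Longrightarrow> width (p' *\<^sub>R e1 + q' *\<^sub>R e2) s \<le> 4 * l"
proof -
  have sT: "s \<in> {0..<T}" using s t0_T by blast
  define d where "d u u' = ((g u s - g u' s) \<bullet> e1)\<^sup>2 + ((g u s - g u' s) \<bullet> e2)\<^sup>2" for u u'
  let ?S = "{0..2*pi} \<times> {0..2*pi} :: (real \<times> real) set"
  have cd: "continuous_on ?S (\<lambda>z. d (fst z) (snd z))" unfolding d_def using sT by (intro continuous_intros) auto
  have cS: "compact ?S" by (intro compact_Times compact_Icc)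
  have "(0, 0) \<in> ?S" by simp
  then have "?S \<noteq> {}" by blast
  from continuous_attains_sup[OF cS this cd] obtain z0 where
    z0: "\<And>z. z \<in> ?S \<Longrightarrow> d (fst z) (snd z) \<le> d (fst z0) (snd z0)" by blast
  define u1 where "u1 = fst z0"
  define u2 where "u2 = snd z0"
  have u12: "d u u' \<le> d u1 u2" if "u \<in> {0..2*pi}" "u' \<in> {0..2*pi}" for u u'
    using z0[of "(u, u')"] that by (simp add: u1_def u2_def)
  have max: "d u u' \<le> d u1 u2" for u u'
  proof -
    obtain v where v: "0 \<le> v" "v < 0 + 2 * pi" "g u s = g v s" using representative[of 0 u] sT by metis
    obtain v' where v': "0 \<le> v'" "v' < 0 + 2 * pi" "g u' s = g v' s" using representative[of 0 u'] sT by metis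
    have "d u u' = d v v'" by (simp add: d_def v(3) v'(3))
    then show ?thesis using u12[of v v'] v v' by simp
  qed
  define D1 where "D1 = sqrt (d u1 u2)"
  have d0: "0 \<le> d u1 u2" by (simp add: d_def)
  then have D2: "D1\<^sup>2 = d u1 u2" "0 \<le> D1" by (auto simp: D1_def)
  have proj: "\<bar>(g u s - g u' s) \<bullet> (p *\<^sub>R e1 + q *\<^sub>R e2)\<bar> \<le> D1" if "p\<^sup>2 + q\<^sup>2 = 1" for u u' p q
  proof -
    have "((g u s - g u' s) \<bullet> (p *\<^sub>R e1 + q *\<^sub>R e2))\<^sup>2 \<le> D1\<^sup>2"
      using plane_dist_rotate[OF that, of "g u s - g u' s"] max[of u u'] unfolding D2(1) d_def by linarith
    then show ?thesis using D2(2) by (simp add: abs_le_square_iff[symmetric])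
  qed
  have wid: "width (p *\<^sub>R e1 + q *\<^sub>R e2) s \<le> D1" if "p\<^sup>2 + q\<^sup>2 = 1" for p q
    using width_attained[OF sT, of "p *\<^sub>R e1 + q *\<^sub>R e2"] proj[OF that] by (metis abs_le_iff)
  have D0: "0 < D1" using wid[of 1 0] w(1) w(2)[of 1 0] by simp
  define p where "p = ((g u1 s - g u2 s) \<bullet> e1) / D1"
  define q where "q = ((g u1 s - g u2 s) \<bullet> e2) / D1"
  have pq: "p\<^sup>2 + q\<^sup>2 = 1"
  proof -
    have "p\<^sup>2 + q\<^sup>2 = d u1 u2 / D1\<^sup>2" by (simp add: p_def q_def power_divide d_def add_divide_distrib)
    then show ?thesis using D0 by (simp only: D2(1)[symmetric]) simp
  qed
  define ex where "ex = p *\<^sub>R e1 + q *\<^sub>R e2"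
  define ey where "ey = p *\<^sub>R e2 - q *\<^sub>R e1"
  interpret R: convex_flow D T ex ey lam t0 unfolding ex_def ey_def by (rule rotate[OF pq])
  have KR: "K ex ey s = K e1 e2 s" unfolding ex_def ey_def by (rule K_rotate[OF pq])
  have dx: "(g u1 s - g u2 s) \<bullet> ex = D1" and dy: "(g u1 s - g u2 s) \<bullet> ey = 0"
  proof -
    have 1: "(g u1 s - g u2 s) \<bullet> e1 = D1 * p" "(g u1 s - g u2 s) \<bullet> e2 = D1 * q" using D0 by (simp_all add: p_def q_def)
    have "(g u1 s - g u2 s) \<bullet> ex = D1 * (p\<^sup>2 + q\<^sup>2)"
      unfolding ex_def inner_add_right inner_scaleR_right 1 by (simp add: algebra_simps power2_eq_square)
    then show "(g u1 s - g u2 s) \<bullet> ex = D1" by (simp add: pq)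
    show "(g u1 s - g u2 s) \<bullet> ey = 0"
      unfolding ey_def inner_diff_right inner_scaleR_right 1 by simp
  qed
  have ey_unit: "ey = (- q) *\<^sub>R e1 + p *\<^sub>R e2" "(- q)\<^sup>2 + p\<^sup>2 = 1" using pq by (auto simp: ey_def add.commute)
  define X where "X = g u2 s \<bullet> ex"
  define Y where "Y = g u2 s \<bullet> ey"
  have P: "g u1 s \<bullet> ex = X + D1" "g u1 s \<bullet> ey = Y" using dx dy by (auto simp: X_def Y_def inner_diff_left)
  have "\<exists>u. w / 2 \<le> \<bar>g u s \<bullet> ey - Y\<bar>"
  proof -
    obtain u u' where uu: "width ey s = (g u s - g u' s) \<bullet> ey" using width_attained[OF sT] by blast
    have "w \<le> width ey s" using w(2)[OF ey_unit(2)] by (simp add: ey_unit(1))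
    then have "w \<le> (g u s \<bullet> ey - Y) - (g u' s \<bullet> ey - Y)" using uu by (simp add: inner_diff_left)
    then have "w / 2 \<le> \<bar>g u s \<bullet> ey - Y\<bar> \<or> w / 2 \<le> \<bar>g u' s \<bullet> ey - Y\<bar>" by linarith
    then show ?thesis by blast
  qed
  then obtain uq where uq: "w / 2 \<le> \<bar>g uq s \<bullet> ey - Y\<bar>" by blast
  define \<xi> where "\<xi> = g uq s \<bullet> ex - X"
  define \<eta> where "\<eta> = g uq s \<bullet> ey - Y"
  have Q: "g uq s \<bullet> ex = X + \<xi>" "g uq s \<bullet> ey = Y + \<eta>" by (auto simp: \<xi>_def \<eta>_def)
  have \<xi>: "0 \<le> \<xi>" "\<xi> \<le> D1"
    using proj[OF pq, of u1 uq] proj[OF pq, of uq u2]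
    unfolding ex_def[symmetric] inner_diff_left P Q X_def[symmetric] by (auto simp: abs_le_iff)
  have \<eta>: "w / 2 \<le> \<bar>\<eta>\<bar>" "\<bar>\<eta>\<bar> \<le> D1"
    using uq proj[OF ey_unit(2), of uq u2] unfolding ey_unit(1)[symmetric] inner_diff_left Q Y_def[symmetric] by (auto simp: \<eta>_def)
  define z where "z = (X + \<xi> / 2 + D1 / 4) *\<^sub>R ex + (Y + 3 * \<eta> / 8) *\<^sub>R ey"
  have z: "z \<bullet> ex = X + \<xi> / 2 + D1 / 4" "z \<bullet> ey = Y + 3 * \<eta> / 8"
    by (simp_all add: z_def inner_add_left R.inner_e)
  show ?thesis
  proof (rule that[of p q "\<bar>\<eta>\<bar> / 8" "D1 / 4" z])
    show "p\<^sup>2 + q\<^sup>2 = 1" by (rule pq)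
    show "w / 16 \<le> \<bar>\<eta>\<bar> / 8" "2 * (\<bar>\<eta>\<bar> / 8) \<le> D1 / 4" using \<eta> by auto
    show "width (p' *\<^sub>R e1 + q' *\<^sub>R e2) s \<le> 4 * (D1 / 4)" if "p'\<^sup>2 + q'\<^sup>2 = 1" for p' q' using wid[OF that] by simp
    fix \<sigma> \<tau> :: real assume \<sigma>: "\<sigma> \<in> {-1, 1}" and \<tau>: "\<tau> \<in> {-1, 1}"
    define c where "c = z + (\<sigma> * (D1 / 4)) *\<^sub>R ex + (\<tau> * (\<bar>\<eta>\<bar> / 8)) *\<^sub>R ey"
    have c: "c \<bullet> ex = X + \<xi> / 2 + D1 / 4 + \<sigma> * D1 / 4" "c \<bullet> ey = Y + 3 * \<eta> / 8 + \<tau> * \<bar>\<eta>\<bar> / 8"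
      by (simp_all add: c_def inner_add_left R.inner_e z)
    have cy: "c \<bullet> ey = Y + \<eta> / 2 \<or> c \<bullet> ey = Y + \<eta> / 4" using \<tau> c(2) by (auto simp: abs_if)
    have "c \<in> K ex ey s"
      using cy
    proof
      assume y: "c \<bullet> ey = Y + \<eta> / 2"
      show ?thesis
        by (rule R.K_comb[OF R.g_in_K[OF sT, of u2] R.g_in_K[OF sT, of u1] R.g_in_K[OF sT, of uq],
          of "1 / 4 - \<sigma> / 4" "1 / 4 + \<sigma> / 4" "1 / 2"])
          (use \<sigma> in \<open>auto simp: c(1) y P Q X_def[symmetric] Y_def[symmetric] field_simps\<close>)
    next
      assume y: "c \<bullet> ey = Y + \<eta> / 4"
      \<comment> \<open>At this height the apex has weight 1 / 4 and moves the point by only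
        \<open>\<xi> / 4\<close>; b transfers the missing \<open>\<xi> / 4\<close> to the weights of
        the base points.\<close>
      define b where "b = \<xi> / (4 * D1)"
      have b: "0 \<le> b" "b \<le> 1 / 4" "b * D1 = \<xi> / 4" using \<xi> D0 by (auto simp: b_def field_simps)
      show ?thesis
        by (rule R.K_comb[OF R.g_in_K[OF sT, of u2] R.g_in_K[OF sT, of u1] R.g_in_K[OF sT, of uq],
          of "1 / 2 - \<sigma> / 4 - b" "1 / 4 + \<sigma> / 4 + b" "1 / 4"])
          (use \<sigma> b in \<open>auto simp: c(1) y P Q X_def[symmetric] Y_def[symmetric] field_simps\<close>)
    qed
    then show "z + (\<sigma> * (D1 / 4)) *\<^sub>R (p *\<^sub>R e1 + q *\<^sub>R e2) + (\<tau> * (\<bar>\<eta>\<bar> / 8)) *\<^sub>R (p *\<^sub>R e2 - q *\<^sub>R e1) \<in> K e1 e2 s"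
      by (simp only: KR c_def ex_def[symmetric] ey_def[symmetric])
  qed
qed

text \<open>The oval in the inscribed rectangle cannot outlive the flow, so h l / 4 is at most T -
  s. The constant is 16 * 4 * 4, from w \<le> 16 h, width \<le> 4 l and this lifetime.\<close>

lemma width_times_diameter:
  assumes s: "s \<in> {t0..<T}" and w: "0 < w" "\<And>p q. p\<^sup>2 + q\<^sup>2 = 1 \<Longrightarrow> w \<le> width (p *\<^sub>R e1 + q *\<^sub>R e2) s"
    and pq: "p\<^sup>2 + q\<^sup>2 = 1"
  shows "w * width (p *\<^sub>R e1 + q *\<^sub>R e2) s \<le> 256 * (T - s)"
proof (rule rectangle_exists[OF s w])
  fix p' q' z l h
  assume r: "p'\<^sup>2 + q'\<^sup>2 = 1" "w / 16 \<le> h" "2 * h \<le> l"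
    "\<And>\<sigma> \<tau>. \<sigma> \<in> {-1, 1} \<Longrightarrow> \<tau> \<in> {-1, 1} \<Longrightarrow>
      z + (\<sigma> * l) *\<^sub>R (p' *\<^sub>R e1 + q' *\<^sub>R e2) + (\<tau> * h) *\<^sub>R (p' *\<^sub>R e2 - q' *\<^sub>R e1) \<in> K e1 e2 s"
    "\<And>p' q'. p'\<^sup>2 + q'\<^sup>2 = 1 \<Longrightarrow> width (p' *\<^sub>R e1 + q' *\<^sub>R e2) s \<le> 4 * l"
  have h0: "0 < h" using w r by linarith
  have "h * l / 4 \<le> T - s"
    using convex_flow.oval_lifetime[OF rotate[OF r(1)] s h0 r(3), of z] r(4) unfolding K_rotate[OF r(1)] by blast
  moreover have "w * width (p *\<^sub>R e1 + q *\<^sub>R e2) s \<le> (16 * h) * (4 * l)"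
  proof -
    have "w * width (p *\<^sub>R e1 + q *\<^sub>R e2) s \<le> w * (4 * l)" using r(5)[OF pq] w(1) by (intro mult_left_mono) auto
    also have "\<dots> \<le> (16 * h) * (4 * l)" using r h0 by (intro mult_right_mono) auto
    finally show ?thesis .
  qed
  ultimately show ?thesis by simp
qed

text \<open>Initially the curve keeps the distance w / 16 from the centre of the rectangle. During
  the time \<open>w\<^sup>2 / 1024\<close> the squared distance drops by at most
  \<open>w\<^sup>2 / 512\<close>, which leaves more than \<open>(w / 32)\<^sup>2\<close>; no point
  of the smaller disc is crossed.\<close>

lemma enclosed_ball:
  assumes s: "s \<in> {t0..<T}" and w: "0 < w" "\<And>p q. p\<^sup>2 + q\<^sup>2 = 1 \<Longrightarrow> w \<le> width (p *\<^sub>R e1 + q *\<^sub>R e2) s"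
  obtains z where "\<And>t z'. t \<in> {s..<T} \<Longrightarrow> t - s \<le> w\<^sup>2 / 1024 \<Longrightarrow>
      ((z' - z) \<bullet> e1)\<^sup>2 + ((z' - z) \<bullet> e2)\<^sup>2 \<le> (w / 32)\<^sup>2 \<Longrightarrow> z' \<in> K e1 e2 t"
proof (rule rectangle_exists[OF s w])
  fix p q z l h
  assume r: "p\<^sup>2 + q\<^sup>2 = 1" "w / 16 \<le> h" "2 * h \<le> l"
    "\<And>\<sigma> \<tau>. \<sigma> \<in> {-1, 1} \<Longrightarrow> \<tau> \<in> {-1, 1} \<Longrightarrow>
      z + (\<sigma> * l) *\<^sub>R (p *\<^sub>R e1 + q *\<^sub>R e2) + (\<tau> * h) *\<^sub>R (p *\<^sub>R e2 - q *\<^sub>R e1) \<in> K e1 e2 s"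
  have h0: "0 < h" using w r by linarith
  define ex where "ex = p *\<^sub>R e1 + q *\<^sub>R e2"
  define ey where "ey = p *\<^sub>R e2 - q *\<^sub>R e1"
  interpret R: convex_flow D T ex ey lam t0 unfolding ex_def ey_def by (rule rotate[OF r(1)])
  have KR: "K ex ey t = K e1 e2 t" for t unfolding ex_def ey_def by (rule K_rotate[OF r(1)])
  have corner: "z + (\<sigma> * l) *\<^sub>R ex + (\<tau> * h) *\<^sub>R ey \<in> K ex ey s" if "\<sigma> \<in> {-1, 1}" "\<tau> \<in> {-1, 1}" for \<sigma> \<tau>
    using r(4)[OF that] by (simp only: KR ex_def[symmetric] ey_def[symmetric])
  have rot: "(v \<bullet> ex)\<^sup>2 + (v \<bullet> ey)\<^sup>2 = (v \<bullet> e1)\<^sup>2 + (v \<bullet> e2)\<^sup>2" for v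
    unfolding ex_def ey_def by (rule norm_rotate[OF r(1)])
  have far: "(w / 16)\<^sup>2 \<le> ((g u s - z) \<bullet> ex)\<^sup>2 + ((g u s - z) \<bullet> ey)\<^sup>2" for u
  proof -
    have "w / 16 \<le> \<bar>(g u s - z) \<bullet> ex\<bar> \<or> w / 16 \<le> \<bar>(g u s - z) \<bullet> ey\<bar>"
      using R.rectangle_outside[OF s corner, of u] r h0 by (auto simp: inner_diff_left)
    then have "(w / 16)\<^sup>2 \<le> ((g u s - z) \<bullet> ex)\<^sup>2 \<or> (w / 16)\<^sup>2 \<le> ((g u s - z) \<bullet> ey)\<^sup>2"
      using w(1) by (auto simp: abs_le_square_iff[symmetric])
    then show ?thesis using zero_le_power2[of "(g u s - z) \<bullet> ex"] zero_le_power2[of "(g u s - z) \<bullet> ey"] by linarith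
  qed
  show ?thesis
  proof (rule that[of z])
    fix t z' assume t: "t \<in> {s..<T}" "t - s \<le> w\<^sup>2 / 1024"
      and z': "((z' - z) \<bullet> e1)\<^sup>2 + ((z' - z) \<bullet> e2)\<^sup>2 \<le> (w / 32)\<^sup>2"
    then have z'': "((z' - z) \<bullet> ex)\<^sup>2 + ((z' - z) \<bullet> ey)\<^sup>2 \<le> (w / 32)\<^sup>2" by (simp add: rot)
    have "((z' - z) \<bullet> ex)\<^sup>2 \<le> (w / 32)\<^sup>2" "((z' - z) \<bullet> ey)\<^sup>2 \<le> (w / 32)\<^sup>2"
      using z'' zero_le_power2[of "(z' - z) \<bullet> ex"] zero_le_power2[of "(z' - z) \<bullet> ey"] by linarith+
    then have "\<bar>(z' - z) \<bullet> ex\<bar> \<le> w / 32" "\<bar>(z' - z) \<bullet> ey\<bar> \<le> w / 32"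
      using w(1) by (auto simp: abs_le_square_iff[symmetric])
    then have in_rect: "\<bar>z' \<bullet> ex - z \<bullet> ex\<bar> < l" "\<bar>z' \<bullet> ey - z \<bullet> ey\<bar> < h"
      using r w(1) h0 by (auto simp: inner_diff_left)
    have "z' \<in> K ex ey t"
    proof (rule R.enclosed_persists[OF s t(1)])
      show "0 < dd ex ey (gu u s) (z' - g u s)" for u by (rule R.rectangle_inside[OF s corner in_rect])
      fix r u assume rr: "r \<in> {s..t}"
      show "g u r \<bullet> ex \<noteq> z' \<bullet> ex \<or> g u r \<bullet> ey \<noteq> z' \<bullet> ey"
      proof (rule ccontr)
        assume "\<not> ?thesis"
        then have eq: "(g u r - z) \<bullet> ex = (z' - z) \<bullet> ex" "(g u r - z) \<bullet> ey = (z' - z) \<bullet> ey"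
          by (auto simp: inner_diff_left)
        have "(w / 16)\<^sup>2 - 2 * (r - s) \<le> ((g u r - z) \<bullet> ex)\<^sup>2 + ((g u r - z) \<bullet> ey)\<^sup>2"
          by (rule R.circle_barrier[OF s _ far]) (use rr t in auto)
        then have "(w / 16)\<^sup>2 - 2 * (r - s) \<le> (w / 32)\<^sup>2" using z'' unfolding eq by linarith
        then have "w\<^sup>2 / 256 - w\<^sup>2 / 1024 \<le> 2 * (r - s)" by (simp add: power_divide)
        moreover have "2 * (r - s) \<le> w\<^sup>2 / 512" using rr t by auto
        moreover have "0 < w\<^sup>2" using w by simp
        ultimately show False by linarith
      qed
    qed
    then show "z' \<in> K e1 e2 t" by (simp add: KR)
  qed
qed

text \<open>The enclosed disc of radius w / 32 has width w / 16 in every direction.\<close>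

lemma min_width_persists:
  assumes s: "s \<in> {t0..<T}" and t: "t \<in> {s..<T}" "t - s \<le> (min_width e1 e2 s)\<^sup>2 / 1024"
  shows "min_width e1 e2 s / 16 \<le> min_width e1 e2 t"
proof -
  define w where "w = min_width e1 e2 s"
  have w: "0 < w" unfolding w_def by (rule min_width_pos[OF s])
  have "w \<le> width (p *\<^sub>R e1 + q *\<^sub>R e2) s" if "p\<^sup>2 + q\<^sup>2 = 1" for p q
    unfolding w_def by (rule min_width_le[OF t0_T[OF s] that])
  from enclosed_ball[OF s w this] obtain z where
    "\<And>t z'. t \<in> {s..<T} \<Longrightarrow> t - s \<le> w\<^sup>2 / 1024 \<Longrightarrow>
      ((z' - z) \<bullet> e1)\<^sup>2 + ((z' - z) \<bullet> e2)\<^sup>2 \<le> (w / 32)\<^sup>2 \<Longrightarrow> z' \<in> K e1 e2 t" by blast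
  from this[OF t[folded w_def]]
  have z: "((z' - z) \<bullet> e1)\<^sup>2 + ((z' - z) \<bullet> e2)\<^sup>2 \<le> (w / 32)\<^sup>2 \<Longrightarrow> z' \<in> K e1 e2 t" for z' .
  have tT: "t \<in> {0..<T}" using s t t0_T by auto
  obtain p q where pq: "p\<^sup>2 + q\<^sup>2 = 1" "min_width e1 e2 t = width (p *\<^sub>R e1 + q *\<^sub>R e2) t"
    using min_width_attained[OF tT] .
  let ?v = "p *\<^sub>R e1 + q *\<^sub>R e2"
  have vv: "?v \<bullet> ?v = 1" "?v \<bullet> e1 = p" "?v \<bullet> e2 = q"
    using pq(1) by (simp_all add: inner_add_left inner_add_right inner_e power2_eq_square)
  have "z + (c * (w / 32)) *\<^sub>R ?v \<in> K e1 e2 t" if "c \<in> {-1, 1}" for c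
  proof (rule z)
    have "((z + (c * (w / 32)) *\<^sub>R ?v - z) \<bullet> e1)\<^sup>2 + ((z + (c * (w / 32)) *\<^sub>R ?v - z) \<bullet> e2)\<^sup>2 = c\<^sup>2 * (w / 32)\<^sup>2 * (p\<^sup>2 + q\<^sup>2)"
      unfolding add_diff_cancel_left' inner_scaleR_left vv by (simp add: power2_eq_square field_simps)
    also have "\<dots> = (w / 32)\<^sup>2" using that pq(1) by auto
    finally show "((z + (c * (w / 32)) *\<^sub>R ?v - z) \<bullet> e1)\<^sup>2 + ((z + (c * (w / 32)) *\<^sub>R ?v - z) \<bullet> e2)\<^sup>2 \<le> (w / 32)\<^sup>2" by simp
  qed
  from K_width[OF this[of 1] this[of "-1"], of p q]
  have "\<bar>((w / 16) *\<^sub>R ?v) \<bullet> ?v\<bar> \<le> width ?v t" by (simp add: algebra_simps flip: scaleR_left_distrib)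
  then show ?thesis using w by (simp add: vv pq(2) w_def[symmetric])
qed

section \<open>Lenses over a long thin projection\<close>

lemma K_chord:
  assumes P: "P \<in> K e1 e2 t" "P' \<in> K e1 e2 t" "P' \<bullet> e1 < P \<bullet> e1" "P' \<bullet> e1 \<le> x" "x \<le> P \<bullet> e1"
    and line: "P \<bullet> e2 = m * (P \<bullet> e1) + n" "P' \<bullet> e2 = m * (P' \<bullet> e1) + n"
  shows "x *\<^sub>R e1 + (m * x + n) *\<^sub>R e2 \<in> K e1 e2 t"
proof -
  define \<alpha> where "\<alpha> = (x - P' \<bullet> e1) / (P \<bullet> e1 - P' \<bullet> e1)"
  have \<alpha>: "0 \<le> \<alpha>" "\<alpha> \<le> 1" using P by (auto simp: \<alpha>_def divide_simps)
  have "\<alpha> * (P \<bullet> e1 - P' \<bullet> e1) = x - P' \<bullet> e1" using P(3) by (simp add: \<alpha>_def)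
  then have x: "x = \<alpha> * (P \<bullet> e1) + (1 - \<alpha>) * (P' \<bullet> e1)" by (simp add: algebra_simps)
  show ?thesis
    by (rule K_comb[OF P(1,2,2), of \<alpha> "1 - \<alpha>" 0])
      (use \<alpha> in \<open>simp_all add: inner_add_left inner_e line x algebra_simps\<close>)
qed

text \<open>With counterclockwise orientation, the arc traversed from right to left is the upper
  boundary: the hull lies below its tangents.\<close>

lemma upper_above:
  assumes "t \<in> {t0..<T}" "z \<in> K e1 e2 t" "z \<bullet> e1 = g u t \<bullet> e1" "gu u t \<bullet> e1 < 0"
  shows "z \<bullet> e2 \<le> g u t \<bullet> e2"
  using K_tangent[OF assms(1,2), of u] assms(3,4) by (simp add: dd_def inner_diff_left zero_le_mult_iff)

lemma not_vertical:
  assumes t: "t \<in> {t0..<T}" and P: "P \<in> K e1 e2 t" "g u t \<bullet> e1 < P \<bullet> e1" and P': "P' \<in> K e1 e2 t" "P' \<bullet> e1 < g u t \<bullet> e1"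
  shows "gu u t \<bullet> e1 \<noteq> 0"
proof
  assume v: "gu u t \<bullet> e1 = 0"
  then have "gu u t \<bullet> e2 \<noteq> 0" using gu_nonzero[OF t, of u] by blast
  moreover have "(gu u t \<bullet> e2) * (P \<bullet> e1 - g u t \<bullet> e1) \<le> 0" "(gu u t \<bullet> e2) * (P' \<bullet> e1 - g u t \<bullet> e1) \<le> 0"
    using K_tangent[OF t P(1), of u] K_tangent[OF t P'(1), of u] v by (simp_all add: dd_def inner_diff_left)
  ultimately show False using P(2) P'(2) by (simp add: mult_le_0_iff)
qed

text \<open>On the way from a point right of x to one left of x, the last parameter with abscissa at
  least x is a crossing towards the left; its tangent is not vertical, since the hull extends to
  both sides.\<close>

lemma upper_point:
  assumes t: "t \<in> {t0..<T}" and above: "x < g u1 t \<bullet> e1" and below: "g u2 t \<bullet> e1 < x"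
  obtains u where "g u t \<bullet> e1 = x" "gu u t \<bullet> e1 < 0"
proof -
  have tT: "t \<in> {0..<T}" using t t0_T by blast
  obtain w where w: "u1 \<le> w" "g u2 t = g w t" using representative[of u1 u2] tT by metis
  have cont: "continuous_on A (\<lambda>u. g u t \<bullet> e1)" for A using tT by (intro continuous_intros) auto
  let ?S = "{u1..w} \<inter> (\<lambda>u. g u t \<bullet> e1) -` {x..}"
  have "closed ?S" by (intro continuous_closed_preimage cont) auto
  moreover have "bounded ?S" by (rule bounded_subset[OF bounded_closed_interval[of u1 w]]) auto
  ultimately have "compact ?S" by (simp add: compact_eq_bounded_closed)
  moreover have "u1 \<in> ?S" using w above by simp
  then have "?S \<noteq> {}" by blast
  ultimately obtain u where u: "u \<in> ?S" "\<And>v. v \<in> ?S \<Longrightarrow> v \<le> u" using compact_attains_sup by metis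
  have after: "g v t \<bullet> e1 < x" if "u < v" "v \<le> w" for v
    using u(2)[of v] u(1) that by (cases "x \<le> g v t \<bullet> e1") auto
  have uw: "u < w" using u(1) below w(2) by (cases "u = w") auto
  have "g u t \<bullet> e1 \<le> x"
  proof (rule ccontr)
    assume above: "\<not> g u t \<bullet> e1 \<le> x"
    then obtain v where "u \<le> v" "v \<le> w" "g v t \<bullet> e1 = (x + g u t \<bullet> e1) / 2"
      using IVT2'[of "\<lambda>v. g v t \<bullet> e1" w "(x + g u t \<bullet> e1) / 2" u] cont below w(2) uw by auto
    then show False using after[of v] above by (cases "u = v") auto
  qed
  then have eq: "g u t \<bullet> e1 = x" using u(1) by simp
  have "gu u t \<bullet> e1 \<le> 0"
  proof (rule ccontr)
    assume "\<not> ?thesis"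
    then obtain d where d: "0 < d" "\<And>h. 0 < h \<Longrightarrow> h < d \<Longrightarrow> g u t \<bullet> e1 < g (u + h) t \<bullet> e1"
      using DERIV_pos_inc_right[OF inner_u[OF tT, where k = 0 and l = 0 and u = u and e = e1]] by auto
    define h where "h = min (d / 2) (w - u)"
    have "0 < h" "h < d" "u + h \<le> w" using d(1) uw by (auto simp: h_def)
    then show False using d(2)[of h] after[of "u + h"] eq by simp
  qed
  moreover have "gu u t \<bullet> e1 \<noteq> 0"
    by (rule not_vertical[OF t g_in_K[OF tT, of u1] _ g_in_K[OF tT, of u2]]) (use above below eq in auto)
  ultimately show ?thesis using that[OF eq] by simp
qed

text \<open>The parabola \<open>c (1 - x\<^sup>2/\<beta>\<^sup>2 - 3 t/\<beta>\<^sup>2)\<close> over a chord whose end points stay in the convex hull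
  is an inner barrier for the upper arc.\<close>

lemma lens_barrier:
  assumes s: "s \<in> {t0..<T}" and t: "t \<in> {s..<T}" and \<beta>: "0 < \<beta>" and c0: "0 < c0"
    and P: "P \<in> K e1 e2 t" "\<beta> < P \<bullet> e1" and P': "P' \<in> K e1 e2 t" "P' \<bullet> e1 < - \<beta>"
    and line: "P \<bullet> e2 = m * (P \<bullet> e1) + n" "P' \<bullet> e2 = m * (P' \<bullet> e1) + n"
    and Q: "Q \<in> K e1 e2 s" "Q \<bullet> e1 = 0" "n + 2 * c0 \<le> Q \<bullet> e2"
    and u: "gu u t \<bullet> e1 \<le> 0" "\<bar>g u t \<bullet> e1\<bar> \<le> \<beta>"
  shows "m * (g u t \<bullet> e1) + n + c0 * (1 - (g u t \<bullet> e1)\<^sup>2 / \<beta>\<^sup>2 - 3 * (t - s) / \<beta>\<^sup>2) \<le> g u t \<bullet> e2"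
proof -
  have sT: "s \<in> {0..<T}" using s t0_T by blast
  have rT: "r \<in> {0..<T}" "r \<in> {t0..<T}" if "r \<in> {s..t}" for r using that s sT t by auto
  \<comment> \<open>The hulls decrease, so the end points of the chord at the final time lie in all
    earlier hulls, and the chord bounds the upper arc from below during the whole interval.\<close>
  have Pr: "P \<in> K e1 e2 r" "P' \<in> K e1 e2 r" if "r \<in> {s..t}" for r
    using K_antimono[of r t] P(1) P'(1) that sT t by auto
  have chord: "x *\<^sub>R e1 + (m * x + n) *\<^sub>R e2 \<in> K e1 e2 r" if "r \<in> {s..t}" "\<bar>x\<bar> \<le> \<beta>" for r x
    using that P P' \<beta> by (intro K_chord[OF Pr[OF that(1)] _ _ _ line]) auto
  define \<kappa> where "\<kappa> = c0 / \<beta>\<^sup>2"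
  have \<kappa>: "0 < \<kappa>" "\<kappa> * \<beta>\<^sup>2 = c0" using c0 \<beta> by (auto simp: \<kappa>_def)
  define f where "f u r = g u r \<bullet> e2 - (m * (g u r \<bullet> e1) + n + c0 - \<kappa> * (g u r \<bullet> e1)\<^sup>2 - 3 * \<kappa> * (r - s))" for u r
  define q where "q z = max (gu (fst z) (snd z) \<bullet> e1) (\<bar>g (fst z) (snd z) \<bullet> e1\<bar> - \<beta>)" for z
  let ?E = "(UNIV \<times> {s..t}) \<inter> q -` {..0}"
  have E: "(u, r) \<in> ?E \<longleftrightarrow> r \<in> {s..t} \<and> gu u r \<bullet> e1 \<le> 0 \<and> \<bar>g u r \<bullet> e1\<bar> \<le> \<beta>" for u r
    by (auto simp: q_def)
  have cq: "continuous_on (UNIV \<times> {0..<T}) q" unfolding q_def by (intro continuous_intros) auto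
  have left: "gu u r \<bullet> e1 < 0" if "(u, r) \<in> ?E" for u r
  proof -
    have r: "r \<in> {s..t}" "gu u r \<bullet> e1 \<le> 0" "\<bar>g u r \<bullet> e1\<bar> \<le> \<beta>" using that E by blast+
    have "gu u r \<bullet> e1 \<noteq> 0"
      using r(3) P(2) P'(2) by (intro not_vertical[OF rT(2)[OF r(1)] Pr(1)[OF r(1)] _ Pr(2)[OF r(1)]]) auto
    then show ?thesis using r(2) by simp
  qed
  have above: "m * (g u r \<bullet> e1) + n \<le> g u r \<bullet> e2" if "(u, r) \<in> ?E" for u r
  proof -
    have r: "r \<in> {s..t}" "\<bar>g u r \<bullet> e1\<bar> \<le> \<beta>" using that E by blast+
    from upper_above[OF rT(2)[OF r(1)] chord[OF r] _ left[OF that]]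
    show ?thesis by (simp add: inner_add_left inner_e)
  qed
  have "0 \<le> f u t"
  proof (rule region_max_principle[of s t ?E f 0 u t])
    show "closed ?E" using sT t
      by (intro continuous_closed_preimage continuous_on_subset[OF cq]) (auto intro!: closed_Times)
    show "(u + 2 * pi * of_int k, r) \<in> ?E" if "(u, r) \<in> ?E" for u r k
      using that D_per_int[of r _ _ u k] rT(1) unfolding E by auto
    show "continuous_on ?E (\<lambda>z. f (fst z) (snd z))"
      unfolding f_def using sT t by (intro continuous_intros) auto
    show "f (u + 2 * pi * of_int k) r = f u r" if "r \<in> {s..t}" for u r k
      using D_per_int[OF rT(1)[OF that], of 0 0 u k] by (simp add: f_def)
    show "0 \<le> f u s" if uE: "(u, s) \<in> ?E" for u
    proof -
      define x where "x = g u s \<bullet> e1"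
      have x: "\<bar>x\<bar> \<le> \<beta>" and ss: "s \<in> {s..t}" using uE unfolding E by (auto simp: x_def)
      \<comment> \<open>By convexity the upper arc lies above the segments joining Q to the chord at
        abscissae \<open>\<beta>\<close> and \<open>- \<beta>\<close>. This tent of height 2 c0
        dominates the parabola of height c0: the difference is
        \<open>c0 * (1 - \<bar>x\<bar> / \<beta>)\<^sup>2\<close>.\<close>
      have tent: "m * x + n + 2 * c0 * (1 - \<bar>x\<bar> / \<beta>) \<le> g u s \<bullet> e2"
      proof (cases "0 \<le> x")
        case True
        define m' where "m' = m + (n - Q \<bullet> e2) / \<beta>"
        have "x *\<^sub>R e1 + (m' * x + Q \<bullet> e2) *\<^sub>R e2 \<in> K e1 e2 s"
          by (rule K_chord[OF chord[OF ss, of \<beta>] Q(1)])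
            (use \<beta> x True in \<open>simp_all add: inner_add_left inner_e Q(2) m'_def field_simps\<close>)
        from upper_above[OF s this _ left[OF uE]] have "m' * x + Q \<bullet> e2 \<le> g u s \<bullet> e2"
          by (simp add: inner_add_left inner_e x_def)
        moreover have "m' * x + Q \<bullet> e2 = m * x + n + (Q \<bullet> e2 - n) * (1 - x / \<beta>)"
          using \<beta> by (simp add: m'_def field_simps)
        moreover have "2 * c0 * (1 - x / \<beta>) \<le> (Q \<bullet> e2 - n) * (1 - x / \<beta>)"
          using Q(3) x \<beta> by (intro mult_right_mono) auto
        ultimately show ?thesis using True by simp
      next
        case False
        define m' where "m' = m - (n - Q \<bullet> e2) / \<beta>"
        have "x *\<^sub>R e1 + (m' * x + Q \<bullet> e2) *\<^sub>R e2 \<in> K e1 e2 s"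
          by (rule K_chord[OF Q(1) chord[OF ss, of "- \<beta>"]])
            (use \<beta> x False in \<open>simp_all add: inner_add_left inner_diff_left inner_e Q(2) m'_def field_simps\<close>)
        from upper_above[OF s this _ left[OF uE]] have "m' * x + Q \<bullet> e2 \<le> g u s \<bullet> e2"
          by (simp add: inner_add_left inner_e x_def)
        moreover have "m' * x + Q \<bullet> e2 = m * x + n + (Q \<bullet> e2 - n) * (1 + x / \<beta>)"
          using \<beta> by (simp add: m'_def field_simps)
        moreover have "2 * c0 * (1 + x / \<beta>) \<le> (Q \<bullet> e2 - n) * (1 + x / \<beta>)"
          using Q(3) x \<beta> False by (intro mult_right_mono) (auto simp: field_simps)
        ultimately show ?thesis using False by simp
      qed
      have "1 - x\<^sup>2 / \<beta>\<^sup>2 \<le> 2 * (1 - \<bar>x\<bar> / \<beta>)"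
      proof -
        have "2 * (1 - \<bar>x\<bar> / \<beta>) - (1 - x\<^sup>2 / \<beta>\<^sup>2) = (1 - \<bar>x\<bar> / \<beta>)\<^sup>2"
          by (simp add: power2_diff power_divide)
        then show ?thesis using zero_le_power2[of "1 - \<bar>x\<bar> / \<beta>"] by linarith
      qed
      then have "c0 * (1 - x\<^sup>2 / \<beta>\<^sup>2) \<le> c0 * (2 * (1 - \<bar>x\<bar> / \<beta>))" using c0 by (intro mult_left_mono) auto
      then have "c0 - \<kappa> * x\<^sup>2 \<le> 2 * c0 * (1 - \<bar>x\<bar> / \<beta>)" by (simp add: \<kappa>_def algebra_simps)
      then show ?thesis using tent by (simp add: f_def x_def[symmetric])
    qed
    fix u r assume uE: "(u, r) \<in> ?E" and r: "s < r" "r \<le> t" and neg: "f u r < 0"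
      and min: "\<And>w. (w, r) \<in> ?E \<Longrightarrow> f u r \<le> f w r"
    have rr: "r \<in> {0..<T}" "r \<in> {t0..<T}" using rT[of r] r by auto
    have "\<bar>g u r \<bullet> e1\<bar> \<noteq> \<beta>"
    proof
      assume "\<bar>g u r \<bullet> e1\<bar> = \<beta>"
      then have "(g u r \<bullet> e1)\<^sup>2 = \<beta>\<^sup>2" by (metis power2_abs)
      then have "f u r = g u r \<bullet> e2 - (m * (g u r \<bullet> e1) + n) + 3 * \<kappa> * (r - s)"
        using \<kappa>(2) by (simp add: f_def)
      moreover have "0 \<le> 3 * \<kappa> * (r - s)" using \<kappa> r by simp
      ultimately show False using above[OF uE] neg by linarith
    qed
    then have "\<bar>g u r \<bullet> e1\<bar> < \<beta>" using uE unfolding E by auto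
    then have "q (u, r) < 0" using left[OF uE] by (simp add: q_def)
    then obtain e where e: "0 < e" "\<And>w. \<bar>w - u\<bar> < e \<Longrightarrow> q (w, r) < 0"
        "\<And>r'. r - e < r' \<Longrightarrow> r' < r \<Longrightarrow> 0 < r' \<and> q (u, r') < 0"
      using eventually_nbhd[OF cq, of r u 0] r sT rr by auto
    define c' where "c' = (2 * \<kappa> * (g u r \<bullet> e1) - m) * (gt u r \<bullet> e1) + 1 * (gt u r \<bullet> e2)"
    have "- (2 * \<kappa> * (a u r * (gu u r \<bullet> e1)\<^sup>2)) - 0 * (a u r * (gu u r \<bullet> e2)\<^sup>2) \<le> c'"
      unfolding c'_def
    proof (rule spatial_min[OF rr(1) e(1), where \<phi> = "\<lambda>x. \<kappa> * x\<^sup>2 - m * x" and \<phi>' = "\<lambda>x. 2 * \<kappa> * x - m"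
          and \<psi> = "\<lambda>y. y" and \<psi>' = "\<lambda>y. 1"])
      fix w assume "\<bar>w - u\<bar> < e"
      then have "(w, r) \<in> ?E" using e(2)[of w] r by auto
      from min[OF this] show "\<kappa> * (g u r \<bullet> e1)\<^sup>2 - m * (g u r \<bullet> e1) + g u r \<bullet> e2
          \<le> \<kappa> * (g w r \<bullet> e1)\<^sup>2 - m * (g w r \<bullet> e1) + g w r \<bullet> e2" by (simp add: f_def algebra_simps)
    qed (auto intro!: derivative_eq_intros)
    moreover have "2 * \<kappa> * (a u r * (gu u r \<bullet> e1)\<^sup>2) \<le> 2 * \<kappa> * 1"
      using speed_bounds[OF rr(2), of u] \<kappa> by (intro mult_left_mono) auto
    \<comment> \<open>The curvature of the parabola costs at most \<open>2 * \<kappa>\<close>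
      because x_s^2 is at most 1, while the barrier sinks at rate
      \<open>3 * \<kappa>\<close>.\<close>
    ultimately have "0 \<le> c' + 3 * \<kappa>" using \<kappa>(1) by linarith
    then have "0 * f u r \<le> c' + 3 * \<kappa>" by simp
    moreover have "(f u has_real_derivative c' + 3 * \<kappa>) (at r within {0..<T})"
      unfolding f_def[abs_def] c'_def
      by (rule derivative_eq_intros inner_t rr refl)+ (simp add: algebra_simps)
    ultimately have "\<exists>c. (f u has_real_derivative c) (at r within {0..<T}) \<and> 0 * f u r \<le> c" by blast
    moreover have "(u, r') \<in> ?E" if "r - min e (r - s) < r'" "r' < r" for r'
    proof -
      have "r - e < r'" "s < r'" using that by linarith+
      then show ?thesis using e(3)[of r'] that r by auto
    qed
    ultimately show "\<exists>e>0. (\<forall>r'. r - e < r' \<and> r' < r \<longrightarrow> (u, r') \<in> ?E) \<and>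
        (\<exists>c. (f u has_real_derivative c) (at r within {0..<T}) \<and> 0 * f u r \<le> c)"
      using e(1) r by (intro exI[of _ "min e (r - s)"]) auto
  next
    show "(u, t) \<in> ?E" using u t E by auto
  qed (use sT t in auto)
  then show ?thesis using \<beta> by (simp add: f_def \<kappa>_def algebra_simps)
qed

lemma half_turn: "convex_flow D T (- e1) (- e2) lam t0" "K (- e1) (- e2) t = K e1 e2 t"
  using rotate[of "-1" 0] K_rotate[of "-1" 0] by simp_all

lemma lam_le_1: "lam \<le> 1"
  using speed_bounds(3,4)[of t0 0] t0 by fastforce

lemma lens_width:
  assumes s: "s \<in> {t0..<T}" and t: "t \<in> {s..<T}" "9 * (t - s) \<le> \<beta>\<^sup>2" and \<beta>: "0 < \<beta>" and c0: "0 < c0" "c0 \<le> \<beta>"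
    and P: "\<beta> < g u1 t \<bullet> e1" "g u2 t \<bullet> e1 < - \<beta>"
    and line: "g u1 t \<bullet> e2 = m * (g u1 t \<bullet> e1) + n" "g u2 t \<bullet> e2 = m * (g u2 t \<bullet> e1) + n"
    and w: "width e2 t \<le> \<beta>"
    and Q: "Q \<in> K e1 e2 s" "Q \<bullet> e1 = 0" "n + 2 * c0 \<le> Q \<bullet> e2"
    and pq: "p\<^sup>2 + q\<^sup>2 = 1"
  shows "c0 / 3 \<le> width (p *\<^sub>R e1 + q *\<^sub>R e2) t"
proof -
  have tT: "t \<in> {0..<T}" "t \<in> {t0..<T}" using s t t0_T by auto
  let ?P = "g u1 t" and ?P' = "g u2 t"
  have PK: "?P \<in> K e1 e2 t" "?P' \<in> K e1 e2 t" by (intro g_in_K tT)+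
  show ?thesis
  proof (cases "1 / 2 \<le> \<bar>q\<bar>")
    case True
    obtain u where u: "g u t \<bullet> e1 = 0" "gu u t \<bullet> e1 < 0"
      using upper_point[OF tT(2), of 0 u1 u2] P \<beta> by auto
    have "m * (g u t \<bullet> e1) + n + c0 * (1 - (g u t \<bullet> e1)\<^sup>2 / \<beta>\<^sup>2 - 3 * (t - s) / \<beta>\<^sup>2) \<le> g u t \<bullet> e2"
      by (rule lens_barrier[OF s t(1) \<beta> c0(1) PK(1) P(1) PK(2) P(2) line Q]) (use u \<beta> in auto)
    then have "n + c0 * (1 - 3 * (t - s) / \<beta>\<^sup>2) \<le> g u t \<bullet> e2" unfolding u(1) by simp
    moreover have "c0 * (2 / 3) \<le> c0 * (1 - 3 * (t - s) / \<beta>\<^sup>2)"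
      using t(2) \<beta> c0 by (intro mult_left_mono) (auto simp: field_simps)
    ultimately have y: "2 / 3 * c0 \<le> g u t \<bullet> e2 - n" by linarith
    have "0 *\<^sub>R e1 + (m * 0 + n) *\<^sub>R e2 \<in> K e1 e2 t"
      by (rule K_chord[OF PK _ _ _ line]) (use P \<beta> in auto)
    from K_width[OF g_in_K[OF tT(1), of u] this, of p q]
    have "\<bar>q * (g u t \<bullet> e2 - n)\<bar> \<le> width (p *\<^sub>R e1 + q *\<^sub>R e2) t"
      by (simp add: inner_add_right inner_diff_left inner_e u)
    moreover have "1 / 2 * (2 / 3 * c0) \<le> \<bar>q\<bar> * \<bar>g u t \<bullet> e2 - n\<bar>"
      using True y c0 by (intro mult_mono) auto
    ultimately show ?thesis by (simp add: abs_mult)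
  next
    case False
    have "\<bar>q\<bar>\<^sup>2 \<le> (1 / 2)\<^sup>2" using False by (intro power_mono) auto
    then have "(1 / 2)\<^sup>2 \<le> p\<^sup>2" using pq by (simp add: power_divide)
    then have p: "1 / 2 \<le> \<bar>p\<bar>" by (simp add: abs_le_square_iff[symmetric])
    have "\<bar>(?P - ?P') \<bullet> e2\<bar> \<le> \<beta>" using K_width[OF PK, of 0 1] w by simp
    then have "\<bar>q\<bar> * \<bar>(?P - ?P') \<bullet> e2\<bar> \<le> 1 / 2 * \<beta>" using False by (intro mult_mono) auto
    moreover have "1 / 2 * (2 * \<beta>) \<le> \<bar>p\<bar> * \<bar>(?P - ?P') \<bullet> e1\<bar>"
      using P p \<beta> by (intro mult_mono) (auto simp: inner_diff_left)
    moreover have "\<bar>p * ((?P - ?P') \<bullet> e1) + q * ((?P - ?P') \<bullet> e2)\<bar> \<le> width (p *\<^sub>R e1 + q *\<^sub>R e2) t"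
      using K_width[OF PK, of p q] by (simp add: inner_add_right)
    moreover have "\<bar>p\<bar> * \<bar>(?P - ?P') \<bullet> e1\<bar> - \<bar>q\<bar> * \<bar>(?P - ?P') \<bullet> e2\<bar> \<le> \<bar>p * ((?P - ?P') \<bullet> e1) + q * ((?P - ?P') \<bullet> e2)\<bar>"
      unfolding abs_mult[symmetric] by linarith
    ultimately show ?thesis using c0 by simp
  qed
qed

text \<open>The segment from Q to a point b of the line on the other side of the axis crosses the
  axis at a height proportional to that of Q above the line; the ratio is at least l / L.\<close>

lemma axis_point:
  assumes K: "Q \<in> K e1 e2 t" "b \<in> K e1 e2 t" and l: "0 < l" "l \<le> \<bar>b \<bullet> e1\<bar>" and sign: "(Q \<bullet> e1) * (b \<bullet> e1) \<le> 0"
    and L: "\<bar>(Q - b) \<bullet> e1\<bar> \<le> L" and b: "b \<bullet> e2 = m * (b \<bullet> e1) + n"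
  obtains y where "y *\<^sub>R e2 \<in> K e1 e2 t" "l / L * \<bar>Q \<bullet> e2 - m * (Q \<bullet> e1) - n\<bar> \<le> \<bar>y - n\<bar>"
proof -
  define \<alpha> where "\<alpha> = \<bar>b \<bullet> e1\<bar> / \<bar>(Q - b) \<bullet> e1\<bar>"
  have 1: "\<bar>(Q - b) \<bullet> e1\<bar> = \<bar>b \<bullet> e1\<bar> + \<bar>Q \<bullet> e1\<bar>"
    using sign l by (auto simp: inner_diff_left mult_le_0_iff abs_if)
  have \<alpha>: "0 \<le> \<alpha>" "\<alpha> \<le> 1" using 1 l by (auto simp: \<alpha>_def divide_simps)
  have x: "\<alpha> * (Q \<bullet> e1) + (1 - \<alpha>) * (b \<bullet> e1) = 0"
  proof -
    have "\<alpha> * ((Q - b) \<bullet> e1) = - (b \<bullet> e1)"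
      using sign l by (auto simp: \<alpha>_def inner_diff_left mult_le_0_iff abs_if field_simps)
    then show ?thesis by (simp add: inner_diff_left algebra_simps)
  qed
  define y where "y = \<alpha> * (Q \<bullet> e2) + (1 - \<alpha>) * (b \<bullet> e2)"
  have yn: "y - n = \<alpha> * (Q \<bullet> e2 - m * (Q \<bullet> e1) - n)"
  proof -
    have "y - n = \<alpha> * (Q \<bullet> e2 - m * (Q \<bullet> e1) - n) + m * (\<alpha> * (Q \<bullet> e1) + (1 - \<alpha>) * (b \<bullet> e1))"
      by (simp add: y_def b algebra_simps)
    then show ?thesis by (simp add: x)
  qed
  show ?thesis
  proof (rule that[of y])
    show "y *\<^sub>R e2 \<in> K e1 e2 t"
      by (rule K_comb[OF K(1,2,2), of \<alpha> "1 - \<alpha>" 0]) (use \<alpha> x in \<open>simp_all add: inner_e y_def\<close>)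
    have "l / L \<le> \<alpha>" unfolding \<alpha>_def using 1 l L by (intro frac_le) auto
    then show "l / L * \<bar>Q \<bullet> e2 - m * (Q \<bullet> e1) - n\<bar> \<le> \<bar>y - n\<bar>"
      unfolding yn abs_mult abs_of_nonneg[OF \<alpha>(1)] by (intro mult_right_mono) auto
  qed
qed

text \<open>The axis e2 is the direction of least width. At time s the hull reaches at least l = lam
  (T - s) / w to both sides. Thinness with the factor \<open>M\<^sup>2\<close> keeps both tips
  beyond 3 r at time t, where r = sqrt (T - s), so a lens over the half-length
  \<open>\<beta> = 3 * r\<close> survives until t.\<close>

lemma width_growth_frame:
  assumes s: "s \<in> {t0..<T}" and t: "t \<in> {s..<T}" and M: "1 \<le> M" "T - s \<le> M\<^sup>2 * (T - t)"
    and w: "0 < w" "width e2 s = w" "\<And>p q. p\<^sup>2 + q\<^sup>2 = 1 \<Longrightarrow> w \<le> width (p *\<^sub>R e1 + q *\<^sub>R e2) s"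
    and thin: "w \<le> lam / (2 * M\<^sup>2) * sqrt (T - s)"
    and pq: "p\<^sup>2 + q\<^sup>2 = 1"
  shows "lam / 6144 * w \<le> width (p *\<^sub>R e1 + q *\<^sub>R e2) t"
proof -
  interpret R: convex_flow D T "- e1" "- e2" lam t0 by (rule half_turn)
  have sT: "s \<in> {0..<T}" and tT: "t \<in> {0..<T}" "t \<in> {t0..<T}" using s t t0_T by auto
  define r where "r = sqrt (T - s)"
  have r: "0 < r" "r\<^sup>2 = T - s" using sT by (auto simp: r_def)
  have M2: "1 \<le> M\<^sup>2" using M(1) by (simp add: one_le_power)
  have thin': "2 * M\<^sup>2 * w \<le> lam * r" using thin M(1) by (simp add: r_def[symmetric] pos_le_divide_eq mult.commute)
  have wr: "2 * w \<le> lam * r" "2 * w \<le> r"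
  proof -
    have "1 * (2 * w) \<le> M\<^sup>2 * (2 * w)" using M2 w by (intro mult_right_mono) auto
    then show "2 * w \<le> lam * r" using thin' by simp
    also have "\<dots> \<le> 1 * r" using lam_le_1 r by (intro mult_right_mono) auto
    finally show "2 * w \<le> r" by simp
  qed
  define l where "l = lam * (T - s) / w"
  have l: "0 < l" using lam r w by (simp add: l_def flip: r(2))
  have "w * w \<le> lam * r * r"
    using wr w r by (intro mult_mono) auto
  then have wl: "w \<le> l" using w by (simp add: l_def r(2)[symmetric] pos_le_divide_eq power2_eq_square mult.assoc)
  have Hw: "H e2 s + H (- e2) s \<le> w" using w(2) by (simp add: width_def)
  have l2: "2 * lam * (T - s) / w = 2 * l" by (simp add: l_def)
  have tip_s: "l \<le> H e1 s" "l \<le> H (- e1) s"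
    using tip[OF s w(1) Hw] R.tip[OF s w(1)] Hw wl unfolding l2 by (simp_all add: add.commute)
  have Hwt: "H e2 t + H (- e2) t \<le> w" using width_antimono[of s t e2] t sT w(2) by (simp add: width_def)
  have "4 * r \<le> 2 * lam * (T - t) / w"
  proof -
    have "(2 * M\<^sup>2 * w) * r \<le> (lam * r) * r" using thin' r by (intro mult_right_mono) auto
    then have "M\<^sup>2 * (2 * w * r) \<le> lam * r\<^sup>2" by (simp only: power2_eq_square ac_simps)
    also have "\<dots> \<le> lam * (M\<^sup>2 * (T - t))" using M(2) lam r(2) by (intro mult_left_mono) auto
    finally have "M\<^sup>2 * (2 * w * r) \<le> M\<^sup>2 * (lam * (T - t))" by (simp add: ac_simps)
    then have "2 * w * r \<le> lam * (T - t)" by (rule mult_left_le_imp_le) (use M2 in linarith)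
    then show ?thesis using w by (simp add: pos_le_divide_eq algebra_simps)
  qed
  then have tip_t: "3 * r < H e1 t" "3 * r < H (- e1) t"
    using tip[OF tT(2) w(1) Hwt] R.tip[OF tT(2) w(1)] Hwt wr r by (simp_all add: add.commute)
  obtain u1 where u1: "g u1 t \<bullet> e1 = H e1 t" using H_attained[OF tT(1)] by blast
  obtain u2 where u2: "g u2 t \<bullet> (- e1) = H (- e1) t" using H_attained[OF tT(1)] by blast
  have P: "3 * r < g u1 t \<bullet> e1" "g u2 t \<bullet> e1 < - (3 * r)" using u1 u2 tip_t by auto
  define m where "m = ((g u1 t - g u2 t) \<bullet> e2) / ((g u1 t - g u2 t) \<bullet> e1)"
  define n where "n = g u1 t \<bullet> e2 - m * (g u1 t \<bullet> e1)"
  have "m * ((g u1 t - g u2 t) \<bullet> e1) = (g u1 t - g u2 t) \<bullet> e2"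
    using P r by (simp add: m_def inner_diff_left)
  then have line: "g u1 t \<bullet> e2 = m * (g u1 t \<bullet> e1) + n" "g u2 t \<bullet> e2 = m * (g u2 t \<bullet> e1) + n"
    by (simp_all add: n_def inner_diff_left algebra_simps)
  obtain v1 where "g v1 s \<bullet> e1 = H e1 s" using H_attained[OF sT] by blast
  then have v1: "l \<le> g v1 s \<bullet> e1" using tip_s by simp
  obtain v2 where "g v2 s \<bullet> (- e1) = H (- e1) s" using H_attained[OF sT] by blast
  then have v2: "g v2 s \<bullet> e1 \<le> - l" using tip_s by simp
  define m' where "m' = ((g v1 s - g v2 s) \<bullet> e2) / ((g v1 s - g v2 s) \<bullet> e1)"
  define n' where "n' = g v1 s \<bullet> e2 - m' * (g v1 s \<bullet> e1)"
  have "m' * ((g v1 s - g v2 s) \<bullet> e1) = (g v1 s - g v2 s) \<bullet> e2"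
    using v1 v2 l by (simp add: m'_def inner_diff_left)
  then have line': "g v1 s \<bullet> e2 = m' * (g v1 s \<bullet> e1) + n'" "g v2 s \<bullet> e2 = m' * (g v2 s \<bullet> e1) + n'"
    by (simp_all add: n'_def inner_diff_left algebra_simps)
  have KL: "\<bar>(z - z') \<bullet> e1\<bar> \<le> 256 * (T - s) / w" if "z \<in> K e1 e2 s" "z' \<in> K e1 e2 s" for z z'
  proof -
    have "w * width e1 s \<le> 256 * (T - s)" using width_times_diameter[OF s w(1,3), of 1 0] by simp
    then have "width e1 s \<le> 256 * (T - s) / w" using w(1) by (simp add: pos_le_divide_eq mult.commute)
    then show ?thesis using K_width[OF that, of 1 0] by simp
  qed
  have "lam * x / w / (256 * x / w) = lam / 256" if "x \<noteq> 0" for x using w(1) that by simp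
  from this[of "T - s"] have lL: "l / (256 * (T - s) / w) = lam / 256" using sT unfolding l_def by auto
  have gK: "g u s \<in> K e1 e2 s" for u by (rule g_in_K[OF sT])
  have "\<exists>u. w / 2 \<le> \<bar>g u s \<bullet> e2 - m' * (g u s \<bullet> e1) - n'\<bar>"
  proof -
    \<comment> \<open>The unit normal of the chord line has components - m' / R and 1 / R; since the
      width in this direction is at least w, one of two extremal points is w / 2 away from the
      line.\<close>
    define R where "R = sqrt (1 + m'\<^sup>2)"
    have R: "1 \<le> R" "R\<^sup>2 = 1 + m'\<^sup>2" by (auto simp: R_def)
    have "(- m' / R)\<^sup>2 + (1 / R)\<^sup>2 = (1 + m'\<^sup>2) / R\<^sup>2" by (simp add: power_divide add_divide_distrib)
    also have "\<dots> = 1" using R by (simp flip: R(2))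
    finally have unit: "(- m' / R)\<^sup>2 + (1 / R)\<^sup>2 = 1" .
    obtain u u' where "width ((- m' / R) *\<^sub>R e1 + (1 / R) *\<^sub>R e2) s = (g u s - g u' s) \<bullet> ((- m' / R) *\<^sub>R e1 + (1 / R) *\<^sub>R e2)"
      using width_attained[OF sT] by blast
    then have "w \<le> (g u s - g u' s) \<bullet> ((- m' / R) *\<^sub>R e1 + (1 / R) *\<^sub>R e2)" using w(3)[OF unit] by simp
    also have "\<dots> = ((g u s \<bullet> e2 - m' * (g u s \<bullet> e1) - n') - (g u' s \<bullet> e2 - m' * (g u' s \<bullet> e1) - n')) / R"
      using R(1) unfolding inner_add_right inner_scaleR_right inner_diff_left by (simp add: field_simps)
    finally have "w * R \<le> (g u s \<bullet> e2 - m' * (g u s \<bullet> e1) - n') - (g u' s \<bullet> e2 - m' * (g u' s \<bullet> e1) - n')"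
      using R by (simp add: pos_le_divide_eq)
    moreover have "w * 1 \<le> w * R" using R w by (intro mult_left_mono) auto
    ultimately have "w / 2 \<le> \<bar>g u s \<bullet> e2 - m' * (g u s \<bullet> e1) - n'\<bar> \<or> w / 2 \<le> \<bar>g u' s \<bullet> e2 - m' * (g u' s \<bullet> e1) - n'\<bar>"
      by linarith
    then show ?thesis by blast
  qed
  then obtain v where v: "w / 2 \<le> \<bar>g v s \<bullet> e2 - m' * (g v s \<bullet> e1) - n'\<bar>" by blast
  have "\<exists>y. y *\<^sub>R e2 \<in> K e1 e2 s \<and> lam / 256 * \<bar>g v s \<bullet> e2 - m' * (g v s \<bullet> e1) - n'\<bar> \<le> \<bar>y - n'\<bar>"
  proof (cases "0 \<le> g v s \<bullet> e1")
    case True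
    have "l \<le> \<bar>g v2 s \<bullet> e1\<bar>" "(g v s \<bullet> e1) * (g v2 s \<bullet> e1) \<le> 0"
      using True v2 l by (auto simp: mult_le_0_iff)
    from axis_point[OF gK gK l this KL[OF gK gK] line'(2)] show ?thesis unfolding lL by blast
  next
    case False
    have "l \<le> \<bar>g v1 s \<bullet> e1\<bar>" "(g v s \<bullet> e1) * (g v1 s \<bullet> e1) \<le> 0"
      using False v1 l by (auto simp: mult_le_0_iff)
    from axis_point[OF gK gK l this KL[OF gK gK] line'(1)] show ?thesis unfolding lL by blast
  qed
  then obtain y where y: "y *\<^sub>R e2 \<in> K e1 e2 s" "lam / 256 * \<bar>g v s \<bullet> e2 - m' * (g v s \<bullet> e1) - n'\<bar> \<le> \<bar>y - n'\<bar>" by blast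
  have "0 *\<^sub>R e1 + (m' * 0 + n') *\<^sub>R e2 \<in> K e1 e2 s"
    by (rule K_chord[OF gK gK _ _ _ line']) (use v1 v2 l in auto)
  then have n': "n' *\<^sub>R e2 \<in> K e1 e2 s" by simp
  have "lam / 256 * (w / 2) \<le> lam / 256 * \<bar>g v s \<bullet> e2 - m' * (g v s \<bullet> e1) - n'\<bar>"
    using v lam by (intro mult_left_mono) auto
  then have gap: "lam * w / 512 \<le> \<bar>y - n'\<bar>" using y(2) by simp
  \<comment> \<open>The chords at times s and t are unrelated. But two hull points on the axis with
    gap lam w / 512 cannot both be within half of it from the height n of the later chord; the side
    of Y decides between the lens and its half-turn.\<close>
  obtain Y where Y: "Y *\<^sub>R e2 \<in> K e1 e2 s" "lam * w / 1024 \<le> \<bar>Y - n\<bar>"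
  proof (cases "lam * w / 1024 \<le> \<bar>y - n\<bar>")
    case False
    then have "lam * w / 1024 \<le> \<bar>n' - n\<bar>" using gap by linarith
    then show ?thesis using that n' by blast
  qed (use that y in blast)
  \<comment> \<open>Half of the offset of Y, since the lens asks for a point at height 2 c0; the
    width c0 / 3 then gives the factor lam / 6144.\<close>
  define c0 where "c0 = lam * w / 2048"
  have c0: "0 < c0" "c0 \<le> 3 * r"
  proof -
    show "0 < c0" using lam w by (simp add: c0_def)
    have "lam * w \<le> 1 * w" using lam_le_1 w by (intro mult_right_mono) auto
    then show "c0 \<le> 3 * r" using wr(2) w(1) r(1) unfolding c0_def by linarith
  qed
  have dur: "9 * (t - s) \<le> (3 * r)\<^sup>2" using t r(2) by (simp add: power_mult_distrib)
  have wt: "width e2 t \<le> 3 * r" "width (- e2) t \<le> 3 * r" using Hwt wr w by (simp_all add: width_def)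
  have r3: "0 < 3 * r" using r by simp
  have "c0 / 3 \<le> width (p *\<^sub>R e1 + q *\<^sub>R e2) t"
  proof (cases "n \<le> Y")
    case True
    show ?thesis
      by (rule lens_width[OF s t dur r3 c0 P line wt(1) Y(1) _ _ pq])
        (use True Y(2) in \<open>simp_all add: inner_e c0_def\<close>)
  next
    case False
    have unit: "(- p)\<^sup>2 + (- q)\<^sup>2 = 1" using pq by simp
    have "c0 / 3 \<le> width ((- p) *\<^sub>R (- e1) + (- q) *\<^sub>R (- e2)) t"
      by (rule R.lens_width[OF s t dur r3 c0 _ _ _ _ wt(2) _ _ _ unit, of u2 u1 m "- n" "Y *\<^sub>R e2"])
        (use False Y P line in \<open>simp_all add: inner_e c0_def half_turn(2)\<close>)
    then show ?thesis by simp
  qed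
  then show ?thesis by (simp add: c0_def)
qed

lemma width_growth:
  assumes s: "s \<in> {t0..<T}" and t: "t \<in> {s..<T}" and M: "1 \<le> M" "T - s \<le> M\<^sup>2 * (T - t)"
    and thin: "min_width e1 e2 s \<le> lam / (2 * M\<^sup>2) * sqrt (T - s)"
  shows "lam / 6144 * min_width e1 e2 s \<le> min_width e1 e2 t"
proof -
  define w where "w = min_width e1 e2 s"
  have sT: "s \<in> {0..<T}" and tT: "t \<in> {0..<T}" using s t t0_T by auto
  have w0: "0 < w" unfolding w_def by (rule min_width_pos[OF s])
  obtain p q where pq: "p\<^sup>2 + q\<^sup>2 = 1" "min_width e1 e2 s = width (p *\<^sub>R e1 + q *\<^sub>R e2) s"
    using min_width_attained[OF sT] .
  obtain p' q' where pq': "p'\<^sup>2 + q'\<^sup>2 = 1" "min_width e1 e2 t = width (p' *\<^sub>R e1 + q' *\<^sub>R e2) t"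
    using min_width_attained[OF tT] .
  define ex where "ex = q *\<^sub>R e1 + (- p) *\<^sub>R e2"
  define ey where "ey = q *\<^sub>R e2 - (- p) *\<^sub>R e1"
  have unit: "q\<^sup>2 + (- p)\<^sup>2 = 1" using pq(1) by simp
  interpret R: convex_flow D T ex ey lam t0 unfolding ex_def ey_def by (rule rotate[OF unit])
  have comb: "x *\<^sub>R ex + y *\<^sub>R ey = (x * q + y * p) *\<^sub>R e1 + (y * q - x * p) *\<^sub>R e2"
    and norm: "(x * q + y * p)\<^sup>2 + (y * q - x * p)\<^sup>2 = x\<^sup>2 + y\<^sup>2" for x y
  proof -
    show "x *\<^sub>R ex + y *\<^sub>R ey = (x * q + y * p) *\<^sub>R e1 + (y * q - x * p) *\<^sub>R e2"
      by (simp add: ex_def ey_def algebra_simps)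
    have "(x * q + y * p)\<^sup>2 + (y * q - x * p)\<^sup>2 = (x\<^sup>2 + y\<^sup>2) * (p\<^sup>2 + q\<^sup>2)"
      by (simp add: power2_eq_square algebra_simps)
    then show "(x * q + y * p)\<^sup>2 + (y * q - x * p)\<^sup>2 = x\<^sup>2 + y\<^sup>2" by (simp add: pq(1))
  qed
  have wey: "width ey s = w" using pq(2) by (simp add: ey_def w_def add.commute)
  have wmin: "w \<le> width (x *\<^sub>R ex + y *\<^sub>R ey) s" if "x\<^sup>2 + y\<^sup>2 = 1" for x y
    unfolding comb w_def by (rule min_width_le[OF sT]) (simp add: norm that)
  have "lam / 6144 * w \<le> width ((p' * q - q' * p) *\<^sub>R ex + (p' * p + q' * q) *\<^sub>R ey) t"
  proof (rule R.width_growth_frame[OF s t M w0 wey wmin thin[folded w_def]])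
    have "(p' * q - q' * p)\<^sup>2 + (p' * p + q' * q)\<^sup>2 = (p'\<^sup>2 + q'\<^sup>2) * (p\<^sup>2 + q\<^sup>2)"
      by (simp add: power2_eq_square algebra_simps)
    then show "(p' * q - q' * p)\<^sup>2 + (p' * p + q' * q)\<^sup>2 = 1" by (simp add: pq(1) pq'(1))
  qed
  moreover have "(p' * q - q' * p) *\<^sub>R ex + (p' * p + q' * q) *\<^sub>R ey = p' *\<^sub>R e1 + q' *\<^sub>R e2"
  proof -
    have "(p' * q - q' * p) * q + (p' * p + q' * q) * p = p' * (p\<^sup>2 + q\<^sup>2)"
      "(p' * p + q' * q) * q - (p' * q - q' * p) * p = q' * (p\<^sup>2 + q\<^sup>2)"
      by (simp_all add: power2_eq_square algebra_simps)
    then show ?thesis unfolding comb by (simp add: pq(1))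
  qed
  ultimately show ?thesis by (simp add: pq'(2) w_def)
qed

text \<open>If the ratio of the width to \<open>\<surd>(T - t)\<close> is almost minimal at \<open>t\<close>, then it cannot be
  small on the whole preceding time interval of comparable length, by the growth of thin curves;
  and once it is not small, persistence of the width and growth together bound it at \<open>t\<close>.\<close>

lemma width_bound:
  obtains \<omega> where "0 < \<omega>" "\<And>t. t \<in> {t0..<T} \<Longrightarrow> \<omega> * sqrt (T - t) \<le> min_width e1 e2 t"
proof -
  define W where "W = min_width e1 e2"
  define c where "c = lam / 6144"
  \<comment> \<open>Since c M = 2, thinness over a time ratio of exactly \<open>M\<^sup>2\<close>
    would make the ratio at t1 at least twice its infimum, against the choice of t1.\<close>
  define M where "M = 2 / c"
  define \<epsilon> where "\<epsilon> = lam / (2 * M\<^sup>2)"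
  define \<delta> where "\<delta> t = sqrt (T - t)" for t
  define \<omega>1 where "\<omega>1 = min (c * \<epsilon> / 16) (c * (W t0 / \<delta> t0))"
  have c: "0 < c" "c \<le> 1" using lam lam_le_1 by (auto simp: c_def)
  have M: "1 \<le> M" "c * M = 2" using c by (auto simp: M_def divide_simps)
  have \<epsilon>: "0 < \<epsilon>" using lam M by (simp add: \<epsilon>_def)
  have W0: "0 < W t" if "t \<in> {t0..<T}" for t unfolding W_def by (rule min_width_pos[OF that])
  have \<delta>0: "0 < \<delta> t" if "t \<in> {t0..<T}" for t using that by (simp add: \<delta>_def)
  have \<delta>_mono: "\<delta> t \<le> \<delta> s" if "s \<le> t" for s t using that by (simp add: \<delta>_def)
  have W_mono: "W t \<le> W s" if "t0 \<le> s" "s \<le> t" "t < T" for s t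
    unfolding W_def using that t0 by (intro min_width_antimono) auto
  have t0T: "t0 \<in> {t0..<T}" using t0 by simp
  have \<omega>1_le: "\<omega>1 \<le> c * \<epsilon> / 16" "\<omega>1 \<le> c * (W t0 / \<delta> t0)" unfolding \<omega>1_def by (rule min.cobounded1, rule min.cobounded2)
  have \<omega>1: "0 < \<omega>1" using c \<epsilon> W0[OF t0T] \<delta>0[OF t0T] by (simp add: \<omega>1_def)
  have grow: "c * W s \<le> W t" if "s \<in> {t0..<T}" "t \<in> {s..<T}" "T - s \<le> M\<^sup>2 * (T - t)" "W s \<le> \<epsilon> * \<delta> s" for s t
    using width_growth[OF that(1,2) M(1) that(3)] that(4) by (simp add: W_def c_def \<epsilon>_def \<delta>_def)
  have persist: "W s / 16 \<le> W t" if "s \<in> {t0..<T}" "t \<in> {s..<T}" "t - s \<le> (W s)\<^sup>2 / 1024" for s t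
    using min_width_persists that unfolding W_def by blast
  show ?thesis
  proof (rule that[of "2 / 3 * \<omega>1"])
    show "0 < 2 / 3 * \<omega>1" using \<omega>1 by simp
    fix t assume t: "t \<in> {t0..<T}"
    define I where "I = (INF r\<in>{t0..t}. W r / \<delta> r)"
    have tt: "r \<in> {t0..<T}" if "r \<in> {t0..t}" for r using that t by auto
    have lower: "W t / \<delta> t0 \<le> W r / \<delta> r" if "r \<in> {t0..t}" for r
      using W_mono[of r t] \<delta>_mono[of t0 r] \<delta>0[OF tt[OF that]] W0[OF t] that t by (intro frac_le) auto
    have bdd: "bdd_below ((\<lambda>r. W r / \<delta> r) ` {t0..t})" using lower by (intro bdd_belowI2[of _ "W t / \<delta> t0"]) auto
    have ne: "{t0..t} \<noteq> {}" using t by simp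
    have "W t / \<delta> t0 \<le> I" unfolding I_def by (rule cINF_greatest[OF ne lower])
    then have I0: "0 < I" using W0[OF t] \<delta>0[OF t0T] by (meson divide_pos_pos less_le_trans)
    have Ile: "I \<le> W r / \<delta> r" if "r \<in> {t0..t}" for r
      unfolding I_def by (rule cINF_lower[OF bdd that])
    \<comment> \<open>A near-minimiser replaces a minimiser, so no continuity of the width in time
      is needed; the factor 3 / 2 only has to be less than 2.\<close>
    obtain t1 where t1: "t1 \<in> {t0..t}" "W t1 / \<delta> t1 < 3 / 2 * I"
      using I0 cInf_lessD[of "(\<lambda>r. W r / \<delta> r) ` {t0..t}" "3 / 2 * I"] ne unfolding I_def by auto
    have t1T: "t1 \<in> {t0..<T}" by (rule tt[OF t1(1)])
    define s where "s = max t0 (T - M\<^sup>2 * (T - t1))"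
    have M2: "1 \<le> M\<^sup>2" using M(1) by (simp add: one_le_power)
    have "1 * (T - t1) \<le> M\<^sup>2 * (T - t1)" using M2 t1T by (intro mult_right_mono) auto
    then have "T - M\<^sup>2 * (T - t1) \<le> t1" by (simp only: mult_1 diff_le_eq add.commute)
    then have s: "s \<in> {t0..<T}" "s \<le> t1" using t1T by (auto simp: s_def)
    have Ts: "T - r \<le> M\<^sup>2 * (T - t1)" if "s \<le> r" for r using that by (simp add: s_def)
    have "\<omega>1 * \<delta> t1 \<le> W t1"
    proof (cases "\<exists>r\<in>{s..t1}. \<epsilon> * \<delta> r < W r")
      case True
      define S where "S = {r\<in>{s..t1}. \<epsilon> * \<delta> r < W r}"
      have S: "S \<noteq> {}" "bdd_above S" using True by (auto simp: S_def intro: bdd_aboveI[of _ t1])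
      define \<tau> where "\<tau> = (W t1)\<^sup>2 / 1024"
      have \<tau>: "0 < \<tau>" using W0[OF t1T] by (simp add: \<tau>_def)
      have "Sup S - \<tau> / 2 < Sup S" using \<tau> by simp
      then obtain r1 where r1: "r1 \<in> S" "Sup S - \<tau> / 2 < r1" using less_cSup_iff[OF S] by blast
      have r1S: "s \<le> r1" "r1 \<le> t1" "\<epsilon> * \<delta> r1 < W r1" using r1(1) by (auto simp: S_def)
      have r1T: "r1 \<in> {t0..<T}" using r1S s t1T by auto
      have r1_le: "r1 \<le> Sup S" by (rule cSup_upper[OF r1(1) S(2)])
      \<comment> \<open>The supremum of the times that are not thin may fail to be attained.
        Persistence carries the width from r1, just before it, to r2, just after it, within time
        \<open>\<tau>\<close>; unless r2 is t1 itself, the curve is thin at r2 and growth applies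
        from there.\<close>
      define r2 where "r2 = min t1 (Sup S + \<tau> / 2)"
      have r2: "r1 \<le> r2" "r2 \<le> t1" "r2 - r1 \<le> \<tau>" using r1S r1_le r1(2) \<tau> by (auto simp: r2_def)
      have r2T: "r2 \<in> {r1..<T}" "r2 \<in> {t0..<T}" using r2 r1T t1T by auto
      have "(W t1)\<^sup>2 \<le> (W r1)\<^sup>2" using W_mono[of r1 t1] r1S r1T t1T W0[OF t1T] by (intro power_mono) auto
      then have "W r1 / 16 \<le> W r2" using r2 by (intro persist[OF r1T r2T(1)]) (simp add: \<tau>_def)
      moreover have "\<epsilon> * \<delta> t1 \<le> \<epsilon> * \<delta> r1" using \<delta>_mono[of r1 t1] r1S \<epsilon> by simp
      ultimately have big: "\<epsilon> / 16 * \<delta> t1 \<le> W r2" using r1S(3) by simp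
      have "c * W r2 \<le> W t1"
      proof (cases "r2 = t1")
        case True
        then show ?thesis using c W0[OF t1T] mult_right_mono[of c 1 "W t1"] by simp
      next
        case False
        then have "Sup S < r2" using \<tau> by (auto simp: r2_def min_def split: if_splits)
        then have "r2 \<notin> S" using cSup_upper[OF _ S(2)] by (metis not_less)
        then have "W r2 \<le> \<epsilon> * \<delta> r2" using r2 r1S by (auto simp: S_def)
        then show ?thesis using r2 r1S t1T by (intro grow[OF r2T(2)] Ts) auto
      qed
      moreover have "c * (\<epsilon> / 16 * \<delta> t1) \<le> c * W r2" using big c by (intro mult_left_mono) auto
      moreover have "\<omega>1 * \<delta> t1 \<le> c * \<epsilon> / 16 * \<delta> t1" using \<delta>0[OF t1T] by (intro mult_right_mono \<omega>1_le) auto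
      ultimately show ?thesis by simp
    next
      case False
      then have "\<not> \<epsilon> * \<delta> s < W s" using s(2) by auto
      then have "W s \<le> \<epsilon> * \<delta> s" by simp
      then have cW: "c * W s \<le> W t1" using s t1T by (intro grow[OF s(1)] Ts) auto
      have st0: "s = t0"
      proof (rule ccontr)
        assume "s \<noteq> t0"
        then have "T - s = M\<^sup>2 * (T - t1)" by (auto simp: s_def max_def split: if_splits)
        then have \<delta>s: "\<delta> s = M * \<delta> t1" using M(1) by (simp add: \<delta>_def real_sqrt_mult)
        have "I \<le> W s / \<delta> s" using s t1(1) by (intro Ile) auto
        then have "I * \<delta> s \<le> W s" using \<delta>0[OF s(1)] by (simp add: pos_le_divide_eq)
        then have "c * (I * \<delta> s) \<le> W t1" using cW c mult_left_mono[of "I * \<delta> s" "W s" c] by linarith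
        moreover have "c * (I * \<delta> s) = 2 * I * \<delta> t1" unfolding \<delta>s M(2)[symmetric] by simp
        moreover have "W t1 < 3 / 2 * I * \<delta> t1" using t1(2) \<delta>0[OF t1T] by (simp add: pos_divide_less_eq)
        ultimately have "2 * (I * \<delta> t1) < 3 / 2 * (I * \<delta> t1)" by linarith
        then show False using I0 \<delta>0[OF t1T] by (simp add: mult_less_0_iff)
      qed
      have "\<omega>1 * \<delta> t1 \<le> c * (W t0 / \<delta> t0) * \<delta> t1" using \<delta>0[OF t1T] by (intro mult_right_mono \<omega>1_le) auto
      also have "\<dots> \<le> c * (W t0 / \<delta> t0) * \<delta> t0"
        using \<delta>_mono[of t0 t1] t1T c W0[OF t0T] \<delta>0[OF t0T] by (intro mult_left_mono) auto
      also have "\<dots> = c * W t0" using \<delta>0[OF t0T] by simp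
      finally show ?thesis using cW st0 by simp
    qed
    then have "\<omega>1 \<le> W t1 / \<delta> t1" using \<delta>0[OF t1T] by (simp add: pos_le_divide_eq)
    then have "2 / 3 * \<omega>1 \<le> I" using t1(2) by linarith
    also have "I \<le> W t / \<delta> t" using t by (intro Ile) auto
    finally show "2 / 3 * \<omega>1 * sqrt (T - t) \<le> min_width e1 e2 t"
      using \<delta>0[OF t] by (simp add: pos_le_divide_eq \<delta>_def W_def)
  qed
qed

end

context flow
begin

section \<open>Curvature bound\<close>

lemma norm_gu_u:
  assumes t: "t \<in> {0..<T}"
  shows "((\<lambda>u. norm (gu u t)) has_real_derivative ch u t * norm (gu u t)) (at u)"
proof -
  have n: "0 < norm (gu u t)" using regular[OF t, of u] by simp
  have "0 < gu u t \<bullet> gu u t" using regular[OF t, of u] by simp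
  from DERIV_chain2[OF DERIV_real_sqrt[OF this] inner_D_u[OF t]]
  have "((\<lambda>u. sqrt (gu u t \<bullet> gu u t)) has_real_derivative
      inverse (sqrt (gu u t \<bullet> gu u t)) / 2 * (gu u t \<bullet> guu u t + guu u t \<bullet> gu u t)) (at u)" .
  moreover have "inverse (sqrt (gu u t \<bullet> gu u t)) / 2 * (gu u t \<bullet> guu u t + guu u t \<bullet> gu u t) = ch u t * norm (gu u t)"
    using n by (simp add: ch_def norm_eq_sqrt_inner[symmetric] inner_commute[of "guu u t"] field_simps power2_eq_square)
  ultimately show ?thesis by (simp only: norm_eq_sqrt_inner[symmetric])
qed

lemma norm_gu_t:
  assumes t: "t \<in> {0..<T}"
  shows "((\<lambda>t. norm (gu u t)) has_real_derivative - ((norm (gt u t))\<^sup>2 * norm (gu u t))) (at t within {0..<T})"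
proof -
  have n: "0 < norm (gu u t)" using regular[OF t, of u] by simp
  have "0 < gu u t \<bullet> gu u t" using regular[OF t, of u] by simp
  from DERIV_chain2[OF DERIV_real_sqrt[OF this] inner_D_t[OF t]]
  have "((\<lambda>t. sqrt (gu u t \<bullet> gu u t)) has_real_derivative
      inverse (sqrt (gu u t \<bullet> gu u t)) / 2 * (gu u t \<bullet> gtu u t + gtu u t \<bullet> gu u t)) (at t within {0..<T})" .
  moreover have "inverse (sqrt (gu u t \<bullet> gu u t)) / 2 * (gu u t \<bullet> gtu u t + gtu u t \<bullet> gu u t)
      = - ((norm (gt u t))\<^sup>2 * norm (gu u t))"
    using n by (simp add: norm_eq_sqrt_inner[symmetric] inner_commute[of "gtu u t"] gu_gtu[OF t] field_simps power2_eq_square)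
  ultimately show ?thesis by (simp only: norm_eq_sqrt_inner[symmetric])
qed

text \<open>The distance of \<open>z\<close> from the tangent line of the projection, multiplied by the length of
  the projection of the unit tangent vector. This normalization by the speed of the space curve
  makes the evolution equation below close.\<close>

definition hh :: "'a \<Rightarrow> 'a \<Rightarrow> 'a \<Rightarrow> real \<Rightarrow> real \<Rightarrow> real" where
  "hh e1 e2 z u t = dd e1 e2 (gu u t) (z - g u t) / norm (gu u t)"

lemma dd_radial_u:
  assumes "t \<in> {0..<T}"
  shows "((\<lambda>u. dd e1 e2 (D k l u t) (z - g u t)) has_real_derivative
    dd e1 e2 (D (Suc k) l u t) (z - g u t) - dd e1 e2 (D k l u t) (gu u t)) (at u)"
  unfolding dd_def inner_diff_left
  by (rule derivative_eq_intros inner_u assms refl)+ (simp add: algebra_simps)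

lemma dd_radial_t:
  assumes "t \<in> {0..<T}"
  shows "((\<lambda>t. dd e1 e2 (D k l u t) (z - g u t)) has_real_derivative
    dd e1 e2 (D k (Suc l) u t) (z - g u t) - dd e1 e2 (D k l u t) (gt u t)) (at t within {0..<T})"
  unfolding dd_def inner_diff_left
  by (rule derivative_eq_intros inner_t assms refl)+ (simp add: algebra_simps)

lemma hh_u:
  assumes t: "t \<in> {0..<T}"
  shows "((\<lambda>u. hh e1 e2 z u t) has_real_derivative norm (gu u t) * dd e1 e2 (gt u t) (z - g u t)) (at u)"
proof -
  have n: "norm (gu u t) \<noteq> 0" using regular[OF t, of u] by simp
  let ?n = "norm (gu u t)"
  have "((\<lambda>u. hh e1 e2 z u t) has_real_derivative
      (dd e1 e2 (guu u t) (z - g u t) * ?n - dd e1 e2 (gu u t) (z - g u t) * (ch u t * ?n)) / (?n * ?n)) (at u)"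
    unfolding hh_def
    by (rule DERIV_cong[OF DERIV_divide[OF dd_radial_u[OF t, where k = "Suc 0" and l = 0] norm_gu_u[OF t] n]]) simp
  moreover have "dd e1 e2 (guu u t) (z - g u t) = ?n\<^sup>2 * dd e1 e2 (gt u t) (z - g u t) + ch u t * dd e1 e2 (gu u t) (z - g u t)"
    by (simp add: guu_eq[OF t] dd_linear(1,5))
  then have "(dd e1 e2 (guu u t) (z - g u t) * ?n - dd e1 e2 (gu u t) (z - g u t) * (ch u t * ?n)) / (?n * ?n)
      = ?n * dd e1 e2 (gt u t) (z - g u t)"
    using n by (simp add: field_simps power2_eq_square)
  ultimately show ?thesis by simp
qed

lemma hh_uu:
  assumes t: "t \<in> {0..<T}"
  shows "((\<lambda>u. norm (gu u t) * dd e1 e2 (gt u t) (z - g u t)) has_real_derivative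
    ch u t * (norm (gu u t) * dd e1 e2 (gt u t) (z - g u t))
      + norm (gu u t) * (dd e1 e2 (gtu u t) (z - g u t) + dd e1 e2 (gu u t) (gt u t))) (at u)"
  by (rule DERIV_cong[OF DERIV_mult[OF norm_gu_u[OF t] dd_radial_u[OF t, where k = 0 and l = "Suc 0"]]])
    (simp add: dd_anti[of e1 e2 "gt u t" "gu u t"] algebra_simps)

lemma hh_t:
  assumes t: "t \<in> {0..<T}"
  shows "((\<lambda>t. hh e1 e2 z u t) has_real_derivative
    (dd e1 e2 (gtu u t) (z - g u t) - dd e1 e2 (gu u t) (gt u t)) / norm (gu u t)
      + (norm (gt u t))\<^sup>2 * hh e1 e2 z u t) (at t within {0..<T})"
proof -
  have n: "norm (gu u t) \<noteq> 0" using regular[OF t, of u] by simp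
  show ?thesis
    unfolding hh_def
    by (rule DERIV_cong[OF DERIV_divide[OF dd_radial_t[OF t, where k = "Suc 0" and l = 0] norm_gu_t[OF t] n]])
      (use n in \<open>simp add: field_simps\<close>)
qed

lemma bessel:
  fixes v x y :: "'b::real_inner"
  assumes "x \<bullet> y = 0" "x \<noteq> 0" "y \<noteq> 0"
  shows "(v \<bullet> x)\<^sup>2 / (x \<bullet> x) + (v \<bullet> y)\<^sup>2 / (y \<bullet> y) \<le> v \<bullet> v"
proof -
  define c where "c = (v \<bullet> x) / (x \<bullet> x)"
  define d where "d = (v \<bullet> y) / (y \<bullet> y)"
  have cd: "c * (x \<bullet> x) = v \<bullet> x" "d * (y \<bullet> y) = v \<bullet> y" using assms by (auto simp: c_def d_def)
  have "0 \<le> (v - c *\<^sub>R x - d *\<^sub>R y) \<bullet> (v - c *\<^sub>R x - d *\<^sub>R y)" by simp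
  also have "\<dots> = v \<bullet> v - 2 * c * (v \<bullet> x) - 2 * d * (v \<bullet> y) + c * (c * (x \<bullet> x)) + d * (d * (y \<bullet> y))"
    using assms(1) by (simp add: inner_diff_left inner_diff_right inner_commute algebra_simps)
  also have "\<dots> = v \<bullet> v - c * (v \<bullet> x) - d * (v \<bullet> y)" unfolding cd by simp
  finally show ?thesis by (simp add: c_def d_def power2_eq_square)
qed

text \<open>In arc length this reads (k^2)_t \<le> (k^2)_ss - ((k^2)_s)^2 / (2 k^2) + 2 k^4.
  Bessel's inequality for \<open>gtu\<close> along tangent and velocity discards the torsion part,
  which has the favourable sign.\<close>

lemma squared_curvature_evolution:
  assumes t: "t \<in> {0..<T}" and k: "gt u t \<noteq> 0"
  defines "\<kappa> \<equiv> gt u t \<bullet> gt u t" and "\<kappa>' \<equiv> 2 * (gt u t \<bullet> gtu u t)"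
    and "\<kappa>'' \<equiv> 2 * (gt u t \<bullet> gtuu u t + gtu u t \<bullet> gtu u t)"
  shows "2 * (gt u t \<bullet> gtt u t) \<le> a u t * (\<kappa>'' - ch u t * \<kappa>') - a u t * \<kappa>'\<^sup>2 / (2 * \<kappa>) + 2 * \<kappa>\<^sup>2"
proof -
  have \<kappa>: "0 < \<kappa>" using k by (simp add: \<kappa>_def)
  have a: "0 < a u t" by (rule a_pos[OF t])
  obtain r where r: "gtt u t = a u t *\<^sub>R (gtuu u t - ch u t *\<^sub>R gtu u t)
    + (2 * (norm (gt u t))\<^sup>2) *\<^sub>R gt u t + r *\<^sub>R gu u t" using gtt_eq[OF t] .
  have "gt u t \<bullet> gtt u t = a u t * (gt u t \<bullet> gtuu u t - ch u t * (gt u t \<bullet> gtu u t)) + 2 * \<kappa> * \<kappa>"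
    unfolding r using gu_gt[OF t, of u]
    by (simp add: inner_add_right inner_diff_right inner_commute[of "gt u t" "gu u t"] \<kappa>_def power2_norm_eq_inner)
  then have 1: "2 * (gt u t \<bullet> gtt u t) = a u t * (\<kappa>'' - ch u t * \<kappa>') - 2 * (a u t * (gtu u t \<bullet> gtu u t)) + 4 * \<kappa>\<^sup>2"
    by (simp add: \<kappa>'_def \<kappa>''_def power2_eq_square algebra_simps)
  have "(gtu u t \<bullet> gu u t)\<^sup>2 / (gu u t \<bullet> gu u t) + (gtu u t \<bullet> gt u t)\<^sup>2 / \<kappa> \<le> gtu u t \<bullet> gtu u t"
    unfolding \<kappa>_def by (rule bessel[OF gu_gt[OF t] regular[OF t] k])
  moreover have "gtu u t \<bullet> gu u t = - ((gu u t \<bullet> gu u t) * \<kappa>)"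
    unfolding inner_commute[of "gtu u t"] gu_gtu[OF t] by (simp add: \<kappa>_def power2_norm_eq_inner)
  ultimately have "(gu u t \<bullet> gu u t) * \<kappa>\<^sup>2 + (\<kappa>' / 2)\<^sup>2 / \<kappa> \<le> gtu u t \<bullet> gtu u t"
    using regular[OF t, of u] by (simp add: \<kappa>'_def inner_commute power2_eq_square ac_simps)
  then have "a u t * ((gu u t \<bullet> gu u t) * \<kappa>\<^sup>2 + (\<kappa>' / 2)\<^sup>2 / \<kappa>) \<le> a u t * (gtu u t \<bullet> gtu u t)"
    using a by (intro mult_left_mono) auto
  moreover have "a u t * ((gu u t \<bullet> gu u t) * \<kappa>\<^sup>2 + (\<kappa>' / 2)\<^sup>2 / \<kappa>)
      = (a u t * (gu u t \<bullet> gu u t)) * \<kappa>\<^sup>2 + a u t * \<kappa>'\<^sup>2 / (4 * \<kappa>)"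
    by (simp add: power_divide algebra_simps)
  moreover have "a u t * (gu u t \<bullet> gu u t) = 1" using a_norm[OF t, of u] by (simp add: power2_norm_eq_inner)
  ultimately have "\<kappa>\<^sup>2 + a u t * \<kappa>'\<^sup>2 / (4 * \<kappa>) \<le> a u t * (gtu u t \<bullet> gtu u t)" by simp
  moreover have "a u t * \<kappa>'\<^sup>2 / (2 * \<kappa>) = 2 * (a u t * \<kappa>'\<^sup>2 / (4 * \<kappa>))" by simp
  ultimately show ?thesis unfolding 1 by linarith
qed

text \<open>Tso's estimate: as long as \<open>hh\<close> is bounded below by \<open>2 b\<close>, the maximum principle applies to
  \<open>t k\<^sup>2 / (hh - b)\<^sup>2\<close>.\<close>

lemma curvature_estimate:
  assumes s: "0 \<le> s" "s \<le> t1" "t1 < T" and e: "norm e1 = 1" "norm e2 = 1"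
    and b: "0 < b" "\<And>u t. t \<in> {s..t1} \<Longrightarrow> 2 * b \<le> hh e1 e2 z u t"
    and \<Lambda>: "1 \<le> \<Lambda> * b\<^sup>2" "64 * (t1 - s) \<le> \<Lambda> * (b\<^sup>2)\<^sup>2"
  shows "(t1 - s) * (norm (gt u t1))\<^sup>2 \<le> \<Lambda> * (hh e1 e2 z u t1 - b)\<^sup>2"
proof -
  define q where "q u t = hh e1 e2 z u t - b" for u t
  have q: "b \<le> q u t" "0 < q u t" if "t \<in> {s..t1}" for u t using b(2)[OF that, of u] b(1) by (auto simp: q_def)
  define f where "f u t = \<Lambda> - (t - s) * (gt u t \<bullet> gt u t) / (q u t)\<^sup>2" for u t
  have rT: "r \<in> {0..<T}" if "r \<in> {s..t1}" for r using that s by auto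
  have \<Lambda>0: "0 < \<Lambda>" using \<Lambda>(1) b(1) by (metis less_le_trans zero_less_one zero_less_mult_pos2 zero_less_power)
  have "0 \<le> f u t1"
  proof (rule circle_max_principle[OF s, of f 0 u])
    show "continuous_on (UNIV \<times> {s..t1}) (\<lambda>z. f (fst z) (snd z))"
    proof -
      have "hh e1 e2 z u r - b \<noteq> 0" if "r \<in> {s..t1}" for u r using q(2)[OF that, of u] by (simp add: q_def)
      then show ?thesis
        unfolding f_def q_def hh_def dd_def using s regular by (intro continuous_intros) auto
    qed
    show "f (u + 2 * pi * of_int m) r = f u r" if "r \<in> {s..t1}" for u r m
      using D_per_int[OF rT[OF that]] by (simp add: f_def q_def hh_def)
    show "0 \<le> f u s" for u using \<Lambda>0 by (simp add: f_def)
    fix u r assume r: "s < r" "r \<le> t1" and neg: "f u r < 0" and min: "\<And>w. f u r \<le> f w r"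
    have rr: "r \<in> {s..t1}" using r by simp
    note rT = rT[OF rr]
    define \<tau> where "\<tau> = r - s"
    define \<kappa> where "\<kappa> = gt u r \<bullet> gt u r"
    define \<kappa>1 where "\<kappa>1 = 2 * (gt u r \<bullet> gtu u r)"
    define \<kappa>2 where "\<kappa>2 = 2 * (gt u r \<bullet> gtuu u r + gtu u r \<bullet> gtu u r)"
    define \<kappa>t where "\<kappa>t = 2 * (gt u r \<bullet> gtt u r)"
    define Q where "Q = q u r"
    define Q1 where "Q1 = norm (gu u r) * dd e1 e2 (gt u r) (z - g u r)"
    define Q2 where "Q2 = ch u r * Q1 + norm (gu u r) * (dd e1 e2 (gtu u r) (z - g u r) + dd e1 e2 (gu u r) (gt u r))"
    define J where "J = dd e1 e2 (gu u r) (gt u r) / norm (gu u r)"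
    define Qt where "Qt = (dd e1 e2 (gtu u r) (z - g u r) - dd e1 e2 (gu u r) (gt u r)) / norm (gu u r) + \<kappa> * (Q + b)"
    define c where "c = \<kappa> / Q\<^sup>2"
    have \<tau>: "0 < \<tau>" "\<tau> \<le> t1 - s" using r by (auto simp: \<tau>_def)
    have Q: "b \<le> Q" "0 < Q" using q[OF rr, of u] by (auto simp: Q_def)
    have n0: "0 < norm (gu u r)" using regular[OF rT, of u] by simp
    have big: "\<Lambda> * Q\<^sup>2 < \<tau> * \<kappa>"
      using neg Q by (simp add: f_def \<tau>_def \<kappa>_def Q_def[symmetric] pos_less_divide_eq)
    have \<kappa>0: "0 < \<kappa>"
    proof -
      have "0 < \<Lambda> * Q\<^sup>2" using \<Lambda>0 Q by simp
      then have "0 < \<tau> * \<kappa>" using big by linarith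
      then show ?thesis using \<tau> by (simp add: zero_less_mult_iff)
    qed
    have cQ: "c * Q\<^sup>2 = \<kappa>" "0 < c" using Q \<kappa>0 by (auto simp: c_def)
    have d\<kappa>: "((\<lambda>u. gt u r \<bullet> gt u r) has_real_derivative 2 * (gt x r \<bullet> gtu x r)) (at x)" for x
      using inner_D_u[OF rT, where k = 0 and l = "Suc 0" and k' = 0 and l' = "Suc 0" and u = x] by (simp add: inner_commute)
    have dQ: "((\<lambda>u. q u r) has_real_derivative norm (gu x r) * dd e1 e2 (gt x r) (z - g x r)) (at x)" for x
      unfolding q_def using DERIV_diff[OF hh_u[OF rT] DERIV_const] by simp
    \<comment> \<open>With c the spatial maximum of \<open>\<kappa> / q\<^sup>2\<close>, the
      function \<open>c * q\<^sup>2 - \<kappa>\<close> has a zero minimum at u; testing it avoids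
      differentiating the quotient twice.\<close>
    have crit: "c * (2 * Q * Q1) - \<kappa>1 = 0" and conv: "0 \<le> c * (2 * (Q1 * Q1 + Q * Q2)) - \<kappa>2"
    proof -
      let ?F = "\<lambda>w. c * (q w r)\<^sup>2 - gt w r \<bullet> gt w r"
      let ?F1 = "\<lambda>w. c * (2 * q w r * (norm (gu w r) * dd e1 e2 (gt w r) (z - g w r))) - 2 * (gt w r \<bullet> gtu w r)"
      have 1: "(?F has_real_derivative ?F1 x) (at x)" for x
        by (rule derivative_eq_intros d\<kappa> dQ refl)+ simp
      have 2: "(?F1 has_real_derivative c * (2 * (Q1 * Q1 + Q * Q2)) - \<kappa>2) (at u)"
        unfolding Q_def Q1_def Q2_def \<kappa>2_def
        by (rule derivative_eq_intros dQ hh_uu[OF rT] inner_D_u[OF rT] refl)+ (simp add: algebra_simps)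
      have 3: "?F u \<le> ?F w" for w
      proof -
        have "\<tau> * ((gt w r \<bullet> gt w r) / (q w r)\<^sup>2) \<le> \<tau> * c"
          using min[of w] by (simp add: f_def \<tau>_def c_def \<kappa>_def Q_def)
        then have "(gt w r \<bullet> gt w r) / (q w r)\<^sup>2 \<le> c" using \<tau>(1) by (rule mult_left_le_imp_le)
        then have "gt w r \<bullet> gt w r \<le> c * (q w r)\<^sup>2" using q[OF rr, of w] by (simp add: pos_divide_le_eq)
        then show ?thesis using cQ by (simp add: Q_def \<kappa>_def)
      qed
      show "c * (2 * Q * Q1) - \<kappa>1 = 0"
        using local_min_second_derivative(1)[OF zero_less_one 1 2 3] by (simp add: Q_def Q1_def \<kappa>1_def)
      show "0 \<le> c * (2 * (Q1 * Q1 + Q * Q2)) - \<kappa>2"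
        by (rule local_min_second_derivative(2)[OF zero_less_one 1 2 3])
    qed
    have \<kappa>t_le: "\<kappa>t \<le> a u r * (\<kappa>2 - ch u r * \<kappa>1) - a u r * \<kappa>1\<^sup>2 / (2 * \<kappa>) + 2 * \<kappa>\<^sup>2"
      unfolding \<kappa>t_def \<kappa>_def \<kappa>1_def \<kappa>2_def using \<kappa>0
      by (intro squared_curvature_evolution[OF rT]) (auto simp: \<kappa>_def)
    have Qt_eq: "Qt = a u r * (Q2 - ch u r * Q1) + \<kappa> * (Q + b) - 2 * J"
      using n0 by (simp add: Qt_def Q2_def J_def a_def field_simps power2_eq_square)
    have an: "0 < a u r" by (rule a_pos[OF rT])
    have J: "\<bar>J\<bar> \<le> 2 * sqrt \<kappa>"
    proof -
      have "\<bar>dd e1 e2 (gu u r) (gt u r)\<bar> \<le> 2 * (norm (gu u r) * norm (gt u r))"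
        using dd_abs_le[of e1 e2 "gu u r" "gt u r"] e by simp
      then have "\<bar>J\<bar> \<le> 2 * norm (gt u r)" using n0 by (simp add: J_def abs_divide pos_divide_le_eq ac_simps)
      then show ?thesis by (simp add: \<kappa>_def norm_eq_sqrt_inner)
    qed
    \<comment> \<open>The gradient terms cancel at the critical point. The negative term with b
      comes from the shift in q = hh - b, whose evolution contains \<open>\<kappa> * (q + b)\<close>
      instead of \<open>\<kappa> * q\<close>.\<close>
    have mainineq: "\<kappa>t - 2 * c * Q * Qt \<le> 2 * \<kappa> * (- b * \<kappa> + 2 * J) / Q"
    proof -
      have k1: "\<kappa>1 = 2 * c * Q * Q1" using crit by simp
      have "a u r * \<kappa>1\<^sup>2 / (2 * \<kappa>) = 2 * c * (a u r * (Q1 * Q1))"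
        using cQ Q \<kappa>0 unfolding k1 cQ(1)[symmetric] by (simp add: field_simps power2_eq_square)
      moreover have "a u r * \<kappa>2 \<le> a u r * (c * (2 * (Q1 * Q1 + Q * Q2)))" using conv an by (intro mult_left_mono) auto
      ultimately have "\<kappa>t \<le> 2 * c * Q * (a u r * (Q2 - ch u r * Q1)) + 2 * \<kappa>\<^sup>2"
        using \<kappa>t_le unfolding k1 by (simp add: algebra_simps)
      then have "\<kappa>t - 2 * c * Q * Qt \<le> 2 * \<kappa>\<^sup>2 - 2 * (c * Q) * (\<kappa> * (Q + b) - 2 * J)"
        unfolding Qt_eq by (simp add: algebra_simps)
      also have "c * Q = \<kappa> / Q" using Q by (simp add: c_def power2_eq_square)
      also have "2 * \<kappa>\<^sup>2 - 2 * (\<kappa> / Q) * (\<kappa> * (Q + b) - 2 * J) = 2 * \<kappa> * (- b * \<kappa> + 2 * J) / Q"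
        using Q by (simp add: field_simps power2_eq_square)
      finally show ?thesis .
    qed
    \<comment> \<open>A negative f means \<open>\<tau> * \<kappa> > \<Lambda> * Q\<^sup>2\<close>;
      the second condition on \<open>\<Lambda>\<close> then forces
      \<open>b * sqrt \<kappa> \<ge> 8\<close>, so that the J term consumes at most half of the good
      term.\<close>
    have k8: "8 * sqrt \<kappa> \<le> b * \<kappa>"
    proof -
      have "\<tau> * 64 \<le> \<Lambda> * (b\<^sup>2)\<^sup>2" by (rule order_trans[OF _ \<Lambda>(2)]) (use \<tau>(2) in simp)
      also have "\<dots> \<le> b\<^sup>2 * (\<Lambda> * Q\<^sup>2)"
      proof -
        have "b\<^sup>2 \<le> Q\<^sup>2" using Q b by (intro power_mono) auto
        then have "\<Lambda> * b\<^sup>2 * b\<^sup>2 \<le> \<Lambda> * b\<^sup>2 * Q\<^sup>2" using \<Lambda>0 by (intro mult_left_mono) auto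
        then show ?thesis by (simp add: power2_eq_square ac_simps)
      qed
      also have "\<dots> \<le> b\<^sup>2 * (\<tau> * \<kappa>)" using big by (intro mult_left_mono) auto
      finally have "\<tau> * 8\<^sup>2 \<le> \<tau> * (b * sqrt \<kappa>)\<^sup>2" using \<kappa>0 by (simp add: power_mult_distrib ac_simps)
      then have "8\<^sup>2 \<le> (b * sqrt \<kappa>)\<^sup>2" using \<tau> by simp
      then have "8 \<le> b * sqrt \<kappa>" by (rule power2_le_imp_le) (use b \<kappa>0 in simp)
      then have "8 * sqrt \<kappa> \<le> (b * sqrt \<kappa>) * sqrt \<kappa>" using \<kappa>0 by (intro mult_right_mono) auto
      then show ?thesis using \<kappa>0 by (simp add: mult.assoc)
    qed
    \<comment> \<open>The first condition on \<open>\<Lambda>\<close> lets the other half absorb the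
      summand \<open>\<kappa>\<close> produced by differentiating the factor t - s.\<close>
    have k1: "Q \<le> b * \<tau> * \<kappa>"
    proof -
      have "b * Q \<le> Q * Q" using Q by (intro mult_right_mono) auto
      then have "\<Lambda> * (b * (b * Q)) \<le> \<Lambda> * (b * Q\<^sup>2)"
        using \<Lambda>0 b by (intro mult_left_mono) (auto simp: power2_eq_square)
      moreover have "1 * Q \<le> (\<Lambda> * b\<^sup>2) * Q" using \<Lambda>(1) Q by (intro mult_right_mono) auto
      moreover have "b * (\<Lambda> * Q\<^sup>2) \<le> b * (\<tau> * \<kappa>)" using big b by (intro mult_left_mono) auto
      ultimately show ?thesis by (simp add: power2_eq_square ac_simps)
    qed
    have "\<kappa> + \<tau> * (\<kappa>t - 2 * c * Q * Qt) \<le> 0"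
    proof -
      have "2 * (- b * \<kappa> + 2 * J) \<le> - (b * \<kappa>)" using abs_le_D1[OF J] k8 by (simp add: algebra_simps)
      then have "\<kappa> * (2 * (- b * \<kappa> + 2 * J)) / Q \<le> \<kappa> * (- (b * \<kappa>)) / Q"
        using \<kappa>0 Q by (intro divide_right_mono mult_left_mono) auto
      also have "\<kappa> * (2 * (- b * \<kappa> + 2 * J)) / Q = 2 * \<kappa> * (- b * \<kappa> + 2 * J) / Q" by (simp only: ac_simps)
      finally have "\<kappa>t - 2 * c * Q * Qt \<le> - (\<kappa> * (b * \<kappa>) / Q)" using mainineq by simp
      then have "\<tau> * (\<kappa>t - 2 * c * Q * Qt) \<le> \<tau> * (- (\<kappa> * (b * \<kappa>) / Q))" using \<tau> by (intro mult_left_mono) auto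
      moreover have "\<kappa> * Q \<le> \<kappa> * (b * \<tau> * \<kappa>)" using k1 \<kappa>0 by (intro mult_left_mono) auto
      then have "\<kappa> \<le> \<tau> * (\<kappa> * (b * \<kappa>) / Q)" using Q by (simp add: pos_le_divide_eq ac_simps)
      ultimately show ?thesis by simp
    qed
    then have "0 * f u r \<le> - ((\<kappa> + \<tau> * (\<kappa>t - 2 * c * Q * Qt)) / Q\<^sup>2)"
      using Q by (simp add: divide_le_0_iff)
    moreover have "(f u has_real_derivative - ((\<kappa> + \<tau> * (\<kappa>t - 2 * c * Q * Qt)) / Q\<^sup>2)) (at r within {0..<T})"
    proof -
      have d1: "((\<lambda>t. gt u t \<bullet> gt u t) has_real_derivative \<kappa>t) (at r within {0..<T})"
        using inner_D_t[OF rT, where k = 0 and l = "Suc 0" and k' = 0 and l' = "Suc 0" and u = u] by (simp add: \<kappa>t_def inner_commute)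
      have d2: "((\<lambda>t. q u t) has_real_derivative Qt) (at r within {0..<T})"
        unfolding q_def using DERIV_diff[OF hh_t[OF rT] DERIV_const]
        by (simp add: Qt_def \<kappa>_def Q_def q_def power2_norm_eq_inner)
      have "(q u r)\<^sup>2 \<noteq> 0" using q[OF rr, of u] by simp
      then have "((\<lambda>t. \<Lambda> - (t - s) * (gt u t \<bullet> gt u t) / (q u t)\<^sup>2) has_real_derivative
          0 - ((1 * \<kappa> + \<kappa>t * \<tau>) * Q\<^sup>2 - (\<tau> * \<kappa>) * (2 * Q * Qt)) / (Q\<^sup>2 * Q\<^sup>2)) (at r within {0..<T})"
        unfolding \<tau>_def \<kappa>_def Q_def
        by (intro DERIV_diff DERIV_const DERIV_divide DERIV_mult d1)
          (rule derivative_eq_intros d2 refl | simp)+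
      moreover have "0 - ((1 * \<kappa> + \<kappa>t * \<tau>) * Q\<^sup>2 - (\<tau> * \<kappa>) * (2 * Q * Qt)) / (Q\<^sup>2 * Q\<^sup>2)
          = - ((\<kappa> + \<tau> * (\<kappa>t - 2 * c * Q * Qt)) / Q\<^sup>2)"
      proof -
        have "(1 * \<kappa> + \<kappa>t * \<tau>) * Q\<^sup>2 - (\<tau> * \<kappa>) * (2 * Q * Qt) = Q\<^sup>2 * (\<kappa> + \<tau> * (\<kappa>t - 2 * c * Q * Qt))"
        proof -
          have "Q\<^sup>2 * (\<kappa> + \<tau> * (\<kappa>t - 2 * c * Q * Qt)) = Q\<^sup>2 * \<kappa> + \<tau> * (Q\<^sup>2 * \<kappa>t - 2 * (c * Q\<^sup>2) * (Q * Qt))"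
            by (simp add: algebra_simps power2_eq_square)
          then have "Q\<^sup>2 * (\<kappa> + \<tau> * (\<kappa>t - 2 * c * Q * Qt)) = Q\<^sup>2 * \<kappa> + \<tau> * (Q\<^sup>2 * \<kappa>t - 2 * \<kappa> * (Q * Qt))"
            unfolding cQ(1) .
          then show ?thesis by (simp only: algebra_simps)
        qed
        moreover have "Q\<^sup>2 \<noteq> 0" using Q by simp
        ultimately show ?thesis by (simp only: mult_divide_mult_cancel_left diff_0 not_False_eq_True)
      qed
      ultimately show ?thesis unfolding f_def[abs_def] by simp
    qed
    ultimately show "\<exists>c. (f u has_real_derivative c) (at r within {0..<T}) \<and> 0 * f u r \<le> c" by blast
  qed
  then show ?thesis using q(2)[of t1 u] s
    by (simp add: f_def q_def[symmetric] pos_divide_le_eq power2_norm_eq_inner)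
qed

end

context convex_flow
begin

text \<open>The point of the disc farthest to the right of a tangent still lies in the hull, so z is
  at distance at least \<open>\<rho>\<close> from that tangent; sqrt lam bounds the projected length
  of the unit tangent.\<close>

lemma hh_lower:
  assumes t: "t \<in> {t0..<T}" and \<rho>: "0 < \<rho>"
    and ball: "\<And>z'. ((z' - z) \<bullet> e1)\<^sup>2 + ((z' - z) \<bullet> e2)\<^sup>2 \<le> \<rho>\<^sup>2 \<Longrightarrow> z' \<in> K e1 e2 t"
  shows "sqrt lam * \<rho> \<le> hh e1 e2 z u t"
proof -
  define x where "x = gu u t \<bullet> e1"
  define y where "y = gu u t \<bullet> e2"
  define \<nu> where "\<nu> = sqrt (x\<^sup>2 + y\<^sup>2)"
  have n: "0 < norm (gu u t)" using regular t0_T[OF t] by simp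
  have xy: "lam * (norm (gu u t))\<^sup>2 \<le> x\<^sup>2 + y\<^sup>2"
    using immersed[OF t, of u] n by (simp add: a_def x_def y_def pos_le_divide_eq)
  have \<nu>: "\<nu>\<^sup>2 = x\<^sup>2 + y\<^sup>2" "sqrt lam * norm (gu u t) \<le> \<nu>"
    using real_sqrt_le_mono[OF xy] n by (simp_all add: \<nu>_def real_sqrt_mult)
  have "0 < sqrt lam * norm (gu u t)" using lam n by simp
  then have \<nu>0: "0 < \<nu>" using \<nu>(2) by linarith
  define z' where "z' = z + (\<rho> / \<nu>) *\<^sub>R (y *\<^sub>R e1 - x *\<^sub>R e2)"
  have z': "(z' - z) \<bullet> e1 = \<rho> / \<nu> * y" "(z' - z) \<bullet> e2 = - (\<rho> / \<nu> * x)"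
    by (simp_all add: z'_def inner_diff_left inner_e)
  have "(\<rho> / \<nu> * y)\<^sup>2 + (- (\<rho> / \<nu> * x))\<^sup>2 = (\<rho> / \<nu>)\<^sup>2 * (x\<^sup>2 + y\<^sup>2)"
    by (simp only: power_mult_distrib power2_minus distrib_left add.commute)
  also have "\<dots> = \<rho>\<^sup>2" using \<nu>0 by (simp add: \<nu>(1)[symmetric] power_divide)
  finally have "z' \<in> K e1 e2 t" by (intro ball) (simp add: z')
  from K_tangent[OF t this, of u] have "0 \<le> dd e1 e2 (gu u t) (z - g u t) + dd e1 e2 (gu u t) (z' - z)"
    by (simp add: dd_linear)
  also have "dd e1 e2 (gu u t) (z' - z) = - (\<rho> / \<nu> * (x\<^sup>2 + y\<^sup>2))"
    unfolding dd_def z' x_def[symmetric] y_def[symmetric] by (simp add: power2_eq_square algebra_simps)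
  also have "\<rho> / \<nu> * (x\<^sup>2 + y\<^sup>2) = \<rho> * \<nu>" unfolding \<nu>(1)[symmetric] using \<nu>0 by (simp add: power2_eq_square)
  finally have "\<rho> * \<nu> \<le> dd e1 e2 (gu u t) (z - g u t)" by simp
  moreover have "\<rho> * (sqrt lam * norm (gu u t)) \<le> \<rho> * \<nu>" using \<nu>(2) \<rho> by (intro mult_left_mono) auto
  ultimately show ?thesis using n by (simp add: hh_def pos_le_divide_eq ac_simps)
qed

text \<open>At each time the estimate is started a fixed fraction of the remaining time earlier: T -
  s = A and t1 - s = \<open>\<eta> * A\<close>. Then A is comparable with T - t1, and all lengths
  scale like sqrt A.\<close>

lemma curvature_bound:
  obtains C t2 where "t2 < T" "\<And>t u. t2 < t \<Longrightarrow> t < T \<Longrightarrow> (norm (gt u t))\<^sup>2 * (T - t) \<le> C"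
proof -
  obtain \<omega> where \<omega>: "0 < \<omega>" "\<And>t. t \<in> {t0..<T} \<Longrightarrow> \<omega> * sqrt (T - t) \<le> min_width e1 e2 t"
    using width_bound by blast
  \<comment> \<open>The second entry is the lifetime of the enclosed disc in units of A; the first
    keeps A within twice T - t1.\<close>
  define \<eta> where "\<eta> = min (1 / 2) (\<omega>\<^sup>2 / 1024)"
  have \<eta>: "0 < \<eta>" "\<eta> \<le> 1 / 2" "\<eta> \<le> \<omega>\<^sup>2 / 1024" using \<omega>(1) by (auto simp: \<eta>_def)
  \<comment> \<open>Chosen so that \<open>c1 / A * b\<^sup>2 = 1\<close> for half of the lower bound
    of hh, b = sqrt lam * w / 64 and w = \<open>\<omega>\<close> sqrt A.\<close>
  define c1 where "c1 = 4096 / (lam * \<omega>\<^sup>2)"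
  have c1: "0 < c1" using lam \<omega> by (simp add: c1_def)
  \<comment> \<open>The two entries are the two conditions on \<open>\<Lambda> = C0 / A\<close> in
    the curvature estimate.\<close>
  define C0 where "C0 = max c1 (64 * \<eta> * c1\<^sup>2)"
  have C0: "c1 \<le> C0" "64 * \<eta> * c1\<^sup>2 \<le> C0" by (auto simp: C0_def)
  define C where "C = C0 * (512 / \<omega>)\<^sup>2 / \<eta>"
  show ?thesis
  proof (rule that[of "T - (1 - \<eta>) * (T - t0)" C])
    show "T - (1 - \<eta>) * (T - t0) < T" using \<eta> t0 by simp
    fix t1 u assume t1: "T - (1 - \<eta>) * (T - t0) < t1" "t1 < T"
    define A where "A = (T - t1) / (1 - \<eta>)"
    define s where "s = T - A"
    have A: "0 < A" "(1 - \<eta>) * A = T - t1" using t1 \<eta> by (auto simp: A_def)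
    have "(1 - \<eta>) * A < (1 - \<eta>) * (T - t0)" using t1(1) A(2) by linarith
    then have "A < T - t0" using \<eta> by simp
    then have s: "s \<in> {t0..<T}" using A by (simp add: s_def)
    have sT: "s \<in> {0..<T}" by (rule t0_T[OF s])
    have t1s: "t1 - s = \<eta> * A" using A(2) by (simp add: s_def algebra_simps)
    have st1: "s \<le> t1" using t1s \<eta> A by (metis diff_ge_0_iff_ge less_imp_le mult_nonneg_nonneg)
    define \<delta> where "\<delta> = sqrt A"
    have \<delta>: "0 < \<delta>" "\<delta>\<^sup>2 = A" "\<delta> = sqrt (T - s)" using A by (auto simp: \<delta>_def s_def)
    define w where "w = \<omega> * \<delta>"
    have w0: "0 < w" using \<omega> \<delta> by (simp add: w_def)
    have w: "w \<le> width (p *\<^sub>R e1 + q *\<^sub>R e2) s" if "p\<^sup>2 + q\<^sup>2 = 1" for p q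
      using \<omega>(2)[OF s] min_width_le[OF sT that, of e1 e2] by (simp add: w_def \<delta>(3))
    obtain z where z: "\<And>t z'. t \<in> {s..<T} \<Longrightarrow> t - s \<le> w\<^sup>2 / 1024 \<Longrightarrow>
        ((z' - z) \<bullet> e1)\<^sup>2 + ((z' - z) \<bullet> e2)\<^sup>2 \<le> (w / 32)\<^sup>2 \<Longrightarrow> z' \<in> K e1 e2 t"
      using enclosed_ball[OF s w0 w] by blast
    have ball: "z' \<in> K e1 e2 t" if "t \<in> {s..t1}" "((z' - z) \<bullet> e1)\<^sup>2 + ((z' - z) \<bullet> e2)\<^sup>2 \<le> (w / 32)\<^sup>2" for t z'
    proof (rule z[OF _ _ that(2)])
      show "t \<in> {s..<T}" using that t1 by auto
      have "\<eta> * A \<le> \<omega>\<^sup>2 / 1024 * A" using \<eta> A by (intro mult_right_mono) auto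
      then show "t - s \<le> w\<^sup>2 / 1024" using that t1s by (simp add: w_def power_mult_distrib \<delta>(2))
    qed
    have zK: "z \<in> K e1 e2 s" by (rule ball) (use st1 in auto)
    define b where "b = sqrt lam * (w / 32) / 2"
    have b0: "0 < b" using lam w0 by (simp add: b_def)
    have hb: "2 * b \<le> hh e1 e2 z u t" if t: "t \<in> {s..t1}" for u t
    proof -
      have tT: "t \<in> {t0..<T}" using t s t1 by auto
      have "sqrt lam * (w / 32) \<le> hh e1 e2 z u t"
        by (rule hh_lower[OF tT _ ball[OF t]]) (use w0 in simp_all)
      then show ?thesis unfolding b_def by linarith
    qed
    have b2: "c1 / A * b\<^sup>2 = 1"
    proof -
      have "b\<^sup>2 = lam * \<omega>\<^sup>2 * A / 4096"
        using lam by (simp add: b_def w_def power_mult_distrib power_divide \<delta>(2))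
      then show ?thesis using lam \<omega> A by (simp add: c1_def)
    qed
    have "(t1 - s) * (norm (gt u t1))\<^sup>2 \<le> C0 / A * (hh e1 e2 z u t1 - b)\<^sup>2"
    proof (rule curvature_estimate[OF _ st1 t1(2) orth(1,2) b0])
      show "0 \<le> s" using sT by simp
      show "2 * b \<le> hh e1 e2 z u t" if "t \<in> {s..t1}" for u t by (rule hb[OF that])
      have "c1 / A * b\<^sup>2 \<le> C0 / A * b\<^sup>2" using C0 A by (intro mult_right_mono divide_right_mono) auto
      then show "1 \<le> C0 / A * b\<^sup>2" unfolding b2 .
      have "64 * (t1 - s) = (64 * \<eta> * A) * (c1 / A * b\<^sup>2)\<^sup>2" unfolding t1s b2 by simp
      also have "\<dots> = 64 * \<eta> * c1\<^sup>2 / A * (b\<^sup>2)\<^sup>2"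
        using A by (simp add: power_mult_distrib power_divide) (simp add: power2_eq_square)
      also have "\<dots> \<le> C0 / A * (b\<^sup>2)\<^sup>2" using C0 A by (intro mult_right_mono divide_right_mono) auto
      finally show "64 * (t1 - s) \<le> C0 / A * (b\<^sup>2)\<^sup>2" .
    qed
    moreover have "C0 / A * (hh e1 e2 z u t1 - b)\<^sup>2 \<le> C0 / A * (512 * \<delta> / \<omega>)\<^sup>2"
    proof -
      have t1T: "t1 \<in> {0..<T}" "t1 \<in> {t0..<T}" using st1 s t1 t0_T by auto
      have gK: "g u t1 \<in> K e1 e2 s" using K_antimono[OF _ st1 t1(2) g_in_K[OF t1T(1)]] sT by auto
      \<comment> \<open>Dividing the bound for width times diameter by the width bounds every
        diameter by \<open>256 * \<delta> / \<omega>\<close>. Each of the two products in the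
        determinant is estimated in this way, hence the 512 in the upper bound for hh.\<close>
      have L: "width (p *\<^sub>R e1 + q *\<^sub>R e2) s \<le> 256 * \<delta> / \<omega>" if "p\<^sup>2 + q\<^sup>2 = 1" for p q
      proof -
        have "\<omega> * \<delta> * width (p *\<^sub>R e1 + q *\<^sub>R e2) s \<le> 256 * (\<delta> * \<delta>)"
          using width_times_diameter[OF s w0 w that] \<delta>(2) by (simp add: w_def s_def power2_eq_square)
        then have "\<delta> * (\<omega> * width (p *\<^sub>R e1 + q *\<^sub>R e2) s) \<le> \<delta> * (256 * \<delta>)" by (simp only: ac_simps)
        then have "\<omega> * width (p *\<^sub>R e1 + q *\<^sub>R e2) s \<le> 256 * \<delta>" using \<delta>(1) by (rule mult_left_le_imp_le)
        then show ?thesis using \<omega>(1) by (simp add: pos_le_divide_eq mult.commute)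
      qed
      have c: "\<bar>(z - g u t1) \<bullet> e1\<bar> \<le> 256 * \<delta> / \<omega>" "\<bar>(z - g u t1) \<bullet> e2\<bar> \<le> 256 * \<delta> / \<omega>"
        using K_width[OF zK gK, of 1 0] K_width[OF zK gK, of 0 1] L[of 1 0] L[of 0 1] by simp_all
      define n where "n = norm (gu u t1)"
      have n: "0 < n" using regular[OF t1T(1)] by (simp add: n_def)
      have g12: "\<bar>gu u t1 \<bullet> e1\<bar> \<le> n" "\<bar>gu u t1 \<bullet> e2\<bar> \<le> n"
        using Cauchy_Schwarz_ineq2[of "gu u t1" e1] Cauchy_Schwarz_ineq2[of "gu u t1" e2] orth by (simp_all add: n_def)
      have m: "\<bar>(gu u t1 \<bullet> e1) * ((z - g u t1) \<bullet> e2)\<bar> \<le> n * (256 * \<delta> / \<omega>)"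
        "\<bar>(gu u t1 \<bullet> e2) * ((z - g u t1) \<bullet> e1)\<bar> \<le> n * (256 * \<delta> / \<omega>)"
        unfolding abs_mult using c g12 n by (intro mult_mono; simp)+
      have "dd e1 e2 (gu u t1) (z - g u t1) \<le> 2 * (n * (256 * \<delta> / \<omega>))"
        using add_mono[OF abs_le_D1[OF m(1)] abs_le_D2[OF m(2)]] by (simp only: dd_def mult_2 diff_conv_add_uminus)
      then have "dd e1 e2 (gu u t1) (z - g u t1) \<le> n * (512 * \<delta> / \<omega>)" by (simp add: ac_simps)
      then have up: "hh e1 e2 z u t1 \<le> 512 * \<delta> / \<omega>" using n by (simp add: hh_def n_def[symmetric] pos_divide_le_eq mult.commute)
      have "2 * b \<le> hh e1 e2 z u t1" by (rule hb) (use st1 in simp)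
      then have "(hh e1 e2 z u t1 - b)\<^sup>2 \<le> (512 * \<delta> / \<omega>)\<^sup>2" using up b0 by (intro power_mono) auto
      then show ?thesis using c1 C0 A by (intro mult_left_mono) auto
    qed
    moreover have "C0 / A * (512 * \<delta> / \<omega>)\<^sup>2 = C0 * (512 / \<omega>)\<^sup>2"
      using A by (simp add: power_mult_distrib power_divide \<delta>(2))
    ultimately have "\<eta> * (A * (norm (gt u t1))\<^sup>2) \<le> C0 * (512 / \<omega>)\<^sup>2" unfolding t1s by simp
    then have "A * (norm (gt u t1))\<^sup>2 \<le> C" using \<eta>(1) by (simp add: C_def pos_le_divide_eq mult.commute)
    moreover have "(1 - \<eta>) * A \<le> 1 * A" using \<eta> A by (intro mult_right_mono) auto
    then have "(norm (gt u t1))\<^sup>2 * (T - t1) \<le> (norm (gt u t1))\<^sup>2 * A" using A by (intro mult_left_mono) auto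
    ultimately show "(norm (gt u t1))\<^sup>2 * (T - t1) \<le> C" by (simp add: mult.commute)
  qed
qed

end

text \<open>The sign \<open>\<sigma>\<close> records the sense in which the curve is traversed. A
  clockwise curve is treated by reversing the parameter, which reverses the order of the points and
  thereby the sign of each determinant.\<close>

lemma convex_curve_orientation:
  fixes p :: "real \<Rightarrow> real \<times> real"
  assumes cont: "continuous_on UNIV p" and per: "\<And>u. p (u + 2 * pi) = p u"
    and inj: "\<And>u w. p u = p w \<Longrightarrow> [u = w] (rmod (2 * pi))" and conv: "convex_curve (range p)"
  obtains c \<eta> \<sigma> where "\<sigma> \<in> {1, -1 :: real}" "0 < \<eta>" "\<eta> < 2 * pi"
    "\<And>u1 u2 u3. u1 \<le> u2 \<Longrightarrow> u2 \<le> u3 \<Longrightarrow> u3 \<le> u1 + 2 * pi \<Longrightarrow> 0 \<le> \<sigma> * det2 (p u2 - p u1) (p u3 - p u1)"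
    "\<And>u d. 0 \<le> d \<Longrightarrow> d \<le> \<eta> \<Longrightarrow> 0 \<le> \<sigma> * det2 (p u - c) (p (u + d) - c)"
    "\<And>u. 0 < \<sigma> * det2 (p u - c) (p (u + \<eta>) - c)"
proof (rule convex_curve_polar_angle[OF cont per inj conv])
  fix c \<alpha> r
  assume ca: "continuous_on UNIV \<alpha>" and r: "\<And>u. (0::real) < r u"
    and pol: "\<And>u. p u - c = (r u * cos (\<alpha> u), r u * sin (\<alpha> u))"
    and mono: "strict_mono \<alpha> \<and> (\<forall>u. \<alpha> (u + 2 * pi) = \<alpha> u + 2 * pi) \<or>
     strict_mono (\<lambda>u. \<alpha> (- u)) \<and> (\<forall>u. \<alpha> (u + 2 * pi) = \<alpha> u - 2 * pi)"
    and star: "\<And>u1 u2 u3 s t. 0 \<le> s \<Longrightarrow> 0 \<le> t \<Longrightarrow> p u3 - c = s *\<^sub>R (p u1 - c) + t *\<^sub>R (p u2 - c) \<Longrightarrow> 1 \<le> s + t"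
  show thesis
    using mono
  proof
    assume m: "strict_mono \<alpha> \<and> (\<forall>u. \<alpha> (u + 2 * pi) = \<alpha> u + 2 * pi)"
    then have 1: "strict_mono \<alpha>" "\<And>u. \<alpha> (u + 2 * pi) = \<alpha> u + 2 * pi" by blast+
    have pos: "u1 \<le> u2 \<Longrightarrow> u2 \<le> u3 \<Longrightarrow> u3 \<le> u1 + 2 * pi \<Longrightarrow> 0 \<le> det2 (p u2 - p u1) (p u3 - p u1)" for u1 u2 u3
      by (rule polar_angle_positive_triangles(1)[OF ca r pol 1]) (rule star; assumption)
    obtain \<eta> where \<eta>: "0 < \<eta> \<and> \<eta> < 2 * pi \<and> (\<forall>u. 0 < det2 (p u - c) (p (u + \<eta>) - c) \<and>
      (\<forall>d. 0 \<le> d \<and> d \<le> \<eta> \<longrightarrow> 0 \<le> det2 (p u - c) (p (u + d) - c)))"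
      using polar_angle_positive_triangles(2)[OF ca r pol 1] star by blast
    show thesis by (rule that[of 1 \<eta> c]) (use \<eta> pos in auto)
  next
    assume m: "strict_mono (\<lambda>u. \<alpha> (- u)) \<and> (\<forall>u. \<alpha> (u + 2 * pi) = \<alpha> u - 2 * pi)"
    have 1: "strict_mono (\<lambda>u. \<alpha> (- u))" using m by blast
    have 2: "\<alpha> (- (u + 2 * pi)) = \<alpha> (- u) + 2 * pi" for u
      using spec[OF conjunct2[OF m], of "- (u + 2 * pi)"] by simp
    have 3: "continuous_on UNIV (\<lambda>u. \<alpha> (- u))"
      by (rule continuous_on_compose2[OF ca]) (auto intro!: continuous_intros)
    note orient = polar_angle_positive_triangles[where p = "\<lambda>u. p (- u)" and c = c, OF 3 r pol 1 2]
    have pos: "0 \<le> det2 (p (- u2) - p (- u1)) (p (- u3) - p (- u1))"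
      if "u1 \<le> u2" "u2 \<le> u3" "u3 \<le> u1 + 2 * pi" for u1 u2 u3
      by (rule orient(1)[OF _ that]) (rule star; assumption)
    obtain \<eta> where \<eta>: "0 < \<eta> \<and> \<eta> < 2 * pi \<and> (\<forall>u. 0 < det2 (p (- u) - c) (p (- (u + \<eta>)) - c) \<and>
      (\<forall>d. 0 \<le> d \<and> d \<le> \<eta> \<longrightarrow> 0 \<le> det2 (p (- u) - c) (p (- (u + d)) - c)))"
      using orient(2) star by blast
    have anti: "- det2 x y = det2 y x" for x y by (simp add: det2_def)
    show thesis
    proof (rule that[of "- 1" \<eta> c])
      fix u1 u2 u3 assume "u1 \<le> u2" "u2 \<le> u3" "u3 \<le> u1 + 2 * pi"
      then have "0 \<le> det2 (p u2 - p u3) (p u1 - p u3)" using pos[of "- u3" "- u2" "- u1"] by simp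
      then show "0 \<le> - 1 * det2 (p u2 - p u1) (p u3 - p u1)" by (simp add: det2_def algebra_simps)
    next
      fix u d assume "0 \<le> d" "d \<le> \<eta>"
      then have "0 \<le> det2 (p (- (- (u + d))) - c) (p (- (- (u + d) + d)) - c)" using \<eta> by blast
      then have "0 \<le> det2 (p (u + d) - c) (p u - c)" by (simp add: add.commute)
      then show "0 \<le> - 1 * det2 (p u - c) (p (u + d) - c)" by (simp add: anti)
    next
      fix u
      have "0 < det2 (p (- (- (u + \<eta>))) - c) (p (- (- (u + \<eta>) + \<eta>)) - c)" using \<eta> by blast
      then have "0 < det2 (p (u + \<eta>) - c) (p u - c)" by (simp add: add.commute)
      then show "0 < - 1 * det2 (p u - c) (p (u + \<eta>) - c)" by (simp add: anti)
    qed (use \<eta> in auto)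
  qed
qed

lemma one_to_one_convex_projection_type_I:
  fixes \<gamma> :: "real \<Rightarrow> real \<Rightarrow> real ^ 'n"
  assumes i: "ix \<noteq> iy" and csf: "csf \<gamma> T" and proj: "one_to_one_convex_projection ix iy (\<lambda>u. \<gamma> u 0)"
    and shr: "shrinks_to \<gamma> T 0"
  shows "type_I_singularity \<gamma> T"
proof (rule csf_imp_flow[OF csf])
  fix D assume flow: "flow D T" and D: "\<And>u t. t \<in> {0..<T} \<Longrightarrow> D 0 0 u t = \<gamma> u t"
    and curv: "\<And>u t. t \<in> {0..<T} \<Longrightarrow> curvature (\<lambda>u. \<gamma> u t) u = norm (D 0 (Suc 0) u t)"
  interpret flow D T by (rule flow)
  define p where "p u = P_xy ix iy (\<gamma> u 0)" for u
  have pg: "p = (\<lambda>u. (g u 0 \<bullet> axis ix 1, g u 0 \<bullet> axis iy 1))"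
    using T_pos by (auto simp: p_def P_xy_def D inner_axis)
  have 1: "continuous_on UNIV p" unfolding pg using T_pos by (intro continuous_intros) auto
  have 2: "p (u + 2 * pi) = p u" for u unfolding pg using D_per[of 0] T_pos by simp
  have 3: "[u = w] (rmod (2 * pi))" if "p u = p w" for u w
    using proj that unfolding one_to_one_convex_projection_def p_def by blast
  have 4: "convex_curve (range p)" using proj unfolding one_to_one_convex_projection_def p_def[abs_def] by blast
  show ?thesis
  proof (rule convex_curve_orientation[OF 1 2 3 4])
    fix c \<eta> \<sigma>
    assume \<sigma>: "\<sigma> \<in> {1, -1 :: real}" and \<eta>: "0 < \<eta>" "\<eta> < 2 * pi"
      and tri: "\<And>u1 u2 u3. u1 \<le> u2 \<Longrightarrow> u2 \<le> u3 \<Longrightarrow> u3 \<le> u1 + 2 * pi \<Longrightarrow> 0 \<le> \<sigma> * det2 (p u2 - p u1) (p u3 - p u1)"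
      and rad: "\<And>u d. 0 \<le> d \<Longrightarrow> d \<le> \<eta> \<Longrightarrow> 0 \<le> \<sigma> * det2 (p u - c) (p (u + d) - c)"
      and rad': "\<And>u. 0 < \<sigma> * det2 (p u - c) (p (u + \<eta>) - c)"
    \<comment> \<open>For a clockwise projection the two axes are exchanged, so that
      \<open>dd e1 e2\<close> absorbs the sign \<open>\<sigma>\<close> and the flow is
      counterclockwise in the frame e1, e2.\<close>
    define e1 where "e1 = (if \<sigma> = 1 then axis ix 1 else axis iy 1 :: real ^ 'n)"
    define e2 where "e2 = (if \<sigma> = 1 then axis iy 1 else axis ix 1 :: real ^ 'n)"
    define z where "z = fst c *\<^sub>R axis ix 1 + snd c *\<^sub>R (axis iy 1 :: real ^ 'n)"
    have ax: "axis ix 1 \<bullet> (axis iy 1 :: real ^ 'n) = 0" "axis iy 1 \<bullet> (axis ix 1 :: real ^ 'n) = 0"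
      "norm (axis ix 1 :: real ^ 'n) = 1" "norm (axis iy 1 :: real ^ 'n) = 1"
      using i by (simp_all add: inner_axis_axis norm_axis_1)
    have orth: "norm e1 = 1" "norm e2 = 1" "e1 \<bullet> e2 = 0" using ax by (auto simp: e1_def e2_def)
    have dd: "dd e1 e2 v w = \<sigma> * det2 (v \<bullet> axis ix 1, v \<bullet> axis iy 1) (w \<bullet> axis ix 1, w \<bullet> axis iy 1)" for v w
      using \<sigma> by (auto simp: dd_def e1_def e2_def det2_def)
    have zc: "z \<bullet> axis ix 1 = fst c" "z \<bullet> axis iy 1 = snd c"
      using ax by (simp_all add: z_def inner_add_left dot_square_norm)
    have tri0: "0 \<le> tri e1 e2 0 u1 u2 u3" if "ordered u1 u2 u3" for u1 u2 u3
      using tri[of u1 u2 u3] that by (simp add: tri_eq_dd dd ordered_def pg inner_diff_left)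
    have rad0: "dd e1 e2 (g u 0 - z) (g w 0 - z) = \<sigma> * det2 (p u - c) (p w - c)" for u w
      by (simp add: dd pg inner_diff_left zc prod_eq_iff det2_def)
    show ?thesis
    proof (rule uniformly_immersed_projection[OF orth tri0 \<eta>, of z])
      show "0 \<le> dd e1 e2 (g u 0 - z) (g (u + d) 0 - z)" if "0 \<le> d" "d \<le> \<eta>" for u d
        using rad[OF that] by (simp add: rad0)
      show "0 < dd e1 e2 (g u 0 - z) (g (u + \<eta>) 0 - z)" for u using rad'[of u] by (simp add: rad0)
      fix t0 lam assume t0: "0 < t0" "t0 < T" and lam: "0 < lam"
        and imm: "\<And>u t. t \<in> {t0..<T} \<Longrightarrow> lam \<le> a u t * ((gu u t \<bullet> e1)\<^sup>2 + (gu u t \<bullet> e2)\<^sup>2)"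
        and tan: "\<And>u w t. t \<in> {t0..<T} \<Longrightarrow> 0 \<le> dd e1 e2 (gu u t) (g w t - g u t)"
      interpret convex_flow D T e1 e2 lam t0
      proof unfold_locales
        fix e :: real assume "0 < e"
        then have "\<forall>\<^sub>F t in at_left T. \<forall>u\<in>UNIV. dist (\<gamma> u t) 0 < e"
          using shr unfolding shrinks_to_def uniform_limit_iff by blast
        then obtain b where b: "b < T" "\<And>t u. b < t \<Longrightarrow> t < T \<Longrightarrow> norm (\<gamma> u t) < e"
          unfolding eventually_at_left_field by auto
        show "\<exists>t1<T. \<forall>t u. t1 < t \<longrightarrow> t < T \<longrightarrow> norm (g u t) < e"
        proof (intro exI[of _ "max b 0"] conjI allI impI)
          show "max b 0 < T" using b(1) T_pos by simp
          show "norm (g u t) < e" if "max b 0 < t" "t < T" for t u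
            using b(2)[of t u] D[of t u] that by simp
        qed
      next
        show "lam \<le> a u t * ((gu u t \<bullet> e1)\<^sup>2 + (gu u t \<bullet> e2)\<^sup>2)" if "t \<in> {t0..<T}" for t u by (rule imm[OF that])
        show "0 \<le> dd e1 e2 (gu u t) (g w t - g u t)" if "t \<in> {t0..<T}" for t u w by (rule tan[OF that])
      qed (use t0 in \<open>simp_all add: orth lam\<close>)
      show ?thesis
      proof (rule curvature_bound)
        fix C t2 assume C: "t2 < T" "\<And>t u. t2 < t \<Longrightarrow> t < T \<Longrightarrow> (norm (gt u t))\<^sup>2 * (T - t) \<le> C"
        have "Limsup (at_left T) (\<lambda>t. SUP u. ereal ((curvature (\<lambda>u. \<gamma> u t) u)\<^sup>2 * (T - t))) \<le> ereal C"
        proof (rule Limsup_bounded, rule eventually_at_leftI[of "max t2 0"])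
          fix t assume t: "t \<in> {max t2 0<..<T}"
          have "(curvature (\<lambda>u. \<gamma> u t) u)\<^sup>2 * (T - t) \<le> C" for u using C(2)[of t u] t by (simp add: curv)
          then show "(SUP u. ereal ((curvature (\<lambda>u. \<gamma> u t) u)\<^sup>2 * (T - t))) \<le> ereal C" by (simp add: SUP_least)
        qed (use C T_pos in simp)
        also have "ereal C < \<infinity>" by simp
        finally show ?thesis unfolding type_I_singularity_def .
      qed
    qed
  qed
qed

theorem theorem1p17:
  fixes \<gamma> :: "real \<Rightarrow> real \<Rightarrow> real ^ 'n"
    and T :: real
    and ix iy :: 'n
  assumes "ix \<noteq> iy"
    and "maximal_csf \<gamma> T"
    and "one_to_one_convex_projection ix iy (\<lambda>u. \<gamma> u 0)"
    and "shrinks_to \<gamma> T 0"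
    and "type_II_singularity \<gamma> T"
  shows "\<exists>v. norm v = 1 \<and>
           (\<forall>\<tau>s. filterlim \<tau>s at_top sequentially \<longrightarrow>
              (\<exists>r. strict_mono r \<and>
                locally_smoothly_converges (rescaled_csf \<gamma> T) (\<tau>s \<circ> r) (stationary_double_line v))) \<and>
           (\<forall>w. limit_line_direction \<gamma> T w \<longrightarrow> span {w} = span {v}) \<and>
           tangent_flow \<gamma> T (stationary_double_line v) \<and>
           (\<forall>F. tangent_flow \<gamma> T F \<longrightarrow> reparam_equivalent F (stationary_double_line v))"
proof -
  have "csf \<gamma> T" using assms(2) by (simp add: maximal_csf_def)
  from one_to_one_convex_projection_type_I[OF assms(1) this assms(3,4)] show ?thesis
    using assms(5) by (simp add: type_II_singularity_def)
qed

end
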